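(* For any untwisted Reeb graphs $M,N:\mathbf{ZZ}\to\mathbf{set}$, $$d_{\mathrm{B}}\left(\mathrm{dgm}^{\mathbf{ZZ}}_{\mathbf{set}}(M),\mathrm{dgm}^{\mathbf{ZZ}}_{\mathbf{set}}(N)\right)\le 2\cdot d_{\mathrm{I}}^{\mathbf{Set}}(M,N).$$
   Context: $\mathbf{Set}$ (resp. $\mathbf{set}$) is the category of sets (resp. finite sets). $\mathbf{ZZ}=\{(i,j)\in\mathbb{Z}^2: j=i\text{ or }j=i-1\}$ with the order inherited from $\mathbb{R}^{\mathrm{op}}\times\mathbb{R}$; the nontrivial relations are $(i,i-1)\le(i,i)$ and $(i,i-1)\le(i-1,i-1)$. A Reeb graph here means a functor $\mathbf{ZZ}\to\mathbf{set}$. $\mathbf{Int}(\mathbf{ZZ})$ is the collection of nonempty connected convex subsets of $\mathbf{ZZ}$. With $\preceq$ the product order on $\mathbb{Z}^2$ (extended to infinite values) and $\prec$ its strict version, each interval is of exactly one of the forms $(b,d)_{\mathbf{ZZ}}=\{(b,b)\prec(i,j)\prec(d,d)\}$ ($b<d$ in $\mathbb{Z}\cup\{\pm\infty\}$), $[b,d)_{\mathbf{ZZ}}=\{(b,b)\preceq(i,j)\prec(d,d)\}$ ($b<d$ in $\mathbb{Z}\cup\{\infty\}$), $(b,d]_{\mathbf{ZZ}}=\{(b,b)\prec(i,j)\preceq(d,d)\}$ ($b<d$ in $\mathbb{Z}\cup\{-\infty\}$), $[b,d]_{\mathbf{ZZ}}=\{(b,b)\preceq(i,j)\preceq(d,d)\}$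 ($b\le d$ in $\mathbb{Z}$), where $(i,j)\in\mathbf{ZZ}$; any of these is denoted $\langle b,d\rangle_{\mathbf{ZZ}}$. Untwisted. For $I\in\mathbf{Int}(\mathbf{ZZ})$, a functor $I\to\mathbf{set}$ is nonempty if some value is a nonempty set; a nonempty functor is indecomposable if it is not isomorphic to a pointwise disjoint union of two nonempty functors. A nonempty indecomposable $N':I\to\mathbf{set}$ has a one-point colimit, and $\mathrm{supp}(N')=\{k\in I:N'_k\ne\emptyset\}$. A nonempty $M:\mathbf{ZZ}\to\mathbf{set}$ is untwisted if, for every $I\in\mathbf{Int}(\mathbf{ZZ})$ with $M|_I$ nonempty, whenever $M|_I\cong\coprod_{j\in J}N^j$ with $N^j:I\to\mathbf{set}$ nonempty indecomposable, one has $\varprojlim N^j|_{\mathrm{supp}(N^j)}\ne\emptyset$ for each $j\in J$. Persistence diagram. For $I\in\mathbf{Int}(\mathbf{ZZ})$, $\mathrm{rk}(M)(I)$ is the cardinality of the image of the canonical map $\varprojlim M|_I\to\varinjlim M|_I$ in $\mathbf{Set}$ (the composite through $M_a$ for any $a\in I$). Let $\mathrm{nbd}(I)$ be the set of $p\in\mathbf{ZZ}\setminus I$ that cover or are covered by some element of $I$ (at most two elements). $\mathrm{dgm}^{\mathbf{ZZ}}_{\mathbf{set}}(M)(I)=\sum_{S\subset\mathrm{nbd}(I)}(-1)^{|S|}\,\mathrm{rk}(M)(I\cup S)\in\mathbb{Z}$. For untwisted $M$ these values are nonnegative, and $\mathrm{dgm}^{\mathbf{ZZ}}_{\mathbf{set}}(M)$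 is regarded as the corresponding multiset of intervals. Bottleneck distance. Let $\overline{\mathbf{U}}=\{(u_1,u_2)\in[-\infty,\infty]^2:u_1\le u_2\}$. For multisets $X_1,X_2$ in $\overline{\mathbf{U}}$, an $\varepsilon$-matching ($\varepsilon\in[0,\infty)$) is a partial injection $\alpha:X_1\nrightarrow X_2$ with $\|\mathbf{u}-\alpha(\mathbf{u})\|_\infty\le\varepsilon$ for all $\mathbf{u}\in\mathrm{dom}(\alpha)$ (equal infinite coordinates differ by $0$), such that every unmatched point $(u_1,u_2)$ of $X_1$ or $X_2$ satisfies $u_2-u_1\le2\varepsilon$. $d_{\mathrm{B}}(X_1,X_2)$ is the infimum of such $\varepsilon$ ($\infty$ if none). Multisets of intervals of $\mathbf{ZZ}$ are compared via $\langle b,d\rangle_{\mathbf{ZZ}}\leftrightarrow(b,d)\in\overline{\mathbf{U}}$. Interleaving distance. Let $\mathbf{U}=\{(u_1,u_2)\in\mathbb{R}^2:u_1\le u_2\}$ with order inherited from $\mathbb{R}^{\mathrm{op}}\times\mathbb{R}$: $(u_1,u_2)\le(u_1',u_2')$ iff $u_1'\le u_1$ and $u_2\le u_2'$. For $M:\mathbf{ZZ}\to\mathbf{Set}$ define $E(M):\mathbf{U}\to\mathbf{Set}$ by $E(M)(u_1,u_2)=\varinjlim M|_{\{(i,j)\in\mathbf{ZZ}:\,u_1\le i,\ j\le u_2\}}$, with the maps induced by inclusion of index posets. For $G:\mathbf{U}\to\mathbf{Set}$ and $\varepsilon\ge0$, $G(\varepsilon)_{(u_1,u_2)}=G_{(u_1-\varepsilon,u_2+\varepsilon)}$.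 Two functors $G,H:\mathbf{U}\to\mathbf{Set}$ are $\varepsilon$-interleaved if there are natural transformations $f:G\Rightarrow H(\varepsilon)$, $g:H\Rightarrow G(\varepsilon)$ such that $g(\varepsilon)\circ f$ and $f(\varepsilon)\circ g$ are the natural transformations $G\Rightarrow G(2\varepsilon)$, $H\Rightarrow H(2\varepsilon)$ given by structure maps. $d_{\mathrm{I}}^{\mathbf{Set}}(M,N)$ is the infimum of $\varepsilon\in[0,\infty)$ such that $E(M),E(N)$ are $\varepsilon$-interleaved ($\infty$ if none). *)

theory Defs
  imports "HOL-Library.Extended_Real" "HOL-Library.Product_Order" "HOL-Library.FuncSet"
begin

section \<open>Diagrams of sets over subposets of $\mathbf{R}^{op} \times \mathbf{R}$\<close>

text \<open>
  All index posets are sets of pairs carrying the order below. It is not the product order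
  \<open>\<le>\<close> on pairs from \<^theory>\<open>HOL-Library.Product_Order\<close>, which is used only to
  describe the intervals \<open>\<langle>b,d\<rangle>\<close>.
\<close>

definition op_le :: "'p::linorder \<times> 'p \<Rightarrow> 'p \<times> 'p \<Rightarrow> bool" (infix "\<unlhd>" 50) where
  "p \<unlhd> q \<longleftrightarrow> fst q \<le> fst p \<and> snd p \<le> snd q"

text \<open>
  Only the values \<open>Ob F p\<close>, and \<open>Mor F p q\<close> on \<open>Ob F p\<close>, with \<open>p \<unlhd> q\<close> in the index set \<open>P\<close>
  under consideration are meaningful. The restriction of \<open>F\<close> to \<open>Q \<subseteq> P\<close> is \<open>F\<close> itself, regarded
  over \<open>Q\<close>.
\<close>

record ('p, 'a) diagram =
  Ob :: "'p \<times> 'p \<Rightarrow> 'a set"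
  Mor :: "'p \<times> 'p \<Rightarrow> 'p \<times> 'p \<Rightarrow> 'a \<Rightarrow> 'a"

definition is_functor :: "('p::linorder \<times> 'p) set \<Rightarrow> ('p, 'a) diagram \<Rightarrow> bool" where
  "is_functor P F \<longleftrightarrow>
     (\<forall>p\<in>P. \<forall>q\<in>P. p \<unlhd> q \<longrightarrow> Mor F p q \<in> Ob F p \<rightarrow> Ob F q) \<and>
     (\<forall>p\<in>P. \<forall>x\<in>Ob F p. Mor F p p x = x) \<and>
     (\<forall>p\<in>P. \<forall>q\<in>P. \<forall>r\<in>P. p \<unlhd> q \<longrightarrow> q \<unlhd> r \<longrightarrow>
        (\<forall>x\<in>Ob F p. Mor F p r x = Mor F q r (Mor F p q x)))"

definition finset_functor :: "('p::linorder \<times> 'p) set \<Rightarrow> ('p, 'a) diagram \<Rightarrow> bool" where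
  "finset_functor P F \<longleftrightarrow> is_functor P F \<and> (\<forall>p\<in>P. finite (Ob F p))"

definition nat_trans ::
  "('p::linorder \<times> 'p) set \<Rightarrow> ('p, 'a) diagram \<Rightarrow> ('p, 'b) diagram \<Rightarrow> ('p \<times> 'p \<Rightarrow> 'a \<Rightarrow> 'b) \<Rightarrow> bool"
where
  "nat_trans P F G \<eta> \<longleftrightarrow>
     (\<forall>p\<in>P. \<eta> p \<in> Ob F p \<rightarrow> Ob G p) \<and>
     (\<forall>p\<in>P. \<forall>q\<in>P. p \<unlhd> q \<longrightarrow> (\<forall>x\<in>Ob F p. \<eta> q (Mor F p q x) = Mor G p q (\<eta> p x)))"

definition isomorphic ::
  "('p::linorder \<times> 'p) set \<Rightarrow> ('p, 'a) diagram \<Rightarrow> ('p, 'b) diagram \<Rightarrow> bool" where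
  "isomorphic P F G \<longleftrightarrow> (\<exists>\<eta>. nat_trans P F G \<eta> \<and> (\<forall>p\<in>P. bij_betw (\<eta> p) (Ob F p) (Ob G p)))"

definition coprod2 :: "('p, 'a) diagram \<Rightarrow> ('p, 'b) diagram \<Rightarrow> ('p, 'a + 'b) diagram" where
  "coprod2 A B =
     \<lparr>Ob = (\<lambda>p. Ob A p <+> Ob B p), Mor = (\<lambda>p q. map_sum (Mor A p q) (Mor B p q))\<rparr>"

definition coprod :: "'j set \<Rightarrow> ('j \<Rightarrow> ('p, 'a) diagram) \<Rightarrow> ('p, 'j \<times> 'a) diagram" where
  "coprod J N =
     \<lparr>Ob = (\<lambda>p. SIGMA j:J. Ob (N j) p), Mor = (\<lambda>p q (j, x). (j, Mor (N j) p q x))\<rparr>"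

definition nonempty_diagram :: "('p \<times> 'p) set \<Rightarrow> ('p, 'a) diagram \<Rightarrow> bool" where
  "nonempty_diagram P F \<longleftrightarrow> (\<exists>p\<in>P. Ob F p \<noteq> {})"

definition supp :: "('p \<times> 'p) set \<Rightarrow> ('p, 'a) diagram \<Rightarrow> ('p \<times> 'p) set" where
  "supp P F = {p \<in> P. Ob F p \<noteq> {}}"

text \<open>
  It is enough to let the summands take values in subsets of the element type of \<open>F\<close>: summands of
  any decomposition of \<open>F\<close> are isomorphic, via the decomposing isomorphism, to subfunctors of
  \<open>F\<close>.
\<close>

definition indecomposable :: "('p::linorder \<times> 'p) set \<Rightarrow> ('p, 'a) diagram \<Rightarrow> bool" where
  "indecomposable P F \<longleftrightarrow>
     nonempty_diagram P F \<and>
     \<not> (\<exists>(A :: ('p, 'a) diagram) (B :: ('p, 'a) diagram).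
          finset_functor P A \<and> finset_functor P B \<and>
          nonempty_diagram P A \<and> nonempty_diagram P B \<and>
          isomorphic P F (coprod2 A B))"

definition dlim :: "('p::linorder \<times> 'p) set \<Rightarrow> ('p, 'a) diagram \<Rightarrow> ('p \<times> 'p \<Rightarrow> 'a) set" where
  "dlim P F = {s \<in> (\<Pi>\<^sub>E p\<in>P. Ob F p). \<forall>p\<in>P. \<forall>q\<in>P. p \<unlhd> q \<longrightarrow> Mor F p q (s p) = s q}"

definition colim_rel ::
  "('p::linorder \<times> 'p) set \<Rightarrow> ('p, 'a) diagram \<Rightarrow> ((('p \<times> 'p) \<times> 'a) \<times> (('p \<times> 'p) \<times> 'a)) set"
where
  "colim_rel P F =
     (let R = {((p, x), (q, Mor F p q x)) | p q x. p \<in> P \<and> q \<in> P \<and> p \<unlhd> q \<and> x \<in> Ob F p}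
      in (R \<union> R\<inverse>)\<^sup>*)"

definition colim :: "('p::linorder \<times> 'p) set \<Rightarrow> ('p, 'a) diagram \<Rightarrow> (('p \<times> 'p) \<times> 'a) set set" where
  "colim P F = (SIGMA p:P. Ob F p) // colim_rel P F"

text \<open>
  For connected \<open>P\<close> the choice of the index \<open>a\<close> is immaterial.
\<close>

definition lim_to_colim ::
  "('p::linorder \<times> 'p) set \<Rightarrow> ('p, 'a) diagram \<Rightarrow> ('p \<times> 'p \<Rightarrow> 'a) \<Rightarrow> (('p \<times> 'p) \<times> 'a) set" where
  "lim_to_colim P F s = (let a = (SOME a. a \<in> P) in colim_rel P F `` {(a, s a)})"


section \<open>The zigzag poset and its intervals\<close>

definition ZZ :: "(int \<times> int) set" where
  "ZZ = {(i, j). j = i \<or> j = i - 1}"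

definition connected_poset :: "('p::linorder \<times> 'p) set \<Rightarrow> bool" where
  "connected_poset I \<longleftrightarrow>
     (\<forall>p\<in>I. \<forall>q\<in>I. (p, q) \<in> {(x, y). x \<in> I \<and> y \<in> I \<and> (x \<unlhd> y \<or> y \<unlhd> x)}\<^sup>*)"

definition convex_in :: "('p::linorder \<times> 'p) set \<Rightarrow> ('p \<times> 'p) set \<Rightarrow> bool" where
  "convex_in P I \<longleftrightarrow> (\<forall>p\<in>I. \<forall>r\<in>I. \<forall>q\<in>P. p \<unlhd> q \<and> q \<unlhd> r \<longrightarrow> q \<in> I)"

definition IntZZ :: "(int \<times> int) set set" where
  "IntZZ = {I. I \<subseteq> ZZ \<and> I \<noteq> {} \<and> connected_poset I \<and> convex_in ZZ I}"

text \<open>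
  Here \<open>\<le>\<close> and \<open><\<close> on pairs are the product order and its strict version; for instance
  \<open>(b, b) < (i, j)\<close> means \<open>b \<le> i\<close>, \<open>b \<le> j\<close> and \<open>(i, j) \<noteq> (b, b)\<close>.
\<close>

definition ereal_pt :: "int \<times> int \<Rightarrow> ereal \<times> ereal" where
  "ereal_pt p = (ereal (of_int (fst p)), ereal (of_int (snd p)))"

definition ZZ_oo :: "ereal \<Rightarrow> ereal \<Rightarrow> (int \<times> int) set" where
  "ZZ_oo b d = {p \<in> ZZ. (b, b) < ereal_pt p \<and> ereal_pt p < (d, d)}"

definition ZZ_co :: "ereal \<Rightarrow> ereal \<Rightarrow> (int \<times> int) set" where
  "ZZ_co b d = {p \<in> ZZ. (b, b) \<le> ereal_pt p \<and> ereal_pt p < (d, d)}"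

definition ZZ_oc :: "ereal \<Rightarrow> ereal \<Rightarrow> (int \<times> int) set" where
  "ZZ_oc b d = {p \<in> ZZ. (b, b) < ereal_pt p \<and> ereal_pt p \<le> (d, d)}"

definition ZZ_cc :: "ereal \<Rightarrow> ereal \<Rightarrow> (int \<times> int) set" where
  "ZZ_cc b d = {p \<in> ZZ. (b, b) \<le> ereal_pt p \<and> ereal_pt p \<le> (d, d)}"

definition ereal_ints :: "ereal set" where
  "ereal_ints = range (\<lambda>i::int. ereal (of_int i))"

definition has_endpoints :: "(int \<times> int) set \<Rightarrow> ereal \<times> ereal \<Rightarrow> bool" where
  "has_endpoints I u \<longleftrightarrow> (case u of (b, d) \<Rightarrow>
     (b < d \<and> b \<in> ereal_ints \<union> {-\<infinity>, \<infinity>} \<and> d \<in> ereal_ints \<union> {-\<infinity>, \<infinity>} \<and> I = ZZ_oo b d) \<or>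
     (b < d \<and> b \<in> ereal_ints \<union> {\<infinity>} \<and> d \<in> ereal_ints \<union> {\<infinity>} \<and> I = ZZ_co b d) \<or>
     (b < d \<and> b \<in> ereal_ints \<union> {-\<infinity>} \<and> d \<in> ereal_ints \<union> {-\<infinity>} \<and> I = ZZ_oc b d) \<or>
     (b \<le> d \<and> b \<in> ereal_ints \<and> d \<in> ereal_ints \<and> I = ZZ_cc b d))"

definition endpoints :: "(int \<times> int) set \<Rightarrow> ereal \<times> ereal" where
  "endpoints I = (THE u. has_endpoints I u)"


section \<open>Reeb graphs, untwistedness and persistence diagrams\<close>

definition reeb_graph :: "(int, 'a) diagram \<Rightarrow> bool" where
  "reeb_graph M \<longleftrightarrow> finset_functor ZZ M"

text \<open>
  As above, the summands may be taken with elements in \<open>'a\<close>. Index sets \<open>J :: nat set\<close> suffice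
  because \<open>I\<close> is countable and each \<open>Ob M p\<close> is finite, so that \<open>M\<close> has only countably many
  nonempty summands over \<open>I\<close>.
\<close>

definition untwisted :: "(int, 'a) diagram \<Rightarrow> bool" where
  "untwisted M \<longleftrightarrow>
     nonempty_diagram ZZ M \<and>
     (\<forall>I\<in>IntZZ. nonempty_diagram I M \<longrightarrow>
        (\<forall>(J :: nat set) (N :: nat \<Rightarrow> (int, 'a) diagram).
           (\<forall>j\<in>J. finset_functor I (N j) \<and> nonempty_diagram I (N j) \<and> indecomposable I (N j)) \<and>
           isomorphic I M (coprod J N) \<longrightarrow>
           (\<forall>j\<in>J. dlim (supp I (N j)) (N j) \<noteq> {})))"

definition rk :: "(int, 'a) diagram \<Rightarrow> (int \<times> int) set \<Rightarrow> nat" where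
  "rk M I = card (lim_to_colim I M ` dlim I M)"

definition covers :: "('p::linorder \<times> 'p) set \<Rightarrow> 'p \<times> 'p \<Rightarrow> 'p \<times> 'p \<Rightarrow> bool" where
  "covers P q p \<longleftrightarrow>
     p \<in> P \<and> q \<in> P \<and> p \<unlhd> q \<and> p \<noteq> q \<and>
     \<not> (\<exists>r\<in>P. p \<unlhd> r \<and> r \<unlhd> q \<and> r \<noteq> p \<and> r \<noteq> q)"

definition nbd :: "(int \<times> int) set \<Rightarrow> (int \<times> int) set" where
  "nbd I = {p \<in> ZZ - I. \<exists>q\<in>I. covers ZZ p q \<or> covers ZZ q p}"

definition dgm :: "(int, 'a) diagram \<Rightarrow> (int \<times> int) set \<Rightarrow> int" where
  "dgm M I = (\<Sum>S\<in>Pow (nbd I). (- 1) ^ card S * int (rk M (I \<union> S)))"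


section \<open>Bottleneck distance\<close>

text \<open>
  A possibly infinite multiset of points is given by a set of labels together with the position
  of each label. In the persistence diagram, the labels \<open>(I, 0), \<dots>, (I, m - 1)\<close> are the \<open>m\<close>
  copies of an interval \<open>I\<close> of multiplicity \<open>m\<close>.
\<close>

type_synonym 'x point_mset = "'x set \<times> ('x \<Rightarrow> ereal \<times> ereal)"

definition dgm_mset :: "(int, 'a) diagram \<Rightarrow> ((int \<times> int) set \<times> nat) point_mset" where
  "dgm_mset M = ({(I, k). I \<in> IntZZ \<and> k < nat (dgm M I)}, \<lambda>(I, k). endpoints I)"

text \<open>Equal infinite coordinates differ by \<open>0\<close>, whereas \<open>\<infinity> - \<infinity> = \<infinity>\<close> in type \<^typ>\<open>ereal\<close>.\<close>

definition ediff :: "ereal \<Rightarrow> ereal \<Rightarrow> ereal" where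
  "ediff x y = (if x = y then 0 else x - y)"

definition linf_dist :: "ereal \<times> ereal \<Rightarrow> ereal \<times> ereal \<Rightarrow> ereal" where
  "linf_dist u v = max \<bar>ediff (fst u) (fst v)\<bar> \<bar>ediff (snd u) (snd v)\<bar>"

definition is_matching ::
  "real \<Rightarrow> 'x point_mset \<Rightarrow> 'y point_mset \<Rightarrow> ('x \<rightharpoonup> 'y) \<Rightarrow> bool" where
  "is_matching \<epsilon> X Y \<alpha> \<longleftrightarrow>
     dom \<alpha> \<subseteq> fst X \<and> ran \<alpha> \<subseteq> fst Y \<and> inj_on \<alpha> (dom \<alpha>) \<and>
     (\<forall>x y. \<alpha> x = Some y \<longrightarrow> linf_dist (snd X x) (snd Y y) \<le> ereal \<epsilon>) \<and>
     (\<forall>x \<in> fst X - dom \<alpha>. ediff (snd (snd X x)) (fst (snd X x)) \<le> ereal (2 * \<epsilon>)) \<and>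
     (\<forall>y \<in> fst Y - ran \<alpha>. ediff (snd (snd Y y)) (fst (snd Y y)) \<le> ereal (2 * \<epsilon>))"

definition d_B :: "'x point_mset \<Rightarrow> 'y point_mset \<Rightarrow> ereal" where
  "d_B X Y = Inf {ereal \<epsilon> | \<epsilon>. 0 \<le> \<epsilon> \<and> (\<exists>\<alpha>. is_matching \<epsilon> X Y \<alpha>)}"


section \<open>Interleaving distance\<close>

definition UU :: "(real \<times> real) set" where
  "UU = {(u1, u2). u1 \<le> u2}"

definition ZZ_below :: "real \<times> real \<Rightarrow> (int \<times> int) set" where
  "ZZ_below u = {(i, j) \<in> ZZ. fst u \<le> of_int i \<and> of_int j \<le> snd u}"

text \<open>
  The map induced by an inclusion of index posets sends a class \<open>c\<close> to the unique larger class
  containing it, which is the image of \<open>c\<close> under the coarser relation.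
\<close>

definition colim_ext :: "(int, 'a) diagram \<Rightarrow> (real, ((int \<times> int) \<times> 'a) set) diagram" where
  "colim_ext M = \<lparr>Ob = (\<lambda>u. colim (ZZ_below u) M),
          Mor = (\<lambda>u v c. colim_rel (ZZ_below v) M `` c)\<rparr>"

definition shift_pt :: "real \<Rightarrow> real \<times> real \<Rightarrow> real \<times> real" where
  "shift_pt \<epsilon> u = (fst u - \<epsilon>, snd u + \<epsilon>)"

definition shift :: "real \<Rightarrow> (real, 'a) diagram \<Rightarrow> (real, 'a) diagram" where
  "shift \<epsilon> G =
     \<lparr>Ob = (\<lambda>u. Ob G (shift_pt \<epsilon> u)), Mor = (\<lambda>u v. Mor G (shift_pt \<epsilon> u) (shift_pt \<epsilon> v))\<rparr>"

definition interleaved :: "real \<Rightarrow> (real, 'a) diagram \<Rightarrow> (real, 'b) diagram \<Rightarrow> bool" where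
  "interleaved \<epsilon> G H \<longleftrightarrow>
     (\<exists>f g. nat_trans UU G (shift \<epsilon> H) f \<and> nat_trans UU H (shift \<epsilon> G) g \<and>
        (\<forall>u\<in>UU. \<forall>x\<in>Ob G u. g (shift_pt \<epsilon> u) (f u x) = Mor G u (shift_pt (2 * \<epsilon>) u) x) \<and>
        (\<forall>u\<in>UU. \<forall>y\<in>Ob H u. f (shift_pt \<epsilon> u) (g u y) = Mor H u (shift_pt (2 * \<epsilon>) u) y))"

definition d_I :: "(int, 'a) diagram \<Rightarrow> (int, 'b) diagram \<Rightarrow> ereal" where
  "d_I M N = Inf {ereal \<epsilon> | \<epsilon>. 0 \<le> \<epsilon> \<and> interleaved \<epsilon> (colim_ext M) (colim_ext N)}"

end

theory Submission
  imports Defs "HOL-Library.Function_Algebras" "HOL-Library.Countable_Set"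
begin

text \<open>
  Up to the enumeration of \<open>ZZ\<close> by the integers, a Reeb graph is a graph with levels, and the colimit
  over an interval is the set of components of the part over this interval. Over an interval \<open>S\<close> an
  untwisted Reeb graph has as rank the number of components reaching all of \<open>S\<close>, so its diagram is an
  alternating sum of such numbers. This identifies the diagram, one of the four kinds of intervals at a time:
  closed intervals correspond to the components of the whole graph; intervals open on the right to
  components of sublevel sets which die by the elder rule, and those open on the left to the same for
  the reflected graph; open intervals to a basis of the space of cycles which is adapted to the
  supports of cycles.

  An \<open>\<epsilon>\<close>-interleaving induces a bijection between the components of the whole graphs. On the bars of the
  other kinds it induces two matrices whose nonzero entries respect a product order on the bars up to an
  error \<open>\<epsilon>\<close> in each endpoint, and whose product is unitriangular on bars longer than a multiple of
  \<open>\<epsilon>\<close>, ordered by a suitable size. The bars through which the product factors lie between two bars of comparable size, hence within \<open>\<epsilon>\<close>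
  of one of them; comparing dimensions yields Hall's condition. Hence bars of length more than \<open>4 * \<epsilon>\<close>
  on both sides can be matched within \<open>\<epsilon>\<close>, which is more than a \<open>2 * \<epsilon>\<close>-matching requires.
\<close>

subsection \<open>Hall's theorem and matchings\<close>

text \<open>The obstacle is that bars carry no maps of their own. An interleaving acts on components
  as a map of sets, and on bars it gives matrices only with real coefficients: a half-open bar
  becomes the difference of two components that merge at its death, an open bar becomes a cycle. On
  cycles there is not even an induced map, only a transport of crossing numbers through windows; the
  adapted basis makes these numbers determine the coefficients at all bars that contain the window.
  A window inside an open bar loses \<open>\<epsilon>\<close> at each end under each of the two
  maps, whence \<open>4 * \<epsilon>\<close>; half-open bars lose it at one end only and get by with
  \<open>2 * \<epsilon>\<close>. Only for pairs of bars ordered by the sum of their endpoints (with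
  left ends negated for open bars) must an intermediate bar be close to one of them, so the matrix
  product is used for such pairs only, and unitriangularity replaces invertibility. There may be
  infinitely many bars, hence the infinite form of Hall's theorem. Untwistedness enters only in the
  computation of ranks; the remaining arguments concern arbitrary zigzags of finite sets.\<close>

lemma hall_union_submodular:
  assumes f: "finite A" "finite B" and fin: "finite (r `` A)" "finite (r `` B)"
    and y: "y1 \<in> r `` {x}" "y2 \<in> r `` {x}" "y1 \<noteq> y2" and finx: "finite (r `` {x})"
    and x: "x \<notin> A" "x \<notin> B"
    and hall: "card (insert x (A \<union> B)) \<le> card (r `` (insert x (A \<union> B)))"
      "card (A \<inter> B) \<le> card (r `` (A \<inter> B))"
    and bad: "card (r `` A \<union> (r `` {x} - {y1})) \<le> card A" "card (r `` B \<union> (r `` {x} - {y2})) \<le> card B"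
  shows False
proof -
  \<comment> \<open>Submodularity of the neighbourhood size: the two reduced neighbourhoods have the
    full neighbourhood of \<open>insert x (A \<union> B)\<close> as union and contain that of
    \<open>A \<inter> B\<close> in their intersection, so their sizes add up to more than
    \<open>card A + card B\<close>.\<close>
  let ?P = "r `` A \<union> (r `` {x} - {y1})" and ?Q = "r `` B \<union> (r `` {x} - {y2})"
  have fP: "finite ?P" "finite ?Q" using fin finx by auto
  have "(r `` {x} - {y1}) \<union> (r `` {x} - {y2}) = r `` {x}" using y(3) by blast
  moreover have "r `` (insert x (A \<union> B)) = r `` {x} \<union> r `` A \<union> r `` B" by blast
  ultimately have "?P \<union> ?Q = r `` (insert x (A \<union> B))" by blast
  moreover have "r `` (A \<inter> B) \<subseteq> ?P \<inter> ?Q" by (intro Int_greatest le_supI1 Image_mono) auto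
  hence "card (r `` (A \<inter> B)) \<le> card (?P \<inter> ?Q)" using fP by (meson card_mono finite_Int)
  moreover have "card ?P + card ?Q = card (?P \<union> ?Q) + card (?P \<inter> ?Q)"
    by (rule card_Un_Int[OF fP])
  moreover have "card A + card B = card (A \<union> B) + card (A \<inter> B)" by (rule card_Un_Int[OF f])
  moreover have "card (insert x (A \<union> B)) = Suc (card (A \<union> B))" using f x by simp
  ultimately show False using hall bad by simp
qed

text \<open>Rado's proof: a minimal subrelation with Hall's property is a function.\<close>

theorem hall_infinite:
  fixes r :: "('x \<times> 'y) set"
  assumes fin: "\<And>x. x \<in> X \<Longrightarrow> finite (r `` {x})"
    and hall: "\<And>A. finite A \<Longrightarrow> A \<subseteq> X \<Longrightarrow> card A \<le> card (r `` A)"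
  shows "\<exists>h. inj_on h X \<and> (\<forall>x\<in>X. (x, h x) \<in> r)"
proof -
  define base where "base = r \<inter> (X \<times> UNIV)"
  define H where "H q \<longleftrightarrow> (\<forall>A. finite A \<longrightarrow> A \<subseteq> X \<longrightarrow> card A \<le> card (q `` A))" for q :: "('x \<times> 'y) set"
  let ?S = "{Q. Q \<subseteq> base \<and> H (base - Q)}"
  have finb: "finite (base \<inter> A \<times> UNIV)" if "finite A" "A \<subseteq> X" for A
  proof -
    have "base \<inter> A \<times> UNIV \<subseteq> Sigma A (\<lambda>x. r `` {x})" by (auto simp: base_def)
    thus ?thesis using that fin by (meson finite_SigmaI finite_subset subsetD)
  qed
  have finq: "finite (q `` A)" if "q \<subseteq> base" "finite A" "A \<subseteq> X" for q A
  proof -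
    have "q `` A \<subseteq> snd ` (base \<inter> A \<times> UNIV)"
    proof
      fix y assume "y \<in> q `` A"
      then obtain x where "x \<in> A" "(x, y) \<in> q" by blast
      hence "(x, y) \<in> base \<inter> A \<times> UNIV" using that by blast
      thus "y \<in> snd ` (base \<inter> A \<times> UNIV)" by (metis image_eqI snd_conv)
    qed
    thus ?thesis using finb[OF that(2,3)] finite_surj by blast
  qed
  \<comment> \<open>Zorn's lemma is applied to the set of removed pairs, so a maximal set leaves a
    minimal relation.\<close>
  have "\<exists>M\<in>?S. \<forall>Q\<in>?S. M \<subseteq> Q \<longrightarrow> Q = M"
  proof (rule subset_Zorn_nonempty)
    have "base `` A = r `` A" if "A \<subseteq> X" for A using that by (auto simp: base_def)
    hence "{} \<in> ?S" using hall by (auto simp: H_def)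
    thus "?S \<noteq> {}" by blast
  next
    fix C assume C: "C \<noteq> {}" "subset.chain ?S C"
    have "H (base - \<Union>C)"
      unfolding H_def
    proof (intro allI impI)
      fix A assume A: "finite A" "A \<subseteq> X"
      have sub: "\<Union>C \<subseteq> base" using C by (auto simp: subset.chain_def)
      \<comment> \<open>Only finitely many pairs start in the finite set \<open>A\<close>, so on
        \<open>A\<close> the union of the chain agrees with one of its members.\<close>
      have "finite (\<Union>C \<inter> A \<times> UNIV)" using finb[OF A] sub by (meson Int_mono finite_subset order_refl)
      moreover have "\<Union>C \<inter> A \<times> UNIV \<subseteq> \<Union>C" by blast
      ultimately obtain c where c: "c \<in> C" "\<Union>C \<inter> A \<times> UNIV \<subseteq> c"
        using C finite_subset_Union_chain by metis
      hence "(base - \<Union>C) `` A = (base - c) `` A" by blast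
      moreover have "H (base - c)" using C c by (auto simp: subset.chain_def)
      ultimately show "card A \<le> card ((base - \<Union>C) `` A)" using A by (simp add: H_def)
    qed
    moreover have "\<Union>C \<subseteq> base" using C by (auto simp: subset.chain_def)
    ultimately show "\<Union>C \<in> ?S" by simp
  qed
  then obtain M where M: "M \<subseteq> base" "H (base - M)"
    and max: "\<And>Q. Q \<subseteq> base \<Longrightarrow> H (base - Q) \<Longrightarrow> M \<subseteq> Q \<Longrightarrow> Q = M" by auto
  define q where "q = base - M"
  have Hq: "card A \<le> card (q `` A)" if "finite A" "A \<subseteq> X" for A
    using M that by (simp add: H_def q_def)
  have qb: "q \<subseteq> base" by (auto simp: q_def)
  \<comment> \<open>Every remaining pair is critical: its removal violates Hall's condition on a
    finite set, which must contain \<open>x\<close>; the witness is this set without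
    \<open>x\<close>.\<close>
  have crit: "\<exists>A. finite A \<and> A \<subseteq> X \<and> x \<notin> A \<and> card (q `` A \<union> (q `` {x} - {y})) \<le> card A"
    if xy: "(x, y) \<in> q" for x y
  proof -
    have xX: "x \<in> X" using xy by (auto simp: q_def base_def)
    have "\<not> H (base - insert (x, y) M)"
      using max[of "insert (x, y) M"] M xy by (auto simp: q_def)
    moreover have "base - insert (x, y) M = q - {(x, y)}" by (auto simp: q_def)
    ultimately obtain A where A: "finite A" "A \<subseteq> X" "card ((q - {(x, y)}) `` A) < card A"
      by (auto simp: H_def not_le)
    have xA: "x \<in> A"
    proof (rule ccontr)
      assume "x \<notin> A"
      hence "(q - {(x, y)}) `` A = q `` A" by auto
      thus False using A Hq by (metis not_le)
    qed
    have "(q - {(x, y)}) `` A = q `` (A - {x}) \<union> (q `` {x} - {y})" using xA by auto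
    moreover have "card A = Suc (card (A - {x}))" using xA A by (metis card.remove)
    ultimately show ?thesis using A by (intro exI[of _ "A - {x}"]) auto
  qed
  have uniq: "y1 = y2" if xy: "(x, y1) \<in> q" "(x, y2) \<in> q" for x y1 y2
  proof (rule ccontr)
    assume ne: "y1 \<noteq> y2"
    have xX: "x \<in> X" using that by (auto simp: q_def base_def)
    obtain A where A: "finite A" "A \<subseteq> X" "x \<notin> A" "card (q `` A \<union> (q `` {x} - {y1})) \<le> card A"
      using crit[OF xy(1)] by blast
    obtain B where B: "finite B" "B \<subseteq> X" "x \<notin> B" "card (q `` B \<union> (q `` {x} - {y2})) \<le> card B"
      using crit[OF xy(2)] by blast
    have AB: "finite (insert x (A \<union> B))" "insert x (A \<union> B) \<subseteq> X" "finite (A \<inter> B)" "A \<inter> B \<subseteq> X"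
      using A B xX by blast+
    have y: "y1 \<in> q `` {x}" "y2 \<in> q `` {x}" using that by blast+
    have x: "finite {x}" "{x} \<subseteq> X" using xX by simp_all
    show False
      using hall_union_submodular[OF A(1) B(1) finq[OF qb A(1,2)] finq[OF qb B(1,2)] y ne
          finq[OF qb x] A(3) B(3) Hq[OF AB(1,2)] Hq[OF AB(3,4)] A(4) B(4)] .
  qed
  have ex: "\<exists>y. (x, y) \<in> q" if "x \<in> X" for x
  proof -
    have "card {x} \<le> card (q `` {x})" using Hq[of "{x}"] that by simp
    thus ?thesis by (cases "q `` {x} = {}") auto
  qed
  define h where "h x = (SOME y. (x, y) \<in> q)" for x
  have h: "(x, h x) \<in> q" if "x \<in> X" for x unfolding h_def using ex[OF that] by (rule someI_ex)
  have "inj_on h X"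
  proof (rule inj_onI)
    fix x x' assume xx: "x \<in> X" "x' \<in> X" "h x = h x'"
    have "y = h x" if "(x, y) \<in> q \<or> (x', y) \<in> q" for y
      using that uniq h[OF xx(1)] h[OF xx(2)] xx(3) by metis
    hence "q `` {x, x'} \<subseteq> {h x}" by blast
    hence "card (q `` {x, x'}) \<le> 1" using card_mono[of "{h x}"] by simp
    hence "card {x, x'} \<le> 1" using Hq[of "{x, x'}"] xx by simp
    thus "x = x'" by (cases "x = x'") auto
  qed
  thus ?thesis using h qb by (auto simp: base_def)
qed

definition partial_inj :: "('x \<times> 'y) set \<Rightarrow> bool" where
  "partial_inj m \<longleftrightarrow> single_valued m \<and> single_valued (m\<inverse>)"

text \<open>The Schroeder-Bernstein argument for partial injections: use \<open>\<alpha>\<close> on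
  a fixed point \<open>U\<close> and \<open>\<beta>\<close> backwards elsewhere. The fixed point
  equation makes the two parts disjoint on the left and exhausts \<open>A\<close>; an element of
  \<open>B\<close> not hit from \<open>U\<close> is covered by the second part.\<close>

lemma banach_matching:
  assumes A: "A \<subseteq> X" "inj_on \<alpha> A" "\<And>x. x \<in> A \<Longrightarrow> \<alpha> x \<in> Y \<and> (x, \<alpha> x) \<in> r"
    and B: "B \<subseteq> Y" "inj_on \<beta> B" "\<And>y. y \<in> B \<Longrightarrow> \<beta> y \<in> X \<and> (\<beta> y, y) \<in> r"
  shows "\<exists>m. m \<subseteq> r \<inter> (X \<times> Y) \<and> partial_inj m \<and> A \<subseteq> Domain m \<and> B \<subseteq> Range m"
proof -
  have "mono (\<lambda>S. A - \<beta> ` (B - \<alpha> ` S))"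
    by (intro monoI Diff_mono image_mono order_refl)
  then obtain U where U: "U = A - \<beta> ` (B - \<alpha> ` U)"
    using lfp_unfold[of "\<lambda>S. A - \<beta> ` (B - \<alpha> ` S)"] by metis
  define m where "m = (\<lambda>x. (x, \<alpha> x)) ` U \<union> (\<lambda>y. (\<beta> y, y)) ` (B - \<alpha> ` U)"
  have UA: "U \<subseteq> A" using U by blast
  have "m \<subseteq> r \<inter> (X \<times> Y)" using UA A B by (auto simp: m_def)
  moreover have "single_valued m"
    using U B(2) by (auto simp: m_def single_valued_def inj_on_def)
  moreover have "single_valued (m\<inverse>)"
    using inj_on_subset[OF A(2) UA] by (auto simp: m_def single_valued_def inj_on_def)
  moreover have "A \<subseteq> Domain m"
  proof
    fix x assume "x \<in> A"
    hence "x \<in> U \<or> x \<in> \<beta> ` (B - \<alpha> ` U)" using U by blast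
    thus "x \<in> Domain m" by (auto simp: m_def)
  qed
  moreover have "B \<subseteq> Range m"
  proof
    fix y assume "y \<in> B"
    thus "y \<in> Range m" by (cases "y \<in> \<alpha> ` U") (auto simp: m_def)
  qed
  ultimately show ?thesis by (auto simp: partial_inj_def)
qed

section \<open>Counting by linear systems\<close>

lemma homogeneous_system:
  fixes P :: "'x \<Rightarrow> 'y \<Rightarrow> real"
  assumes "finite N" "finite A" "card N < card A"
  shows "\<exists>c. (\<exists>x\<in>A. c x \<noteq> 0) \<and> (\<forall>y\<in>N. (\<Sum>x\<in>A. c x * P x y) = 0)"
  using assms
proof (induction N arbitrary: A P rule: finite_induct)
  case empty
  hence "A \<noteq> {}" by auto
  thus ?case by (intro exI[of _ "\<lambda>_. 1"]) auto
next
  case (insert n N)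
  show ?case
  proof (cases "\<forall>x\<in>A. P x n = 0")
    case True
    have "card N < card A" using insert.hyps insert.prems by simp
    then obtain c where "\<exists>x\<in>A. c x \<noteq> 0" "\<forall>y\<in>N. (\<Sum>x\<in>A. c x * P x y) = 0"
      using insert.IH[of A P] insert.prems(1) by blast
    thus ?thesis using True by (intro exI[of _ c]) auto
  next
    case False
    then obtain a where a: "a \<in> A" "P a n \<noteq> 0" by blast
    let ?A = "A - {a}"
    \<comment> \<open>One step of Gaussian elimination with pivot \<open>P a n\<close>: the equation
      \<open>n\<close> is used to eliminate the unknown \<open>a\<close>, whose value is later
      recovered as \<open>- s\<close>.\<close>
    define Q where "Q x y = P x y - P x n / P a n * P a y" for x y
    have "card N < card ?A" using insert a by (simp add: card_Diff_singleton)
    then obtain c where c: "\<exists>x\<in>?A. c x \<noteq> 0" "\<And>y. y \<in> N \<Longrightarrow> (\<Sum>x\<in>?A. c x * Q x y) = 0"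
      using insert.IH[of ?A Q] insert.prems by auto
    define s where "s = (\<Sum>x\<in>?A. c x * P x n) / P a n"
    define c' where "c' = c(a := - s)"
    have eq: "(\<Sum>x\<in>A. c' x * P x y) = - s * P a y + (\<Sum>x\<in>?A. c x * P x y)" for y
    proof -
      have "(\<Sum>x\<in>?A. c' x * P x y) = (\<Sum>x\<in>?A. c x * P x y)" by (rule sum.cong) (auto simp: c'_def)
      thus ?thesis using a insert.prems by (simp add: sum.remove[of A a] c'_def)
    qed
    have "(\<Sum>x\<in>A. c' x * P x n) = 0" using a by (simp add: eq s_def)
    moreover have "(\<Sum>x\<in>A. c' x * P x y) = 0" if "y \<in> N" for y
    proof -
      have "(\<Sum>x\<in>?A. c x * Q x y) = (\<Sum>x\<in>?A. c x * P x y) - (\<Sum>x\<in>?A. c x * P x n) / P a n * P a y"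
        by (simp add: Q_def right_diff_distrib sum_subtractf sum_distrib_right sum_divide_distrib
            sum_distrib_left ac_simps)
      thus ?thesis using c(2)[OF that] by (simp add: eq s_def)
    qed
    moreover have "\<exists>x\<in>A. c' x \<noteq> 0" using c(1) by (auto simp: c'_def)
    ultimately show ?thesis by blast
  qed
qed

text \<open>The product of the two matrices is unitriangular, so its size is bounded by the inner
  dimension.\<close>

lemma card_le_if_unitriangular:
  fixes P :: "'x \<Rightarrow> 'y \<Rightarrow> real" and s1 s2 :: "'x \<Rightarrow> real"
  assumes fin: "finite A" "finite N"
    and tri: "\<And>x x'. x \<in> A \<Longrightarrow> x' \<in> A \<Longrightarrow> s1 x < s1 x' \<or> s1 x = s1 x' \<and> s2 x \<le> s2 x' \<Longrightarrow>
      (\<Sum>y\<in>N. P x y * R y x') = (if x = x' then 1 else 0)"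
  shows "card A \<le> card N"
proof (rule ccontr)
  assume "\<not> card A \<le> card N"
  then obtain c where c: "\<exists>x\<in>A. c x \<noteq> 0" "\<And>y. y \<in> N \<Longrightarrow> (\<Sum>x\<in>A. c x * P x y) = 0"
    using homogeneous_system[of N A P] fin by auto
  \<comment> \<open>\<open>c\<close> is a nonzero row vector killed by \<open>P\<close>. Pairing it
    with the column of \<open>R\<close> at the lexicographically last element \<open>x'\<close> of
    its support involves only entries of the product that \<open>tri\<close> controls, and yields
    \<open>c x' = 0\<close>.\<close>
  let ?C = "{x \<in> A. c x \<noteq> 0}"
  have fC: "finite ?C" "?C \<noteq> {}" using fin c(1) by auto
  let ?D = "{x \<in> ?C. s1 x = Max (s1 ` ?C)}"
  have "Max (s1 ` ?C) \<in> s1 ` ?C" by (rule Max_in) (use fC in auto)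
  hence fD: "finite ?D" "?D \<noteq> {}" using fin by auto
  have "Max (s2 ` ?D) \<in> s2 ` ?D" by (rule Max_in) (use fD in auto)
  then obtain x' where x': "x' \<in> ?D" "s2 x' = Max (s2 ` ?D)" by auto
  have mx: "s1 x < s1 x' \<or> s1 x = s1 x' \<and> s2 x \<le> s2 x'" if x: "x \<in> ?C" for x
  proof -
    have "s1 x \<le> Max (s1 ` ?C)" by (rule Max_ge) (use fC x in auto)
    moreover have "s2 x \<le> Max (s2 ` ?D)" if "x \<in> ?D" by (rule Max_ge) (use fD that in auto)
    ultimately show ?thesis using x' x by auto
  qed
  have "0 = (\<Sum>y\<in>N. (\<Sum>x\<in>A. c x * P x y) * R y x')" using c(2) by simp
  also have "\<dots> = (\<Sum>x\<in>A. c x * (\<Sum>y\<in>N. P x y * R y x'))"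
    by (simp add: sum_distrib_left sum_distrib_right sum.swap[of _ A N] mult.assoc)
  also have "\<dots> = (\<Sum>x\<in>A. if x = x' then c x else 0)"
  proof (intro sum.cong refl)
    fix x assume x: "x \<in> A"
    show "c x * (\<Sum>y\<in>N. P x y * R y x') = (if x = x' then c x else 0)"
    proof (cases "c x = 0")
      case False
      hence "s1 x < s1 x' \<or> s1 x = s1 x' \<and> s2 x \<le> s2 x'" using mx x by blast
      thus ?thesis using tri[of x x'] x x' by simp
    qed auto
  qed
  also have "\<dots> = c x'" using fin x' by simp
  finally show False using x' by simp
qed

subsection \<open>Components of a zigzag\<close>

text \<open>The poset \<open>ZZ\<close> is enumerated by the integers: level \<open>2 * i\<close> stands for \<open>(i, i)\<close> and level
  \<open>2 * i - 1\<close> for \<open>(i, i - 1)\<close>. Hence only odd levels carry maps, one to each neighbouring level.\<close>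

record 'a zigzag =
  Lev :: "int \<Rightarrow> 'a set"
  Up :: "int \<Rightarrow> 'a \<Rightarrow> 'a"
  Dn :: "int \<Rightarrow> 'a \<Rightarrow> 'a"

type_synonym 'a node = "int \<times> 'a"

definition nodes :: "'a zigzag \<Rightarrow> int set \<Rightarrow> 'a node set" where
  "nodes G S = {(n, x). n \<in> S \<and> x \<in> Lev G n}"

definition edges :: "'a zigzag \<Rightarrow> int set \<Rightarrow> ('a node \<times> 'a node) set" where
  "edges G S = {((n, x), (n + 1, Up G n x)) | n x. odd n \<and> x \<in> Lev G n \<and> n \<in> S \<and> n + 1 \<in> S} \<union>
            {((n, x), (n - 1, Dn G n x)) | n x. odd n \<and> x \<in> Lev G n \<and> n \<in> S \<and> n - 1 \<in> S}"

definition linked :: "'a zigzag \<Rightarrow> int set \<Rightarrow> ('a node \<times> 'a node) set" where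
  "linked G S = (edges G S \<union> (edges G S)\<inverse>)\<^sup>*"

definition cmp :: "'a zigzag \<Rightarrow> int set \<Rightarrow> 'a node \<Rightarrow> 'a node set" where
  "cmp G S a = linked G S `` {a}"

definition comps :: "'a zigzag \<Rightarrow> int set \<Rightarrow> 'a node set set" where
  "comps G S = cmp G S ` nodes G S"

definition lev :: "'a node set \<Rightarrow> int set" where
  "lev K = fst ` K"

text \<open>The map that an inclusion of level sets induces on components. The chosen node does not
  matter when \<open>K\<close> is a component over a subset of \<open>T\<close>.\<close>

definition ext :: "'a zigzag \<Rightarrow> int set \<Rightarrow> 'a node set \<Rightarrow> 'a node set" where
  "ext G T K = cmp G T (SOME a. a \<in> K)"

definition convex_ints :: "int set \<Rightarrow> bool" where
  "convex_ints S \<longleftrightarrow> (\<forall>i\<in>S. \<forall>k\<in>S. \<forall>j. i \<le> j \<longrightarrow> j \<le> k \<longrightarrow> j \<in> S)"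

definition comps_at :: "'a zigzag \<Rightarrow> int set \<Rightarrow> int set \<Rightarrow> 'a node set set" where
  "comps_at G T S = {K \<in> comps G T. lev K = S}"

lemma mem_nodes [simp]: "(n, x) \<in> nodes G S \<longleftrightarrow> n \<in> S \<and> x \<in> Lev G n"
  by (simp add: nodes_def)

lemma nodes_mono: "S \<subseteq> T \<Longrightarrow> nodes G S \<subseteq> nodes G T"
  by (auto simp: nodes_def)

lemma fst_nodes: "a \<in> nodes G S \<Longrightarrow> fst a \<in> S"
  by (auto simp: nodes_def)

lemma linked_refl [simp]: "(a, a) \<in> linked G S"
  by (simp add: linked_def)

lemma linked_trans: "(a, b) \<in> linked G S \<Longrightarrow> (b, c) \<in> linked G S \<Longrightarrow> (a, c) \<in> linked G S"
  unfolding linked_def by (rule rtrancl_trans)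

lemma linked_sym: "(a, b) \<in> linked G S \<Longrightarrow> (b, a) \<in> linked G S"
  unfolding linked_def by (meson sym_Un_converse sym_rtrancl symD)

lemma edges_linked: "(a, b) \<in> edges G S \<Longrightarrow> (a, b) \<in> linked G S"
  by (auto simp: linked_def)

lemma edges_mono: "S \<subseteq> T \<Longrightarrow> edges G S \<subseteq> edges G T"
  unfolding edges_def by blast

lemma linked_mono:
  assumes "S \<subseteq> T" "(a, b) \<in> linked G S"
  shows "(a, b) \<in> linked G T"
proof -
  have "edges G S \<union> (edges G S)\<inverse> \<subseteq> edges G T \<union> (edges G T)\<inverse>" using edges_mono[OF assms(1), of G] by blast
  from rtrancl_mono[OF this] show ?thesis using assms(2) unfolding linked_def by (rule subsetD)
qed

lemma linked_induct [consumes 1, case_names refl step]: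
  assumes "(a, b) \<in> linked G S" and "P a"
    and "\<And>b c. (a, b) \<in> linked G S \<Longrightarrow> P b \<Longrightarrow> (b, c) \<in> edges G S \<or> (c, b) \<in> edges G S \<Longrightarrow> P c"
  shows "P b"
proof -
  have "(a, b) \<in> (edges G S \<union> (edges G S)\<inverse>)\<^sup>*" using assms(1) by (simp add: linked_def)
  thus ?thesis
  proof (induction rule: rtrancl_induct)
    case base
    show ?case by (rule assms(2))
  next
    case (step y z)
    have "(a, y) \<in> linked G S" using step.hyps(1) by (simp add: linked_def)
    moreover have "(y, z) \<in> edges G S \<or> (z, y) \<in> edges G S" using step.hyps(2) by simp
    ultimately show ?case using assms(3) step.IH by blast
  qed
qed

lemma mem_cmp [simp]: "a \<in> cmp G S a"
  by (simp add: cmp_def)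

lemma cmp_iff: "b \<in> cmp G S a \<longleftrightarrow> (a, b) \<in> linked G S"
  by (simp add: cmp_def)

lemma cmp_eq: "(a, b) \<in> linked G S \<Longrightarrow> cmp G S a = cmp G S b"
  unfolding set_eq_iff cmp_iff by (meson linked_sym linked_trans)

lemma comps_cmp: "K \<in> comps G S \<Longrightarrow> a \<in> K \<Longrightarrow> K = cmp G S a"
  unfolding comps_def using cmp_eq cmp_iff by (metis imageE)

lemma comps_eqI: "K \<in> comps G S \<Longrightarrow> K' \<in> comps G S \<Longrightarrow> a \<in> K \<Longrightarrow> a \<in> K' \<Longrightarrow> K = K'"
  using comps_cmp by metis

lemma cmp_comps: "a \<in> nodes G S \<Longrightarrow> cmp G S a \<in> comps G S"
  by (simp add: comps_def)

lemma comps_nonempty: "K \<in> comps G S \<Longrightarrow> \<exists>a. a \<in> K"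
  unfolding comps_def using mem_cmp by fast

lemma comps_linked: "K \<in> comps G S \<Longrightarrow> a \<in> K \<Longrightarrow> b \<in> K \<Longrightarrow> (a, b) \<in> linked G S"
  using comps_cmp cmp_iff by metis

lemma comps_closed: "K \<in> comps G S \<Longrightarrow> a \<in> K \<Longrightarrow> (a, b) \<in> linked G S \<Longrightarrow> b \<in> K"
  using comps_cmp cmp_iff by metis

lemma mem_lev: "(n, x) \<in> K \<Longrightarrow> n \<in> lev K"
  unfolding lev_def by force

lemma mem_levE: "n \<in> lev K \<Longrightarrow> (\<And>x. (n, x) \<in> K \<Longrightarrow> thesis) \<Longrightarrow> thesis"
  unfolding lev_def by force

lemma comps_subset_if_meet:
  assumes "S \<subseteq> T" "K \<in> comps G S" "K' \<in> comps G T" "a \<in> K" "a \<in> K'"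
  shows "K \<subseteq> K'"
proof
  fix b assume "b \<in> K"
  hence "(a, b) \<in> linked G T" using linked_mono[OF assms(1) comps_linked[OF assms(2,4)]] by simp
  thus "b \<in> K'" by (rule comps_closed[OF assms(3,5)])
qed

locale reeb =
  fixes G :: "'a zigzag"
  assumes finite_Lev: "finite (Lev G n)"
    and Up: "odd n \<Longrightarrow> x \<in> Lev G n \<Longrightarrow> Up G n x \<in> Lev G (n + 1)"
    and Dn: "odd n \<Longrightarrow> x \<in> Lev G n \<Longrightarrow> Dn G n x \<in> Lev G (n - 1)"
begin

lemma edges_nodes: "(a, b) \<in> edges G S \<Longrightarrow> a \<in> nodes G S \<and> b \<in> nodes G S"
  unfolding edges_def using Up Dn by auto

lemma linked_nodes: "(a, b) \<in> linked G S \<Longrightarrow> a \<in> nodes G S \<Longrightarrow> b \<in> nodes G S"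
  by (induction rule: linked_induct) (use edges_nodes in auto)

lemma comps_sub: "K \<in> comps G S \<Longrightarrow> K \<subseteq> nodes G S"
  unfolding comps_def using linked_nodes cmp_iff by (metis imageE subsetI)

lemma comps_lev: "K \<in> comps G S \<Longrightarrow> lev K \<subseteq> S"
  using comps_sub fst_nodes unfolding lev_def by fastforce

lemma ext:
  assumes "K \<in> comps G S" "S \<subseteq> T"
  shows ext_comps: "ext G T K \<in> comps G T" and ext_sub: "K \<subseteq> ext G T K"
proof -
  obtain a where "a \<in> K" using comps_nonempty assms(1) by blast
  hence a: "(SOME a. a \<in> K) \<in> K" by (rule someI)
  hence "(SOME a. a \<in> K) \<in> nodes G T"
    using comps_sub[OF assms(1)] nodes_mono[OF assms(2)] by blast
  thus e: "ext G T K \<in> comps G T" unfolding ext_def by (rule cmp_comps)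
  show "K \<subseteq> ext G T K"
    by (rule comps_subset_if_meet[OF assms(2,1) e a]) (simp add: ext_def)
qed

lemma ext_eqI:
  assumes "K \<in> comps G S" "S \<subseteq> T" "K' \<in> comps G T" "K \<subseteq> K'"
  shows "ext G T K = K'"
proof -
  obtain a where a: "a \<in> K" using comps_nonempty assms(1) by blast
  show ?thesis
    using comps_eqI[OF ext_comps[OF assms(1,2)] assms(3), of a] ext_sub[OF assms(1,2)] a assms(4)
    by blast
qed

text \<open>A path over \<open>T\<close> that starts in \<open>K\<close> never leaves
  \<open>K\<close>, hence never leaves the levels \<open>S\<close>, so its edges are already present
  over \<open>S\<close>.\<close>

lemma comps_restrict:
  assumes K: "K \<in> comps G T" "S \<subseteq> T" "lev K \<subseteq> S"
  shows "K \<in> comps G S"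
proof -
  obtain a where a: "a \<in> K" using comps_nonempty K(1) by blast
  have KS: "K \<subseteq> nodes G S"
    using comps_sub[OF K(1)] K(3) unfolding lev_def nodes_def by auto
  have stp: "(b, c) \<in> edges G S" if "(b, c) \<in> edges G T" "fst b \<in> S" "fst c \<in> S" for b c
    using that unfolding edges_def by auto
  have "b \<in> K \<and> (a, b) \<in> linked G S" if "(a, b) \<in> linked G T" for b
    using that
  proof (induction rule: linked_induct)
    case (step b c)
    have "(b, c) \<in> linked G T" using step.hyps(2) edges_linked linked_sym by blast
    hence c: "c \<in> K" using comps_closed[OF K(1)] step.IH by blast
    have "fst b \<in> S" "fst c \<in> S" using KS c step.IH fst_nodes by blast+
    hence "(b, c) \<in> linked G S" using step.hyps(2) stp edges_linked linked_sym by metis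
    thus ?case using c step.IH linked_trans by metis
  qed (use a in simp)
  hence "K = cmp G S a"
    using comps_linked[OF K(1) a] linked_mono[OF K(2)] comps_closed[OF K(1) a] cmp_iff by blast
  thus ?thesis using a KS cmp_comps by blast
qed

lemma comps_extend:
  assumes K: "K \<in> comps G S" "S \<subseteq> T"
    and cl: "\<And>a b. a \<in> K \<Longrightarrow> (a, b) \<in> edges G T \<or> (b, a) \<in> edges G T \<Longrightarrow> fst b \<in> S"
  shows "K \<in> comps G T"
proof -
  obtain a where a: "a \<in> K" using comps_nonempty K(1) by blast
  have stp: "(b, c) \<in> edges G S" if "(b, c) \<in> edges G T" "fst b \<in> S" "fst c \<in> S" for b c
    using that unfolding edges_def by auto
  have "b \<in> K" if "(a, b) \<in> linked G T" for b
    using that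
  proof (induction rule: linked_induct)
    case (step b c)
    have "fst b \<in> S" "fst c \<in> S"
      using step.IH step.hyps(2) cl comps_sub[OF K(1)] fst_nodes by blast+
    hence "(b, c) \<in> linked G S" using step.hyps(2) stp edges_linked linked_sym by metis
    thus ?case using comps_closed[OF K(1)] step.IH by blast
  qed (use a in simp)
  hence "cmp G T a \<subseteq> K" using cmp_iff by blast
  moreover have "K \<subseteq> cmp G T a"
    using comps_linked[OF K(1) a] linked_mono[OF K(2)] cmp_iff by blast
  moreover have "a \<in> nodes G T" using a comps_sub[OF K(1)] nodes_mono[OF K(2)] by blast
  ultimately show ?thesis using cmp_comps by (metis subset_antisym)
qed

lemma edges_fst: "(a, b) \<in> edges G S \<Longrightarrow> odd (fst a) \<and> (fst b = fst a + 1 \<or> fst b = fst a - 1)"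
  unfolding edges_def by auto

text \<open>A discrete intermediate value theorem, since an edge changes the level by one.\<close>

lemma linked_between:
  assumes "(a, b) \<in> linked G S" "fst a \<le> k \<and> k \<le> fst b \<or> fst b \<le> k \<and> k \<le> fst a"
  shows "\<exists>c. (a, c) \<in> linked G S \<and> fst c = k"
  using assms
proof (induction rule: linked_induct)
  case refl
  thus ?case by (intro exI[of _ a]) auto
next
  case (step b c)
  show ?case
  proof (cases "fst c = k")
    case True
    have "(b, c) \<in> linked G S" using step.hyps(2) edges_linked linked_sym by blast
    hence "(a, c) \<in> linked G S" using step.hyps(1) linked_trans by metis
    thus ?thesis using True by blast
  next
    case False
    have "fst c = fst b + 1 \<or> fst c = fst b - 1" using step.hyps(2) edges_fst by fastforce
    hence "fst a \<le> k \<and> k \<le> fst b \<or> fst b \<le> k \<and> k \<le> fst a" using step.prems False by auto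
    thus ?thesis by (rule step.IH)
  qed
qed

lemma lev_convex:
  assumes K: "K \<in> comps G S"
  shows "convex_ints (lev K)"
  unfolding convex_ints_def
proof (intro ballI allI impI)
  fix i k j assume ik: "i \<in> lev K" "k \<in> lev K" "i \<le> j" "j \<le> k"
  obtain x y where xy: "(i, x) \<in> K" "(k, y) \<in> K" using ik mem_levE by metis
  then obtain c where c: "((i, x), c) \<in> linked G S" "fst c = j"
    using linked_between[OF comps_linked[OF K xy], of j] ik by auto
  hence "c \<in> K" using comps_closed[OF K xy(1)] by blast
  thus "j \<in> lev K" using c(2) by (auto simp: lev_def)
qed

text \<open>Each of these components contains one of the finitely many nodes at a fixed level of
  \<open>S\<close>.\<close>

lemma finite_comps_at:
  assumes "S \<noteq> {}"
  shows "finite (comps_at G T S)"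
proof -
  obtain s where s: "s \<in> S" using assms by blast
  have "comps_at G T S \<subseteq> (\<lambda>x. cmp G T (s, x)) ` Lev G s"
  proof
    fix K assume K: "K \<in> comps_at G T S"
    hence "s \<in> lev K" using s by (simp add: comps_at_def)
    then obtain x where x: "(s, x) \<in> K" by (rule mem_levE)
    have KT: "K \<in> comps G T" using K by (simp add: comps_at_def)
    have "x \<in> Lev G s" using comps_sub[OF KT] x by auto
    thus "K \<in> (\<lambda>x. cmp G T (s, x)) ` Lev G s" using comps_cmp[OF KT x] by blast
  qed
  thus ?thesis using finite_Lev finite_surj by blast
qed

text \<open>With at most one neighbouring level present, every node of the odd level
  \<open>p\<close> has at most one edge. The retraction \<open>\<rho>\<close> slides it along this
  edge and so pushes paths into \<open>S\<close>. An even level behaves differently, because several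
  odd nodes may attach to one even node.\<close>

lemma linked_leaf:
  assumes p: "odd p" "p \<notin> S" "\<not> (p - 1 \<in> S \<and> p + 1 \<in> S)"
    and ab: "a \<in> nodes G S" "b \<in> nodes G S" "(a, b) \<in> linked G (insert p S)"
  shows "(a, b) \<in> linked G S"
proof -
  define \<rho> where "\<rho> c = (if fst c = p then if p + 1 \<in> S then (p + 1, Up G p (snd c))
      else (p - 1, Dn G p (snd c)) else c)" for c
  have stp: "(\<rho> c, \<rho> d) \<in> linked G S" if "(c, d) \<in> edges G (insert p S)" for c d
  proof (cases "fst c = p")
    case True
    have "fst d \<noteq> p" using edges_fst[OF that] True by auto
    hence "\<rho> c = \<rho> d" using that True p unfolding \<rho>_def edges_def by auto
    thus ?thesis by simp
  next
    case False
    have "odd (fst c)" "fst d = fst c + 1 \<or> fst d = fst c - 1" using edges_fst[OF that] by auto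
    hence "even (fst d)" by auto
    hence "fst d \<noteq> p" using p(1) by auto
    hence "(c, d) \<in> edges G S" using that False unfolding edges_def by auto
    thus ?thesis using False \<open>fst d \<noteq> p\<close> edges_linked by (simp add: \<rho>_def)
  qed
  have "(\<rho> a, \<rho> b) \<in> linked G S" using ab(3)
  proof (induction rule: linked_induct)
    case (step b c)
    have "(\<rho> b, \<rho> c) \<in> linked G S" using step.hyps(2) stp linked_sym by blast
    thus ?case using step.IH linked_trans by metis
  qed simp
  moreover have "\<rho> a = a" "\<rho> b = b" using ab(1,2) p(2) fst_nodes unfolding \<rho>_def by metis+
  ultimately show ?thesis by simp
qed

lemma comps_leaf:
  assumes p: "odd p" "p \<notin> S" "\<not> (p - 1 \<in> S \<and> p + 1 \<in> S)"
    and K: "K \<in> comps G (insert p S)" "K \<inter> nodes G S \<noteq> {}"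
  shows "K \<inter> nodes G S \<in> comps G S"
proof -
  obtain a where a: "a \<in> K" "a \<in> nodes G S" using K(2) by blast
  have "K \<inter> nodes G S = cmp G S a"
  proof (intro set_eqI iffI)
    fix b assume "b \<in> K \<inter> nodes G S"
    thus "b \<in> cmp G S a" using comps_linked[OF K(1) a(1)] linked_leaf[OF p a(2)] cmp_iff by blast
  next
    fix b assume "b \<in> cmp G S a"
    hence b: "(a, b) \<in> linked G S" by (simp add: cmp_iff)
    hence "b \<in> K" using comps_closed[OF K(1) a(1)] linked_mono[of S "insert p S"] by blast
    thus "b \<in> K \<inter> nodes G S" using linked_nodes[OF b a(2)] by blast
  qed
  thus ?thesis using a cmp_comps by metis
qed

text \<open>A component over \<open>T\<close> with levels \<open>S\<close> either survives unchanged
  over \<open>T'\<close>, or it is joined to level \<open>p\<close>, by \<open>adj\<close> the only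
  new level next to \<open>S\<close>. In the second case adding the leaf level \<open>p\<close> to
  \<open>T\<close> enlarges it without merging it with another component, so it is counted by the
  last term.\<close>

lemma card_comps_at_leaf:
  assumes p: "odd p" "p \<notin> T" "\<not> (p - 1 \<in> T \<and> p + 1 \<in> T)"
    and T: "T \<subseteq> T'" "p \<in> T'" "S \<noteq> {}" "S \<subseteq> T"
    and adj: "\<And>k s. k \<in> T' - T \<Longrightarrow> s \<in> S \<Longrightarrow> k = s + 1 \<or> k = s - 1 \<Longrightarrow> k = p"
    and adjp: "p - 1 \<in> S \<or> p + 1 \<in> S"
  shows "card (comps_at G T S) = card (comps_at G T' S) + card (comps_at G (insert p T) (insert p S))"
proof -
  define \<psi> where "\<psi> K = K \<inter> nodes G T" for K :: "'a node set"
  let ?C = "comps_at G (insert p T) (insert p S)"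
  have pS: "p \<notin> S" using p T by blast
  have comp: "\<psi> K \<in> comps G T" "lev (\<psi> K) = S" if "K \<in> ?C" for K
  proof -
    have K: "K \<in> comps G (insert p T)" "lev K = insert p S" using that by (auto simp: comps_at_def)
    have "b \<in> \<psi> K" if "b \<in> K" "fst b \<in> S" for b
      using that comps_sub[OF K(1)] T(4) by (auto simp: \<psi>_def nodes_def)
    hence "S \<subseteq> lev (\<psi> K)" using K(2) unfolding lev_def by fastforce
    moreover have "lev (\<psi> K) \<subseteq> lev K \<inter> T" unfolding \<psi>_def lev_def nodes_def by auto
    ultimately show "lev (\<psi> K) = S" using K(2) p(2) by auto
    hence "\<psi> K \<noteq> {}" using T(3) by (auto simp: lev_def)
    thus "\<psi> K \<in> comps G T" unfolding \<psi>_def using comps_leaf[OF p K(1)] by blast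
  qed
  have "inj_on \<psi> ?C"
  proof (rule inj_onI)
    fix K K' assume KK: "K \<in> ?C" "K' \<in> ?C" "\<psi> K = \<psi> K'"
    obtain a where "a \<in> \<psi> K" using comps_nonempty comp(1)[OF KK(1)] by blast
    hence "a \<in> K" "a \<in> K'" using KK(3) unfolding \<psi>_def by blast+
    moreover have "K \<in> comps G (insert p T)" "K' \<in> comps G (insert p T)"
      using KK(1,2) by (simp_all add: comps_at_def)
    ultimately show "K = K'" using comps_eqI by metis
  qed
  moreover have "comps_at G T' S \<inter> \<psi> ` ?C = {}"
  proof (rule ccontr)
    assume "comps_at G T' S \<inter> \<psi> ` ?C \<noteq> {}"
    then obtain K where K: "K \<in> ?C" "\<psi> K \<in> comps_at G T' S" by blast
    have KC: "K \<in> comps G (insert p T)" "p \<in> lev K" using K by (auto simp: comps_at_def)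
    have \<psi>: "\<psi> K \<in> comps G T'" using K by (auto simp: comps_at_def)
    obtain a where a: "a \<in> \<psi> K" using comps_nonempty[OF \<psi>] by blast
    have "insert p T \<subseteq> T'" using T by blast
    hence "K \<subseteq> \<psi> K" using comps_subset_if_meet[OF _ KC(1) \<psi> _ a] a unfolding \<psi>_def by blast
    thus False using KC(2) p(2) unfolding \<psi>_def lev_def nodes_def by auto
  qed
  moreover have "comps_at G T S = comps_at G T' S \<union> \<psi> ` ?C"
  proof (intro set_eqI iffI)
    fix K assume K: "K \<in> comps_at G T' S \<union> \<psi> ` ?C"
    show "K \<in> comps_at G T S"
    proof (cases "K \<in> comps_at G T' S")
      case True
      thus ?thesis using comps_restrict[OF _ T(1)] T(4) by (auto simp: comps_at_def)
    next
      case False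
      thus ?thesis using K comp by (auto simp: comps_at_def)
    qed
  next
    fix K assume "K \<in> comps_at G T S"
    hence K: "K \<in> comps G T" "lev K = S" by (auto simp: comps_at_def)
    show "K \<in> comps_at G T' S \<union> \<psi> ` ?C"
    proof (cases "K \<in> comps G T'")
      case True
      thus ?thesis using K(2) by (simp add: comps_at_def)
    next
      case False
      then obtain a b where ab: "a \<in> K" "(a, b) \<in> edges G T' \<or> (b, a) \<in> edges G T'" "fst b \<notin> T"
        using comps_extend[OF K(1) T(1)] by blast
      have fa: "fst a \<in> S" using K ab by (auto simp: lev_def)
      have b: "b \<in> nodes G T'" using ab(2) edges_nodes by blast
      have nb: "fst b = fst a + 1 \<or> fst b = fst a - 1" using ab(2) edges_fst by fastforce
      have fb: "fst b = p" using adj[OF _ fa nb] ab(3) fst_nodes[OF b] by blast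
      have "(a, b) \<in> edges G (insert p T) \<or> (b, a) \<in> edges G (insert p T)"
        using ab(2) fb fa T(4) unfolding edges_def by auto
      hence abc: "(a, b) \<in> linked G (insert p T)" using edges_linked linked_sym by blast
      let ?K = "ext G (insert p T) K"
      have sub: "T \<subseteq> insert p T" by blast
      note e = ext_comps[OF K(1) sub] ext_sub[OF K(1) sub]
      have be: "b \<in> ?K" using comps_closed[OF e(1)] e(2) ab(1) abc by blast
      have aK: "a \<in> nodes G T" using comps_sub[OF K(1)] ab(1) by blast
      have "\<psi> ?K \<in> comps G T"
        unfolding \<psi>_def using comps_leaf[OF p e(1)] e(2) ab(1) aK by blast
      hence eq: "\<psi> ?K = K" using comps_eqI[OF _ K(1), of _ a] e(2) ab(1) aK unfolding \<psi>_def by blast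
      have "lev ?K = insert p S"
      proof
        show "insert p S \<subseteq> lev ?K" using e(2) be fb K(2) unfolding lev_def by auto
        show "lev ?K \<subseteq> insert p S"
        proof
          fix k assume "k \<in> lev ?K"
          then obtain x where x: "(k, x) \<in> ?K" by (rule mem_levE)
          hence "(k, x) \<in> nodes G (insert p T)" using comps_sub[OF e(1)] by blast
          hence "k = p \<or> (k, x) \<in> \<psi> ?K" using x by (auto simp: \<psi>_def)
          moreover have "k \<in> lev K" if "(k, x) \<in> \<psi> ?K"
            using that mem_lev unfolding eq by metis
          ultimately show "k \<in> insert p S" using K(2) by blast
        qed
      qed
      hence "?K \<in> ?C" using e(1) by (simp add: comps_at_def)
      thus ?thesis using eq by (metis UnI2 imageI)
    qed
  qed
  moreover have "finite (comps_at G T' S)" "finite ?C"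
    using finite_comps_at[OF T(3)] finite_comps_at[of "insert p S"] by simp_all
  ultimately show ?thesis by (simp add: card_Un_disjoint card_image)
qed

end

text \<open>A set rather than a number, so that an infinite end, which has no neighbour, needs no
  separate treatment; for convex \<open>S\<close> it has at most one element.\<close>

definition lo :: "int set \<Rightarrow> int set" where
  "lo S = {n. n \<notin> S \<and> n + 1 \<in> S}"

definition hi :: "int set \<Rightarrow> int set" where
  "hi S = {n. n \<notin> S \<and> n - 1 \<in> S}"

text \<open>The counterparts of the rank and of the diagram: if the zigzag comes from an untwisted diagram, every
  component that reaches all levels of \<open>S\<close> has a section.\<close>

definition full :: "'a zigzag \<Rightarrow> int set \<Rightarrow> nat" where
  "full G S = card (comps_at G S S)"

definition dgz :: "'a zigzag \<Rightarrow> int set \<Rightarrow> int" where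
  "dgz G S = (\<Sum>A\<in>Pow (lo S \<union> hi S). (- 1) ^ card A * int (full G (S \<union> A)))"

text \<open>The alternating sum over the left neighbour alone; the diagram is the difference of two
  such terms over the right neighbour.\<close>

definition lb :: "'a zigzag \<Rightarrow> int set \<Rightarrow> int" where
  "lb G S = int (full G S) - (\<Sum>p\<in>lo S. int (full G (insert p S)))"

definition dclose :: "int set \<Rightarrow> int set" where
  "dclose S = {k. \<exists>s\<in>S. k \<le> s}"

lemma lo_less: "convex_ints S \<Longrightarrow> p \<in> lo S \<Longrightarrow> s \<in> S \<Longrightarrow> p < s"
  unfolding convex_ints_def lo_def by (smt (verit) mem_Collect_eq)

lemma hi_greater: "convex_ints S \<Longrightarrow> q \<in> hi S \<Longrightarrow> s \<in> S \<Longrightarrow> s < q"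
  unfolding convex_ints_def hi_def by (smt (verit) mem_Collect_eq)

lemma lo_unique: "convex_ints S \<Longrightarrow> p \<in> lo S \<Longrightarrow> p' \<in> lo S \<Longrightarrow> p = p'"
  using lo_less[of S p "p' + 1"] lo_less[of S p' "p + 1"] by (auto simp: lo_def)

lemma hi_unique: "convex_ints S \<Longrightarrow> p \<in> hi S \<Longrightarrow> p' \<in> hi S \<Longrightarrow> p = p'"
  using hi_greater[of S p "p' - 1"] hi_greater[of S p' "p - 1"] by (auto simp: hi_def)

lemma lo_cases:
  assumes "convex_ints S"
  obtains "lo S = {}" | p where "lo S = {p}"
  using lo_unique[OF assms] by (cases "lo S = {}") blast+

lemma hi_cases:
  assumes "convex_ints S"
  obtains "hi S = {}" | q where "hi S = {q}"
  using hi_unique[OF assms] by (cases "hi S = {}") blast+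

lemma lo_insert_hi:
  assumes "convex_ints S" "q \<in> hi S"
  shows "lo (insert q S) = lo S"
proof (intro set_eqI iffI)
  fix n assume "n \<in> lo (insert q S)"
  thus "n \<in> lo S" using assms(2) by (auto simp: lo_def hi_def)
next
  fix n assume n: "n \<in> lo S"
  have "q - 1 \<in> S" using assms(2) by (simp add: hi_def)
  hence "n < q - 1" using lo_less[OF assms(1) n] by blast
  thus "n \<in> lo (insert q S)" using n by (auto simp: lo_def)
qed

lemma convex_insert_hi:
  assumes "convex_ints S" "q \<in> hi S"
  shows "convex_ints (insert q S)"
proof -
  have "q - 1 \<in> S" using assms(2) by (simp add: hi_def)
  moreover have "s < q" if "s \<in> S" for s using hi_greater[OF assms that] .
  ultimately show ?thesis using assms(1) unfolding convex_ints_def by (smt (verit) insert_iff)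
qed

text \<open>The alternating sum factors because adding the right neighbour leaves the left neighbour
  unchanged.\<close>

lemma dgz_eq:
  assumes S: "convex_ints S" "S \<noteq> {}"
  shows "dgz G S = lb G S - (\<Sum>q\<in>hi S. lb G (insert q S))"
proof -
  have ne: "p \<noteq> q" if "p \<in> lo S" "q \<in> hi S" for p q
    using that lo_less[OF S(1)] hi_greater[OF S(1)] S(2) by force
  show ?thesis
  proof (cases rule: lo_cases[OF S(1)])
    case 1
    show ?thesis
      by (cases rule: hi_cases[OF S(1)])
        (auto simp: dgz_def lb_def Pow_insert 1 lo_insert_hi[OF S(1)])
  next
    case (2 p)
    show ?thesis
    proof (cases rule: hi_cases[OF S(1)])
      case 1
      thus ?thesis by (auto simp: dgz_def lb_def Pow_insert 2)
    next
      case q: (2 q)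
      have pq: "p \<noteq> q" using ne q 2 by blast
      have "Pow (lo S \<union> hi S) = {{}, {p}, {q}, {p, q}}" unfolding 2 q by (auto simp: Pow_insert)
      moreover have "{p} \<noteq> {q}" "{p} \<noteq> {p, q}" "{q} \<noteq> {p, q}" using pq by blast+
      ultimately show ?thesis
        using pq by (simp add: dgz_def lb_def 2 q lo_insert_hi[OF S(1)] insert_commute)
    qed
  qed
qed

lemma dclose_sub: "S \<subseteq> dclose S"
  by (auto simp: dclose_def)

lemma dclose_insert_hi: "q \<in> hi S \<Longrightarrow> dclose (insert q S) = insert q (dclose S)"
  by (auto simp: dclose_def hi_def intro: bexI[of _ "q - 1"])

lemma dclose_hi: "convex_ints S \<Longrightarrow> q \<in> hi S \<Longrightarrow> dclose S = {..q - 1}"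
  using hi_greater[of S q] by (fastforce simp: dclose_def hi_def intro: bexI[of _ "q - 1"])

lemma dclose_no_hi:
  assumes "hi S = {}" "S \<noteq> {}"
  shows "dclose S = UNIV"
proof -
  obtain s where s: "s \<in> S" using assms by blast
  have "s + int n \<in> S" for n
  proof (induction n)
    case (Suc n)
    have "s + int n + 1 \<notin> hi S" using assms by blast
    thus ?case using Suc by (simp add: hi_def algebra_simps)
  qed (use s in simp)
  hence "k \<in> dclose S" for k
    by (auto simp: dclose_def intro!: bexI[of _ "s + int (nat (k - s))"])
  thus ?thesis by blast
qed

lemma dclose_no_lo:
  assumes "convex_ints S" "lo S = {}" "S \<noteq> {}"
  shows "dclose S = S"
proof
  show "S \<subseteq> dclose S" by (rule dclose_sub)
  show "dclose S \<subseteq> S"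
  proof
    fix k assume "k \<in> dclose S"
    then obtain s where s: "s \<in> S" "k \<le> s" by (auto simp: dclose_def)
    have "s - int n \<in> S" for n
    proof (induction n)
      case (Suc n)
      have "s - int n - 1 \<notin> lo S" using assms by blast
      thus ?case using Suc by (simp add: lo_def algebra_simps)
    qed (use s in simp)
    from this[of "nat (s - k)"] show "k \<in> S" using s(2) by simp
  qed
qed

text \<open>An odd left neighbour is a leaf level, so \<open>card_comps_at_leaf\<close> applies with
  \<open>T = S\<close>: subtracting the components that reach \<open>p\<close> leaves those that
  stay isolated when all lower levels are added.\<close>

lemma (in reeb) lb_closed:
  assumes S: "convex_ints S" "S \<noteq> {}" and odd: "\<And>p. p \<in> lo S \<Longrightarrow> odd p"
  shows "lb G S = int (card (comps_at G (dclose S) S))"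
proof (cases rule: lo_cases[OF S(1)])
  case 1
  thus ?thesis using dclose_no_lo[OF S(1) 1 S(2)] by (simp add: lb_def full_def)
next
  case (2 p)
  have p: "p \<in> lo S" using 2 by simp
  have le: "p < s" if "s \<in> S" for s using lo_less[OF S(1) p that] .
  have "card (comps_at G S S) = card (comps_at G (dclose S) S) + card (comps_at G (insert p S) (insert p S))"
  proof (rule card_comps_at_leaf)
    show "odd p" using odd p .
    show "\<not> (p - 1 \<in> S \<and> p + 1 \<in> S)" using le by force
    show "p \<in> dclose S" using p by (auto simp: dclose_def lo_def intro: bexI[of _ "p + 1"])
    show "p - 1 \<in> S \<or> p + 1 \<in> S" "p \<notin> S" using p by (auto simp: lo_def)
    show "k = p" if k: "k \<in> dclose S - S" "s \<in> S" "k = s + 1 \<or> k = s - 1" for k s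
    proof -
      obtain s' where "s' \<in> S" "k \<le> s'" using k by (auto simp: dclose_def)
      moreover have "k \<notin> S" using k(1) by blast
      ultimately have "\<not> s \<le> k" using S(1) k(2) unfolding convex_ints_def by blast
      hence "k = s - 1" using k(3) by linarith
      hence "k \<in> lo S" using k by (simp add: lo_def)
      thus ?thesis using 2 by simp
    qed
  qed (use S dclose_sub in auto)
  thus ?thesis using 2 by (simp add: lb_def full_def)
qed

text \<open>Valid for either parity of \<open>q\<close>. For odd \<open>q\<close> the leaf lemma
  reduces the difference to components of the whole graph; for even \<open>q\<close> the second term
  will count eldest children.\<close>

lemma (in reeb) dgz_half_open:
  assumes S: "convex_ints S" "S \<noteq> {}" and odd: "\<And>p. p \<in> lo S \<Longrightarrow> odd p" and q: "q \<in> hi S"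
  shows "dgz G S = int (card (comps_at G {..q - 1} S)) - int (card (comps_at G {..q} (insert q S)))"
proof -
  have hi: "hi S = {q}" using q hi_unique[OF S(1)] by blast
  have "dgz G S = lb G S - lb G (insert q S)" using dgz_eq[OF S] hi by simp
  moreover have "lb G S = int (card (comps_at G {..q - 1} S))"
    using lb_closed[OF S odd] dclose_hi[OF S(1) q] by simp
  moreover have "dclose (insert q S) = {..q}"
    using dclose_insert_hi[OF q] dclose_hi[OF S(1) q] by auto
  hence "lb G (insert q S) = int (card (comps_at G {..q} (insert q S)))"
    using lb_closed[OF convex_insert_hi[OF S(1) q]] lo_insert_hi[OF S(1) q] odd by simp
  ultimately show ?thesis by simp
qed

text \<open>An odd right neighbour is again a leaf level, and the leaf lemma with
  \<open>T' = UNIV\<close> absorbs the second half-open term.\<close>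

lemma (in reeb) dgz_closed:
  assumes S: "convex_ints S" "S \<noteq> {}"
    and odd: "\<And>p. p \<in> lo S \<Longrightarrow> odd p" "\<And>q. q \<in> hi S \<Longrightarrow> odd q"
  shows "dgz G S = int (card (comps_at G UNIV S))"
proof (cases rule: hi_cases[OF S(1)])
  case 1
  thus ?thesis using dgz_eq[OF S, of G] lb_closed[OF S odd(1)] dclose_no_hi[OF 1 S(2)] by simp
next
  case (2 q)
  have q: "q \<in> hi S" using 2 by simp
  have ins: "insert q {..q - 1} = {..q}" by auto
  have "card (comps_at G {..q - 1} S) =
    card (comps_at G UNIV S) + card (comps_at G (insert q {..q - 1}) (insert q S))"
  proof (rule card_comps_at_leaf)
    show "odd q" using odd(2) q .
    show "S \<subseteq> {..q - 1}" using hi_greater[OF S(1) q] by force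
    show "q - 1 \<in> S \<or> q + 1 \<in> S" using q by (auto simp: hi_def)
    show "k = q" if "k \<in> UNIV - {..q - 1}" "s \<in> S" "k = s + 1 \<or> k = s - 1" for k s
      using that hi_greater[OF S(1) q, of s] by auto
  qed (use S in auto)
  thus ?thesis using dgz_half_open[OF S odd(1) q] ins by simp
qed

subsection \<open>Reflection\<close>

text \<open>The negation of levels preserves parity, so odd levels still carry the maps, and left
  and right ends of intervals are exchanged.\<close>

definition rfl :: "'a zigzag \<Rightarrow> 'a zigzag" where
  "rfl G = \<lparr>Lev = (\<lambda>n. Lev G (- n)), Up = (\<lambda>n. Dn G (- n)), Dn = (\<lambda>n. Up G (- n))\<rparr>"

definition rn :: "'a node \<Rightarrow> 'a node" where
  "rn a = (- fst a, snd a)"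

lemma rn_rn [simp]: "rn (rn a) = a"
  by (simp add: rn_def)

lemma rn_image_rn [simp]: "rn ` (rn ` K) = K"
  by (simp add: image_image)

lemma uminus_image_uminus [simp]: "uminus ` (uminus ` S) = (S :: int set)"
  by (simp add: image_image)

lemma reeb_rfl: "reeb G \<Longrightarrow> reeb (rfl G)"
proof -
  assume "reeb G"
  then interpret reeb G .
  show ?thesis
  proof
    fix n x assume n: "odd n" "x \<in> Lev (rfl G) n"
    have e: "- (n + 1) = - n - 1" "- (n - 1) = - n + 1" by simp_all
    show "Up (rfl G) n x \<in> Lev (rfl G) (n + 1)"
      using Dn[of "- n" x] n by (simp add: rfl_def e del: minus_add_distrib minus_diff_eq)
    show "Dn (rfl G) n x \<in> Lev (rfl G) (n - 1)"
      using Up[of "- n" x] n by (simp add: rfl_def e del: minus_add_distrib minus_diff_eq)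
  qed (simp add: rfl_def finite_Lev)
qed

lemma nodes_rfl: "nodes (rfl G) S = rn ` nodes G (uminus ` S)"
proof (intro set_eqI iffI)
  fix a assume "a \<in> nodes (rfl G) S"
  hence "rn a \<in> nodes G (uminus ` S)" by (auto simp: nodes_def rfl_def rn_def)
  thus "a \<in> rn ` nodes G (uminus ` S)" by (metis imageI rn_rn)
qed (auto simp: nodes_def rfl_def rn_def)

lemma edges_rfl: "(a, b) \<in> edges (rfl G) S \<longleftrightarrow> (rn a, rn b) \<in> edges G (uminus ` S)"
proof -
  obtain m x n y where ab: "a = (m, x)" "b = (n, y)" by (metis surj_pair)
  have 1: "n = m + 1 \<longleftrightarrow> - n = - m - 1" "n = m - 1 \<longleftrightarrow> - n = - m + 1" by auto
  have 2: "m \<in> S \<longleftrightarrow> - m \<in> uminus ` S" "n \<in> S \<longleftrightarrow> - n \<in> uminus ` S" by auto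
  show ?thesis unfolding ab edges_def rfl_def rn_def using 1 2 by auto
qed

lemma linked_rfl_imp: "(a, b) \<in> linked (rfl G) S \<Longrightarrow> (rn a, rn b) \<in> linked G (uminus ` S)"
proof (induction rule: linked_induct)
  case (step b c)
  have "(rn b, rn c) \<in> linked G (uminus ` S)"
    using step.hyps(2) edges_rfl edges_linked linked_sym by metis
  thus ?case using step.IH linked_trans by metis
qed simp

lemma rfl_rfl [simp]: "rfl (rfl G) = G"
  by (simp add: rfl_def)

lemma linked_rfl: "(a, b) \<in> linked (rfl G) S \<longleftrightarrow> (rn a, rn b) \<in> linked G (uminus ` S)"
  using linked_rfl_imp[of a b G S] linked_rfl_imp[of "rn a" "rn b" "rfl G" "uminus ` S"] by auto

lemma cmp_rfl: "cmp (rfl G) S a = rn ` cmp G (uminus ` S) (rn a)"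
proof (intro set_eqI iffI)
  fix b assume "b \<in> cmp (rfl G) S a"
  hence "rn b \<in> cmp G (uminus ` S) (rn a)" by (simp add: cmp_iff linked_rfl)
  thus "b \<in> rn ` cmp G (uminus ` S) (rn a)" by (metis imageI rn_rn)
qed (auto simp: cmp_iff linked_rfl)

lemma comps_rfl: "comps (rfl G) S = (`) rn ` comps G (uminus ` S)"
  unfolding comps_def nodes_rfl by (simp add: image_image cmp_rfl)

lemma lev_rn: "lev (rn ` K) = uminus ` lev K"
  by (simp add: lev_def image_image rn_def)

lemma comps_at_rfl: "comps_at (rfl G) T S = (`) rn ` comps_at G (uminus ` T) (uminus ` S)"
proof -
  have "lev (rn ` K) = S \<longleftrightarrow> lev K = uminus ` S" for K :: "'a node set"
    unfolding lev_rn using uminus_image_uminus by metis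
  thus ?thesis unfolding comps_at_def comps_rfl by blast
qed

lemma full_rfl: "full (rfl G) S = full G (uminus ` S)"
proof -
  have "inj_on ((`) rn) A" for A :: "'a node set set"
    by (rule inj_onI) (metis rn_image_rn)
  thus ?thesis unfolding full_def comps_at_rfl by (rule card_image)
qed

lemma mem_uminus_image: "n \<in> uminus ` S \<longleftrightarrow> - n \<in> (S :: int set)"
  by force

lemma lo_uminus: "lo (uminus ` S) = uminus ` hi S"
proof -
  have "- (n + 1) = - n - 1" for n :: int by simp
  thus ?thesis unfolding set_eq_iff lo_def hi_def mem_uminus_image mem_Collect_eq by metis
qed

lemma hi_uminus: "hi (uminus ` S) = uminus ` lo S"
  using lo_uminus[of "uminus ` S"] by (metis uminus_image_uminus)

lemma dgz_rfl: "dgz (rfl G) (uminus ` S) = dgz G S"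
proof -
  have "Pow (lo (uminus ` S) \<union> hi (uminus ` S)) = (`) uminus ` Pow (lo S \<union> hi S)"
    unfolding lo_uminus hi_uminus by (metis image_Pow_surj image_Un sup_commute)
  moreover have "inj_on ((`) uminus) (Pow (lo S \<union> hi S))"
    by (rule inj_onI) (metis uminus_image_uminus)
  moreover have "card (uminus ` A) = card A" for A :: "int set" by (simp add: card_image)
  moreover have "full (rfl G) (uminus ` S \<union> uminus ` A) = full G (S \<union> A)" for A
    by (simp add: full_rfl image_Un)
  ultimately show ?thesis unfolding dgz_def by (simp add: sum.reindex)
qed

lemma convex_ints_uminus:
  assumes "convex_ints S"
  shows "convex_ints (uminus ` S)"
  unfolding convex_ints_def
proof (intro ballI allI impI)
  fix i k j assume "i \<in> uminus ` S" "k \<in> uminus ` S" "i \<le> j" "j \<le> k"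
  hence "- i \<in> S" "- k \<in> S" "- k \<le> - j" "- j \<le> - i" by auto
  hence "- j \<in> S" using assms unfolding convex_ints_def by blast
  thus "j \<in> uminus ` S" by force
qed

subsection \<open>Interleavings\<close>

text \<open>The levels of the index set over which the extended functor at \<open>u\<close> is a
  colimit: level \<open>n\<close> stands for the pair \<open>((n + 1) div 2, n div 2)\<close>. In
  \<open>swin\<close> the left bound is dropped.\<close>

definition win :: "real \<times> real \<Rightarrow> int set" where
  "win u = {n. fst u \<le> of_int ((n + 1) div 2) \<and> of_int (n div 2) \<le> snd u}"

definition swin :: "ereal \<Rightarrow> int set" where
  "swin t = {n. ereal (of_int (n div 2)) \<le> t}"

text \<open>The map induced by \<open>f\<close> on the components of sublevel sets, which are colimits of windows.\<close>

definition fbar ::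
  "'a zigzag \<Rightarrow> 'b zigzag \<Rightarrow> real \<Rightarrow> (real \<times> real \<Rightarrow> 'a node set \<Rightarrow> 'b node set) \<Rightarrow>
    ereal \<Rightarrow> 'a node set \<Rightarrow> 'b node set"
where
  "fbar G H \<epsilon> f t K = (SOME K'. K' \<in> comps H (swin (t + ereal \<epsilon>)) \<and>
     (\<exists>u c. u \<in> UU \<and> ereal (snd u) \<le> t \<and> c \<in> comps G (win u) \<and> c \<subseteq> K \<and> f u c \<subseteq> K'))"

text \<open>Only even levels are read off, as \<open>2 * i\<close> sits at the integer
  \<open>i\<close>. In a sublevel set every odd node is linked to the even level below it, so a
  lowest level is even.\<close>

definition birth :: "'a node set \<Rightarrow> ereal" where
  "birth K = Inf {ereal (of_int i) | i x. (2 * i, x) \<in> K}"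

definition death :: "'a node set \<Rightarrow> ereal" where
  "death K = Sup {ereal (of_int i) | i x. (2 * i, x) \<in> K}"

text \<open>Stated without subtraction, so that equal infinite values are near each other.\<close>

definition near :: "real \<Rightarrow> ereal \<Rightarrow> ereal \<Rightarrow> bool" where
  "near \<epsilon> a b \<longleftrightarrow> a \<le> b + ereal \<epsilon> \<and> b \<le> a + ereal \<epsilon>"

lemma near_sym: "near \<epsilon> a b \<longleftrightarrow> near \<epsilon> b a"
  by (auto simp: near_def)

lemma win_mono: "u \<unlhd> v \<Longrightarrow> win u \<subseteq> win v"
  by (auto simp: win_def op_le_def)

lemma win_swin: "ereal (snd u) \<le> t \<Longrightarrow> win u \<subseteq> swin t"
  by (auto simp: win_def swin_def intro: order_trans[rotated])

lemma swin_mono: "t \<le> t' \<Longrightarrow> swin t \<subseteq> swin t'"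
  by (auto simp: swin_def)

lemma swin_real: "swin (ereal t) = {..2 * \<lfloor>t\<rfloor> + 1}"
proof -
  have "real_of_int (n div 2) \<le> t \<longleftrightarrow> n \<le> 2 * \<lfloor>t\<rfloor> + 1" for n
  proof -
    have "real_of_int (n div 2) \<le> t \<longleftrightarrow> n div 2 \<le> \<lfloor>t\<rfloor>" by linarith
    thus ?thesis by presburger
  qed
  thus ?thesis by (auto simp: swin_def)
qed

lemma swin_infty [simp]: "swin \<infinity> = UNIV"
  by (simp add: swin_def)

lemma shift_pt_UU: "u \<in> UU \<Longrightarrow> 0 \<le> \<epsilon> \<Longrightarrow> shift_pt \<epsilon> u \<in> UU"
  by (auto simp: UU_def shift_pt_def)

lemma shift_pt_mono: "u \<unlhd> v \<Longrightarrow> shift_pt \<epsilon> u \<unlhd> shift_pt \<epsilon> v"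
  by (auto simp: op_le_def shift_pt_def)

text \<open>An interleaving transported to components of windows. Naturality and the composition
  laws can be stated as inclusions, because the component of a larger window that contains a given
  component is unique.\<close>

locale interleaving = X: reeb G + Y: reeb H
  for G :: "'a zigzag" and H :: "'b zigzag" +
  fixes \<epsilon> :: real
    and f :: "real \<times> real \<Rightarrow> 'a node set \<Rightarrow> 'b node set"
    and g :: "real \<times> real \<Rightarrow> 'b node set \<Rightarrow> 'a node set"
  assumes eps: "0 \<le> \<epsilon>"
    and f_comps: "u \<in> UU \<Longrightarrow> c \<in> comps G (win u) \<Longrightarrow> f u c \<in> comps H (win (shift_pt \<epsilon> u))"
    and f_mono: "u \<in> UU \<Longrightarrow> v \<in> UU \<Longrightarrow> u \<unlhd> v \<Longrightarrow> c \<in> comps G (win u) \<Longrightarrow> c' \<in> comps G (win v) \<Longrightarrow>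
      c \<subseteq> c' \<Longrightarrow> f u c \<subseteq> f v c'"
    and gf: "u \<in> UU \<Longrightarrow> c \<in> comps G (win u) \<Longrightarrow> c \<subseteq> g (shift_pt \<epsilon> u) (f u c)"
    and g_comps: "u \<in> UU \<Longrightarrow> d \<in> comps H (win u) \<Longrightarrow> g u d \<in> comps G (win (shift_pt \<epsilon> u))"
    and g_mono: "u \<in> UU \<Longrightarrow> v \<in> UU \<Longrightarrow> u \<unlhd> v \<Longrightarrow> d \<in> comps H (win u) \<Longrightarrow> d' \<in> comps H (win v) \<Longrightarrow>
      d \<subseteq> d' \<Longrightarrow> g u d \<subseteq> g v d'"
    and fg: "u \<in> UU \<Longrightarrow> d \<in> comps H (win u) \<Longrightarrow> d \<subseteq> f (shift_pt \<epsilon> u) (g u d)"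
begin

lemma interleaving_sym: "interleaving H G \<epsilon> g f"
  by unfold_locales (fact eps f_comps f_mono gf g_comps g_mono fg)+

end

context reeb
begin

text \<open>A path meets finitely many levels, so the components of a sublevel set are assembled
  from bounded windows.\<close>

lemma linked_swin_window:
  assumes "(a, b) \<in> linked G (swin t)" "a \<in> nodes G (swin t)"
  shows "\<exists>u\<in>UU. ereal (snd u) \<le> t \<and> a \<in> nodes G (win u) \<and> (a, b) \<in> linked G (win u)"
  using assms(1)
proof (induction rule: linked_induct)
  case refl
  let ?s = "real_of_int (fst a div 2)"
  have "a \<in> nodes G (win (?s, ?s))" using assms(2) by (auto simp: nodes_def win_def intro: zdiv_mono1)
  moreover have "ereal ?s \<le> t" using assms(2) by (auto simp: nodes_def swin_def)
  ultimately show ?case by (intro bexI[of _ "(?s, ?s)"]) (auto simp: UU_def)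
next
  case (step b c)
  then obtain u where u: "u \<in> UU" "ereal (snd u) \<le> t" "a \<in> nodes G (win u)" "(a, b) \<in> linked G (win u)"
    by blast
  let ?s = "real_of_int (fst c div 2)"
  let ?v = "(min (fst u) ?s, max (snd u) ?s)"
  have c: "c \<in> nodes G (swin t)" using step.hyps(2) edges_nodes by blast
  have uv: "u \<unlhd> ?v" by (simp add: op_le_def)
  have "ereal ?s \<le> t" using c by (auto simp: nodes_def swin_def)
  hence vt: "ereal (snd ?v) \<le> t" using u(2) by (simp add: max_def)
  have "real_of_int (fst c div 2) \<le> real_of_int ((fst c + 1) div 2)" by simp
  hence cv: "fst c \<in> win ?v" unfolding win_def by (simp add: min_le_iff_disj)
  have bv: "fst b \<in> win ?v" using linked_nodes[OF u(4,3)] fst_nodes win_mono[OF uv] by blast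
  have "(b, c) \<in> edges G (win ?v) \<or> (c, b) \<in> edges G (win ?v)"
    using step.hyps(2) cv bv unfolding edges_def by auto
  hence "(b, c) \<in> linked G (win ?v)" using edges_linked linked_sym by blast
  hence "(a, c) \<in> linked G (win ?v)" using linked_mono[OF win_mono[OF uv] u(4)] linked_trans by blast
  moreover have "a \<in> nodes G (win ?v)" using u(3) nodes_mono[OF win_mono[OF uv]] by blast
  moreover have "?v \<in> UU" using u(1) by (auto simp: UU_def)
  ultimately show ?case using vt by blast
qed

lemma comps_swin_window:
  assumes "K \<in> comps G (swin t)" "a \<in> K" "b \<in> K"
  shows "\<exists>u\<in>UU. \<exists>c\<in>comps G (win u). ereal (snd u) \<le> t \<and> a \<in> c \<and> b \<in> c \<and> c \<subseteq> K"
proof -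
  have "a \<in> nodes G (swin t)" using comps_sub assms by blast
  then obtain u where u: "u \<in> UU" "ereal (snd u) \<le> t" "a \<in> nodes G (win u)" "(a, b) \<in> linked G (win u)"
    using linked_swin_window[OF comps_linked[OF assms]] by blast
  have c: "cmp G (win u) a \<in> comps G (win u)" using u(3) by (rule cmp_comps)
  have "cmp G (win u) a \<subseteq> K"
    by (rule comps_subset_if_meet[OF win_swin[OF u(2)] c assms(1) _ assms(2)]) simp
  thus ?thesis using u c by (intro bexI[of _ u] bexI[of _ "cmp G (win u) a"]) (auto simp: cmp_iff)
qed

end

context interleaving
begin

abbreviation "fb \<equiv> fbar G H \<epsilon> f"
abbreviation "gb \<equiv> fbar H G \<epsilon> g"

lemma win_shift_swin: "ereal (snd u) \<le> t \<Longrightarrow> win (shift_pt \<epsilon> u) \<subseteq> swin (t + ereal \<epsilon>)"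
  by (rule win_swin) (auto simp: shift_pt_def simp flip: plus_ereal.simps(1) intro: add_right_mono)

text \<open>Independence of the choices in \<open>fbar\<close>: two window components inside
  \<open>K\<close> lie in a common component over a larger window whose right end is still at most
  \<open>t\<close>, and monotonicity of \<open>f\<close> puts their images into one
  component.\<close>

lemma fb_aux:
  assumes K: "K \<in> comps G (swin t)" and u: "u \<in> UU" "ereal (snd u) \<le> t"
    and c: "c \<in> comps G (win u)" "c \<subseteq> K"
  shows "fb t K \<in> comps H (swin (t + ereal \<epsilon>)) \<and> f u c \<subseteq> fb t K"
proof -
  let ?P = "\<lambda>K'. K' \<in> comps H (swin (t + ereal \<epsilon>)) \<and>
     (\<exists>u c. u \<in> UU \<and> ereal (snd u) \<le> t \<and> c \<in> comps G (win u) \<and> c \<subseteq> K \<and> f u c \<subseteq> K')"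
  have "?P (ext H (swin (t + ereal \<epsilon>)) (f u c))"
    using Y.ext[OF f_comps[OF u(1) c(1)] win_shift_swin[OF u(2)]] u c by blast
  hence P: "?P (fb t K)" unfolding fbar_def by (rule someI)
  then obtain u0 c0 where u0: "u0 \<in> UU" "ereal (snd u0) \<le> t" "c0 \<in> comps G (win u0)" "c0 \<subseteq> K"
    "f u0 c0 \<subseteq> fb t K" by blast
  obtain a a0 where a: "a \<in> c" "a0 \<in> c0" using comps_nonempty c(1) u0(3) by blast
  obtain w cw where w: "w \<in> UU" "cw \<in> comps G (win w)" "ereal (snd w) \<le> t" "a \<in> cw" "a0 \<in> cw"
    using X.comps_swin_window[OF K, of a a0] a c(2) u0(4) by blast
  define v where "v = (min (fst u) (min (fst u0) (fst w)), max (snd u) (max (snd u0) (snd w)))"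
  have v: "v \<in> UU" "u \<unlhd> v" "u0 \<unlhd> v" "w \<unlhd> v" "ereal (snd v) \<le> t"
    using u u0(1,2) w(1,3) by (auto simp: v_def UU_def op_le_def max_def)
  let ?c = "ext G (win v) cw"
  note e = X.ext[OF w(2) win_mono[OF v(4)]]
  have sub: "c \<subseteq> ?c" "c0 \<subseteq> ?c"
    using comps_subset_if_meet[OF win_mono[OF v(2)] c(1) e(1) a(1)]
      comps_subset_if_meet[OF win_mono[OF v(3)] u0(3) e(1) a(2)] e(2) w(4,5) by blast+
  have fc: "f u c \<subseteq> f v ?c" "f u0 c0 \<subseteq> f v ?c"
    using f_mono[OF u(1) v(1,2) c(1) e(1) sub(1)] f_mono[OF u0(1) v(1,3) u0(3) e(1) sub(2)] .
  obtain b where b: "b \<in> f u0 c0" using comps_nonempty f_comps[OF u0(1,3)] by blast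
  have "f v ?c \<subseteq> fb t K"
    using comps_subset_if_meet[OF win_shift_swin[OF v(5)] f_comps[OF v(1) e(1)], of "fb t K" b]
      P fc(2) u0(5) b by blast
  thus ?thesis using P fc(1) by blast
qed

lemma fb_comps:
  assumes K: "K \<in> comps G (swin t)"
  shows "fb t K \<in> comps H (swin (t + ereal \<epsilon>))"
proof -
  obtain a where "a \<in> K" using comps_nonempty K by blast
  then obtain u c where "u \<in> UU" "c \<in> comps G (win u)" "ereal (snd u) \<le> t" "c \<subseteq> K"
    using X.comps_swin_window[OF K] by blast
  thus ?thesis using fb_aux[OF K] by blast
qed

lemma f_fb:
  assumes "K \<in> comps G (swin t)" "u \<in> UU" "ereal (snd u) \<le> t" "c \<in> comps G (win u)" "c \<subseteq> K"
  shows "f u c \<subseteq> fb t K"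
  using fb_aux[OF assms] by blast

lemma fb_mono:
  assumes K: "K \<in> comps G (swin t)" "K' \<in> comps G (swin t')" "t \<le> t'" "K \<subseteq> K'"
  shows "fb t K \<subseteq> fb t' K'"
proof -
  obtain a where "a \<in> K" using comps_nonempty K(1) by blast
  then obtain u c where u: "u \<in> UU" "c \<in> comps G (win u)" "ereal (snd u) \<le> t" "c \<subseteq> K"
    using X.comps_swin_window[OF K(1)] by blast
  obtain b where b: "b \<in> f u c" using comps_nonempty f_comps[OF u(1,2)] by blast
  have "f u c \<subseteq> fb t K" "f u c \<subseteq> fb t' K'"
    using f_fb[OF K(1) u(1,3,2,4)] f_fb[OF K(2) u(1) _ u(2)] u(3,4) K(3,4) by auto
  moreover have "swin (t + ereal \<epsilon>) \<subseteq> swin (t' + ereal \<epsilon>)"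
    by (rule swin_mono[OF add_right_mono[OF K(3)]])
  ultimately show ?thesis
    using comps_subset_if_meet[OF _ fb_comps[OF K(1)] fb_comps[OF K(2)], of b] b by blast
qed

lemma gb_fb:
  assumes K: "K \<in> comps G (swin t)"
  shows "K \<subseteq> gb (t + ereal \<epsilon>) (fb t K)"
proof -
  interpret S: interleaving H G \<epsilon> g f by (rule interleaving_sym)
  obtain a where "a \<in> K" using comps_nonempty K(1) by blast
  then obtain u c where u: "u \<in> UU" "c \<in> comps G (win u)" "ereal (snd u) \<le> t" "c \<subseteq> K"
    using X.comps_swin_window[OF K(1)] by blast
  obtain b where b: "b \<in> c" using comps_nonempty u(2) by blast
  have "ereal (snd (shift_pt \<epsilon> u)) \<le> t + ereal \<epsilon>"
    using u(3) by (auto simp: shift_pt_def simp flip: plus_ereal.simps(1) intro: add_right_mono)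
  hence "g (shift_pt \<epsilon> u) (f u c) \<subseteq> gb (t + ereal \<epsilon>) (fb t K)"
    using S.f_fb[OF fb_comps[OF K] shift_pt_UU[OF u(1) eps] _ f_comps[OF u(1,2)] f_fb[OF K u(1,3,2,4)]]
    by blast
  hence "b \<in> gb (t + ereal \<epsilon>) (fb t K)" using gf[OF u(1,2)] b by blast
  moreover have "t \<le> t + ereal \<epsilon> + ereal \<epsilon>" using eps by (cases t) auto
  ultimately show ?thesis
    using comps_subset_if_meet[OF swin_mono K S.fb_comps[OF fb_comps[OF K]]] b u(4) by blast
qed

text \<open>The window at the single point \<open>i\<close> is mapped into the window of radius
  \<open>\<epsilon>\<close> around \<open>i\<close>. This localization is what bounds the change of
  births and deaths.\<close>

lemma fb_even_node:
  assumes K: "K \<in> comps G (swin t)" and x: "(2 * i, x) \<in> K"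
  shows "\<exists>j y. (2 * j, y) \<in> fb t K \<and> \<bar>real_of_int i - real_of_int j\<bar> \<le> \<epsilon>"
proof -
  let ?u = "(real_of_int i, real_of_int i)"
  let ?c = "cmp G (win ?u) (2 * i, x)"
  have nod: "(2 * i, x) \<in> nodes G (swin t)" using X.comps_sub[OF K] x by blast
  hence it: "ereal (snd ?u) \<le> t" by (simp add: swin_def)
  have u: "?u \<in> UU" by (simp add: UU_def)
  have "(2 * i, x) \<in> nodes G (win ?u)" using nod by (simp add: win_def)
  hence c: "?c \<in> comps G (win ?u)" by (rule cmp_comps)
  have "?c \<subseteq> K" by (rule comps_subset_if_meet[OF win_swin[OF it] c K _ x]) simp
  hence sub: "f ?u ?c \<subseteq> fb t K" using f_fb[OF K u it c] by blast
  note fc = f_comps[OF u c]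
  let ?w = "win (shift_pt \<epsilon> ?u)"
  obtain n y where ny: "(n, y) \<in> f ?u ?c" using comps_nonempty[OF fc] by auto
  have nw: "n \<in> ?w" "y \<in> Lev H n" using Y.comps_sub[OF fc] ny by auto
  have ineq: "i - \<epsilon> \<le> of_int ((n + 1) div 2)" "of_int (n div 2) \<le> i + \<epsilon>"
    using nw(1) by (auto simp: win_def shift_pt_def)
  have "\<exists>j y. (2 * j, y) \<in> f ?u ?c \<and> \<bar>real_of_int i - real_of_int j\<bar> \<le> \<epsilon>"
  proof (cases "even n")
    case True
    then obtain j where "n = 2 * j" by blast
    thus ?thesis using ny ineq by (intro exI[of _ j] exI[of _ y]) auto
  next
    case False
    then obtain j where j: "n = 2 * j + 1" using oddE by blast
    have e: "(n + 1) div 2 = j + 1" "n div 2 = j" using j by simp_all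
    \<comment> \<open>The edge from \<open>j\<close> to \<open>j + 1\<close> may stick out of the
      interval of radius \<open>\<epsilon>\<close>, but its end nearer to \<open>i\<close> does
      not.\<close>
    show ?thesis
    proof (cases "j < i")
      case True
      have "real_of_int j + 1 \<le> real_of_int i" using True by linarith
      hence in1: "\<bar>real_of_int i - real_of_int (j + 1)\<bar> \<le> \<epsilon>" using ineq e by (auto simp: abs_le_iff)
      have "n + 1 \<in> ?w" using ineq e j eps in1 by (auto simp: win_def shift_pt_def abs_le_iff)
      hence "((n, y), (n + 1, Up H n y)) \<in> edges H ?w" using nw False by (auto simp: edges_def)
      hence "(n + 1, Up H n y) \<in> f ?u ?c" using comps_closed[OF fc ny] edges_linked by blast
      thus ?thesis using in1 j by (intro exI[of _ "j + 1"] exI[of _ "Up H n y"]) (simp add: algebra_simps)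
    next
      case False': False
      have "real_of_int i \<le> real_of_int j" using False' by linarith
      hence in1: "\<bar>real_of_int i - real_of_int j\<bar> \<le> \<epsilon>" using ineq e by (auto simp: abs_le_iff)
      have "n - 1 \<in> ?w" using ineq e j eps in1 by (auto simp: win_def shift_pt_def abs_le_iff)
      hence "((n, y), (n - 1, Dn H n y)) \<in> edges H ?w" using nw False by (auto simp: edges_def)
      hence "(n - 1, Dn H n y) \<in> f ?u ?c" using comps_closed[OF fc ny] edges_linked by blast
      thus ?thesis using in1 j by (intro exI[of _ j] exI[of _ "Dn H n y"]) (simp add: algebra_simps)
    qed
  qed
  thus ?thesis using sub by blast
qed

lemma birth_fb:
  assumes K: "K \<in> comps G (swin t)"
  shows "birth (fb t K) \<le> birth K + ereal \<epsilon>"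
proof -
  have "birth (fb t K) - ereal \<epsilon> \<le> birth K"
    unfolding birth_def[of K]
  proof (rule Inf_greatest)
    fix z assume "z \<in> {ereal (of_int i) | i x. (2 * i, x) \<in> K}"
    then obtain i x where z: "z = ereal (of_int i)" "(2 * i, x) \<in> K" by blast
    obtain j y where j: "(2 * j, y) \<in> fb t K" "\<bar>real_of_int i - real_of_int j\<bar> \<le> \<epsilon>"
      using fb_even_node[OF K z(2)] by blast
    have "birth (fb t K) \<le> ereal (of_int j)" unfolding birth_def using j(1) by (intro Inf_lower) blast
    also have "\<dots> \<le> z + ereal \<epsilon>" using j(2) z by simp
    finally show "birth (fb t K) - ereal \<epsilon> \<le> z" by (simp add: ereal_minus_le)
  qed
  thus ?thesis by (simp add: ereal_minus_le)
qed

lemma death_fb: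
  assumes K: "K \<in> comps G (swin t)"
  shows "death K \<le> death (fb t K) + ereal \<epsilon>"
  unfolding death_def[of K]
proof (rule Sup_least)
  fix z assume "z \<in> {ereal (of_int i) | i x. (2 * i, x) \<in> K}"
  then obtain i x where z: "z = ereal (of_int i)" "(2 * i, x) \<in> K" by blast
  obtain j y where j: "(2 * j, y) \<in> fb t K" "\<bar>real_of_int i - real_of_int j\<bar> \<le> \<epsilon>"
    using fb_even_node[OF K z(2)] by blast
  have "z \<le> ereal (of_int j) + ereal \<epsilon>" using j(2) z by simp
  also have "\<dots> \<le> death (fb t K) + ereal \<epsilon>"
    unfolding death_def using j(1) by (intro add_right_mono Sup_upper) blast
  finally show "z \<le> death (fb t K) + ereal \<epsilon>" .
qed

end

text \<open>At \<open>t = \<infinity>\<close> the shift by \<open>\<epsilon>\<close> disappears, so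
  the two induced maps are inverse to each other.\<close>

theorem global_matching:
  assumes "interleaving G H \<epsilon> f g"
  shows "\<exists>m. m \<subseteq> {(K, K'). near \<epsilon> (birth K) (birth K') \<and> near \<epsilon> (death K) (death K')} \<and>
    partial_inj m \<and> Domain m = comps G UNIV \<and> Range m = comps H UNIV"
proof -
  interpret interleaving G H \<epsilon> f g by fact
  interpret S: interleaving H G \<epsilon> g f by (rule interleaving_sym)
  have F: "fb \<infinity> K \<in> comps H UNIV" if "K \<in> comps G UNIV" for K using fb_comps[of K \<infinity>] that by simp
  have G: "gb \<infinity> K \<in> comps G UNIV" if "K \<in> comps H UNIV" for K using S.fb_comps[of K \<infinity>] that by simp
  have GF: "gb \<infinity> (fb \<infinity> K) = K" if "K \<in> comps G UNIV" for K
    using gb_fb[of K \<infinity>] that comps_nonempty[OF that] comps_eqI[OF that G[OF F[OF that]]] by auto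
  have FG: "fb \<infinity> (gb \<infinity> K) = K" if "K \<in> comps H UNIV" for K
    using S.gb_fb[of K \<infinity>] that comps_nonempty[OF that] comps_eqI[OF that F[OF G[OF that]]] by auto
  let ?m = "{(K, K'). K \<in> comps G UNIV \<and> K' = fb \<infinity> K}"
  have "near \<epsilon> (birth K) (birth (fb \<infinity> K)) \<and> near \<epsilon> (death K) (death (fb \<infinity> K))"
    if K: "K \<in> comps G UNIV" for K
    using birth_fb[of K \<infinity>] S.birth_fb[of "fb \<infinity> K" \<infinity>] death_fb[of K \<infinity>] S.death_fb[of "fb \<infinity> K" \<infinity>]
      K F[OF K] GF[OF K] by (simp add: near_def)
  hence "?m \<subseteq> {(K, K'). near \<epsilon> (birth K) (birth K') \<and> near \<epsilon> (death K) (death K')}" by blast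
  moreover have "K = K'" if "K \<in> comps G UNIV" "K' \<in> comps G UNIV" "fb \<infinity> K = fb \<infinity> K'" for K K'
    using that GF by metis
  hence "partial_inj ?m" unfolding partial_inj_def single_valued_def by blast
  moreover have "Domain ?m = comps G UNIV" by blast
  moreover have "Range ?m = comps H UNIV" using F G FG by force
  ultimately show ?thesis by blast
qed

text \<open>Compares half-open bars by the sum of their endpoints, bars born at \<open>- \<infinity>\<close> coming first.\<close>

definition rank_le :: "ereal \<Rightarrow> real \<Rightarrow> ereal \<Rightarrow> real \<Rightarrow> bool" where
  "rank_le b d b' d' \<longleftrightarrow>
     (if b = -\<infinity> then b' = -\<infinity> \<longrightarrow> d \<le> d' else b' \<noteq> -\<infinity> \<and> real_of_ereal b + d \<le> real_of_ereal b' + d')"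

section \<open>Matching bars through a product of two matrices\<close>

lemma near_ereal: "near \<epsilon> (ereal a) (ereal b) \<longleftrightarrow> a \<le> b + \<epsilon> \<and> b \<le> a + \<epsilon>"
  by (simp add: near_def)

text \<open>The middle bar cannot be too large for the first bar nor too small for the second. If it
  were far from both, it would have a coordinate too small for the first and one too large for the
  second; whether or not these coordinates coincide, the sum of the endpoints would drop from the
  first bar to the second.\<close>

lemma near_if_between:
  assumes fin: "b \<noteq> \<infinity>" "b' \<noteq> \<infinity>"
    and le: "bm \<le> b + ereal \<epsilon>" "dm \<le> d + \<epsilon>" "b' \<le> bm + ereal \<epsilon>" "d' \<le> dm + \<epsilon>"
    and rank: "rank_le b d b' d'" and eps: "0 \<le> \<epsilon>"
  shows "near \<epsilon> b bm \<and> near \<epsilon> (ereal d) (ereal dm) \<or> near \<epsilon> b' bm \<and> near \<epsilon> (ereal d') (ereal dm)"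
proof (cases b)
  case MInf
  hence bm: "bm = -\<infinity>" using le(1) by simp
  hence "b' = -\<infinity>" using le(3) by simp
  hence "d \<le> d'" using rank MInf by (simp add: rank_le_def)
  thus ?thesis using MInf bm le(2,4) by (simp add: near_def)
next
  case (real r)
  hence "b' \<noteq> -\<infinity>" using rank by (auto simp: rank_le_def)
  then obtain r' where r': "b' = ereal r'" using fin(2) by (cases b') auto
  obtain m where m: "bm = ereal m" using le(1,3) real r' by (cases bm) auto
  have "r + d \<le> r' + d'" using rank real r' by (simp add: rank_le_def)
  thus ?thesis using le real r' m by (simp add: near_def) linarith
qed (use fin in simp)

text \<open>Hall's condition for a finite \<open>A\<close> compares it with its neighbourhood
  \<open>N\<close>: an intermediate bar with a nonzero term is near one of the two outer bars, so
  the product factors through \<open>N\<close>, and unitriangularity bounds \<open>card A\<close> by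
  \<open>card N\<close>.\<close>

theorem bars_injection:
  fixes bX :: "'x \<Rightarrow> ereal" and dX :: "'x \<Rightarrow> real" and bY :: "'y \<Rightarrow> ereal" and dY :: "'y \<Rightarrow> real"
    and P :: "'x \<Rightarrow> 'y \<Rightarrow> real"
  assumes eps: "0 \<le> \<epsilon>" and binf: "\<And>x. x \<in> L \<Longrightarrow> bX x \<noteq> \<infinity>"
    and P: "\<And>x y. x \<in> L \<Longrightarrow> y \<in> B \<Longrightarrow> P x y \<noteq> 0 \<Longrightarrow> bY y \<le> bX x + ereal \<epsilon> \<and> dY y \<le> dX x + \<epsilon>"
    and R: "\<And>x y. x \<in> L \<Longrightarrow> y \<in> B \<Longrightarrow> R y x \<noteq> 0 \<Longrightarrow> bX x \<le> bY y + ereal \<epsilon> \<and> dX x \<le> dY y + \<epsilon>"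
    and comp: "\<And>x x' N. x \<in> L \<Longrightarrow> x' \<in> L \<Longrightarrow> rank_le (bX x) (dX x) (bX x') (dX x') \<Longrightarrow>
      finite N \<Longrightarrow> N \<subseteq> B \<Longrightarrow> (\<And>y. y \<in> B \<Longrightarrow> P x y * R y x' \<noteq> 0 \<Longrightarrow> y \<in> N) \<Longrightarrow>
      (\<Sum>y\<in>N. P x y * R y x') = (if x = x' then 1 else 0)"
    and fin: "\<And>x. x \<in> L \<Longrightarrow>
      finite {y \<in> B. near \<epsilon> (bX x) (bY y) \<and> near \<epsilon> (ereal (dX x)) (ereal (dY y))}"
  shows "\<exists>h. inj_on h L \<and>
    (\<forall>x\<in>L. h x \<in> B \<and> near \<epsilon> (bX x) (bY (h x)) \<and> near \<epsilon> (ereal (dX x)) (ereal (dY (h x))))"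
proof -
  define r where "r = {(x, y). y \<in> B \<and> near \<epsilon> (bX x) (bY y) \<and> near \<epsilon> (ereal (dX x)) (ereal (dY y))}"
  have img: "r `` {x} = {y \<in> B. near \<epsilon> (bX x) (bY y) \<and> near \<epsilon> (ereal (dX x)) (ereal (dY y))}" for x
    by (auto simp: r_def)
  have "\<exists>h. inj_on h L \<and> (\<forall>x\<in>L. (x, h x) \<in> r)"
  proof (rule hall_infinite)
    show "finite (r `` {x})" if "x \<in> L" for x unfolding img by (rule fin[OF that])
    fix A assume A: "finite A" "A \<subseteq> L"
    have "r `` A = (\<Union>x\<in>A. r `` {x})" by blast
    hence finN: "finite (r `` A)" using A fin img by auto
    \<comment> \<open>Lexicographic keys for \<open>rank_le\<close>: \<open>s1\<close> puts the bars
      born at minus infinity first.\<close>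
    define s1 :: "'x \<Rightarrow> real" where "s1 x = (if bX x = -\<infinity> then 0 else 1)" for x
    define s2 where "s2 x = (if bX x = -\<infinity> then dX x else real_of_ereal (bX x) + dX x)" for x
    show "card A \<le> card (r `` A)"
    proof (rule card_le_if_unitriangular[OF A(1) finN])
      fix x x' assume xx: "x \<in> A" "x' \<in> A" and s: "s1 x < s1 x' \<or> s1 x = s1 x' \<and> s2 x \<le> s2 x'"
      have rank: "rank_le (bX x) (dX x) (bX x') (dX x')"
        using s unfolding rank_le_def s1_def s2_def by (auto split: if_splits)
      have L: "x \<in> L" "x' \<in> L" using xx A by auto
      show "(\<Sum>y\<in>r `` A. P x y * R y x') = (if x = x' then 1 else 0)"
      proof (rule comp[OF L rank finN])
        show "r `` A \<subseteq> B" by (auto simp: r_def)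
        fix y assume y: "y \<in> B" "P x y * R y x' \<noteq> 0"
        hence nz: "P x y \<noteq> 0" "R y x' \<noteq> 0" by auto
        have "(x, y) \<in> r \<or> (x', y) \<in> r"
          using near_if_between[OF binf[OF L(1)] binf[OF L(2)], of "bY y" \<epsilon> "dY y" "dX x" "dX x'"]
            P[OF L(1) y(1) nz(1)] R[OF L(2) y(1) nz(2)] rank eps y(1) unfolding r_def by blast
        thus "y \<in> r `` A" using xx by blast
      qed
    qed
  qed
  thus ?thesis unfolding r_def by blast
qed

subsection \<open>Half-open intervals: the elder rule\<close>

text \<open>The components of the sublevel set of all points strictly below \<open>q + 1\<close>.\<close>

definition cq :: "'a zigzag \<Rightarrow> int \<Rightarrow> 'a node set set" where
  "cq G q = comps G {..2 * q + 1}"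

text \<open>This includes \<open>K\<close> itself if nothing is attached to it at the two new
  levels.\<close>

definition children :: "'a zigzag \<Rightarrow> int \<Rightarrow> 'a node set \<Rightarrow> 'a node set set" where
  "children G q K = {c \<in> cq G (q - 1). c \<subseteq> K}"

definition eldest :: "'a zigzag \<Rightarrow> int \<Rightarrow> 'a node set \<Rightarrow> 'a node set" where
  "eldest G q K = (SOME c. c \<in> children G q K \<and> (\<forall>c'\<in>children G q K. birth c \<le> birth c'))"

definition ancestor :: "'a zigzag \<Rightarrow> int \<Rightarrow> 'a node set \<Rightarrow> 'a node set" where
  "ancestor G q K = ext G {..2 * q + 1} K"

primrec thread_iter :: "'a zigzag \<Rightarrow> nat \<Rightarrow> int \<Rightarrow> 'a node set \<Rightarrow> 'a node set" where
  "thread_iter G 0 q K = K"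
| "thread_iter G (Suc n) q K = eldest G (q - int n) (thread_iter G n q K)"

text \<open>Follows the eldest children from level \<open>q\<close> down to level \<open>p\<close>.\<close>

definition thread :: "'a zigzag \<Rightarrow> int \<Rightarrow> int \<Rightarrow> 'a node set \<Rightarrow> 'a node set" where
  "thread G q p K = thread_iter G (nat (q - p)) q K"

text \<open>For \<open>x = (d, c)\<close> this is the component that survives when \<open>c\<close>
  merges at \<open>d\<close>; it is \<open>c\<close> itself if \<open>c\<close> is the
  eldest.\<close>

definition sibling :: "'a zigzag \<Rightarrow> int \<times> 'a node set \<Rightarrow> 'a node set" where
  "sibling G x = eldest G (fst x) (ancestor G (fst x) (snd x))"

text \<open>A component of the sublevel set below \<open>d\<close> dies at \<open>d\<close> unless it is the eldest child of its
  successor.\<close>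

definition half_bars :: "'a zigzag \<Rightarrow> (int \<times> 'a node set) set" where
  "half_bars G = {(d, c). c \<in> cq G (d - 1) \<and> sibling G (d, c) \<noteq> c}"

lemma cq_comps_swin: "comps G (swin (ereal t)) = cq G \<lfloor>t\<rfloor>"
  by (simp add: cq_def swin_real)

lemma birth_antimono: "c \<subseteq> K \<Longrightarrow> birth K \<le> birth c"
  unfolding birth_def by (rule Inf_superset_mono) blast

lemma birth_le_int: "birth K \<le> ereal (of_int p) \<Longrightarrow> \<exists>i x. i \<le> p \<and> (2 * i, x) \<in> K"
proof -
  assume "birth K \<le> ereal (of_int p)"
  also have "\<dots> < ereal (of_int (p + 1))" by simp
  finally obtain i x where "(2 * i, x) \<in> K" "ereal (of_int i) < ereal (of_int (p + 1))"
    unfolding birth_def Inf_less_iff by blast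
  thus ?thesis by (intro exI[of _ i] exI[of _ x]) simp
qed

lemma birth_le: "(2 * i, x) \<in> K \<Longrightarrow> birth K \<le> ereal (of_int i)"
  unfolding birth_def by (intro Inf_lower) blast

text \<open>A birth is an infimum of integers, so it cannot lie strictly between two
  integers.\<close>

lemma birth_le_floor: "birth K \<le> ereal t \<Longrightarrow> birth K \<le> ereal (of_int \<lfloor>t\<rfloor>)"
proof -
  assume "birth K \<le> ereal t"
  also have "\<dots> < ereal (of_int (\<lfloor>t\<rfloor> + 1))" by simp
  finally obtain i x where i: "(2 * i, x) \<in> K" "ereal (of_int i) < ereal (of_int (\<lfloor>t\<rfloor> + 1))"
    unfolding birth_def Inf_less_iff by blast
  have "i \<le> \<lfloor>t\<rfloor>" using i(2) by simp
  hence "ereal (of_int i) \<le> ereal (of_int \<lfloor>t\<rfloor>)" by (simp only: ereal_less_eq of_int_le_iff)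
  thus ?thesis using birth_le[OF i(1)] by (rule order_trans[rotated])
qed

context reeb
begin

text \<open>An odd node of a sublevel set always has its lower neighbour there.\<close>

lemma even_below:
  assumes K: "K \<in> cq G q" "(n, x) \<in> K"
  shows "\<exists>i y. (2 * i, y) \<in> K \<and> 2 * i \<le> n"
proof (cases "even n")
  case False
  have K': "K \<in> comps G {..2 * q + 1}" using K by (simp add: cq_def)
  have nx: "n \<in> {..2 * q + 1}" "x \<in> Lev G n" using comps_sub[OF K'] K(2) by auto
  hence "((n, x), (n - 1, Dn G n x)) \<in> edges G {..2 * q + 1}" using False by (auto simp: edges_def)
  hence "(n - 1, Dn G n x) \<in> K" using comps_closed[OF K' K(2)] edges_linked by blast
  moreover have "n - 1 = 2 * ((n - 1) div 2)" using False by simp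
  ultimately show ?thesis by (metis diff_le_eq le_add_same_cancel1 zero_le_one)
qed (use K in \<open>auto elim!: evenE\<close>)

lemma cq_mono_subset: "p \<le> q \<Longrightarrow> {..2 * p + 1} \<subseteq> {..2 * q + (1::int)}"
  by auto

lemma cq_subset_if_meet:
  assumes "K \<in> cq G p" "K' \<in> cq G q" "p \<le> q" "a \<in> K" "a \<in> K'"
  shows "K \<subseteq> K'"
  using comps_subset_if_meet[OF cq_mono_subset[OF assms(3)]] assms(1,2,4,5) unfolding cq_def by blast

lemma cq_nonempty: "K \<in> cq G q \<Longrightarrow> \<exists>a. a \<in> K"
  unfolding cq_def by (rule comps_nonempty)

lemma cq_eqI: "K \<in> cq G q \<Longrightarrow> K' \<in> cq G q \<Longrightarrow> K \<subseteq> K' \<Longrightarrow> K = K'"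
  using cq_nonempty comps_eqI unfolding cq_def by (metis subsetD)

lemma ancestor:
  assumes "K \<in> cq G p" "p \<le> q"
  shows ancestor_cq: "ancestor G q K \<in> cq G q" and ancestor_sub: "K \<subseteq> ancestor G q K"
  using ext[OF _ cq_mono_subset[OF assms(2)], of K] assms(1) unfolding cq_def ancestor_def by auto

lemma ancestor_eqI: "K \<in> cq G p \<Longrightarrow> p \<le> q \<Longrightarrow> K' \<in> cq G q \<Longrightarrow> K \<subseteq> K' \<Longrightarrow> ancestor G q K = K'"
  using ext_eqI[OF _ cq_mono_subset] unfolding cq_def ancestor_def by blast

lemma ancestor_self: "K \<in> cq G q \<Longrightarrow> ancestor G q K = K"
  by (rule ancestor_eqI) auto

lemma birth_child_le:
  assumes K: "K \<in> cq G q" and x: "(2 * i, x) \<in> K" "i \<le> q - 1"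
  shows "\<exists>c\<in>children G q K. (2 * i, x) \<in> c"
proof -
  let ?c = "cmp G {..2 * (q - 1) + 1} (2 * i, x)"
  have "(2 * i, x) \<in> nodes G {..2 * (q - 1) + 1}"
    using comps_sub[of K "{..2 * q + 1}"] K x unfolding cq_def by auto
  hence c: "?c \<in> cq G (q - 1)" unfolding cq_def by (rule cmp_comps)
  have "?c \<subseteq> K" by (rule cq_subset_if_meet[OF c K, of "(2 * i, x)"]) (use x in auto)
  thus ?thesis using c by (auto simp: children_def intro!: bexI[of _ ?c])
qed

text \<open>Only nodes at the top level \<open>2 * q - 1\<close> have edges into the two added
  levels; a child that avoids this level would remain a component.\<close>

lemma child_reaches:
  assumes K: "K \<in> cq G q" and c: "c \<in> children G q K" "c \<noteq> K"
  shows "2 * q - 1 \<in> lev c"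
proof (rule ccontr)
  assume n: "2 * q - 1 \<notin> lev c"
  have cc: "c \<in> comps G {..2 * (q - 1) + 1}" "c \<subseteq> K" using c by (auto simp: children_def cq_def)
  have "c \<in> comps G {..2 * q + 1}"
  proof (rule comps_extend[OF cc(1)])
    fix a b assume ab: "a \<in> c" "(a, b) \<in> edges G {..2 * q + 1} \<or> (b, a) \<in> edges G {..2 * q + 1}"
    have "fst a \<noteq> 2 * q - 1" using n ab(1) unfolding lev_def by (metis imageI)
    moreover have "a \<in> nodes G {..2 * (q - 1) + 1}" using comps_sub[OF cc(1)] ab(1) by blast
    hence "fst a \<le> 2 * (q - 1) + 1" using fst_nodes[of a G "{..2 * (q - 1) + 1}"] by simp
    moreover have "fst b = fst a + 1 \<or> fst b = fst a - 1"
      using ab(2) edges_fst[of a b] edges_fst[of b a] by auto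
    ultimately show "fst b \<in> {..2 * (q - 1) + 1}" by auto
  qed auto
  hence "c \<in> cq G q" by (simp add: cq_def)
  thus False using cq_eqI[OF _ K cc(2)] c(2) by blast
qed

text \<open>\<open>cq G (q - 1)\<close> may be infinite, yet each child other than \<open>K\<close>
  contains one of the finitely many nodes at level \<open>2 * q - 1\<close>. This guarantees that an
  eldest child exists.\<close>

lemma finite_children:
  assumes K: "K \<in> cq G q"
  shows "finite (children G q K)"
proof -
  have "children G q K \<subseteq> insert K ((\<lambda>x. cmp G {..2 * (q - 1) + 1} (2 * q - 1, x)) ` Lev G (2 * q - 1))"
  proof
    fix c assume c: "c \<in> children G q K"
    hence cc: "c \<in> comps G {..2 * (q - 1) + 1}" by (simp add: children_def cq_def)
    show "c \<in> insert K ((\<lambda>x. cmp G {..2 * (q - 1) + 1} (2 * q - 1, x)) ` Lev G (2 * q - 1))"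
    proof (cases "c = K")
      case False
      then obtain x where x: "(2 * q - 1, x) \<in> c" using child_reaches[OF K c] mem_levE by metis
      hence "x \<in> Lev G (2 * q - 1)" using comps_sub[OF cc] by auto
      thus ?thesis using comps_cmp[OF cc x] by blast
    qed simp
  qed
  thus ?thesis by (rule finite_subset) (simp add: finite_Lev)
qed

lemma eldest:
  assumes K: "K \<in> cq G q" and b: "birth K \<le> ereal (of_int (q - 1))"
  shows eldest_child: "eldest G q K \<in> children G q K" and birth_eldest: "birth (eldest G q K) = birth K"
proof -
  obtain i x where i: "i \<le> q - 1" "(2 * i, x) \<in> K" using birth_le_int[OF b] by blast
  have ne: "children G q K \<noteq> {}" using birth_child_le[OF K i(2,1)] by blast
  have "Min (birth ` children G q K) \<in> birth ` children G q K"
    by (rule Min_in) (use ne finite_children[OF K] in auto)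
  then obtain c where c: "c \<in> children G q K" "birth c = Min (birth ` children G q K)" by auto
  have "\<forall>c'\<in>children G q K. birth c \<le> birth c'"
    unfolding c(2) using finite_children[OF K] by (intro ballI Min_le) auto
  hence "\<exists>c. c \<in> children G q K \<and> (\<forall>c'\<in>children G q K. birth c \<le> birth c')" using c(1) by blast
  hence e: "eldest G q K \<in> children G q K \<and> (\<forall>c'\<in>children G q K. birth (eldest G q K) \<le> birth c')"
    unfolding eldest_def by (rule someI_ex)
  thus "eldest G q K \<in> children G q K" by blast
  have le: "birth (eldest G q K) \<le> ereal (of_int j)" if "(2 * j, y) \<in> K" "j \<le> q - 1" for j y
    using birth_child_le[OF K that] e birth_le order_trans by metis
  have "birth (eldest G q K) \<le> birth K"
    unfolding birth_def[of K]
  proof (rule Inf_greatest)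
    fix z assume "z \<in> {ereal (of_int j) | j x. (2 * j, x) \<in> K}"
    then obtain j y where z: "z = ereal (of_int j)" "(2 * j, y) \<in> K" by blast
    \<comment> \<open>Nodes of \<open>K\<close> beyond \<open>q - 1\<close> lie in no child, but
      \<open>i\<close> comes before them and so they do not affect the infimum.\<close>
    show "birth (eldest G q K) \<le> z"
    proof (cases "j \<le> q - 1")
      case True
      thus ?thesis using le z by blast
    next
      case False
      hence "ereal (of_int i) \<le> z" using i(1) z by simp
      thus ?thesis using le[OF i(2,1)] by (rule order_trans[rotated])
    qed
  qed
  moreover have "birth K \<le> birth (eldest G q K)" using e by (auto simp: children_def intro: birth_antimono)
  ultimately show "birth (eldest G q K) = birth K" by simp
qed

lemma thread_iter:
  "K \<in> cq G q \<Longrightarrow> birth K \<le> ereal (of_int (q - int n)) \<Longrightarrow>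
    thread_iter G n q K \<in> cq G (q - int n) \<and> thread_iter G n q K \<subseteq> K \<and> birth (thread_iter G n q K) = birth K"
proof (induction n)
  case (Suc n)
  have "ereal (of_int (q - int (Suc n))) \<le> ereal (of_int (q - int n))" by simp
  hence "birth K \<le> ereal (of_int (q - int n))" using Suc.prems(2) by (rule order_trans[rotated])
  hence IH: "thread_iter G n q K \<in> cq G (q - int n)" "thread_iter G n q K \<subseteq> K" "birth (thread_iter G n q K) = birth K"
    using Suc by blast+
  have e: "q - int (Suc n) = q - int n - 1" by simp
  have b: "birth (thread_iter G n q K) \<le> ereal (of_int (q - int n - 1))"
    using Suc.prems(2) IH(3) unfolding e by simp
  show ?case
    using eldest_child[OF IH(1) b] birth_eldest[OF IH(1) b] IH(2,3) unfolding e by (auto simp: children_def)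
qed simp

lemma thread:
  assumes "K \<in> cq G q" "p \<le> q" "birth K \<le> ereal (of_int p)"
  shows thread_cq: "thread G q p K \<in> cq G p" and thread_sub: "thread G q p K \<subseteq> K" and birth_thread: "birth (thread G q p K) = birth K"
  using thread_iter[OF assms(1), of "nat (q - p)"] assms(2,3) by (auto simp: thread_def)

lemma thread_self [simp]: "thread G q q K = K"
  by (simp add: thread_def)

lemma thread_iter_add: "thread_iter G (m + n) q K = thread_iter G n (q - int m) (thread_iter G m q K)"
  by (induction n) (simp_all add: algebra_simps)

lemma thread_thread: "r \<le> p \<Longrightarrow> p \<le> q \<Longrightarrow> thread G q r K = thread G p r (thread G q p K)"
  using thread_iter_add[of "nat (q - p)" "nat (p - r)" q K] by (simp add: thread_def flip: nat_add_distrib)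

lemma thread_eldest: "p < q \<Longrightarrow> thread G q p K = eldest G (p + 1) (thread G q (p + 1) K)"
  using thread_thread[of p "p + 1" q K] by (simp add: thread_def)

lemma thread_eldest_top: "p < q \<Longrightarrow> thread G q p K = thread G (q - 1) p (eldest G q K)"
  using thread_thread[of p "q - 1" q K] by (simp add: thread_def)

end

text \<open>To be read as a linear functional on formal combinations of components; it is dual to
  the bar \<open>y\<close>, see \<open>inside_dual\<close>.\<close>

definition inside :: "'a node set \<Rightarrow> int \<times> 'a node set \<Rightarrow> real" where
  "inside K y = (if K \<subseteq> snd y then 1 else 0)"

text \<open>While the bar \<open>x\<close> is alive, it is represented by the difference of these two components.\<close>

definition tx :: "'a zigzag \<Rightarrow> int \<Rightarrow> int \<times> 'a node set \<Rightarrow> 'a node set" where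
  "tx G p x = thread G (fst x - 1) p (snd x)"

definition sx :: "'a zigzag \<Rightarrow> int \<Rightarrow> int \<times> 'a node set \<Rightarrow> 'a node set" where
  "sx G p x = thread G (fst x - 1) p (sibling G x)"

context reeb
begin

lemma birth_cq_le: "K \<in> cq G q \<Longrightarrow> birth K \<le> ereal (of_int q)"
proof -
  assume K: "K \<in> cq G q"
  then obtain a where a: "a \<in> K" using cq_nonempty by blast
  have "fst a \<le> 2 * q + 1"
    using comps_sub[of K "{..2 * q + 1}"] K a fst_nodes unfolding cq_def by blast
  moreover obtain i y where i: "(2 * i, y) \<in> K" "2 * i \<le> fst a"
    using even_below[OF K, of "fst a" "snd a"] a by auto
  ultimately have "i \<le> q" by linarith
  hence "ereal (of_int i) \<le> ereal (of_int q)" by simp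
  thus ?thesis using birth_le[OF i(1)] by (rule order_trans[rotated])
qed

lemma half_bar:
  assumes x: "x \<in> half_bars G"
  shows half_bar_cq: "snd x \<in> cq G (fst x - 1)"
    and half_bar_par: "ancestor G (fst x) (snd x) \<in> cq G (fst x)"
    and half_bar_sub: "snd x \<subseteq> ancestor G (fst x) (snd x)"
    and sibling_child: "sibling G x \<in> children G (fst x) (ancestor G (fst x) (snd x))"
    and birth_sibling: "birth (sibling G x) \<le> birth (snd x)"
    and sibling_neq: "sibling G x \<noteq> snd x"
proof -
  show c: "snd x \<in> cq G (fst x - 1)" and "sibling G x \<noteq> snd x"
    using x by (simp_all add: half_bars_def case_prod_beta)
  show K: "ancestor G (fst x) (snd x) \<in> cq G (fst x)" and s: "snd x \<subseteq> ancestor G (fst x) (snd x)"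
    using ancestor[OF c] by auto
  have b: "birth (ancestor G (fst x) (snd x)) \<le> birth (snd x)" by (rule birth_antimono[OF s])
  hence b1: "birth (ancestor G (fst x) (snd x)) \<le> ereal (of_int (fst x - 1))"
    by (rule order_trans[OF _ birth_cq_le[OF c]])
  show "sibling G x \<in> children G (fst x) (ancestor G (fst x) (snd x))"
    unfolding sibling_def by (rule eldest_child[OF K b1])
  show "birth (sibling G x) \<le> birth (snd x)" unfolding sibling_def birth_eldest[OF K b1] by (rule b)
qed

lemma sibling_cq: "x \<in> half_bars G \<Longrightarrow> sibling G x \<in> cq G (fst x - 1)"
  using sibling_child by (auto simp: children_def)

lemma tx:
  assumes "x \<in> half_bars G" "birth (snd x) \<le> ereal (of_int p)" "p \<le> fst x - 1"
  shows tx_cq: "tx G p x \<in> cq G p" and tx_sub: "tx G p x \<subseteq> snd x"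
    and birth_tx: "birth (tx G p x) = birth (snd x)"
  using thread[OF half_bar_cq[OF assms(1)] assms(3,2)] by (auto simp: tx_def)

lemma sx:
  assumes "x \<in> half_bars G" "birth (snd x) \<le> ereal (of_int p)" "p \<le> fst x - 1"
  shows sx_cq: "sx G p x \<in> cq G p" and sx_sub: "sx G p x \<subseteq> ancestor G (fst x) (snd x)"
    and birth_sx: "birth (sx G p x) \<le> birth (snd x)"
proof -
  have b: "birth (sibling G x) \<le> ereal (of_int p)" by (rule order_trans[OF birth_sibling[OF assms(1)] assms(2)])
  note t = thread[OF sibling_cq[OF assms(1)] assms(3) b]
  show "sx G p x \<in> cq G p" using t(1) by (simp add: sx_def)
  show "sx G p x \<subseteq> ancestor G (fst x) (snd x)"
    using t(2) sibling_child[OF assms(1)] unfolding sx_def children_def by blast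
  show "birth (sx G p x) \<le> birth (snd x)" using t(3) birth_sibling[OF assms(1)] by (simp add: sx_def)
qed

text \<open>Components of sublevel sets are nested or disjoint as long as \<open>y\<close> is
  alive.\<close>

lemma inside_cong:
  assumes "K \<in> cq G p" "K' \<in> cq G q" "K \<subseteq> K'" "q \<le> fst y - 1" "y \<in> half_bars G"
  shows "inside K y = inside K' y"
proof -
  have "K' \<subseteq> snd y" if "K \<subseteq> snd y"
  proof -
    obtain a where "a \<in> K" using cq_nonempty assms(1) by blast
    thus ?thesis using cq_subset_if_meet[OF assms(2) half_bar_cq[OF assms(5)] assms(4)] assms(3) that by blast
  qed
  thus ?thesis using assms(3) by (auto simp: inside_def)
qed

text \<open>Each step of a thread is an eldest child, hence its own sibling.\<close>

lemma thread_not_half_bar: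
  assumes K: "K \<in> cq G q" "birth K \<le> ereal (of_int p)" "p < q"
  shows "(p + 1, thread G q p K) \<notin> half_bars G"
proof
  assume h: "(p + 1, thread G q p K) \<in> half_bars G"
  have "ereal (of_int p) \<le> ereal (of_int (p + 1))" by simp
  hence b: "birth K \<le> ereal (of_int (p + 1))" using K(2) by (rule order_trans[rotated])
  have pq: "p + 1 \<le> q" using K(3) by simp
  note t = thread[OF K(1) pq b]
  have b': "birth (thread G q (p + 1) K) \<le> ereal (of_int (p + 1 - 1))" using t(3) K(2) by simp
  have c: "thread G q p K \<in> children G (p + 1) (thread G q (p + 1) K)"
    using eldest_child[OF t(1) b'] thread_eldest[OF K(3)] by simp
  hence "ancestor G (p + 1) (thread G q p K) = thread G q (p + 1) K"
    using ancestor_eqI[of "thread G q p K" p "p + 1" "thread G q (p + 1) K"] t(1) by (auto simp: children_def)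
  hence "sibling G (p + 1, thread G q p K) = thread G q p K" by (simp add: sibling_def thread_eldest[OF K(3)])
  thus False using sibling_neq[OF h] by simp
qed

lemma inside_thread:
  assumes x': "x' \<in> half_bars G" and K: "K \<in> cq G q" "birth K \<le> ereal (of_int p)"
    and p: "p \<le> fst x' - 1" "fst x' - 1 \<le> q"
  shows "inside (thread G q p K) x' = (if fst x' - 1 = q \<and> snd x' = K then 1 else 0)"
proof -
  let ?d = "fst x' - 1"
  have "ereal (of_int p) \<le> ereal (of_int ?d)" using p(1) by (simp only: ereal_less_eq of_int_le_iff)
  hence bd: "birth K \<le> ereal (of_int ?d)" using K(2) by (rule order_trans[rotated])
  note t = thread[OF K(1) p(2) bd]
  have pq: "p \<le> q" using p by simp
  note t' = thread[OF K(1) pq K(2)]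
  have "thread G q p K \<subseteq> thread G q ?d K"
    using thread_sub[OF t(1) p(1)] t(3) K(2) thread_thread[OF p, of K] by simp
  hence "inside (thread G q p K) x' = inside (thread G q ?d K) x'"
    using inside_cong[OF t'(1) t(1) _ _ x'] by simp
  also have "\<dots> = (if thread G q ?d K = snd x' then 1 else 0)"
    using cq_eqI[OF t(1) half_bar_cq[OF x']] by (auto simp: inside_def)
  also have "thread G q ?d K = snd x' \<longleftrightarrow> ?d = q \<and> snd x' = K"
  proof (cases "?d = q")
    case False
    hence "(?d + 1, thread G q ?d K) \<notin> half_bars G" using thread_not_half_bar[OF K(1) bd] p(2) by simp
    moreover have "(?d + 1, snd x') \<in> half_bars G" using x' by simp
    ultimately show ?thesis using False by metis
  qed auto
  finally show ?thesis .
qed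

text \<open>If \<open>x'\<close> dies no later than \<open>x\<close>, its component can contain a
  thread of \<open>x\<close> only at the top, where the threads are \<open>snd x\<close> and its
  sibling, and the sibling is no bar. If \<open>x'\<close> dies later, both threads lie in the
  successor of \<open>x\<close> while \<open>x'\<close> is alive, and the two values agree.\<close>

lemma inside_dual:
  assumes x: "x \<in> half_bars G" "x' \<in> half_bars G" and b: "birth (snd x) \<le> ereal (of_int p)"
    and p: "p \<le> fst x - 1" "p \<le> fst x' - 1"
  shows "inside (tx G p x) x' - inside (sx G p x) x' = (if x = x' then 1 else 0)"
proof (cases "fst x' \<le> fst x")
  case True
  hence d: "fst x' - 1 \<le> fst x - 1" by simp
  have bs: "birth (sibling G x) \<le> ereal (of_int p)" by (rule order_trans[OF birth_sibling[OF x(1)] b])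
  have 1: "inside (tx G p x) x' = (if fst x' = fst x \<and> snd x' = snd x then 1 else 0)"
    using inside_thread[OF x(2) half_bar_cq[OF x(1)] b p(2) d] by (simp add: tx_def)
  have 2: "inside (sx G p x) x' = (if fst x' = fst x \<and> snd x' = sibling G x then 1 else 0)"
    using inside_thread[OF x(2) sibling_cq[OF x(1)] bs p(2) d] by (simp add: sx_def)
  have "\<not> (fst x' = fst x \<and> snd x' = sibling G x)"
  proof
    assume e: "fst x' = fst x \<and> snd x' = sibling G x"
    have "ancestor G (fst x) (sibling G x) = ancestor G (fst x) (snd x)"
      using ancestor_eqI[OF sibling_cq[OF x(1)] _ half_bar_par[OF x(1)]] sibling_child[OF x(1)] by (simp add: children_def)
    hence "sibling G x' = snd x'" using e by (simp add: sibling_def)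
    thus False using sibling_neq[OF x(2)] by simp
  qed
  thus ?thesis unfolding 1 2 by (auto simp: prod_eq_iff)
next
  case False
  hence d: "fst x \<le> fst x' - 1" by simp
  have "inside (tx G p x) x' = inside (ancestor G (fst x) (snd x)) x'"
    using inside_cong[OF tx_cq[OF x(1) b p(1)] half_bar_par[OF x(1)] _ d x(2)]
      tx_sub[OF x(1) b p(1)] half_bar_sub[OF x(1)] by blast
  moreover have "inside (sx G p x) x' = inside (ancestor G (fst x) (snd x)) x'"
    using inside_cong[OF sx_cq[OF x(1) b p(1)] half_bar_par[OF x(1)] sx_sub[OF x(1) b p(1)] d x(2)] .
  ultimately show ?thesis using False by auto
qed

lemma half_bar_reaches:
  assumes x: "x \<in> half_bars G"
  shows "2 * fst x - 1 \<in> lev (snd x)"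
proof -
  have "snd x \<noteq> ancestor G (fst x) (snd x)"
  proof
    assume e: "snd x = ancestor G (fst x) (snd x)"
    have "sibling G x \<subseteq> snd x" using sibling_child[OF x] e by (simp add: children_def)
    thus False using cq_eqI[OF sibling_cq[OF x] half_bar_cq[OF x]] sibling_neq[OF x] by blast
  qed
  moreover have "snd x \<in> children G (fst x) (ancestor G (fst x) (snd x))"
    using half_bar_cq[OF x] half_bar_sub[OF x] by (simp add: children_def)
  ultimately show ?thesis using child_reaches[OF half_bar_par[OF x]] by blast
qed

lemma finite_half_bars_at: "finite {x \<in> half_bars G. fst x = d}"
proof -
  have "{x \<in> half_bars G. fst x = d} \<subseteq>
    Pair d ` (\<lambda>x. cmp G {..2 * (d - 1) + 1} (2 * d - 1, x)) ` Lev G (2 * d - 1)"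
  proof
    fix x assume x: "x \<in> {x \<in> half_bars G. fst x = d}"
    hence h: "x \<in> half_bars G" and d: "fst x = d" by auto
    obtain y where y: "(2 * d - 1, y) \<in> snd x" using half_bar_reaches[OF h] d mem_levE by metis
    have c: "snd x \<in> comps G {..2 * (d - 1) + 1}" using half_bar_cq[OF h] d by (simp add: cq_def)
    have "y \<in> Lev G (2 * d - 1)" using comps_sub[OF c] y by auto
    moreover have "x = (d, cmp G {..2 * (d - 1) + 1} (2 * d - 1, y))"
      using comps_cmp[OF c y] d by (metis prod.collapse)
    ultimately show "x \<in> Pair d ` (\<lambda>x. cmp G {..2 * (d - 1) + 1} (2 * d - 1, x)) ` Lev G (2 * d - 1)"
      by blast
  qed
  thus ?thesis by (rule finite_subset) (simp add: finite_Lev)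
qed

lemma finite_half_bars_between: "finite {x \<in> half_bars G. d \<le> fst x \<and> fst x \<le> d'}"
proof -
  have "{x \<in> half_bars G. d \<le> fst x \<and> fst x \<le> d'} = (\<Union>k\<in>{d..d'}. {x \<in> half_bars G. fst x = k})" by auto
  thus ?thesis using finite_half_bars_at by auto
qed

text \<open>Expansion of a component in the bars above it. Raising \<open>D\<close> by one changes
  the thread only if the current ancestor is not the eldest child of the next one; then it is a bar,
  and the thread jumps from its \<open>tx\<close> to its \<open>sx\<close>.\<close>

lemma telescope:
  assumes K: "K \<in> cq G q" and D: "q \<le> D"
  shows "h K - h (thread G D q (ancestor G D K)) =
    (\<Sum>y | y \<in> half_bars G \<and> q < fst y \<and> fst y \<le> D \<and> K \<subseteq> snd y. h (tx G q y) - h (sx G q y) :: real)"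
  using D
proof (induction D rule: int_ge_induct)
  case base
  have e: "{y. y \<in> half_bars G \<and> q < fst y \<and> fst y \<le> q \<and> K \<subseteq> snd y} = {}" by auto
  show ?case unfolding e by (simp add: ancestor_self[OF K])
next
  case (step D)
  let ?S = "\<lambda>D. {y. y \<in> half_bars G \<and> q < fst y \<and> fst y \<le> D \<and> K \<subseteq> snd y}"
  let ?c = "ancestor G D K" and ?K = "ancestor G (D + 1) K"
  have c: "?c \<in> cq G D" "K \<subseteq> ?c" using ancestor[OF K step.hyps] by auto
  have D1: "q \<le> D + 1" using step.hyps by simp
  have K': "?K \<in> cq G (D + 1)" "K \<subseteq> ?K" using ancestor[OF K D1] by auto
  have cK: "?c \<subseteq> ?K" using cq_subset_if_meet[OF c(1) K'(1)] c(2) K'(2) cq_nonempty[OF K] by auto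
  have par: "ancestor G (D + 1) ?c = ?K" using ancestor_eqI[OF c(1) _ K'(1) cK] by simp
  have top: "thread G (D + 1) q ?K = thread G D q (eldest G (D + 1) ?K)"
    using thread_eldest_top[of q "D + 1"] step.hyps by simp
  have S: "?S (D + 1) = ?S D \<union> ({(D + 1, ?c)} \<inter> half_bars G)"
  proof -
    have c': "y = (D + 1, ?c)" if "y \<in> half_bars G" "fst y = D + 1" "K \<subseteq> snd y" for y
    proof -
      have y: "snd y \<in> cq G D" using half_bar_cq[OF that(1)] that(2) by simp
      show ?thesis using ancestor_eqI[OF K step.hyps y that(3)] that(2) by (metis prod.collapse)
    qed
    show ?thesis
    proof (intro set_eqI iffI)
      fix y assume "y \<in> ?S (D + 1)"
      hence y: "y \<in> half_bars G" "q < fst y" "fst y \<le> D + 1" "K \<subseteq> snd y" by blast+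
      show "y \<in> ?S D \<union> ({(D + 1, ?c)} \<inter> half_bars G)"
      proof (cases "fst y = D + 1")
        case True
        show ?thesis using c'[OF y(1) True y(4)] y(1) by blast
      next
        case False
        hence "fst y \<le> D" using y(3) by simp
        thus ?thesis using y by blast
      qed
    next
      fix y assume y: "y \<in> ?S D \<union> ({(D + 1, ?c)} \<inter> half_bars G)"
      show "y \<in> ?S (D + 1)"
      proof (cases "y \<in> ?S D")
        case False
        hence "y = (D + 1, ?c)" "y \<in> half_bars G" using y by blast+
        thus ?thesis using c(2) step.hyps by simp
      qed simp
    qed
  qed
  have fin: "finite (?S D)"
    by (rule finite_subset[OF _ finite_half_bars_between[of q D]]) auto
  show ?case
  proof (cases "(D + 1, ?c) \<in> half_bars G")
    case True
    have "sum (\<lambda>y. h (tx G q y) - h (sx G q y)) (?S (D + 1)) =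
      h (thread G D q ?c) - h (thread G (D + 1) q ?K) + sum (\<lambda>y. h (tx G q y) - h (sx G q y)) (?S D)"
      using True fin unfolding S by (simp add: tx_def sx_def sibling_def par top)
    thus ?thesis using step.IH by simp
  next
    case False
    hence "eldest G (D + 1) ?K = ?c" using c(1) by (simp add: half_bars_def sibling_def par)
    moreover have "?S (D + 1) = ?S D" using S False by blast
    ultimately show ?thesis using step.IH top by simp
  qed
qed

text \<open>The remainders of the two expansions coincide because the ancestors at \<open>D\<close>
  do.\<close>

lemma telescope_diff:
  assumes K: "K \<in> cq G q" "K' \<in> cq G q" and D: "q \<le> D" and e: "ancestor G D K = ancestor G D K'"
    and B: "B = {y \<in> half_bars G. q < fst y \<and> fst y \<le> D \<and> (K \<subseteq> snd y \<or> K' \<subseteq> snd y)}"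
  shows "h K - h K' =
    (\<Sum>y\<in>B. (inside K y - inside K' y) * (h (tx G q y) - h (sx G q y)) :: real)"
proof -
  have fin: "finite B"
    unfolding B by (rule finite_subset[OF _ finite_half_bars_between[of q D]]) auto
  have s: "(\<Sum>y | y \<in> half_bars G \<and> q < fst y \<and> fst y \<le> D \<and> J \<subseteq> snd y. F y) =
    (\<Sum>y\<in>B. inside J y * F y)" if "J = K \<or> J = K'" for J and F :: "_ \<Rightarrow> real"
  proof -
    have "(\<Sum>y\<in>B. inside J y * F y) = (\<Sum>y\<in>B. if J \<subseteq> snd y then F y else 0)"
      by (rule sum.cong) (auto simp: inside_def)
    also have "\<dots> = (\<Sum>y | y \<in> B \<and> J \<subseteq> snd y. F y)" using fin by (simp add: sum.inter_filter)
    also have "{y. y \<in> B \<and> J \<subseteq> snd y} =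
        {y. y \<in> half_bars G \<and> q < fst y \<and> fst y \<le> D \<and> J \<subseteq> snd y}"
      using that unfolding B by auto
    finally show ?thesis by simp
  qed
  have "h K - h K' = (h K - h (thread G D q (ancestor G D K))) - (h K' - h (thread G D q (ancestor G D K')))"
    using e by simp
  also have "\<dots> = (\<Sum>y\<in>B. inside K y * (h (tx G q y) - h (sx G q y))) -
      (\<Sum>y\<in>B. inside K' y * (h (tx G q y) - h (sx G q y)))"
    unfolding telescope[OF K(1) D] telescope[OF K(2) D] by (simp add: s)
  finally show ?thesis by (simp add: sum_subtractf left_diff_distrib)
qed

end

section \<open>Matrices induced by an interleaving on half-open bars\<close>

definition hval ::
  "'a zigzag \<Rightarrow> 'b zigzag \<Rightarrow> real \<Rightarrow> (real \<times> real \<Rightarrow> 'a node set \<Rightarrow> 'b node set) \<Rightarrow> real \<Rightarrow>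
    int \<times> 'a node set \<Rightarrow> int \<times> 'b node set \<Rightarrow> real"
where
  "hval G H \<epsilon> f t x y = inside (fbar G H \<epsilon> f (ereal t) (tx G \<lfloor>t\<rfloor> x)) y -
     inside (fbar G H \<epsilon> f (ereal t) (sx G \<lfloor>t\<rfloor> x)) y"

text \<open>The bar \<open>x\<close> is alive at time \<open>t\<close> and \<open>y\<close> has not died by time \<open>t + \<epsilon>\<close>; for such \<open>t\<close> the number
  \<open>hval\<close> does not depend on \<open>t\<close>.\<close>

definition hok :: "real \<Rightarrow> real \<Rightarrow> int \<times> 'a node set \<Rightarrow> int \<times> 'b node set \<Rightarrow> bool" where
  "hok \<epsilon> t x y \<longleftrightarrow> birth (snd x) \<le> ereal t \<and> t < of_int (fst x) \<and> t + \<epsilon> < of_int (fst y)"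

text \<open>The coefficient at the bar \<open>y\<close> of the image of the bar \<open>x\<close>.\<close>

definition hmat ::
  "'a zigzag \<Rightarrow> 'b zigzag \<Rightarrow> real \<Rightarrow> (real \<times> real \<Rightarrow> 'a node set \<Rightarrow> 'b node set) \<Rightarrow>
    int \<times> 'a node set \<Rightarrow> int \<times> 'b node set \<Rightarrow> real"
where
  "hmat G H \<epsilon> f x y =
     (if \<exists>t. hok \<epsilon> t x y then hval G H \<epsilon> f (SOME t. hok \<epsilon> t x y) x y else 0)"

lemma (in reeb) tx_mono:
  assumes "x \<in> half_bars G" "birth (snd x) \<le> ereal (of_int p)" "p \<le> p'" "p' \<le> fst x - 1"
  shows "tx G p x \<subseteq> tx G p' x" "sx G p x \<subseteq> sx G p' x"
proof -
  have pp: "ereal (of_int p) \<le> ereal (of_int p')" using assms(3) by simp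
  note b = order_trans[OF assms(2) pp]
  have bs: "birth (sibling G x) \<le> ereal (of_int p)" by (rule order_trans[OF birth_sibling[OF assms(1)] assms(2)])
  note bs' = order_trans[OF bs pp]
  note t = thread[OF half_bar_cq[OF assms(1)] assms(4) b] and s = thread[OF sibling_cq[OF assms(1)] assms(4) bs']
  show "tx G p x \<subseteq> tx G p' x"
    using thread_sub[OF t(1) assms(3)] t(3) assms(2) thread_thread[OF assms(3,4), of "snd x"] by (simp add: tx_def)
  show "sx G p x \<subseteq> sx G p' x"
    using thread_sub[OF s(1) assms(3)] s(3) bs thread_thread[OF assms(3,4), of "sibling G x"] by (simp add: sx_def)
qed

context interleaving
begin

lemma fb_cq: "K \<in> cq G \<lfloor>t\<rfloor> \<Longrightarrow> fb (ereal t) K \<in> cq H \<lfloor>t + \<epsilon>\<rfloor>"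
  using fb_comps[of K "ereal t"] by (simp add: cq_comps_swin)

lemma fb_mono_cq:
  "K \<in> cq G \<lfloor>t\<rfloor> \<Longrightarrow> K' \<in> cq G \<lfloor>t'\<rfloor> \<Longrightarrow> t \<le> t' \<Longrightarrow> K \<subseteq> K' \<Longrightarrow> fb (ereal t) K \<subseteq> fb (ereal t') K'"
  using fb_mono[of K "ereal t" K' "ereal t'"] by (simp add: cq_comps_swin)

lemma birth_fb_cq: "K \<in> cq G \<lfloor>t\<rfloor> \<Longrightarrow> birth (fb (ereal t) K) \<le> birth K + ereal \<epsilon>"
  using birth_fb[of K "ereal t"] by (simp add: cq_comps_swin)

lemma gb_fb_cq: "K \<in> cq G \<lfloor>t\<rfloor> \<Longrightarrow> K \<subseteq> gb (ereal (t + \<epsilon>)) (fb (ereal t) K)"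
  using gb_fb[of K "ereal t"] by (simp add: cq_comps_swin)

lemma hok:
  assumes "hok \<epsilon> t x (y :: int \<times> 'b node set)"
  shows hok_floor: "\<lfloor>t\<rfloor> \<le> fst x - 1" "\<lfloor>t + \<epsilon>\<rfloor> \<le> fst y - 1" "birth (snd x) \<le> ereal (of_int \<lfloor>t\<rfloor>)"
proof -
  have o: "birth (snd x) \<le> ereal t" "t < real_of_int (fst x)" "t + \<epsilon> < real_of_int (fst y)"
    using assms by (simp_all add: hok_def)
  have "\<lfloor>t\<rfloor> < fst x" "\<lfloor>t + \<epsilon>\<rfloor> < fst y" using o(2,3) by (simp_all only: floor_less_iff)
  thus "\<lfloor>t\<rfloor> \<le> fst x - 1" "\<lfloor>t + \<epsilon>\<rfloor> \<le> fst y - 1" by simp_all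
  show "birth (snd x) \<le> ereal (of_int \<lfloor>t\<rfloor>)" by (rule birth_le_floor[OF o(1)])
qed

text \<open>The threads and their images only grow with \<open>t\<close>, and \<open>y\<close> is
  still alive, so \<open>inside_cong\<close> applies to each of the two terms.\<close>

lemma hval_indep:
  assumes xy: "x \<in> half_bars G" "y \<in> half_bars H" and ok: "hok \<epsilon> t x y" "hok \<epsilon> t' x y" and t: "t \<le> t'"
  shows "hval G H \<epsilon> f t x y = hval G H \<epsilon> f t' x y"
proof -
  note o = hok[OF ok(1)] hok[OF ok(2)]
  have ft: "\<lfloor>t\<rfloor> \<le> \<lfloor>t'\<rfloor>" using t by (rule floor_mono)
  note m = X.tx_mono[OF xy(1) o(3) ft o(4)]
  have "inside (fb (ereal t) (tx G \<lfloor>t\<rfloor> x)) y = inside (fb (ereal t') (tx G \<lfloor>t'\<rfloor> x)) y"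
    using Y.inside_cong[OF fb_cq[OF X.tx_cq[OF xy(1) o(3,1)]] fb_cq[OF X.tx_cq[OF xy(1) o(6,4)]]
        fb_mono_cq[OF X.tx_cq[OF xy(1) o(3,1)] X.tx_cq[OF xy(1) o(6,4)] t m(1)] o(5) xy(2)] .
  moreover have "inside (fb (ereal t) (sx G \<lfloor>t\<rfloor> x)) y = inside (fb (ereal t') (sx G \<lfloor>t'\<rfloor> x)) y"
    using Y.inside_cong[OF fb_cq[OF X.sx_cq[OF xy(1) o(3,1)]] fb_cq[OF X.sx_cq[OF xy(1) o(6,4)]]
        fb_mono_cq[OF X.sx_cq[OF xy(1) o(3,1)] X.sx_cq[OF xy(1) o(6,4)] t m(2)] o(5) xy(2)] .
  ultimately show ?thesis by (simp add: hval_def)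
qed

lemma hmat_eq:
  assumes xy: "x \<in> half_bars G" "y \<in> half_bars H" and ok: "hok \<epsilon> t x y"
  shows "hmat G H \<epsilon> f x y = hval G H \<epsilon> f t x y"
proof -
  let ?t = "SOME t. hok \<epsilon> t x y"
  have s: "hok \<epsilon> ?t x y" using ok by (rule someI)
  have "hval G H \<epsilon> f ?t x y = hval G H \<epsilon> f t x y"
    using hval_indep[OF xy s ok] hval_indep[OF xy ok s] linear[of ?t t] by argo
  moreover have "\<exists>t. hok \<epsilon> t x y" using ok by blast
  ultimately show ?thesis by (simp add: hmat_def)
qed

text \<open>Births: \<open>y\<close> contains the image of a component born no later than
  \<open>x\<close>. Deaths: at the death of \<open>x\<close> its two threads lie in one component,
  so a bar \<open>y\<close> that is still alive at \<open>fst x + \<epsilon>\<close> has value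
  zero.\<close>

lemma hmat_nonzero:
  assumes xy: "x \<in> half_bars G" "y \<in> half_bars H" and nz: "hmat G H \<epsilon> f x y \<noteq> 0"
  shows "birth (snd y) \<le> birth (snd x) + ereal \<epsilon>" "real_of_int (fst y) \<le> real_of_int (fst x) + \<epsilon>"
    and "\<exists>t. hok \<epsilon> t x y"
proof -
  show "\<exists>t. hok \<epsilon> t x y" using nz unfolding hmat_def by presburger
  then obtain t where ok: "hok \<epsilon> t x y" by blast
  have nz': "hval G H \<epsilon> f t x y \<noteq> 0" using nz hmat_eq[OF xy ok] by simp
  note o = hok[OF ok]
  note T = X.tx[OF xy(1) o(3,1)] and S = X.sx[OF xy(1) o(3,1)]
  let ?T = "fb (ereal t) (tx G \<lfloor>t\<rfloor> x)" and ?S = "fb (ereal t) (sx G \<lfloor>t\<rfloor> x)"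
  have "?T \<subseteq> snd y \<or> ?S \<subseteq> snd y" using nz' by (auto simp: hval_def inside_def split: if_splits)
  moreover have "birth ?T \<le> birth (snd x) + ereal \<epsilon>" using birth_fb_cq[OF T(1)] T(3) by simp
  moreover have "birth ?S \<le> birth (snd x) + ereal \<epsilon>"
    using birth_fb_cq[OF S(1)] add_right_mono[OF S(3)] by (rule order_trans)
  ultimately show "birth (snd y) \<le> birth (snd x) + ereal \<epsilon>"
    using order_trans[OF birth_antimono] by blast
  show "real_of_int (fst y) \<le> real_of_int (fst x) + \<epsilon>"
  proof (rule ccontr)
    assume "\<not> ?thesis"
    hence "\<lfloor>real_of_int (fst x) + \<epsilon>\<rfloor> < fst y" unfolding floor_less_iff by simp
    hence d: "\<lfloor>real_of_int (fst x) + \<epsilon>\<rfloor> \<le> fst y - 1" by simp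
    let ?K = "ancestor G (fst x) (snd x)"
    have K: "?K \<in> cq G \<lfloor>real_of_int (fst x)\<rfloor>" using X.half_bar_par[OF xy(1)] by simp
    have tx: "t \<le> real_of_int (fst x)" using ok by (simp add: hok_def)
    have "inside ?T y = inside (fb (ereal (of_int (fst x))) ?K) y"
      using Y.inside_cong[OF fb_cq[OF T(1)] fb_cq[OF K] fb_mono_cq[OF T(1) K tx] d xy(2)]
        T(2) X.half_bar_sub[OF xy(1)] by blast
    moreover have "inside ?S y = inside (fb (ereal (of_int (fst x))) ?K) y"
      using Y.inside_cong[OF fb_cq[OF S(1)] fb_cq[OF K] fb_mono_cq[OF S(1) K tx S(2)] d xy(2)] .
    ultimately show False using nz' by (simp add: hval_def)
  qed
qed

text \<open>At the time \<open>t\<close> the bar \<open>x\<close> is alive. The images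
  \<open>K\<close> and \<open>K'\<close> of its two threads have merged by level \<open>D\<close>,
  so \<open>telescope_diff\<close> expands their difference in the bars of \<open>H\<close>.
  Applying the second map and the functional of \<open>x'\<close> gives the matrix product; since
  the round trip only enlarges components, \<open>inside_dual\<close> evaluates it.\<close>

lemma hmat_comp:
  assumes x: "x \<in> half_bars G" "x' \<in> half_bars G"
    and t: "birth (snd x) \<le> ereal t" "t < of_int (fst x)" "t + 2 * \<epsilon> < of_int (fst x')"
    and N: "finite N" "N \<subseteq> half_bars H"
      "\<And>y. y \<in> half_bars H \<Longrightarrow> hmat G H \<epsilon> f x y * hmat H G \<epsilon> g y x' \<noteq> 0 \<Longrightarrow> y \<in> N"
      "\<And>y. y \<in> N \<Longrightarrow> hmat G H \<epsilon> f x y \<noteq> 0 \<Longrightarrow> t + \<epsilon> < of_int (fst y)"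
  shows "(\<Sum>y\<in>N. hmat G H \<epsilon> f x y * hmat H G \<epsilon> g y x') = (if x = x' then 1 else 0)"
proof -
  interpret S: interleaving H G \<epsilon> g f by (rule interleaving_sym)
  define q where "q = \<lfloor>t + \<epsilon>\<rfloor>"
  define K K' where "K = fb (ereal t) (tx G \<lfloor>t\<rfloor> x)" and "K' = fb (ereal t) (sx G \<lfloor>t\<rfloor> x)"
  define h where "h J = inside (gb (ereal (t + \<epsilon>)) J) x'" for J
  define D where "D = \<lfloor>real_of_int (fst x) + \<epsilon>\<rfloor>"
  have "t < of_int (fst x)" "t < of_int (fst x')" "t + \<epsilon> + \<epsilon> < of_int (fst x')" using t(2,3) eps by auto
  hence "\<lfloor>t\<rfloor> < fst x" "\<lfloor>t\<rfloor> < fst x'" "\<lfloor>t + \<epsilon> + \<epsilon>\<rfloor> < fst x'" by (simp_all only: floor_less_iff)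
  hence fl: "\<lfloor>t\<rfloor> \<le> fst x - 1" "\<lfloor>t\<rfloor> \<le> fst x' - 1" "\<lfloor>t + \<epsilon> + \<epsilon>\<rfloor> \<le> fst x' - 1" by simp_all
  have b: "birth (snd x) \<le> ereal (of_int \<lfloor>t\<rfloor>)" using t(1) by (rule birth_le_floor)
  note T = X.tx[OF x(1) b fl(1)] and S = X.sx[OF x(1) b fl(1)]
  have K: "K \<in> cq H q" "K' \<in> cq H q" using fb_cq[OF T(1)] fb_cq[OF S(1)] by (simp_all add: K_def K'_def q_def)
  have par: "ancestor G (fst x) (snd x) \<in> cq G \<lfloor>real_of_int (fst x)\<rfloor>" using X.half_bar_par[OF x(1)] by simp
  let ?P = "fb (ereal (of_int (fst x))) (ancestor G (fst x) (snd x))"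
  have P: "?P \<in> cq H D" using fb_cq[OF par] by (simp add: D_def)
  have qD: "q \<le> D" using t(2) unfolding q_def D_def by (intro floor_mono) simp
  have sub: "K \<subseteq> ?P" "K' \<subseteq> ?P"
    using fb_mono_cq[OF T(1) par] fb_mono_cq[OF S(1) par _ S(2)] t(2) T(2) X.half_bar_sub[OF x(1)]
    unfolding K_def K'_def by auto
  have e: "ancestor H D K = ancestor H D K'"
    using Y.ancestor_eqI[OF K(1) qD P sub(1)] Y.ancestor_eqI[OF K(2) qD P sub(2)] by simp
  define B where "B = {y \<in> half_bars H. q < fst y \<and> fst y \<le> D \<and> (K \<subseteq> snd y \<or> K' \<subseteq> snd y)}"
  have hK: "h K = inside (tx G \<lfloor>t\<rfloor> x) x'" "h K' = inside (sx G \<lfloor>t\<rfloor> x) x'"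
  proof -
    have "gb (ereal (t + \<epsilon>)) K \<in> cq G \<lfloor>t + \<epsilon> + \<epsilon>\<rfloor>" "gb (ereal (t + \<epsilon>)) K' \<in> cq G \<lfloor>t + \<epsilon> + \<epsilon>\<rfloor>"
      using S.fb_cq K unfolding q_def by blast+
    thus "h K = inside (tx G \<lfloor>t\<rfloor> x) x'" "h K' = inside (sx G \<lfloor>t\<rfloor> x) x'"
      using X.inside_cong[OF T(1) _ gb_fb_cq[OF T(1)] fl(3) x(2)]
        X.inside_cong[OF S(1) _ gb_fb_cq[OF S(1)] fl(3) x(2)]
      unfolding h_def K_def K'_def by auto
  qed
  have ok: "hok \<epsilon> t x y \<longleftrightarrow> q < fst y" for y :: "int \<times> 'b node set"
  proof -
    have "t + \<epsilon> < real_of_int (fst y) \<longleftrightarrow> q < fst y" by (simp add: q_def floor_less_iff)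
    thus ?thesis using t by (simp add: hok_def)
  qed
  have val: "hmat G H \<epsilon> f x y = inside K y - inside K' y" if "y \<in> half_bars H" "q < fst y" for y
    using hmat_eq[OF x(1) that(1)] ok[of y] that(2) by (simp add: hval_def K_def K'_def)
  have tm: "hmat G H \<epsilon> f x y * hmat H G \<epsilon> g y x' =
      (inside K y - inside K' y) * (h (tx H q y) - h (sx H q y))" if y: "y \<in> B" for y
  proof -
    have yB: "y \<in> half_bars H" "q < fst y" "K \<subseteq> snd y \<or> K' \<subseteq> snd y" using y by (auto simp: B_def)
    have "birth (snd y) \<le> ereal (of_int q)"
      using yB(3) order_trans[OF birth_antimono Y.birth_cq_le[OF K(1)]]
        order_trans[OF birth_antimono Y.birth_cq_le[OF K(2)]] by blast
    also have "\<dots> \<le> ereal (t + \<epsilon>)" by (simp add: q_def)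
    finally have "hok \<epsilon> (t + \<epsilon>) y x'" using yB(2) t(3) ok[of y] by (auto simp: hok_def)
    from S.hmat_eq[OF yB(1) x(2) this]
    have "hmat H G \<epsilon> g y x' = h (tx H q y) - h (sx H q y)" by (simp add: hval_def h_def q_def)
    thus ?thesis using val[OF yB(1,2)] by simp
  qed
  have fB: "finite B"
    unfolding B_def by (rule finite_subset[OF _ Y.finite_half_bars_between[of q D]]) auto
  have "(\<Sum>y\<in>N. hmat G H \<epsilon> f x y * hmat H G \<epsilon> g y x') =
      (\<Sum>y\<in>B. hmat G H \<epsilon> f x y * hmat H G \<epsilon> g y x')"
  proof (rule sum.mono_neutral_cong[OF fB N(1)])
    fix y assume y: "y \<in> N - B"
    show "hmat G H \<epsilon> f x y * hmat H G \<epsilon> g y x' = 0"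
    proof (rule ccontr)
      assume "\<not> ?thesis"
      hence nz: "hmat G H \<epsilon> f x y \<noteq> 0" by auto
      have yH: "y \<in> half_bars H" using y N(2) by blast
      have "t + \<epsilon> < of_int (fst y)" using N(4) nz y by blast
      hence qy: "q < fst y" by (simp add: q_def floor_less_iff)
      have "K \<subseteq> snd y \<or> K' \<subseteq> snd y"
        using nz val[OF yH qy] by (auto simp: inside_def split: if_splits)
      moreover have "fst y \<le> D" using hmat_nonzero(2)[OF x(1) yH nz]
        unfolding D_def le_floor_iff .
      ultimately show False using y yH qy by (auto simp: B_def)
    qed
  next
    fix y assume "y \<in> B - N"
    hence "y \<in> half_bars H" "y \<notin> N" by (simp_all add: B_def)
    thus "hmat G H \<epsilon> f x y * hmat H G \<epsilon> g y x' = 0" using N(3) by blast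
  qed simp
  also have "\<dots> = h K - h K'"
    unfolding Y.telescope_diff[OF K qD e B_def] by (rule sum.cong[OF refl tm])
  also have "\<dots> = (if x = x' then 1 else 0)" unfolding hK by (rule X.inside_dual[OF x b fl(1,2)])
  finally show ?thesis .
qed

lemma half_bars_injection:
  assumes L: "L = {x \<in> half_bars G. birth (snd x) + ereal (2 * \<epsilon>) < ereal (of_int (fst x))}"
  shows "\<exists>h. inj_on h L \<and> (\<forall>x\<in>L. h x \<in> half_bars H \<and> near \<epsilon> (birth (snd x)) (birth (snd (h x))) \<and>
    near \<epsilon> (ereal (of_int (fst x))) (ereal (of_int (fst (h x)))))"
proof -
  interpret S: interleaving H G \<epsilon> g f by (rule interleaving_sym)
  have LG: "x \<in> half_bars G" if "x \<in> L" for x using that L by blast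
  have b_lt: "birth (snd x) \<noteq> \<infinity>" "birth (snd x) < ereal (of_int (fst x))" if "x \<in> L" for x
  proof -
    have "birth (snd x) \<le> ereal (of_int (fst x - 1))" by (rule X.birth_cq_le[OF X.half_bar_cq[OF LG[OF that]]])
    also have "\<dots> < ereal (of_int (fst x))" by simp
    finally show "birth (snd x) < ereal (of_int (fst x))" .
    thus "birth (snd x) \<noteq> \<infinity>" by auto
  qed
  show ?thesis
  proof (rule bars_injection[where P = "hmat G H \<epsilon> f" and R = "hmat H G \<epsilon> g"])
    show "0 \<le> \<epsilon>" by (rule eps)
    show "birth (snd x) \<noteq> \<infinity>" if "x \<in> L" for x using b_lt that by blast
    show "birth (snd y) \<le> birth (snd x) + ereal \<epsilon> \<and> real_of_int (fst y) \<le> real_of_int (fst x) + \<epsilon>"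
      if "x \<in> L" "y \<in> half_bars H" "hmat G H \<epsilon> f x y \<noteq> 0" for x y
      using hmat_nonzero[OF LG[OF that(1)] that(2,3)] by blast
    show "birth (snd x) \<le> birth (snd y) + ereal \<epsilon> \<and> real_of_int (fst x) \<le> real_of_int (fst y) + \<epsilon>"
      if "x \<in> L" "y \<in> half_bars H" "hmat H G \<epsilon> g y x \<noteq> 0" for x y
      using S.hmat_nonzero[OF that(2) LG[OF that(1)] that(3)] by blast
    show "finite {y \<in> half_bars H. near \<epsilon> (birth (snd x)) (birth (snd y)) \<and>
        near \<epsilon> (ereal (of_int (fst x))) (ereal (of_int (fst y)))}" for x :: "int \<times> 'a node set"
      by (rule finite_subset[OF _ Y.finite_half_bars_between[of "\<lfloor>fst x - \<epsilon>\<rfloor>" "\<lceil>fst x + \<epsilon>\<rceil>"]])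
        (auto simp: near_ereal, linarith+)
    fix x x' N assume x: "x \<in> L" "x' \<in> L"
      and r: "rank_le (birth (snd x)) (of_int (fst x)) (birth (snd x')) (of_int (fst x'))"
      and N: "finite N" "N \<subseteq> half_bars H"
      "\<And>y. y \<in> half_bars H \<Longrightarrow> hmat G H \<epsilon> f x y * hmat H G \<epsilon> g y x' \<noteq> 0 \<Longrightarrow> y \<in> N"
    \<comment> \<open>The birth of \<open>x\<close> serves as \<open>t\<close> if it is finite: that
      it precedes the death of \<open>x'\<close> by more than \<open>2 * \<epsilon>\<close> follows
      from the order of the sums together with the lengths of both bars. For a bar born at minus
      infinity, \<open>t\<close> is taken below all deaths involved.\<close>
    have "\<exists>t. birth (snd x) \<le> ereal t \<and> t < of_int (fst x) \<and> t + 2 * \<epsilon> < of_int (fst x') \<and>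
      (\<forall>y\<in>N. birth (snd x) + ereal \<epsilon> < ereal (of_int (fst y)) \<longrightarrow> t + \<epsilon> < of_int (fst y))"
    proof (cases "birth (snd x)")
      case (real b)
      hence "birth (snd x') \<noteq> -\<infinity>" using r by (auto simp: rank_le_def)
      then obtain b' where b': "birth (snd x') = ereal b'"
        using b_lt(1)[OF x(2)] by (cases "birth (snd x')") auto
      have "b + of_int (fst x) \<le> b' + of_int (fst x')" using r real b' by (simp add: rank_le_def)
      moreover have "b + 2 * \<epsilon> < of_int (fst x)" "b' + 2 * \<epsilon> < of_int (fst x')"
        using x L real b' by auto
      ultimately have "b + 2 * \<epsilon> < of_int (fst x')" by linarith
      thus ?thesis using real b_lt(2)[OF x(1)] by (intro exI[of _ b]) simp
    next
      case MInf
      define m where "m = Min (insert (fst x) (insert (fst x') (fst ` N)))"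
      have "m \<le> fst x" "m \<le> fst x'" "\<And>y. y \<in> N \<Longrightarrow> m \<le> fst y"
        unfolding m_def using N(1) by (intro Min_le; simp)+
      hence m: "real_of_int m \<le> fst x" "real_of_int m \<le> fst x'" "\<And>y. y \<in> N \<Longrightarrow> real_of_int m \<le> fst y"
        by simp_all
      show ?thesis
        using m eps MInf
        by (intro exI[of _ "real_of_int m - 2 * \<epsilon> - 1"]) force
    qed (use b_lt(1)[OF x(1)] in simp)
    then obtain t where t: "birth (snd x) \<le> ereal t" "t < of_int (fst x)" "t + 2 * \<epsilon> < of_int (fst x')"
      "\<And>y. y \<in> N \<Longrightarrow> birth (snd x) + ereal \<epsilon> < ereal (of_int (fst y)) \<Longrightarrow> t + \<epsilon> < of_int (fst y)" by blast
    have "t + \<epsilon> < of_int (fst y)" if y: "y \<in> N" "hmat G H \<epsilon> f x y \<noteq> 0" for y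
    proof -
      obtain s where "hok \<epsilon> s x y" using hmat_nonzero(3)[OF LG[OF x(1)] _ y(2)] y(1) N(2) by blast
      hence s: "birth (snd x) \<le> ereal s" "s + \<epsilon> < of_int (fst y)" by (auto simp: hok_def)
      have "birth (snd x) + ereal \<epsilon> \<le> ereal s + ereal \<epsilon>" using s(1) by (rule add_right_mono)
      also have "\<dots> < ereal (of_int (fst y))" using s(2) by simp
      finally show ?thesis using t(4) y(1) by blast
    qed
    thus "(\<Sum>y\<in>N. hmat G H \<epsilon> f x y * hmat H G \<epsilon> g y x') = (if x = x' then 1 else 0)"
      by (intro hmat_comp[OF LG[OF x(1)] LG[OF x(2)] t(1-3) N])
  qed
qed

end

theorem half_bars_matching:
  assumes "interleaving G H \<epsilon> f g"
  shows "\<exists>m. m \<subseteq> half_bars G \<times> half_bars H \<and> partial_inj m \<and>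
    (\<forall>(x, y)\<in>m. near \<epsilon> (birth (snd x)) (birth (snd y)) \<and>
      near \<epsilon> (ereal (of_int (fst x))) (ereal (of_int (fst y)))) \<and>
    (\<forall>x\<in>half_bars G - Domain m. ereal (of_int (fst x)) \<le> birth (snd x) + ereal (2 * \<epsilon>)) \<and>
    (\<forall>y\<in>half_bars H - Range m. ereal (of_int (fst y)) \<le> birth (snd y) + ereal (2 * \<epsilon>))"
proof -
  interpret interleaving G H \<epsilon> f g by fact
  interpret S: interleaving H G \<epsilon> g f by (rule interleaving_sym)
  define L where "L = {x \<in> half_bars G. birth (snd x) + ereal (2 * \<epsilon>) < ereal (of_int (fst x))}"
  define M where "M = {x \<in> half_bars H. birth (snd x) + ereal (2 * \<epsilon>) < ereal (of_int (fst x))}"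
  let ?r = "{(x, y). near \<epsilon> (birth (snd x)) (birth (snd y)) \<and>
    near \<epsilon> (ereal (of_int (fst x))) (ereal (of_int (fst y)))}"
  obtain \<alpha> where \<alpha>: "inj_on \<alpha> L" "\<And>x. x \<in> L \<Longrightarrow> \<alpha> x \<in> half_bars H \<and> (x, \<alpha> x) \<in> ?r"
    using half_bars_injection[OF L_def] by auto
  obtain \<beta> where \<beta>: "inj_on \<beta> M" and "\<And>y. y \<in> M \<Longrightarrow> \<beta> y \<in> half_bars G \<and>
      near \<epsilon> (birth (snd y)) (birth (snd (\<beta> y))) \<and>
      near \<epsilon> (ereal (of_int (fst y))) (ereal (of_int (fst (\<beta> y))))"
    using S.half_bars_injection[OF M_def] by blast
  hence \<beta>': "\<beta> y \<in> half_bars G \<and> (\<beta> y, y) \<in> ?r" if "y \<in> M" for y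
    using that near_sym unfolding mem_Collect_eq case_prod_conv by metis
  have "L \<subseteq> half_bars G" "M \<subseteq> half_bars H" by (auto simp: L_def M_def)
  then obtain m where m: "m \<subseteq> ?r \<inter> (half_bars G \<times> half_bars H)" "partial_inj m" "L \<subseteq> Domain m" "M \<subseteq> Range m"
    using banach_matching[OF _ \<alpha> _ \<beta> \<beta>'] by blast
  have "ereal (of_int (fst x)) \<le> birth (snd x) + ereal (2 * \<epsilon>)" if "x \<in> half_bars G - Domain m" for x
  proof -
    have "x \<notin> L" using that m(3) by blast
    thus ?thesis using that unfolding L_def by (simp add: not_less)
  qed
  moreover have "ereal (of_int (fst y)) \<le> birth (snd y) + ereal (2 * \<epsilon>)" if "y \<in> half_bars H - Range m" for y
  proof -
    have "y \<notin> M" using that m(4) by blast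
    thus ?thesis using that unfolding M_def by (simp add: not_less)
  qed
  ultimately show ?thesis using m(1,2) by (intro exI[of _ m]) blast
qed

context reeb
begin

text \<open>Level sets are convex: \<open>c\<close> has a node at or below level \<open>n\<close>,
  since it is born no later than \<open>K\<close>, and it reaches \<open>m\<close>.\<close>

lemma lev_from_birth:
  assumes "c \<in> cq G p" "K \<in> cq G q" and b: "birth c \<le> birth K"
    and n: "n \<in> lev K" "n \<le> m" "m \<in> lev c"
  shows "n \<in> lev c"
proof -
  obtain x where "(n, x) \<in> K" using n(1) by (rule mem_levE)
  then obtain i y where i: "(2 * i, y) \<in> K" "2 * i \<le> n" using even_below[OF assms(2)] by blast
  have "birth c \<le> ereal (of_int i)" by (rule order_trans[OF b birth_le[OF i(1)]])
  then obtain j z where j: "j \<le> i" "(2 * j, z) \<in> c" using birth_le_int by blast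
  have "2 * j \<le> n" using j(1) i(2) by simp
  moreover have "2 * j \<in> lev c" using j(2) by (rule mem_lev)
  moreover have "convex_ints (lev c)" using lev_convex assms(1) unfolding cq_def by blast
  ultimately show ?thesis using n(2,3) unfolding convex_ints_def by blast
qed

text \<open>An eldest child is sent to its successor, cut off above level \<open>2 * d\<close>;
  cutting is harmless because \<open>2 * d + 1\<close> is a leaf level. Conversely, the eldest child
  of the successor has the levels \<open>S\<close> because it shares the birth of the
  successor.\<close>

lemma card_elders:
  assumes S: "S \<noteq> {}" "S \<subseteq> {..2 * d - 1}" "2 * d - 1 \<in> S"
  shows "card {c \<in> cq G (d - 1). lev c = S \<and> sibling G (d, c) = c} = card (comps_at G {..2 * d} (insert (2 * d) S))"
proof -
  let ?E = "{c \<in> cq G (d - 1). lev c = S \<and> sibling G (d, c) = c}"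
  let ?C = "comps_at G {..2 * d} (insert (2 * d) S)"
  define \<psi> where "\<psi> c = ancestor G d c \<inter> nodes G {..2 * d}" for c
  have ins: "insert (2 * d + 1) {..2 * d} = {..2 * d + 1}" by auto
  have leaf: "K \<inter> nodes G {..2 * d} \<in> comps G {..2 * d}"
    if "K \<in> cq G d" "K \<inter> nodes G {..2 * d} \<noteq> {}" for K
    using comps_leaf[of "2 * d + 1" "{..2 * d}" K] that unfolding ins cq_def by simp
  have nod: "c \<subseteq> nodes G {..2 * d}" if "c \<in> cq G (d - 1)" for c
    using comps_sub[of c "{..2 * (d - 1) + 1}"] nodes_mono[of "{..2 * (d - 1) + 1}" "{..2 * d}" G] that
    unfolding cq_def by auto
  have lo: "birth K \<le> ereal (of_int (d - 1))" if K: "K \<in> cq G d" "s \<in> lev K" "s \<le> 2 * d - 1" for K s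
  proof -
    obtain x where "(s, x) \<in> K" using K(2) by (rule mem_levE)
    then obtain i y where i: "(2 * i, y) \<in> K" "2 * i \<le> s" using even_below[OF K(1)] by blast
    have "i \<le> d - 1" using i(2) K(3) by simp
    hence "ereal (of_int i) \<le> ereal (of_int (d - 1))" by (simp only: ereal_less_eq of_int_le_iff)
    thus ?thesis using birth_le[OF i(1)] by (rule order_trans[rotated])
  qed
  have E: "c \<in> cq G (d - 1)" "lev c = S" "ancestor G d c \<in> cq G d" "c \<subseteq> ancestor G d c"
    "c = eldest G d (ancestor G d c)" "birth c = birth (ancestor G d c)" if "c \<in> ?E" for c
  proof -
    show c: "c \<in> cq G (d - 1)" "lev c = S" using that by auto
    show a: "ancestor G d c \<in> cq G d" "c \<subseteq> ancestor G d c" using ancestor[OF c(1), of d] by auto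
    show e: "c = eldest G d (ancestor G d c)" using that by (simp add: sibling_def)
    have "2 * d - 1 \<in> lev (ancestor G d c)" using a(2) c(2) S(3) unfolding lev_def by blast
    hence "birth (ancestor G d c) \<le> ereal (of_int (d - 1))" using lo[OF a(1)] by simp
    thus "birth c = birth (ancestor G d c)" using birth_eldest[OF a(1)] e by simp
  qed
  have "bij_betw \<psi> ?E ?C"
  proof (rule bij_betwI')
    fix c c' assume c: "c \<in> ?E" "c' \<in> ?E"
    show "\<psi> c = \<psi> c' \<longleftrightarrow> c = c'"
    proof
      assume e: "\<psi> c = \<psi> c'"
      have "c \<subseteq> ancestor G d c'" using E(4)[OF c(1)] nod[OF E(1)[OF c(1)]] e unfolding \<psi>_def by blast
      hence "ancestor G d c = ancestor G d c'" using ancestor_eqI[OF E(1)[OF c(1)] _ E(3)[OF c(2)]] by simp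
      thus "c = c'" using E(5)[OF c(1)] E(5)[OF c(2)] by simp
    qed simp
  next
    fix c assume c: "c \<in> ?E"
    have ne: "c \<subseteq> \<psi> c" using E(4)[OF c] nod[OF E(1)[OF c]] by (simp add: \<psi>_def)
    have "\<psi> c \<in> comps G {..2 * d}"
      using leaf[OF E(3)[OF c]] ne cq_nonempty[OF E(1)[OF c]] unfolding \<psi>_def by blast
    moreover have "lev (\<psi> c) = insert (2 * d) S"
    proof
      have "2 * d - 1 \<in> lev c" using E(2)[OF c] S(3) by simp
      then obtain x where x: "(2 * d - 1, x) \<in> c" by (rule mem_levE)
      have "x \<in> Lev G (2 * d - 1)" using nod[OF E(1)[OF c]] x by auto
      hence s: "((2 * d - 1, x), (2 * d, Up G (2 * d - 1) x)) \<in> edges G {..2 * d + 1}"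
        unfolding edges_def by force
      hence "(2 * d, Up G (2 * d - 1) x) \<in> ancestor G d c"
        using comps_closed[OF _ _ edges_linked[OF s], of "ancestor G d c"] E(3,4)[OF c] x
        unfolding cq_def by blast
      moreover have "(2 * d, Up G (2 * d - 1) x) \<in> nodes G {..2 * d}"
        using edges_nodes[OF s] by auto
      ultimately have "(2 * d, Up G (2 * d - 1) x) \<in> \<psi> c" by (simp add: \<psi>_def)
      hence "2 * d \<in> lev (\<psi> c)" by (rule mem_lev)
      thus "insert (2 * d) S \<subseteq> lev (\<psi> c)" using ne E(2)[OF c] unfolding lev_def by blast
      show "lev (\<psi> c) \<subseteq> insert (2 * d) S"
      proof
        fix n assume n: "n \<in> lev (\<psi> c)"
        hence n2: "n \<le> 2 * d" "n \<in> lev (ancestor G d c)" by (auto simp: \<psi>_def lev_def nodes_def)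
        show "n \<in> insert (2 * d) S"
        proof (cases "n = 2 * d")
          case False
          hence "n \<in> lev c"
            using lev_from_birth[OF E(1,3)[OF c] _ n2(2), of "2 * d - 1"] n2(1) E(2,6)[OF c] S(3) by simp
          thus ?thesis using E(2)[OF c] by simp
        qed simp
      qed
    qed
    ultimately show "\<psi> c \<in> ?C" by (simp add: comps_at_def)
  next
    fix K assume "K \<in> ?C"
    hence K: "K \<in> comps G {..2 * d}" "lev K = insert (2 * d) S" by (auto simp: comps_at_def)
    let ?K = "ext G {..2 * d + 1} K"
    have sub: "{..2 * d} \<subseteq> {..2 * d + 1}" by auto
    have K': "?K \<in> cq G d" "K \<subseteq> ?K" using ext[OF K(1) sub] by (auto simp: cq_def)
    have KN: "K \<subseteq> nodes G {..2 * d}" by (rule comps_sub[OF K(1)])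
    obtain a where a: "a \<in> K" using comps_nonempty[OF K(1)] by blast
    hence a': "a \<in> ?K \<inter> nodes G {..2 * d}" using K'(2) KN by blast
    have eq: "?K \<inter> nodes G {..2 * d} = K"
      using comps_eqI[OF leaf[OF K'(1)] K(1) a' a] a' by blast
    have levK: "insert (2 * d) S \<subseteq> lev ?K" using K(2) K'(2) unfolding lev_def by blast
    let ?c = "eldest G d ?K"
    have "2 * d - 1 \<in> lev ?K" using levK S(3) by blast
    hence b: "birth ?K \<le> ereal (of_int (d - 1))" using lo[OF K'(1)] by blast
    have c: "?c \<in> children G d ?K" "birth ?c = birth ?K" using eldest[OF K'(1) b] by auto
    hence cq: "?c \<in> cq G (d - 1)" "?c \<subseteq> ?K" by (auto simp: children_def)
    have lc: "lev ?c \<subseteq> {..2 * (d - 1) + 1}" using comps_lev cq(1) unfolding cq_def by blast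
    hence "2 * d \<notin> lev ?c" by auto
    hence "?c \<noteq> ?K" using levK by auto
    hence r: "2 * d - 1 \<in> lev ?c" by (rule child_reaches[OF K'(1) c(1)])
    have "lev ?c = S"
    proof
      have "?c \<subseteq> K" using cq(2) nod[OF cq(1)] eq by blast
      hence "lev ?c \<subseteq> insert (2 * d) S" using K(2) unfolding lev_def by blast
      thus "lev ?c \<subseteq> S" using \<open>2 * d \<notin> lev ?c\<close> by blast
      show "S \<subseteq> lev ?c"
      proof
        fix n assume n: "n \<in> S"
        hence "n \<in> lev ?K" "n \<le> 2 * d - 1" using levK S(2) by auto
        thus "n \<in> lev ?c" using lev_from_birth[OF cq(1) K'(1) _ _ _ r] c(2) by simp
      qed
    qed
    moreover have an: "ancestor G d ?c = ?K" using ancestor_eqI[OF cq(1) _ K'(1) cq(2)] by simp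
    ultimately have "?c \<in> ?E" using cq(1) by (simp add: sibling_def)
    moreover have "K = \<psi> ?c" unfolding \<psi>_def an by (rule eq[symmetric])
    ultimately show "\<exists>c\<in>?E. K = \<psi> c" by blast
  qed
  thus ?thesis by (rule bij_betw_same_card)
qed

text \<open>The bars are the components with levels \<open>S\<close> except for those that are
  eldest children; the two counts are the two terms of \<open>dgz_half_open\<close>.\<close>

theorem card_half_bars:
  assumes S: "convex_ints S" "S \<noteq> {}" and odd: "\<And>p. p \<in> lo S \<Longrightarrow> odd p" and d: "2 * d \<in> hi S"
  shows "int (card {x \<in> half_bars G. lev (snd x) = S}) = dgz G S" "finite {x \<in> half_bars G. lev (snd x) = S}"
proof -
  have Sd: "S \<subseteq> {..2 * d - 1}" "2 * d - 1 \<in> S" using hi_greater[OF S(1) d] d by (auto simp: hi_def)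
  have e: "2 * (d - 1) + 1 = 2 * d - 1" by simp
  let ?A = "{c \<in> cq G (d - 1). lev c = S}"
  let ?E = "{c \<in> cq G (d - 1). lev c = S \<and> sibling G (d, c) = c}"
  have A: "?A = comps_at G {..2 * d - 1} S" unfolding cq_def comps_at_def e ..
  have fin: "finite ?A" unfolding A by (rule finite_comps_at[OF S(2)])
  have B: "{x \<in> half_bars G. lev (snd x) = S} = Pair d ` (?A - ?E)"
  proof (intro set_eqI iffI)
    fix x assume "x \<in> {x \<in> half_bars G. lev (snd x) = S}"
    hence x: "x \<in> half_bars G" "lev (snd x) = S" by auto
    have "2 * fst x - 1 \<in> S" using half_bar_reaches[OF x(1)] x(2) by simp
    hence "fst x \<le> d" using Sd(1) by auto
    moreover have "S \<subseteq> {..2 * (fst x - 1) + 1}"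
      using comps_lev half_bar_cq[OF x(1)] x(2) unfolding cq_def by blast
    hence "d \<le> fst x" using Sd(2) by auto
    ultimately have fd: "fst x = d" by simp
    hence xd: "x = (d, snd x)" by (metis prod.collapse)
    have "snd x \<in> cq G (d - 1)" using half_bar_cq[OF x(1)] fd by simp
    moreover have "sibling G (d, snd x) \<noteq> snd x" using sibling_neq[OF x(1)] xd by simp
    ultimately have "snd x \<in> ?A - ?E" using x(2) by blast
    thus "x \<in> Pair d ` (?A - ?E)" by (subst xd) (rule imageI)
  next
    fix x assume "x \<in> Pair d ` (?A - ?E)"
    thus "x \<in> {x \<in> half_bars G. lev (snd x) = S}" by (auto simp: half_bars_def)
  qed
  show "finite {x \<in> half_bars G. lev (snd x) = S}" unfolding B using fin by simp
  have "card {x \<in> half_bars G. lev (snd x) = S} = card (?A - ?E)"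
    unfolding B by (rule card_image) (simp add: inj_on_def)
  also have "\<dots> = card ?A - card ?E" by (rule card_Diff_subset[OF finite_subset[OF _ fin]]) auto
  finally have c: "card {x \<in> half_bars G. lev (snd x) = S} = card ?A - card ?E" .
  have le: "card ?E \<le> card ?A" by (rule card_mono[OF fin]) auto
  have "dgz G S = int (card ?A) - int (card ?E)"
    using dgz_half_open[OF S odd d] card_elders[OF S(2) Sd] A by simp
  thus "int (card {x \<in> half_bars G. lev (snd x) = S}) = dgz G S" using c le by simp
qed

end

subsection \<open>Linear algebra\<close>

lemma (in vector_space) independent_span_disjoint:
  assumes B: "independent B" "B0 \<subseteq> B" "C \<subseteq> B" "B0 \<inter> C = {}" and z: "z \<in> span B0" "z \<in> span C"
  shows "z = 0"
proof -
  have "representation B z = representation B0 z" "representation B z = representation C z"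
    using representation_extend[OF B(1) z(1) B(2)] representation_extend[OF B(1) z(2) B(3)] by auto
  hence "representation B z b = 0" for b using representation_ne_zero B(4) by (metis disjoint_iff)
  moreover have "z \<in> span B" using z(1) span_mono[OF B(2)] by blast
  ultimately show ?thesis using sum_nonzero_representation_eq[OF B(1)] by fastforce
qed

text \<open>Stated for a subspace of a finite span, as the ambient function spaces need not be
  finite dimensional.\<close>

lemma (in vector_space_pair) rank_nullity:
  assumes lin: "Vector_Spaces.linear s1 s2 h" and S: "vs1.subspace S" and F: "finite F" "S \<subseteq> vs1.span F"
  shows "vs1.dim S = vs2.dim (h ` S) + vs1.dim {x \<in> S. h x = 0}"
proof -
  interpret h: Vector_Spaces.linear s1 s2 h by fact
  let ?K = "{x \<in> S. h x = 0}"
  obtain B0 where B0: "B0 \<subseteq> ?K" "vs1.independent B0" "?K \<subseteq> vs1.span B0" "card B0 = vs1.dim ?K"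
    by (rule vs1.basis_exists)
  have "B0 \<subseteq> S" using B0(1) by blast
  then obtain B where B: "B0 \<subseteq> B" "B \<subseteq> S" "vs1.independent B" "S \<subseteq> vs1.span B"
    using vs1.maximal_independent_subset_extend[OF _ B0(2)] by metis
  have finB: "finite B" using vs1.independent_span_bound[OF F(1) B(3)] B(2) F(2) by blast
  define C where "C = B - B0"
  have C: "C \<subseteq> B" "B0 \<inter> C = {}" "B0 \<union> C = B" using B(1) by (auto simp: C_def)
  have spanS: "vs1.span C \<subseteq> S" using vs1.span_minimal[OF _ S] C(1) B(2) by blast
  have inj: "inj_on h (vs1.span C)"
  proof (rule inj_onI)
    fix x y assume xy: "x \<in> vs1.span C" "y \<in> vs1.span C" "h x = h y"
    have d: "x - y \<in> vs1.span C" using xy vs1.span_diff by blast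
    have "h (x - y) = 0" using xy(3) by (simp add: h.diff)
    hence "x - y \<in> vs1.span B0" using d spanS B0(3) by blast
    hence "x - y = 0" using vs1.independent_span_disjoint[OF B(3,1) C(1,2)] d by blast
    thus "x = y" by simp
  qed
  have indC: "vs1.independent C" using vs1.independent_mono[OF B(3) C(1)] .
  have ind: "vs2.independent (h ` C)" by (rule h.independent_injective_image[OF indC inj])
  have "h ` S \<subseteq> vs2.span (h ` C)"
  proof
    fix w assume "w \<in> h ` S"
    then obtain x where x: "x \<in> S" "w = h x" by blast
    hence "x \<in> vs1.span (B0 \<union> C)" using B(4) C(3) by blast
    then obtain u v where uv: "u \<in> vs1.span B0" "v \<in> vs1.span C" "x = u + v"
      unfolding vs1.span_Un by blast
    have "h u = 0" by (rule h.eq_0_on_span[OF _ uv(1)]) (use B0(1) in blast)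
    hence "w = h v" using x uv by (simp add: h.add)
    thus "w \<in> vs2.span (h ` C)" using uv(2) by (auto simp: h.span_image)
  qed
  moreover have "h ` C \<subseteq> h ` S" using C(1) B(2) by blast
  ultimately have "vs2.dim (h ` S) = card (h ` C)" using vs2.basis_card_eq_dim[OF _ _ ind] by simp
  also have "\<dots> = card C"
    by (rule card_image) (use inj vs1.span_superset in \<open>rule inj_on_subset\<close>)
  finally have 1: "vs2.dim (h ` S) = card C" .
  have "vs1.dim S = card B" using vs1.basis_card_eq_dim[OF B(2,4,3)] by simp
  also have "\<dots> = card B0 + card C"
    using card_Un_disjoint[of B0 C] C finB by (metis finite_Un)
  finally show ?thesis using 1 B0(4) by simp
qed

context vector_space
begin

text \<open>A basis adapted to two filtrations, where \<open>S b d\<close> is the intersection of step \<open>d\<close> of the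
  first filtration with step \<open>b\<close> of the second one.\<close>

context
  fixes S :: "int \<Rightarrow> int \<Rightarrow> 'b set"
  assumes sub: "\<And>b d. subspace (S b d)" and triv: "\<And>b d. d \<le> b \<Longrightarrow> S b d = {0}"
    and mono: "\<And>b d b' d'. b' \<le> b \<Longrightarrow> d \<le> d' \<Longrightarrow> S b d \<subseteq> S b' d'"
    and meet: "\<And>b d b' d'. S b d \<inter> S b' d' \<subseteq> S (max b b') (min d d')"
    and fd: "\<And>b d. \<exists>F. finite F \<and> S b d \<subseteq> span F"
begin

text \<open>The part of \<open>S b d\<close> that comes from the next smaller steps of the two
  filtrations; \<open>cb b d\<close> will span a complement of it.\<close>

definition "lower b d = {x + y | x y. x \<in> S b (d - 1) \<and> y \<in> S (b + 1) d}"

lemma complement_exists: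
  "\<exists>E. finite E \<and> E \<subseteq> S b d \<and> independent E \<and> span E \<inter> lower b d = {0} \<and> S b d \<subseteq> span (lower b d \<union> E)"
proof -
  have l: "subspace (lower b d)" unfolding lower_def by (rule subspace_sums[OF sub sub])
  have "S b (d - 1) \<subseteq> S b d" "S (b + 1) d \<subseteq> S b d" by (rule mono; simp)+
  hence lS: "lower b d \<subseteq> S b d" unfolding lower_def using subspace_add[OF sub] by blast
  obtain B0 where B0: "B0 \<subseteq> lower b d" "independent B0" "lower b d \<subseteq> span B0"
    by (rule basis_exists)
  obtain B where B: "B0 \<subseteq> B" "B \<subseteq> S b d" "independent B" "S b d \<subseteq> span B"
    using maximal_independent_subset_extend[OF _ B0(2), of "S b d"] B0(1) lS by blast
  obtain F where F: "finite F" "S b d \<subseteq> span F" using fd by blast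
  have finB: "finite B" using independent_span_bound[OF F(1) B(3)] B(2) F(2) by blast
  define E where "E = B - B0"
  have "z = 0" if "z \<in> span E" "z \<in> lower b d" for z
    using independent_span_disjoint[OF B(3,1), of E z] that B0(3) by (auto simp: E_def)
  moreover have "0 \<in> span E \<inter> lower b d" using span_zero subspace_0[OF l] by blast
  ultimately have "span E \<inter> lower b d = {0}" by blast
  moreover have "B \<subseteq> lower b d \<union> E" using B0(1) by (auto simp: E_def)
  hence "S b d \<subseteq> span (lower b d \<union> E)" using B(4) span_mono by blast
  moreover have "finite E" "E \<subseteq> S b d" using finB B(2) by (auto simp: E_def)
  moreover have "independent E" by (rule independent_mono[OF B(3)]) (simp add: E_def)
  ultimately show ?thesis by blast
qed

definition "cb b d = (SOME E. finite E \<and> E \<subseteq> S b d \<and> independent E \<and> span E \<inter> lower b d = {0} \<and>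
  S b d \<subseteq> span (lower b d \<union> E))"

lemma cb: "finite (cb b d)" "cb b d \<subseteq> S b d" "independent (cb b d)" "span (cb b d) \<inter> lower b d = {0}"
  "S b d \<subseteq> span (lower b d \<union> cb b d)"
  using someI_ex[OF complement_exists[of b d]] unfolding cb_def by auto

lemma span_cb: "span (cb b d) \<subseteq> S b d"
  by (rule span_minimal[OF cb(2) sub])

lemma cb_empty: "d \<le> b \<Longrightarrow> cb b d = {}"
  using cb(2)[of b d] cb(3)[of b d] triv[of d b] dependent_zero[of "cb b d"] by auto

definition "cbU b d = (\<Union>(b', d')\<in>{(b', d'). b \<le> b' \<and> d' \<le> d}. cb b' d')"

lemma cbU_I: "b \<le> b' \<Longrightarrow> d' \<le> d \<Longrightarrow> x \<in> cb b' d' \<Longrightarrow> x \<in> cbU b d"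
  unfolding cbU_def by blast

lemma cbU_E: "x \<in> cbU b d \<Longrightarrow> (\<And>b' d'. b \<le> b' \<Longrightarrow> d' \<le> d \<Longrightarrow> x \<in> cb b' d' \<Longrightarrow> thesis) \<Longrightarrow> thesis"
  unfolding cbU_def by blast

lemma cbU_mono:
  assumes "b' \<le> b" "d \<le> d'"
  shows "cbU b d \<subseteq> cbU b' d'"
proof
  fix x assume "x \<in> cbU b d"
  thus "x \<in> cbU b' d'"
  proof (rule cbU_E)
    fix c e assume "b \<le> c" "e \<le> d" "x \<in> cb c e"
    thus ?thesis using assms by (intro cbU_I[of b' c e d']) auto
  qed
qed

lemma cbU_finite: "finite (cbU b d)"
proof -
  have "cbU b d = (\<Union>(b', d')\<in>{b..d} \<times> {b..d}. cb b' d')"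
  proof (intro set_eqI iffI)
    fix x assume "x \<in> cbU b d"
    then obtain b' d' where x: "b \<le> b'" "d' \<le> d" "x \<in> cb b' d'" by (rule cbU_E)
    moreover have "b' < d'" using x(3) cb_empty[of d' b'] by (cases "d' \<le> b'") auto
    ultimately show "x \<in> (\<Union>(b', d')\<in>{b..d} \<times> {b..d}. cb b' d')"
      by (intro UN_I[of "(b', d')"]) auto
  qed (auto intro: cbU_I)
  thus ?thesis using cb(1) by auto
qed

lemma cbU_sub: "cbU b d \<subseteq> S b d"
  unfolding cbU_def using cb(2) mono by fast

text \<open>\<open>S b d\<close> is spanned by \<open>lower b d\<close> and a complement, and both
  summands of \<open>lower b d\<close> have a smaller difference of indices.\<close>

lemma cbU_span: "S b d \<subseteq> span (cbU b d)"
proof (induction "nat (d - b)" arbitrary: b d rule: less_induct)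
  case less
  show ?case
  proof (cases "d \<le> b")
    case True
    thus ?thesis using triv span_zero by auto
  next
    case False
    have m: "cbU b (d - 1) \<subseteq> cbU b d" "cbU (b + 1) d \<subseteq> cbU b d" "cb b d \<subseteq> cbU b d"
      using cbU_mono[of b b "d - 1" d] cbU_mono[of b "b + 1" d d] cbU_I[of b b d d] by auto
    have "S b (d - 1) \<subseteq> span (cbU b d)" "S (b + 1) d \<subseteq> span (cbU b d)"
      using less[of "d - 1" b] less[of d "b + 1"] span_mono[OF m(1)] span_mono[OF m(2)] False by auto
    hence "lower b d \<subseteq> span (cbU b d)" unfolding lower_def using span_add by blast
    moreover have "cb b d \<subseteq> span (cbU b d)" using m(3) span_superset by blast
    ultimately have "span (lower b d \<union> cb b d) \<subseteq> span (cbU b d)" by (intro span_minimal) auto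
    thus ?thesis using cb(5) by blast
  qed
qed

text \<open>In a vanishing sum, the summand with largest \<open>d\<close> and, among these, smallest \<open>b\<close> lies in the
  lower part.\<close>

lemma cb_sum_zero:
  assumes J: "finite J" and v: "\<And>j. j \<in> J \<Longrightarrow> v j \<in> span (cb (fst j) (snd j))" and z: "(\<Sum>j\<in>J. v j) = 0"
  shows "\<forall>j\<in>J. v j = 0"
proof (rule ccontr)
  assume "\<not> ?thesis"
  define I where "I = {j \<in> J. v j \<noteq> 0}"
  have I: "finite I" "I \<noteq> {}" using J \<open>\<not> _\<close> by (auto simp: I_def)
  define d where "d = Max (snd ` I)"
  define I' where "I' = {j \<in> I. snd j = d}"
  have "d \<in> snd ` I" unfolding d_def by (rule Max_in) (use I in auto)
  hence I': "finite I'" "I' \<noteq> {}" using I by (auto simp: I'_def)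
  define b where "b = Min (fst ` I')"
  have "b \<in> fst ` I'" unfolding b_def by (rule Min_in) (use I' in auto)
  then obtain j where "j \<in> I'" "fst j = b" by auto
  hence j: "(b, d) \<in> I" by (auto simp: I'_def)
  define b0 where "b0 = Min (fst ` I)"
  have b0: "b0 \<le> fst i" if "i \<in> I" for i unfolding b0_def using I that by simp
  have dm: "snd i \<le> d" if "i \<in> I" for i unfolding d_def using I that by simp
  have bm: "b \<le> fst i" if "i \<in> I'" for i unfolding b_def using I' that by simp
  have sI: "(\<Sum>j\<in>I. v j) = 0"
  proof -
    have "(\<Sum>j\<in>J. v j) = (\<Sum>j\<in>I. v j)" by (rule sum.mono_neutral_right) (use J in \<open>auto simp: I_def\<close>)
    thus ?thesis using z by simp
  qed
  have vI: "v i \<in> span (cb (fst i) (snd i))" if "i \<in> I" for i using v that by (simp add: I_def)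
  let ?R = "I - {(b, d)}"
  define X where "X = {i\<in>?R. snd i < d}"
  define Y where "Y = {i\<in>?R. \<not> snd i < d}"
  define x where "x = - (\<Sum>i\<in>X. v i)"
  define y where "y = - (\<Sum>i\<in>Y. v i)"
  have R: "?R = X \<union> Y" "X \<inter> Y = {}" "finite X" "finite Y" using I(1) by (auto simp: X_def Y_def)
  have "(\<Sum>i\<in>?R. v i) = (\<Sum>i\<in>X. v i) + (\<Sum>i\<in>Y. v i)"
    unfolding R(1) by (rule sum.union_disjoint[OF R(3,4,2)])
  moreover have "(\<Sum>i\<in>I. v i) = v (b, d) + (\<Sum>i\<in>?R. v i)" by (rule sum.remove[OF I(1) j])
  ultimately have "v (b, d) + ((\<Sum>i\<in>X. v i) + (\<Sum>i\<in>Y. v i)) = 0" using sI by simp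
  hence "v (b, d) = - ((\<Sum>i\<in>X. v i) + (\<Sum>i\<in>Y. v i))" by (simp only: eq_neg_iff_add_eq_0)
  hence eq: "v (b, d) = x + y" unfolding x_def y_def by simp
  have x: "x \<in> S b0 (d - 1)"
    unfolding x_def
  proof (intro subspace_neg[OF sub] subspace_sum[OF sub])
    fix i assume "i \<in> X"
    hence i: "i \<in> {i\<in>?R. snd i < d}" by (simp add: X_def)
    hence "v i \<in> S (fst i) (snd i)" using vI span_cb by blast
    thus "v i \<in> S b0 (d - 1)" using mono[of b0 "fst i" "snd i" "d - 1"] b0 i by auto
  qed
  have y: "y \<in> S (b + 1) d"
    unfolding y_def
  proof (intro subspace_neg[OF sub] subspace_sum[OF sub])
    fix i assume "i \<in> Y"
    hence i: "i \<in> {i\<in>?R. \<not> snd i < d}" by (simp add: Y_def)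
    hence iI: "i \<in> I" "snd i = d" using dm[of i] by auto
    hence "i \<in> I'" by (simp add: I'_def)
    hence "b \<le> fst i" by (rule bm)
    moreover have "fst i \<noteq> b"
    proof
      assume "fst i = b"
      hence "i = (b, d)" using iI(2) by (metis prod.collapse)
      thus False using i by simp
    qed
    ultimately have "b + 1 \<le> fst i" by simp
    moreover have "v i \<in> S (fst i) (snd i)" using vI[OF iI(1)] span_cb by blast
    ultimately show "v i \<in> S (b + 1) d" using mono[of "b + 1" "fst i" "snd i" d] iI(2) by auto
  qed
  have vs: "v (b, d) \<in> span (cb b d)" using vI[OF j] by simp
  hence "v (b, d) \<in> S b d" using span_cb by blast
  moreover have "y \<in> S b d" using y mono[of b "b + 1" d d] by auto
  ultimately have "x \<in> S b d" using eq subspace_diff[OF sub, of "v (b, d)" b d y] by simp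
  \<comment> \<open>Compatibility of the filtrations: \<open>x\<close> lies in \<open>S b d\<close>
    as well as in a step with second index \<open>d - 1\<close>, hence in
    \<open>S b (d - 1)\<close>.\<close>
  hence "x \<in> S (max b b0) (min d (d - 1))" using meet[of b d b0 "d - 1"] x by blast
  moreover have "b0 \<le> b" using b0[OF j] by simp
  ultimately have "x \<in> S b (d - 1)" by (simp add: max_def min_def split: if_splits)
  hence "v (b, d) \<in> lower b d" unfolding lower_def eq using y by blast
  hence "v (b, d) = 0" using vs cb(4) by blast
  thus False using j by (simp add: I_def)
qed

lemma cb_disjoint:
  assumes "x \<in> cb b d" "x \<in> cb b' d'"
  shows "b = b' \<and> d = d'"
proof (rule ccontr)
  assume ne: "\<not> ?thesis"
  define v where "v j = (if j = (b, d) then x else - x)" for j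
  have "\<forall>j\<in>{(b, d), (b', d')}. v j = 0"
  proof (rule cb_sum_zero)
    show "(\<Sum>j\<in>{(b, d), (b', d')}. v j) = 0" using ne by (auto simp: v_def)
    show "v j \<in> span (cb (fst j) (snd j))" if "j \<in> {(b, d), (b', d')}" for j
    proof (cases "j = (b, d)")
      case True
      thus ?thesis using assms(1) by (simp add: v_def span_base)
    next
      case False
      hence "j = (b', d')" "v j = - x" using that by (auto simp: v_def)
      thus ?thesis using span_neg[OF span_base[OF assms(2)]] by simp
    qed
  qed simp
  hence "x = 0" by (auto simp: v_def)
  thus False using assms(1) cb(3)[of b d] dependent_zero by blast
qed

text \<open>A vanishing combination is grouped by the positions of its vectors; each group vanishes
  by \<open>cb_sum_zero\<close> and involves one independent set.\<close>

lemma cb_independent: "independent (\<Union>(b, d). cb b d)"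
  unfolding independent_explicit_finite_subsets
proof (intro allI impI ballI)
  fix A u a assume A: "A \<subseteq> (\<Union>(b, d). cb b d)" "finite A" "(\<Sum>v\<in>A. scale (u v) v) = 0" "a \<in> A"
  define pos where "pos x = (THE j. x \<in> cb (fst j) (snd j))" for x
  have pos: "pos x = (b, d)" if "x \<in> cb b d" for x b d
    unfolding pos_def by (rule the_equality) (use that cb_disjoint in fastforce)+
  have in_pos: "x \<in> cb (fst (pos x)) (snd (pos x))" if xA: "x \<in> A" for x
  proof -
    obtain b d where "x \<in> cb b d" using A(1) xA by auto
    thus ?thesis using pos by simp
  qed
  have *: "\<forall>j\<in>pos ` A. (\<Sum>x\<in>{x \<in> A. pos x = j}. scale (u x) x) = 0"
  proof (rule cb_sum_zero)
    show "(\<Sum>j\<in>pos ` A. \<Sum>x\<in>{x \<in> A. pos x = j}. scale (u x) x) = 0"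
      using sum.group[of A "pos ` A" pos "\<lambda>x. scale (u x) x"] A(2,3) by simp
    show "(\<Sum>x\<in>{x \<in> A. pos x = j}. scale (u x) x) \<in> span (cb (fst j) (snd j))" for j
    proof (intro span_sum span_scale span_base)
      fix x assume "x \<in> {x \<in> A. pos x = j}"
      thus "x \<in> cb (fst j) (snd j)" using in_pos[of x] by simp
    qed
  qed (use A(2) in simp)
  let ?A = "{x \<in> A. pos x = pos a}"
  have "(\<Sum>x\<in>?A. scale (u x) x) = 0" using * A(4) by blast
  moreover have "?A \<subseteq> cb (fst (pos a)) (snd (pos a))"
  proof
    fix x assume "x \<in> ?A"
    thus "x \<in> cb (fst (pos a)) (snd (pos a))" using in_pos[of x] by simp
  qed
  moreover have "finite ?A" using A(2) by simp
  ultimately show "u a = 0"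
    using cb(3)[of "fst (pos a)" "snd (pos a)"] A(4) unfolding independent_explicit_finite_subsets by blast
qed

lemma cbU_independent: "independent (cbU b d)"
  by (rule independent_mono[OF cb_independent]) (auto simp: cbU_def)

lemma cbU_dim: "dim (S b d) = card (cbU b d)"
  using basis_card_eq_dim[OF cbU_sub cbU_span cbU_independent] by simp

text \<open>Inclusion-exclusion: \<open>cbU b d\<close> consists of \<open>cb b d\<close> and the
  union of \<open>cbU b (d - 1)\<close> and \<open>cbU (b + 1) d\<close>, which meet in
  \<open>cbU (b + 1) (d - 1)\<close>.\<close>

lemma card_cb:
  assumes "b < d"
  shows "int (card (cb b d)) =
    int (dim (S b d)) - int (dim (S b (d - 1))) - int (dim (S (b + 1) d)) + int (dim (S (b + 1) (d - 1)))"
proof -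
  have U: "cbU b d = (cbU b (d - 1) \<union> cbU (b + 1) d) \<union> cb b d"
  proof (intro set_eqI iffI)
    fix x assume "x \<in> cbU b d"
    then obtain b' d' where x: "b \<le> b'" "d' \<le> d" "x \<in> cb b' d'" by (rule cbU_E)
    consider "d' \<le> d - 1" | "b + 1 \<le> b'" | "b' = b \<and> d' = d" using x(1,2) by linarith
    thus "x \<in> (cbU b (d - 1) \<union> cbU (b + 1) d) \<union> cb b d" using x by cases (auto intro: cbU_I)
  next
    fix x assume "x \<in> (cbU b (d - 1) \<union> cbU (b + 1) d) \<union> cb b d"
    moreover have "cbU b (d - 1) \<subseteq> cbU b d" "cbU (b + 1) d \<subseteq> cbU b d" by (rule cbU_mono; simp)+
    ultimately show "x \<in> cbU b d" using cbU_I[of b b d d x] by blast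
  qed
  have I: "cbU b (d - 1) \<inter> cbU (b + 1) d = cbU (b + 1) (d - 1)"
  proof (intro set_eqI iffI)
    fix x assume "x \<in> cbU b (d - 1) \<inter> cbU (b + 1) d"
    hence x: "x \<in> cbU b (d - 1)" "x \<in> cbU (b + 1) d" by blast+
    obtain b1 d1 where 1: "d1 \<le> d - 1" "x \<in> cb b1 d1" using x(1) by (rule cbU_E)
    obtain b2 d2 where 2: "b + 1 \<le> b2" "x \<in> cb b2 d2" using x(2) by (rule cbU_E)
    show "x \<in> cbU (b + 1) (d - 1)"
      using cb_disjoint[OF 1(2) 2(2)] 1 2 by (intro cbU_I[of _ b1 d1]) auto
  next
    fix x assume "x \<in> cbU (b + 1) (d - 1)"
    moreover have "cbU (b + 1) (d - 1) \<subseteq> cbU b (d - 1)" "cbU (b + 1) (d - 1) \<subseteq> cbU (b + 1) d"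
      by (rule cbU_mono; simp)+
    ultimately show "x \<in> cbU b (d - 1) \<inter> cbU (b + 1) d" by blast
  qed
  have D: "(cbU b (d - 1) \<union> cbU (b + 1) d) \<inter> cb b d = {}"
  proof (rule ccontr)
    assume "\<not> ?thesis"
    then obtain x where x: "x \<in> cb b d" "x \<in> cbU b (d - 1) \<or> x \<in> cbU (b + 1) d" by blast
    then obtain b1 d1 where y: "x \<in> cb b1 d1" "d1 \<le> d - 1 \<or> b + 1 \<le> b1" by (auto elim: cbU_E)
    thus False using cb_disjoint[OF x(1) y(1)] by auto
  qed
  have "card (cbU b d) = card (cbU b (d - 1) \<union> cbU (b + 1) d) + card (cb b d)"
    unfolding U by (rule card_Un_disjoint[OF _ cb(1) D]) (simp add: cbU_finite)
  moreover have "card (cbU b (d - 1)) + card (cbU (b + 1) d) =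
      card (cbU b (d - 1) \<union> cbU (b + 1) d) + card (cbU (b + 1) (d - 1))"
    using card_Un_Int[OF cbU_finite cbU_finite] I by metis
  ultimately show ?thesis unfolding cbU_dim by linarith
qed

theorem adapted_basis:
  "\<exists>E. (\<forall>b d. E b d \<subseteq> S b d \<and> finite (E b d)) \<and>
    (\<forall>b d b' d' x. x \<in> E b d \<longrightarrow> x \<in> E b' d' \<longrightarrow> b = b' \<and> d = d') \<and>
    independent (\<Union>(b, d). E b d) \<and>
    (\<forall>b d. S b d \<subseteq> span (\<Union>(b', d')\<in>{(b', d'). b \<le> b' \<and> d' \<le> d}. E b' d')) \<and>
    (\<forall>b d. b < d \<longrightarrow> int (card (E b d)) = int (dim (S b d)) - int (dim (S b (d - 1)))
      - int (dim (S (b + 1) d)) + int (dim (S (b + 1) (d - 1))))"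
  using cb(1,2) cb_disjoint cb_independent cbU_span card_cb unfolding cbU_def
  by (intro exI[of _ cb] conjI allI impI) blast+

end

end

subsection \<open>Spaces of functions\<close>

definition scl :: "real \<Rightarrow> ('n \<Rightarrow> real) \<Rightarrow> 'n \<Rightarrow> real" where
  "scl c z = (\<lambda>a. c * z a)"

interpretation fn: vector_space "scl :: real \<Rightarrow> ('n \<Rightarrow> real) \<Rightarrow> 'n \<Rightarrow> real"
  by unfold_locales (auto simp: scl_def fun_eq_iff algebra_simps)

interpretation fn2: vector_space_pair
  "scl :: real \<Rightarrow> ('n \<Rightarrow> real) \<Rightarrow> 'n \<Rightarrow> real" "scl :: real \<Rightarrow> ('m \<Rightarrow> real) \<Rightarrow> 'm \<Rightarrow> real" ..

definition supported :: "'n set \<Rightarrow> ('n \<Rightarrow> real) set" where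
  "supported A = {z. \<forall>a. a \<notin> A \<longrightarrow> z a = 0}"

definition unit :: "'n \<Rightarrow> 'n \<Rightarrow> real" where
  "unit a = (\<lambda>b. if b = a then 1 else 0)"

lemma scl_apply [simp]: "scl c z a = c * z a"
  by (simp add: scl_def)

lemma subspace_supported: "fn.subspace (supported A)"
  by (auto simp: fn.subspace_def supported_def)

lemma sum_fun_apply: "(\<Sum>i\<in>I. F i) a = (\<Sum>i\<in>I. F i a)" for F :: "'i \<Rightarrow> 'n \<Rightarrow> real"
  by (induction I rule: infinite_finite_induct) auto

lemma supported_span_unit:
  assumes "finite A"
  shows "supported A \<subseteq> fn.span (unit ` A)"
proof
  fix z :: "'a \<Rightarrow> real" assume z: "z \<in> supported A"
  have "z = (\<Sum>a\<in>A. scl (z a) (unit a))"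
  proof
    fix b
    have "(\<Sum>a\<in>A. scl (z a) (unit a)) b = (\<Sum>a\<in>A. if b = a then z a else 0)"
      unfolding sum_fun_apply by (rule sum.cong) (auto simp: unit_def)
    also have "\<dots> = z b" using z assms by (auto simp: supported_def)
    finally show "z b = (\<Sum>a\<in>A. scl (z a) (unit a)) b" by simp
  qed
  also have "\<dots> \<in> fn.span (unit ` A)" by (intro fn.span_sum fn.span_scale fn.span_base imageI)
  finally show "z \<in> fn.span (unit ` A)" .
qed

lemma dim_supported:
  assumes "finite A"
  shows "fn.dim (supported A) = card A"
proof -
  have inj: "inj_on unit A" by (rule inj_onI) (metis unit_def zero_neq_one)
  have "fn.independent (unit ` A)"
    unfolding fn.independent_explicit_finite_subsets
  proof (intro allI impI ballI)
    fix X u x assume X: "X \<subseteq> unit ` A" "finite X" "(\<Sum>v\<in>X. scl (u v) v) = 0" "x \<in> X"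
    then obtain a where a: "x = unit a" by blast
    have v: "v a = (if v = x then 1 else 0)" if vX: "v \<in> X" for v
    proof -
      obtain c where c: "v = unit c" using vX X(1) by blast
      have "unit c = unit a \<longleftrightarrow> c = a" by (metis unit_def zero_neq_one)
      thus ?thesis unfolding c a by (auto simp: unit_def)
    qed
    have "0 = (\<Sum>v\<in>X. scl (u v) v) a" using X(3) by simp
    also have "\<dots> = (\<Sum>v\<in>X. if v = x then u v else 0)"
      unfolding sum_fun_apply by (rule sum.cong) (auto simp: v)
    also have "\<dots> = u x" using X(2,4) by simp
    finally show "u x = 0" by simp
  qed
  moreover have "unit ` A \<subseteq> supported A" by (auto simp: unit_def supported_def)
  ultimately have "fn.dim (supported A) = card (unit ` A)"
    using fn.basis_card_eq_dim supported_span_unit[OF assms] by metis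
  thus ?thesis using card_image[OF inj] by simp
qed

text \<open>Rank and nullity of the map \<open>h\<close> that sums over the fibres of the idempotent
  \<open>r\<close>. It is onto the functions on the image of \<open>r\<close>, because each of these
  is its own preimage.\<close>

lemma dim_zero_sum:
  assumes A: "finite A" and r: "\<And>a. a \<in> A \<Longrightarrow> r a \<in> A" "\<And>a. a \<in> A \<Longrightarrow> r (r a) = r a"
  shows "fn.dim {s \<in> supported A. \<forall>c\<in>r ` A. (\<Sum>a | a \<in> A \<and> r a = c. s a) = 0} + card (r ` A) = card A"
proof -
  define h where "h s = (\<lambda>c. if c \<in> r ` A then \<Sum>a | a \<in> A \<and> r a = c. s a else 0)" for s :: "'a \<Rightarrow> real"
  have lin: "Vector_Spaces.linear scl scl h"
    unfolding Vector_Spaces.linear_iff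
  proof (intro conjI allI)
    show "h (x + y) = h x + h y" for x y by (auto simp: h_def fun_eq_iff sum.distrib)
    show "h (scl c x) = scl c (h x)" for c x by (auto simp: h_def fun_eq_iff sum_distrib_left)
  qed unfold_locales
  have "h ` supported A = supported (r ` A)"
  proof
    show "h ` supported A \<subseteq> supported (r ` A)" by (auto simp: h_def supported_def)
    show "supported (r ` A) \<subseteq> h ` supported A"
    proof
      fix t :: "'a \<Rightarrow> real" assume t: "t \<in> supported (r ` A)"
      have "t c = h t c" for c
      proof (cases "c \<in> r ` A")
        case True
        hence c: "c \<in> A" "r c = c" using r by auto
        have "(\<Sum>a | a \<in> A \<and> r a = c. t a) = (\<Sum>a | a \<in> A \<and> r a = c. if a = c then t c else 0)"
        proof (rule sum.cong)
          fix a assume a: "a \<in> {a. a \<in> A \<and> r a = c}"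
          have "a \<notin> r ` A" if "a \<noteq> c" using a that r(2) by auto
          thus "t a = (if a = c then t c else 0)" using t by (auto simp: supported_def)
        qed simp
        also have "\<dots> = t c" using c A by simp
        finally show ?thesis using True by (simp add: h_def)
      qed (use t in \<open>simp add: h_def supported_def\<close>)
      moreover have "r ` A \<subseteq> A" using r(1) by blast
      hence "t \<in> supported A" using t unfolding supported_def by blast
      ultimately show "t \<in> h ` supported A" by blast
    qed
  qed
  moreover have "{s \<in> supported A. h s = 0} =
      {s \<in> supported A. \<forall>c\<in>r ` A. (\<Sum>a | a \<in> A \<and> r a = c. s a) = 0}"
    by (auto simp: h_def fun_eq_iff)
  moreover have "fn.dim (supported A) = fn.dim (h ` supported A) + fn.dim {s \<in> supported A. h s = 0}"
    by (rule fn2.rank_nullity[OF lin subspace_supported _ supported_span_unit[OF A]]) (simp add: A)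
  ultimately show ?thesis using dim_supported[OF A] dim_supported[of "r ` A"] A by simp
qed

subsection \<open>Cycles\<close>

text \<open>An odd node is regarded as an edge joining its two neighbours, which turns the zigzag into a graph;
  the 1-chains are the functions supported on the odd nodes.\<close>

definition bnd :: "'a zigzag \<Rightarrow> ('a node \<Rightarrow> real) \<Rightarrow> 'a node \<Rightarrow> real" where
  "bnd G z v = (\<Sum>x | x \<in> Lev G (fst v - 1) \<and> Up G (fst v - 1) x = snd v. z (fst v - 1, x)) -
     (\<Sum>x | x \<in> Lev G (fst v + 1) \<and> Dn G (fst v + 1) x = snd v. z (fst v + 1, x))"

definition oddn :: "'a zigzag \<Rightarrow> int \<Rightarrow> int \<Rightarrow> 'a node set" where
  "oddn G p q = {a \<in> nodes G {2 * p<..<2 * q}. odd (fst a)}"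

definition evn :: "'a zigzag \<Rightarrow> int \<Rightarrow> int \<Rightarrow> 'a node set" where
  "evn G p q = {a \<in> nodes G {2 * p..2 * q}. even (fst a)}"

definition cyc :: "'a zigzag \<Rightarrow> int \<Rightarrow> int \<Rightarrow> ('a node \<Rightarrow> real) set" where
  "cyc G p q = {z \<in> supported (oddn G p q). \<forall>v. even (fst v) \<longrightarrow> bnd G z v = 0}"

text \<open>The flux of a chain through level \<open>k\<close> within \<open>K\<close>. For a cycle
  it is conserved from one odd level to the next, see \<open>cross_step\<close>.\<close>

definition cross :: "'a zigzag \<Rightarrow> int \<Rightarrow> 'a node set \<Rightarrow> ('a node \<Rightarrow> real) \<Rightarrow> real" where
  "cross G k K z = (\<Sum>x | x \<in> Lev G k \<and> (k, x) \<in> K. z (k, x))"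

text \<open>The shape of all windows, see \<open>win_oddwin\<close>: they begin and end with an odd
  level. For \<open>p = q + 1\<close> a single odd level remains.\<close>

definition oddwin :: "int \<Rightarrow> int \<Rightarrow> int set" where
  "oddwin p q = {2 * p - 1..2 * q + 1}"

definition upn :: "'a zigzag \<Rightarrow> 'a node \<Rightarrow> 'a node" where
  "upn G a = (fst a + 1, Up G (fst a) (snd a))"

definition dnn :: "'a zigzag \<Rightarrow> 'a node \<Rightarrow> 'a node" where
  "dnn G a = (fst a - 1, Dn G (fst a) (snd a))"

lemma bnd_0 [simp]: "bnd G 0 v = 0"
  by (simp add: bnd_def)

lemma bnd_add: "bnd G (y + z) v = bnd G y v + bnd G z v"
  by (simp add: bnd_def sum.distrib)

lemma bnd_scl: "bnd G (scl c z) v = c * bnd G z v"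
  by (simp add: bnd_def sum_distrib_left right_diff_distrib)

lemma bnd_uminus: "bnd G (- z) v = - bnd G z v"
  by (simp add: bnd_def sum_negf)

lemma bnd_diff: "bnd G (y - z) v = bnd G y v - bnd G z v"
  by (simp add: bnd_def sum_subtractf)

lemma bnd_sum:
  assumes "finite I"
  shows "bnd G (\<Sum>i\<in>I. F i) v = (\<Sum>i\<in>I. bnd G (F i) v)"
  using assms
proof induction
  case empty
  show ?case unfolding sum.empty by (rule bnd_0)
next
  case (insert i I)
  show ?case unfolding sum.insert[OF insert.hyps] bnd_add insert.IH ..
qed

lemma cross_add: "cross G k K (y + z) = cross G k K y + cross G k K z"
  by (simp add: cross_def sum.distrib)

lemma cross_diff: "cross G k K (y - z) = cross G k K y - cross G k K z"
  by (simp add: cross_def sum_subtractf)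

lemma cross_scl: "cross G k K (scl c z) = c * cross G k K z"
  by (simp add: cross_def sum_distrib_left)

lemma supported_mono: "A \<subseteq> B \<Longrightarrow> supported A \<subseteq> supported B"
  by (auto simp: supported_def)

lemma oddn_mono: "p' \<le> p \<Longrightarrow> q \<le> q' \<Longrightarrow> oddn G p q \<subseteq> oddn G p' q'"
  by (auto simp: oddn_def nodes_def)

lemma subspace_cyc: "fn.subspace (cyc G p q)"
  using subspace_supported[of "oddn G p q"] unfolding fn.subspace_def cyc_def
  by (auto simp: bnd_add bnd_scl)

lemma cyc_mono: "p' \<le> p \<Longrightarrow> q \<le> q' \<Longrightarrow> cyc G p q \<subseteq> cyc G p' q'"
  unfolding cyc_def using supported_mono[OF oddn_mono] by blast

lemma cyc_Int: "cyc G p q \<inter> cyc G p' q' \<subseteq> cyc G (max p p') (min q q')"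
proof -
  have "oddn G p q \<inter> oddn G p' q' \<subseteq> oddn G (max p p') (min q q')"
    by (auto simp: oddn_def nodes_def max_def min_def)
  thus ?thesis unfolding cyc_def supported_def by blast
qed

lemma cyc_triv: "q \<le> p \<Longrightarrow> cyc G p q = {0}"
  unfolding cyc_def supported_def oddn_def nodes_def by (auto simp: fun_eq_iff)

context reeb
begin

lemma finite_nodes: "finite S \<Longrightarrow> finite (nodes G S)"
proof -
  assume "finite S"
  moreover have "nodes G S = Sigma S (Lev G)" by (auto simp: nodes_def)
  ultimately show ?thesis using finite_Lev by simp
qed

lemma finite_oddn: "finite (oddn G p q)"
  using finite_nodes[of "{2 * p<..<2 * q}"] by (simp add: oddn_def)

lemma finite_evn: "finite (evn G p q)"
  using finite_nodes[of "{2 * p..2 * q}"] by (simp add: evn_def)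

lemma finite_comps: "finite S \<Longrightarrow> finite (comps G S)"
  using finite_nodes by (simp add: comps_def)

lemma upn_dnn:
  assumes "a \<in> nodes G S" "odd (fst a)"
  shows "upn G a \<in> nodes G {fst a + 1}" "dnn G a \<in> nodes G {fst a - 1}"
    and "fst a + 1 \<in> S \<Longrightarrow> (a, upn G a) \<in> edges G S" "fst a - 1 \<in> S \<Longrightarrow> (a, dnn G a) \<in> edges G S"
  using assms Up Dn by (auto simp: upn_def dnn_def edges_def nodes_def)

lemma edges_cases:
  assumes "(a, b) \<in> edges G S"
  shows "a \<in> nodes G S \<and> odd (fst a) \<and> (b = upn G a \<or> b = dnn G a)"
  using assms by (auto simp: edges_def upn_def dnn_def)

section \<open>Flows and the dimension of the cycle spaces\<close>

lemma bnd_unit: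
  assumes a: "a \<in> nodes G S"
  shows "bnd G (unit a) v = unit (upn G a) v - unit (dnn G a) v"
proof -
  obtain k y where ky: "a = (k, y)" by (cases a)
  have y: "y \<in> Lev G k" using a ky by simp
  have 1: "(\<Sum>x | x \<in> Lev G (fst v - 1) \<and> Up G (fst v - 1) x = snd v. unit a (fst v - 1, x)) =
      unit (upn G a) v"
  proof (cases "fst v = k + 1")
    case True
    have "(\<Sum>x | x \<in> Lev G k \<and> Up G k x = snd v. unit a (k, x)) =
        (\<Sum>x | x \<in> Lev G k \<and> Up G k x = snd v. if x = y then 1 else 0)"
      by (rule sum.cong) (auto simp: unit_def ky)
    also have "\<dots> = (if Up G k y = snd v then 1 else 0)" using y finite_Lev[of k] by simp
    also have "\<dots> = unit (upn G a) v" using True by (auto simp: unit_def upn_def ky prod_eq_iff)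
    finally show ?thesis using True by simp
  next
    case False
    hence "fst v - 1 \<noteq> k" "v \<noteq> upn G a" by (auto simp: upn_def ky)
    thus ?thesis by (auto simp: unit_def ky intro!: sum.neutral)
  qed
  have 2: "(\<Sum>x | x \<in> Lev G (fst v + 1) \<and> Dn G (fst v + 1) x = snd v. unit a (fst v + 1, x)) =
      unit (dnn G a) v"
  proof (cases "fst v = k - 1")
    case True
    have "(\<Sum>x | x \<in> Lev G k \<and> Dn G k x = snd v. unit a (k, x)) =
        (\<Sum>x | x \<in> Lev G k \<and> Dn G k x = snd v. if x = y then 1 else 0)"
      by (rule sum.cong) (auto simp: unit_def ky)
    also have "\<dots> = (if Dn G k y = snd v then 1 else 0)" using y finite_Lev[of k] by simp
    also have "\<dots> = unit (dnn G a) v" using True by (auto simp: unit_def dnn_def ky prod_eq_iff)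
    finally show ?thesis using True by simp
  next
    case False
    hence "fst v + 1 \<noteq> k" "v \<noteq> dnn G a" by (auto simp: dnn_def ky)
    thus ?thesis by (auto simp: unit_def ky intro!: sum.neutral)
  qed
  show ?thesis unfolding bnd_def 1 2 ..
qed

text \<open>Slides an odd node to its lower end, so that both ends of a path become vertices of the
  graph.\<close>

definition base :: "'a node \<Rightarrow> 'a node" where
  "base a = (if even (fst a) then a else dnn G a)"

lemma unit_supported: "a \<in> A \<Longrightarrow> unit a \<in> supported A"
  by (auto simp: unit_def supported_def)

lemma flow_step:
  assumes "(a, b) \<in> edges G {2 * p..2 * q}"
  shows "\<exists>y\<in>supported (oddn G p q). \<forall>v. bnd G y v = unit (base a) v - unit (base b) v"
proof -
  note c = edges_cases[OF assms]
  have ba: "base a = dnn G a" using c by (simp add: base_def)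
  show ?thesis
  proof (cases "b = dnn G a")
    case True
    hence "base b = b" using c by (simp add: base_def dnn_def)
    hence "bnd G 0 v = unit (base a) v - unit (base b) v" for v
      unfolding bnd_0 ba True by (metis True cancel_comm_monoid_add_class.diff_cancel)
    thus ?thesis by (intro bexI[OF _ fn.subspace_0[OF subspace_supported]] allI)
  next
    case False
    hence b: "b = upn G a" using c by blast
    hence bb: "base b = b" using c by (simp add: base_def upn_def)
    have "fst a \<in> {2 * p..2 * q}" using fst_nodes[OF conjunct1[OF c]] .
    hence "2 * p \<le> fst a" "fst a \<le> 2 * q" by auto
    moreover have "fst a \<noteq> 2 * p" "fst a \<noteq> 2 * q" using c by auto
    ultimately have "a \<in> oddn G p q" using c by (auto simp: oddn_def nodes_def)
    hence "- unit a \<in> supported (oddn G p q)"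
      by (intro fn.subspace_neg[OF subspace_supported] unit_supported)
    moreover have "bnd G (- unit a) v = unit (base a) v - unit (base b) v" for v
      unfolding bnd_uminus bnd_unit[OF conjunct1[OF c]] ba bb unfolding b by (rule minus_diff_eq)
    ultimately show ?thesis by blast
  qed
qed

lemma flow_path:
  assumes "(a, b) \<in> linked G {2 * p..2 * q}"
  shows "\<exists>y\<in>supported (oddn G p q). \<forall>v. bnd G y v = unit (base a) v - unit (base b) v"
  using assms
proof (induction rule: linked_induct)
  case refl
  have "bnd G 0 v = unit (base a) v - unit (base a) v" for v
    unfolding bnd_0 by (rule cancel_comm_monoid_add_class.diff_cancel[symmetric])
  thus ?case by (intro bexI[OF _ fn.subspace_0[OF subspace_supported]] allI)
next
  case (step b c)
  obtain y where y: "y \<in> supported (oddn G p q)" "\<And>v. bnd G y v = unit (base a) v - unit (base b) v"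
    using step.IH by blast
  have "\<exists>w\<in>supported (oddn G p q). \<forall>v. bnd G w v = unit (base b) v - unit (base c) v"
  proof (cases "(b, c) \<in> edges G {2 * p..2 * q}")
    case True
    thus ?thesis by (rule flow_step)
  next
    case False
    hence "(c, b) \<in> edges G {2 * p..2 * q}" using step.hyps(2) by blast
    then obtain w where w: "w \<in> supported (oddn G p q)"
      "\<And>v. bnd G w v = unit (base c) v - unit (base b) v" using flow_step by blast
    have "- w \<in> supported (oddn G p q)" by (rule fn.subspace_neg[OF subspace_supported w(1)])
    moreover have "bnd G (- w) v = unit (base b) v - unit (base c) v" for v
      unfolding bnd_uminus w(2) by simp
    ultimately show ?thesis by blast
  qed
  then obtain w where w: "w \<in> supported (oddn G p q)"
    "\<And>v. bnd G w v = unit (base b) v - unit (base c) v" by blast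
  have "bnd G (y + w) v = unit (base a) v - unit (base c) v" for v
    unfolding bnd_add y(2) w(2) by simp
  thus ?case
    by (intro bexI[OF _ fn.subspace_add[OF subspace_supported y(1) w(1)]] allI)
qed

text \<open>A chosen even node of each component, to which all flows of this component are directed
  in \<open>flow_exists\<close>.\<close>

definition rep :: "int \<Rightarrow> int \<Rightarrow> 'a node \<Rightarrow> 'a node" where
  "rep p q a = (SOME a'. a' \<in> evn G p q \<and> a' \<in> cmp G {2 * p..2 * q} a)"

lemma rep_cong: "(a, b) \<in> linked G {2 * p..2 * q} \<Longrightarrow> rep p q a = rep p q b"
  unfolding rep_def using cmp_eq by metis

lemma rep:
  assumes "a \<in> evn G p q"
  shows "rep p q a \<in> evn G p q" "(a, rep p q a) \<in> linked G {2 * p..2 * q}" "rep p q (rep p q a) = rep p q a"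
proof -
  have "\<exists>a'. a' \<in> evn G p q \<and> a' \<in> cmp G {2 * p..2 * q} a" using assms mem_cmp by blast
  hence r: "rep p q a \<in> evn G p q \<and> rep p q a \<in> cmp G {2 * p..2 * q} a"
    unfolding rep_def by (rule someI_ex)
  thus "rep p q a \<in> evn G p q" and c: "(a, rep p q a) \<in> linked G {2 * p..2 * q}" by (auto simp: cmp_iff)
  show "rep p q (rep p q a) = rep p q a" by (rule rep_cong[OF c, symmetric])
qed

lemma rep_class:
  assumes "c \<in> rep p q ` evn G p q"
  shows "{a. a \<in> evn G p q \<and> rep p q a = c} = evn G p q \<inter> cmp G {2 * p..2 * q} c"
proof -
  obtain a where a: "a \<in> evn G p q" "c = rep p q a" using assms by blast
  have rc: "rep p q c = c" using rep(3)[OF a(1)] a(2) by simp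
  show ?thesis
  proof (intro set_eqI iffI)
    fix x assume "x \<in> {a. a \<in> evn G p q \<and> rep p q a = c}"
    hence "x \<in> evn G p q" "(c, x) \<in> linked G {2 * p..2 * q}" using rep(2)[of x p q] linked_sym by blast+
    thus "x \<in> evn G p q \<inter> cmp G {2 * p..2 * q} c" by (simp add: cmp_iff)
  next
    fix x assume "x \<in> evn G p q \<inter> cmp G {2 * p..2 * q} c"
    hence "x \<in> evn G p q" "(c, x) \<in> linked G {2 * p..2 * q}" by (simp_all add: cmp_iff)
    thus "x \<in> {a. a \<in> evn G p q \<and> rep p q a = c}" using rep_cong[of c x p q] rc by simp
  qed
qed

lemma evn_nodes: "evn G p q \<subseteq> nodes G {2 * p..2 * q}"
  by (auto simp: evn_def)

lemma zero_sum_iff: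
  "(\<forall>c\<in>rep p q ` evn G p q. (\<Sum>a | a \<in> evn G p q \<and> rep p q a = c. s a) = 0) \<longleftrightarrow>
   (\<forall>K\<in>comps G {2 * p..2 * q}. (\<Sum>a\<in>evn G p q \<inter> K. s a) = (0 :: real))" (is "?L \<longleftrightarrow> ?R")
proof
  assume L: ?L
  show ?R
  proof
    fix K assume K: "K \<in> comps G {2 * p..2 * q}"
    show "(\<Sum>a\<in>evn G p q \<inter> K. s a) = 0"
    proof (cases "evn G p q \<inter> K = {}")
      case False
      then obtain a where a: "a \<in> evn G p q" "a \<in> K" by blast
      let ?c = "rep p q a"
      have c: "?c \<in> rep p q ` evn G p q" using a by blast
      have "?c \<in> K" using comps_closed[OF K a(2) rep(2)[OF a(1)]] .
      hence Kc: "K = cmp G {2 * p..2 * q} ?c" by (rule comps_cmp[OF K])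
      have "(\<Sum>b | b \<in> evn G p q \<and> rep p q b = ?c. s b) = 0" using L c by blast
      thus ?thesis unfolding rep_class[OF c] Kc[symmetric] .
    qed simp
  qed
next
  assume R: ?R
  show ?L
  proof
    fix c assume c: "c \<in> rep p q ` evn G p q"
    have "c \<in> nodes G {2 * p..2 * q}" using c rep(1) evn_nodes by blast
    thus "(\<Sum>a | a \<in> evn G p q \<and> rep p q a = c. s a) = 0"
      unfolding rep_class[OF c] using R cmp_comps by blast
  qed
qed

text \<open>The amount \<open>s a\<close> is transported between each even node \<open>a\<close> and
  the representative of its component; nothing is left over at the representative because the
  amounts cancel.\<close>

lemma flow_exists:
  assumes s: "s \<in> supported (evn G p q)"
    and zero: "\<And>K. K \<in> comps G {2 * p..2 * q} \<Longrightarrow> (\<Sum>a\<in>evn G p q \<inter> K. s a) = 0"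
  shows "\<exists>y\<in>supported (oddn G p q). \<forall>v. bnd G y v = s v"
proof -
  let ?E = "evn G p q" and ?r = "rep p q"
  have "\<forall>a\<in>?E. \<exists>y\<in>supported (oddn G p q). \<forall>v. bnd G y v = unit a v - unit (?r a) v"
  proof
    fix a assume a: "a \<in> ?E"
    have "base a = a" "base (?r a) = ?r a" using a rep(1)[OF a] by (auto simp: base_def evn_def)
    thus "\<exists>y\<in>supported (oddn G p q). \<forall>v. bnd G y v = unit a v - unit (?r a) v"
      using flow_path[OF rep(2)[OF a]] by simp
  qed
  then obtain Y where Y: "\<And>a. a \<in> ?E \<Longrightarrow> Y a \<in> supported (oddn G p q)"
    "\<And>a v. a \<in> ?E \<Longrightarrow> bnd G (Y a) v = unit a v - unit (?r a) v" by metis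
  define y where "y = (\<Sum>a\<in>?E. scl (s a) (Y a))"
  have zs: "\<forall>c\<in>?r ` ?E. (\<Sum>a | a \<in> ?E \<and> ?r a = c. s a) = 0"
    unfolding zero_sum_iff using zero by blast
  have "bnd G y v = s v" for v
  proof -
    have "bnd G y v = (\<Sum>a\<in>?E. s a * (unit a v - unit (?r a) v))"
      unfolding y_def bnd_sum[OF finite_evn] bnd_scl by (rule sum.cong) (auto simp: Y(2))
    also have "\<dots> = (\<Sum>a\<in>?E. s a * unit a v) - (\<Sum>a\<in>?E. s a * unit (?r a) v)"
      by (simp add: right_diff_distrib sum_subtractf)
    also have "(\<Sum>a\<in>?E. s a * unit a v) = (\<Sum>a\<in>?E. if a = v then s a else 0)"
      by (rule sum.cong) (auto simp: unit_def)
    also have "\<dots> = s v"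
    proof -
      have "s v = 0" if "v \<notin> ?E" using s that unfolding supported_def by blast
      thus ?thesis using finite_evn[of p q] by simp
    qed
    also have "(\<Sum>a\<in>?E. s a * unit (?r a) v) = (\<Sum>a\<in>?E. if ?r a = v then s a else 0)"
      by (rule sum.cong) (auto simp: unit_def)
    also have "\<dots> = (\<Sum>a | a \<in> ?E \<and> ?r a = v. s a)"
      using finite_evn[of p q] by (simp add: sum.inter_filter)
    also have "\<dots> = 0"
    proof (cases "v \<in> ?r ` ?E")
      case False
      hence "{a. a \<in> ?E \<and> ?r a = v} = {}" by blast
      thus ?thesis by (simp only: sum.empty)
    qed (use zs in blast)
    finally show ?thesis by simp
  qed
  moreover have "y \<in> supported (oddn G p q)"
    unfolding y_def
    by (intro fn.subspace_sum[OF subspace_supported] fn.subspace_scale[OF subspace_supported] Y(1))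
  ultimately show ?thesis by blast
qed

lemma bnd_in_nodes:
  assumes "y \<in> supported (oddn G p q)"
  shows "bnd G y = (\<lambda>v. \<Sum>a\<in>oddn G p q. y a * (unit (upn G a) v - unit (dnn G a) v))"
proof
  fix v
  have "y = (\<Sum>a\<in>oddn G p q. scl (y a) (unit a))"
  proof
    fix b
    have "(\<Sum>a\<in>oddn G p q. scl (y a) (unit a)) b = (\<Sum>a\<in>oddn G p q. if b = a then y a else 0)"
      unfolding sum_fun_apply by (rule sum.cong) (auto simp: unit_def)
    also have "\<dots> = y b"
    proof -
      have "y b = 0" if "b \<notin> oddn G p q" using assms that unfolding supported_def by blast
      thus ?thesis using finite_oddn[of p q] by simp
    qed
    finally show "y b = (\<Sum>a\<in>oddn G p q. scl (y a) (unit a)) b" by simp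
  qed
  hence "bnd G y v = (\<Sum>a\<in>oddn G p q. y a * bnd G (unit a) v)"
    using bnd_sum[OF finite_oddn, of G "\<lambda>a. scl (y a) (unit a)" p q v] unfolding bnd_scl by simp
  also have "\<dots> = (\<Sum>a\<in>oddn G p q. y a * (unit (upn G a) v - unit (dnn G a) v))"
    by (rule sum.cong) (auto simp: bnd_unit[where S = "{2 * p<..<2 * q}"] oddn_def)
  finally show "bnd G y v = (\<Sum>a\<in>oddn G p q. y a * (unit (upn G a) v - unit (dnn G a) v))" .
qed

lemma oddn_nbrs:
  assumes "a \<in> oddn G p q"
  shows "upn G a \<in> evn G p q" "dnn G a \<in> evn G p q" "(upn G a, dnn G a) \<in> linked G {2 * p..2 * q}"
proof -
  have a: "a \<in> nodes G {2 * p..2 * q}" "odd (fst a)" "2 * p < fst a" "fst a < 2 * q"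
    using assms by (auto simp: oddn_def nodes_def)
  note u = upn_dnn[OF a(1,2)]
  have f: "fst (upn G a) = fst a + 1" "fst (dnn G a) = fst a - 1" by (simp_all add: upn_def dnn_def)
  show "upn G a \<in> evn G p q" "dnn G a \<in> evn G p q"
    using u(1,2) a f by (auto simp: evn_def nodes_def)
  have "(a, upn G a) \<in> linked G {2 * p..2 * q}" "(a, dnn G a) \<in> linked G {2 * p..2 * q}"
    using edges_linked[OF u(3)] edges_linked[OF u(4)] a(3,4) by auto
  thus "(upn G a, dnn G a) \<in> linked G {2 * p..2 * q}" using linked_sym linked_trans by metis
qed

lemma bnd_zero_sum:
  assumes y: "y \<in> supported (oddn G p q)" and K: "K \<in> comps G {2 * p..2 * q}"
  shows "(\<Sum>v\<in>evn G p q \<inter> K. bnd G y v) = 0"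
proof -
  have u: "(\<Sum>v\<in>evn G p q \<inter> K. unit w v) = (if w \<in> K then 1 else 0)" if "w \<in> evn G p q" for w
  proof -
    have "(\<Sum>v\<in>evn G p q \<inter> K. unit w v) = (\<Sum>v\<in>evn G p q \<inter> K. if v = w then 1 else 0)"
      by (rule sum.cong) (auto simp: unit_def)
    also have "\<dots> = (if w \<in> evn G p q \<inter> K then 1 else 0)" using finite_evn[of p q] by simp
    finally show ?thesis using that by simp
  qed
  have "(\<Sum>v\<in>evn G p q \<inter> K. bnd G y v) =
      (\<Sum>a\<in>oddn G p q. \<Sum>v\<in>evn G p q \<inter> K. y a * (unit (upn G a) v - unit (dnn G a) v))"
    unfolding bnd_in_nodes[OF y] by (rule sum.swap)
  also have "\<dots> = (\<Sum>a\<in>oddn G p q. 0)"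
  proof (rule sum.cong)
    fix a assume a: "a \<in> oddn G p q"
    note n = oddn_nbrs[OF a]
    have "upn G a \<in> K \<longleftrightarrow> dnn G a \<in> K"
      using comps_closed[OF K _ n(3)] comps_closed[OF K _ linked_sym[OF n(3)]] by blast
    thus "(\<Sum>v\<in>evn G p q \<inter> K. y a * (unit (upn G a) v - unit (dnn G a) v)) = 0"
      using u[OF n(1)] u[OF n(2)] by (simp add: sum_distrib_left[symmetric] sum_subtractf)
  qed simp
  finally show ?thesis by simp
qed

lemma bnd_supported:
  assumes "y \<in> supported (oddn G p q)"
  shows "bnd G y \<in> supported (evn G p q)"
  unfolding supported_def
proof (intro CollectI allI impI)
  fix v assume "v \<notin> evn G p q"
  hence "unit (upn G a) v = 0 \<and> unit (dnn G a) v = 0" if "a \<in> oddn G p q" for a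
    using oddn_nbrs[OF that] by (auto simp: unit_def)
  thus "bnd G y v = 0" unfolding bnd_in_nodes[OF assms] by simp
qed

text \<open>The boundary of such a chain vanishes at odd nodes anyway, so the cycles are the kernel
  of the linear map \<open>bnd G\<close>.\<close>

lemma cyc_alt: "cyc G p q = {z \<in> supported (oddn G p q). bnd G z = 0}"
proof -
  have "bnd G z = 0 \<longleftrightarrow> (\<forall>v. even (fst v) \<longrightarrow> bnd G z v = 0)" if "z \<in> supported (oddn G p q)" for z
    using bnd_supported[OF that] by (auto simp: supported_def evn_def fun_eq_iff)
  thus ?thesis unfolding cyc_def by blast
qed

lemma card_reps:
  "p \<le> q \<Longrightarrow> card (rep p q ` evn G p q) = card (comps G {2 * p..2 * q})"
proof (rule bij_betw_same_card[of "cmp G {2 * p..2 * q}"], rule bij_betwI')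
  fix c c' assume c: "c \<in> rep p q ` evn G p q" "c' \<in> rep p q ` evn G p q"
  show "cmp G {2 * p..2 * q} c = cmp G {2 * p..2 * q} c' \<longleftrightarrow> c = c'"
  proof
    assume "cmp G {2 * p..2 * q} c = cmp G {2 * p..2 * q} c'"
    hence "(c, c') \<in> linked G {2 * p..2 * q}" using mem_cmp cmp_iff by metis
    hence "rep p q c = rep p q c'" by (rule rep_cong)
    thus "c = c'" using c rep(3) by auto
  qed simp
next
  fix c assume "c \<in> rep p q ` evn G p q"
  hence "c \<in> nodes G {2 * p..2 * q}" using rep(1) evn_nodes by blast
  thus "cmp G {2 * p..2 * q} c \<in> comps G {2 * p..2 * q}" by (rule cmp_comps)
next
  fix K assume K: "K \<in> comps G {2 * p..2 * q}"
  obtain a where a: "a \<in> K" using comps_nonempty[OF K] by blast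
  have an: "a \<in> nodes G {2 * p..2 * q}" using comps_sub[OF K] a by blast
  have "\<exists>b\<in>evn G p q. b \<in> K"
  proof (cases "even (fst a)")
    case True
    hence "a \<in> evn G p q" using an by (simp add: evn_def)
    thus ?thesis using a by blast
  next
    case False
    have "2 * p \<le> fst a" "fst a \<le> 2 * q" using fst_nodes[OF an] by simp_all
    moreover have "fst a \<noteq> 2 * p" "fst a \<noteq> 2 * q" using False by auto
    ultimately have "a \<in> oddn G p q" using an False by (auto simp: oddn_def nodes_def)
    moreover have "fst a + 1 \<in> {2 * p..2 * q}"
      using \<open>2 * p \<le> fst a\<close> \<open>fst a \<le> 2 * q\<close> \<open>fst a \<noteq> 2 * q\<close> by simp
    ultimately show ?thesis
      using oddn_nbrs(1) comps_closed[OF K a edges_linked[OF upn_dnn(3)[OF an False]]] by blast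
  qed
  then obtain b where b: "b \<in> evn G p q" "b \<in> K" by blast
  have "rep p q b \<in> K" using comps_closed[OF K b(2) rep(2)[OF b(1)]] .
  hence "K = cmp G {2 * p..2 * q} (rep p q b)" by (rule comps_cmp[OF K])
  thus "\<exists>c\<in>rep p q ` evn G p q. K = cmp G {2 * p..2 * q} c" using b(1) by blast
qed

text \<open>Euler's formula for the finite graph between the levels \<open>2 * p\<close> and
  \<open>2 * q\<close>, written without subtraction.\<close>

theorem dim_cyc:
  assumes "p \<le> q"
  shows "fn.dim (cyc G p q) + card (evn G p q) = card (oddn G p q) + card (comps G {2 * p..2 * q})"
proof -
  have lin: "Vector_Spaces.linear scl scl (bnd G)"
    unfolding Vector_Spaces.linear_iff
    by (intro conjI allI) (unfold_locales, auto simp: bnd_add bnd_scl fun_eq_iff)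
  have "bnd G ` supported (oddn G p q) =
    {s \<in> supported (evn G p q). \<forall>c\<in>rep p q ` evn G p q. (\<Sum>a | a \<in> evn G p q \<and> rep p q a = c. s a) = 0}"
    unfolding zero_sum_iff
  proof (intro set_eqI iffI)
    fix s assume "s \<in> {s \<in> supported (evn G p q).
      \<forall>K\<in>comps G {2 * p..2 * q}. (\<Sum>a\<in>evn G p q \<inter> K. s a) = 0}"
    then obtain y where "y \<in> supported (oddn G p q)" "\<And>v. bnd G y v = s v" using flow_exists by blast
    hence "bnd G y = s" by blast
    thus "s \<in> bnd G ` supported (oddn G p q)" using \<open>y \<in> _\<close> by blast
  qed (use bnd_supported bnd_zero_sum in auto)
  moreover have "fn.dim (supported (oddn G p q)) =
      fn.dim (bnd G ` supported (oddn G p q)) + fn.dim {z \<in> supported (oddn G p q). bnd G z = 0}"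
    by (rule fn2.rank_nullity[OF lin subspace_supported _ supported_span_unit[OF finite_oddn]])
      (simp add: finite_oddn)
  moreover have "fn.dim {s \<in> supported (evn G p q). \<forall>c\<in>rep p q ` evn G p q.
      (\<Sum>a | a \<in> evn G p q \<and> rep p q a = c. s a) = 0} + card (rep p q ` evn G p q) = card (evn G p q)"
    by (rule dim_zero_sum[OF finite_evn]) (auto intro: rep)
  ultimately show ?thesis
    using dim_supported[OF finite_oddn, of p q] card_reps[OF assms] unfolding cyc_alt by simp
qed

end

section \<open>Crossing numbers\<close>

lemma cross_sum:
  assumes "finite I"
  shows "cross G k K (\<Sum>i\<in>I. F i) = (\<Sum>i\<in>I. cross G k K (F i))"
  using assms
proof induction
  case empty
  show ?case unfolding sum.empty by (simp add: cross_def)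
next
  case (insert i I)
  show ?case unfolding sum.insert[OF insert.hyps] cross_add insert.IH ..
qed

lemma cross_eq_0: "z \<in> supported A \<Longrightarrow> (\<And>a. a \<in> A \<Longrightarrow> fst a \<noteq> k) \<Longrightarrow> cross G k K z = 0"
  unfolding cross_def supported_def by (rule sum.neutral) force

context reeb
begin

lemma cross_unit:
  assumes "a \<in> nodes G S"
  shows "cross G k K (unit a) = (if fst a = k \<and> a \<in> K then 1 else 0)"
proof (cases "fst a = k")
  case True
  then obtain y where y: "a = (k, y)" "y \<in> Lev G k" using assms by (cases a) auto
  have "cross G k K (unit a) = (\<Sum>x | x \<in> Lev G k \<and> (k, x) \<in> K. if x = y then 1 else 0)"
    unfolding cross_def by (rule sum.cong) (auto simp: unit_def y)
  also have "\<dots> = (if a \<in> K then 1 else 0)" using y finite_Lev[of k] by simp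
  finally show ?thesis using True by simp
next
  case False
  have "cross G k K (unit a) = 0"
    by (rule cross_eq_0[OF unit_supported[of a "{a}"]]) (use False in auto)
  thus ?thesis using False by simp
qed

text \<open>Conservation of flux: edges of \<open>K\<close> at the levels \<open>k\<close> and
  \<open>k + 2\<close> end at nodes of \<open>K\<close> at level \<open>k + 1\<close>, and grouping
  them by these nodes produces the boundary.\<close>

lemma cross_step:
  assumes K: "K \<in> comps G S" and k: "odd k" "k \<in> S" "k + 1 \<in> S" "k + 2 \<in> S"
  shows "cross G k K z - cross G (k + 2) K z =
    (\<Sum>y | y \<in> Lev G (k + 1) \<and> (k + 1, y) \<in> K. bnd G z (k + 1, y))"
proof -
  let ?B = "{y. y \<in> Lev G (k + 1) \<and> (k + 1, y) \<in> K}"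
  let ?A = "{x. x \<in> Lev G k \<and> (k, x) \<in> K}" and ?C = "{x. x \<in> Lev G (k + 2) \<and> (k + 2, x) \<in> K}"
  have up: "(k, x) \<in> K \<longleftrightarrow> (k + 1, Up G k x) \<in> K" if "x \<in> Lev G k" for x
  proof -
    have "((k, x), (k + 1, Up G k x)) \<in> edges G S" using that k by (auto simp: edges_def)
    thus ?thesis using comps_closed[OF K] edges_linked linked_sym by blast
  qed
  have dn: "(k + 2, x) \<in> K \<longleftrightarrow> (k + 1, Dn G (k + 2) x) \<in> K" if "x \<in> Lev G (k + 2)" for x
  proof -
    have "((k + 2, x), (k + 1, Dn G (k + 2) x)) \<in> edges G S"
      using that k upn_dnn(4)[of "(k + 2, x)" S] by (simp add: dnn_def add.commute[of k])
    thus ?thesis using comps_closed[OF K] edges_linked linked_sym by blast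
  qed
  have fin: "finite ?A" "finite ?B" "finite ?C" using finite_Lev by auto
  have UA: "Up G k ` ?A \<subseteq> ?B" using up Up[OF k(1)] by auto
  have DC: "Dn G (k + 2) ` ?C \<subseteq> ?B" using dn Dn[of "k + 2"] k(1) by (auto simp: add.commute[of k])
  have "(\<Sum>y\<in>?B. \<Sum>x | x \<in> Lev G k \<and> Up G k x = y. z (k, x)) =
      (\<Sum>y\<in>?B. \<Sum>x | x \<in> ?A \<and> Up G k x = y. z (k, x))"
    by (intro sum.cong refl) (use up in auto)
  also have "\<dots> = cross G k K z" unfolding cross_def by (rule sum.group[OF fin(1,2) UA])
  finally have 1: "(\<Sum>y\<in>?B. \<Sum>x | x \<in> Lev G k \<and> Up G k x = y. z (k, x)) = cross G k K z" .
  have "(\<Sum>y\<in>?B. \<Sum>x | x \<in> Lev G (k + 2) \<and> Dn G (k + 2) x = y. z (k + 2, x)) =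
      (\<Sum>y\<in>?B. \<Sum>x | x \<in> ?C \<and> Dn G (k + 2) x = y. z (k + 2, x))"
    by (intro sum.cong refl) (use dn in auto)
  also have "\<dots> = cross G (k + 2) K z" unfolding cross_def by (rule sum.group[OF fin(3,2) DC])
  finally have 2: "(\<Sum>y\<in>?B. \<Sum>x | x \<in> Lev G (k + 2) \<and> Dn G (k + 2) x = y. z (k + 2, x)) =
    cross G (k + 2) K z" .
  have k2: "k + 1 + 1 = k + 2" by simp
  show ?thesis unfolding bnd_def fst_conv snd_conv add_diff_cancel_right' k2 sum_subtractf 1 2 ..
qed

lemma cross_telescope:
  assumes K: "K \<in> comps G (oddwin p q)" and r: "p - 1 \<le> r" "r \<le> q"
  shows "cross G (2 * p - 1) K z - cross G (2 * r + 1) K z = (\<Sum>a\<in>evn G p r \<inter> K. bnd G z a)"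
  using r
proof (induction r rule: int_ge_induct)
  case base
  have "evn G p (p - 1) = {}" by (auto simp: evn_def nodes_def)
  moreover have "2 * (p - 1) + 1 = 2 * p - 1" by simp
  ultimately show ?case by simp
next
  case (step r)
  let ?B = "{y. y \<in> Lev G (2 * r + 2) \<and> (2 * r + 2, y) \<in> K}"
  have e: "evn G p (r + 1) \<inter> K = (evn G p r \<inter> K) \<union> Pair (2 * r + 2) ` ?B"
  proof (intro set_eqI iffI)
    fix a assume a: "a \<in> evn G p (r + 1) \<inter> K"
    show "a \<in> (evn G p r \<inter> K) \<union> Pair (2 * r + 2) ` ?B"
    proof (cases "fst a = 2 * r + 2")
      case True
      hence "a = (2 * r + 2, snd a)" by (metis prod.collapse)
      thus ?thesis using a by (auto simp: evn_def nodes_def)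
    next
      case False
      have "even (fst a)" "fst a \<le> 2 * (r + 1)" using a by (auto simp: evn_def nodes_def)
      hence "fst a \<le> 2 * r" using False by presburger
      thus ?thesis using a by (auto simp: evn_def nodes_def)
    qed
  qed (use step.hyps in \<open>auto simp: evn_def nodes_def\<close>)
  have d: "(evn G p r \<inter> K) \<inter> Pair (2 * r + 2) ` ?B = {}" by (auto simp: evn_def nodes_def)
  have f: "finite (evn G p r \<inter> K)" "finite (Pair (2 * r + 2) ` ?B)" using finite_evn finite_Lev by auto
  have "(\<Sum>a\<in>evn G p (r + 1) \<inter> K. bnd G z a) =
      (\<Sum>a\<in>evn G p r \<inter> K. bnd G z a) + (\<Sum>a\<in>Pair (2 * r + 2) ` ?B. bnd G z a)"
    unfolding e by (rule sum.union_disjoint[OF f d])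
  also have "(\<Sum>a\<in>Pair (2 * r + 2) ` ?B. bnd G z a) = (\<Sum>y\<in>?B. bnd G z (2 * r + 2, y))"
    by (subst sum.reindex) (auto simp: inj_on_def)
  also have "\<dots> = cross G (2 * r + 1) K z - cross G (2 * (r + 1) + 1) K z"
    using cross_step[OF K, of "2 * r + 1" z] step.hyps step.prems
    by (simp add: oddwin_def algebra_simps)
  finally show ?case using step.IH step.prems by simp
qed

text \<open>The two odd end levels are leaf levels and are removed one after the other.\<close>

lemma even_part:
  assumes pq: "p \<le> q" and K: "K \<in> comps G (oddwin p q)"
  shows "K \<inter> nodes G {2 * p..2 * q} \<in> comps G {2 * p..2 * q}"
proof -
  have i1: "insert (2 * q + 1) {2 * p - 1..2 * q} = oddwin p q" using pq by (auto simp: oddwin_def)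
  have i2: "insert (2 * p - 1) {2 * p..2 * q} = {2 * p - 1..2 * q}" using pq by auto
  obtain a where a: "a \<in> K" using comps_nonempty[OF K] by blast
  have an: "a \<in> nodes G (oddwin p q)" using comps_sub[OF K] a by blast
  have "\<exists>b\<in>K. b \<in> nodes G {2 * p..2 * q}"
  proof (cases "fst a \<in> {2 * p..2 * q}")
    case True
    thus ?thesis using a an by (intro bexI[of _ a]) (auto simp: nodes_def)
  next
    case False
    hence "fst a = 2 * p - 1 \<or> fst a = 2 * q + 1" using fst_nodes[OF an] by (auto simp: oddwin_def)
    thus ?thesis
    proof
      assume f: "fst a = 2 * p - 1"
      hence o: "odd (fst a)" by simp
      have "upn G a \<in> K"
        using comps_closed[OF K a edges_linked[OF upn_dnn(3)[OF an o]]] f pq by (simp add: oddwin_def)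
      moreover have "upn G a \<in> nodes G {2 * p..2 * q}"
        using upn_dnn(1)[OF an o] f pq nodes_mono[of "{fst a + 1}" "{2 * p..2 * q}" G] by auto
      ultimately show ?thesis by blast
    next
      assume f: "fst a = 2 * q + 1"
      hence o: "odd (fst a)" by simp
      have "dnn G a \<in> K"
        using comps_closed[OF K a edges_linked[OF upn_dnn(4)[OF an o]]] f pq by (simp add: oddwin_def)
      moreover have "dnn G a \<in> nodes G {2 * p..2 * q}"
        using upn_dnn(2)[OF an o] f pq nodes_mono[of "{fst a - 1}" "{2 * p..2 * q}" G] by auto
      ultimately show ?thesis by blast
    qed
  qed
  then obtain b where b: "b \<in> K" "b \<in> nodes G {2 * p..2 * q}" by blast
  have sub: "nodes G {2 * p..2 * q} \<subseteq> nodes G {2 * p - 1..2 * q}" by (rule nodes_mono) auto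
  let ?K = "K \<inter> nodes G {2 * p - 1..2 * q}"
  have "?K \<in> comps G {2 * p - 1..2 * q}"
    using comps_leaf[of "2 * q + 1" "{2 * p - 1..2 * q}" K] K b sub unfolding i1 by auto
  hence "?K \<inter> nodes G {2 * p..2 * q} \<in> comps G {2 * p..2 * q}"
    using comps_leaf[of "2 * p - 1" "{2 * p..2 * q}" ?K] b sub unfolding i2 by auto
  moreover have "?K \<inter> nodes G {2 * p..2 * q} = K \<inter> nodes G {2 * p..2 * q}" using sub by blast
  ultimately show ?thesis by simp
qed

lemma even_part_ext:
  assumes pq: "p \<le> q" and K: "K \<in> comps G {2 * p..2 * q}"
  shows "ext G (oddwin p q) K \<inter> nodes G {2 * p..2 * q} = K" "ext G (oddwin p q) K \<in> comps G (oddwin p q)"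
proof -
  have "{2 * p..2 * q} \<subseteq> oddwin p q" by (auto simp: oddwin_def)
  note e = ext[OF K this]
  show "ext G (oddwin p q) K \<in> comps G (oddwin p q)" by (rule e(1))
  obtain a where a: "a \<in> K" using comps_nonempty[OF K] by blast
  hence a': "a \<in> ext G (oddwin p q) K \<inter> nodes G {2 * p..2 * q}" using e(2) comps_sub[OF K] by blast
  show "ext G (oddwin p q) K \<inter> nodes G {2 * p..2 * q} = K"
    using comps_eqI[OF even_part[OF pq e(1)] K a' a] .
qed

text \<open>A Mayer-Vietoris argument. Cut \<open>z\<close> above level \<open>2 * p - 1\<close>:
  the lower part \<open>zl\<close> has boundary only at level \<open>2 * p\<close>, with total zero
  on each component of the window because the crossing numbers vanish. So a chain \<open>y\<close>
  inside the window has the same boundary, and \<open>zl - y\<close> and its complement in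
  \<open>z\<close> are the two cycles.\<close>

lemma crossing_kernel:
  assumes z: "z \<in> cyc G b d" and pq: "p \<le> q + 1"
    and zero: "\<And>K. K \<in> comps G (oddwin p q) \<Longrightarrow> cross G (2 * p - 1) K z = 0"
  shows "\<exists>z1\<in>cyc G (min b p) q. \<exists>z2\<in>cyc G p (max d q). z = z1 + z2"
proof -
  define zl where "zl a = (if fst a \<le> 2 * p - 1 then z a else 0)" for a
  have zs: "z \<in> supported (oddn G b d)" "\<And>v. even (fst v) \<Longrightarrow> bnd G z v = 0"
    using z unfolding cyc_def by blast+
  \<comment> \<open>For \<open>p = q + 1\<close> the window is a single odd level, its components
    are single nodes, and \<open>z\<close> itself vanishes on them.\<close>
  have top: "z a = 0" if "p = q + 1" "fst a = 2 * p - 1" for a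
  proof (rule ccontr)
    assume nz: "z a \<noteq> 0"
    hence "a \<in> oddn G b d" using zs(1) unfolding supported_def by blast
    hence a: "a \<in> nodes G (oddwin p q)" "snd a \<in> Lev G (2 * p - 1)"
      using that by (auto simp: oddn_def nodes_def oddwin_def)
    have w: "oddwin p q = {2 * p - 1}" using that(1) by (auto simp: oddwin_def)
    have "cmp G (oddwin p q) a = {a}"
    proof -
      have "b = a" if "(a, b) \<in> linked G (oddwin p q)" for b
        using that by (induction rule: linked_induct) (auto simp: w edges_def)
      thus ?thesis by (auto simp: cmp_iff)
    qed
    hence "{a} \<in> comps G (oddwin p q)" using cmp_comps[OF a(1)] by simp
    hence "cross G (2 * p - 1) {a} z = 0" by (rule zero)
    moreover have "{x. x \<in> Lev G (2 * p - 1) \<and> (2 * p - 1, x) \<in> {a}} = {snd a}"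
      using a(2) that(2) by (auto simp: prod_eq_iff)
    hence "cross G (2 * p - 1) {a} z = z (2 * p - 1, snd a)" unfolding cross_def by simp
    ultimately have "z (2 * p - 1, snd a) = 0" by simp
    thus False using nz that(2) by (metis prod.collapse)
  qed
  have bl: "bnd G zl v = (if fst v = 2 * p then
      \<Sum>x | x \<in> Lev G (2 * p - 1) \<and> Up G (2 * p - 1) x = snd v. z (2 * p - 1, x) else 0)"
    if "even (fst v)" for v
  proof -
    obtain i where "fst v = 2 * i" using \<open>even (fst v)\<close> by (rule evenE)
    hence "fst v \<le> 2 * p - 2 \<or> fst v = 2 * p \<or> fst v \<ge> 2 * p + 2"
      by (cases i p rule: linorder_cases) auto
    then consider "fst v \<le> 2 * p - 2" | "fst v = 2 * p" | "fst v \<ge> 2 * p + 2" by blast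
    thus ?thesis
    proof cases
      case 1
      have "bnd G zl v = bnd G z v" using 1 unfolding bnd_def zl_def by simp
      thus ?thesis using zs(2)[OF that] 1 by simp
    qed (simp_all add: bnd_def zl_def)
  qed
  have "\<exists>y\<in>supported (oddn G p q). \<forall>v. even (fst v) \<longrightarrow> bnd G y v = bnd G zl v"
  proof (cases "p = q + 1")
    case True
    have "bnd G zl v = bnd G 0 v" if "even (fst v)" for v
      unfolding bl[OF that] bnd_0 using top[OF True] by (auto intro!: sum.neutral)
    thus ?thesis by (intro bexI[OF _ fn.subspace_0[OF subspace_supported]]) simp
  next
    case False
    hence pq': "p \<le> q" using pq by simp
    define s where "s v = (if even (fst v) then bnd G zl v else 0)" for v
    have "s \<in> supported (evn G p q)"
      unfolding supported_def
    proof (intro CollectI allI impI)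
      fix v assume v: "v \<notin> evn G p q"
      show "s v = 0"
      proof (rule ccontr)
        assume nz: "s v \<noteq> 0"
        hence ev: "even (fst v)" and nb: "bnd G zl v \<noteq> 0" by (auto simp: s_def split: if_splits)
        hence f: "fst v = 2 * p" using bl[OF ev] by (auto split: if_splits)
        have "{x. x \<in> Lev G (2 * p - 1) \<and> Up G (2 * p - 1) x = snd v} \<noteq> {}"
        proof
          assume "{x. x \<in> Lev G (2 * p - 1) \<and> Up G (2 * p - 1) x = snd v} = {}"
          thus False using nb bl[OF ev] f by (simp only: sum.empty if_cancel simp_thms)
        qed
        then obtain x where "x \<in> Lev G (2 * p - 1)" "Up G (2 * p - 1) x = snd v" by blast
        hence "snd v \<in> Lev G (2 * p)" using Up[of "2 * p - 1" x] by simp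
        hence "v \<in> evn G p q" using f pq' by (auto simp: evn_def nodes_def case_prod_beta)
        thus False using v by blast
      qed
    qed
    moreover have "(\<Sum>a\<in>evn G p q \<inter> K. s a) = 0" if K: "K \<in> comps G {2 * p..2 * q}" for K
    proof -
      let ?K = "ext G (oddwin p q) K"
      note e = even_part_ext[OF pq' K]
      let ?B = "{y. y \<in> Lev G (2 * p) \<and> (2 * p, y) \<in> K}"
      let ?A = "{x. x \<in> Lev G (2 * p - 1) \<and> (2 * p - 1, x) \<in> ?K}"
      have up: "(2 * p - 1, x) \<in> ?K \<longleftrightarrow> (2 * p, Up G (2 * p - 1) x) \<in> K"
        if x: "x \<in> Lev G (2 * p - 1)" for x
      proof -
        have s: "((2 * p - 1, x), (2 * p, Up G (2 * p - 1) x)) \<in> edges G (oddwin p q)"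
          using x pq' unfolding edges_def oddwin_def by force
        have n: "(2 * p, Up G (2 * p - 1) x) \<in> nodes G {2 * p..2 * q}"
          using Up[of "2 * p - 1" x] x pq' by simp
        have "(2 * p - 1, x) \<in> ?K \<longleftrightarrow> (2 * p, Up G (2 * p - 1) x) \<in> ?K"
          using comps_closed[OF e(2)] edges_linked[OF s] linked_sym by blast
        thus ?thesis using n e(1) by blast
      qed
      have UA: "Up G (2 * p - 1) ` ?A \<subseteq> ?B" using up Up[of "2 * p - 1"] by auto
      have fin: "finite ?A" "finite ?B" using finite_Lev by auto
      have "(\<Sum>a\<in>evn G p q \<inter> K. s a) = (\<Sum>a\<in>Pair (2 * p) ` ?B. s a)"
      proof (rule sum.mono_neutral_right)
        show "finite (evn G p q \<inter> K)" using finite_evn by blast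
        show "Pair (2 * p) ` ?B \<subseteq> evn G p q \<inter> K" using pq' by (auto simp: evn_def)
        show "\<forall>a\<in>evn G p q \<inter> K - Pair (2 * p) ` ?B. s a = 0"
        proof
          fix a assume a: "a \<in> evn G p q \<inter> K - Pair (2 * p) ` ?B"
          have "fst a \<noteq> 2 * p"
          proof
            assume f: "fst a = 2 * p"
            hence "a = (2 * p, snd a)" by (metis prod.collapse)
            thus False using a by (auto simp: evn_def nodes_def)
          qed
          thus "s a = 0" by (simp add: s_def bl)
        qed
      qed
      also have "\<dots> = (\<Sum>y\<in>?B. s (2 * p, y))" by (subst sum.reindex) (auto simp: inj_on_def)
      also have "\<dots> = (\<Sum>y\<in>?B. \<Sum>x | x \<in> ?A \<and> Up G (2 * p - 1) x = y. z (2 * p - 1, x))"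
      proof (rule sum.cong[OF refl])
        fix y assume y: "y \<in> ?B"
        have "s (2 * p, y) = (\<Sum>x | x \<in> Lev G (2 * p - 1) \<and> Up G (2 * p - 1) x = y. z (2 * p - 1, x))"
          unfolding s_def by (simp add: bl)
        also have "{x. x \<in> Lev G (2 * p - 1) \<and> Up G (2 * p - 1) x = y} =
            {x. x \<in> ?A \<and> Up G (2 * p - 1) x = y}" using up y by auto
        finally show "s (2 * p, y) = (\<Sum>x | x \<in> ?A \<and> Up G (2 * p - 1) x = y. z (2 * p - 1, x))" .
      qed
      also have "\<dots> = cross G (2 * p - 1) ?K z"
        unfolding cross_def by (rule sum.group[OF fin UA])
      also have "\<dots> = 0" by (rule zero[OF e(2)])
      finally show ?thesis .
    qed
    ultimately obtain y where "y \<in> supported (oddn G p q)" "\<And>v. bnd G y v = s v"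
      using flow_exists by blast
    thus ?thesis by (intro bexI[of _ y]) (auto simp: s_def)
  qed
  then obtain y where y: "y \<in> supported (oddn G p q)" "\<And>v. even (fst v) \<Longrightarrow> bnd G y v = bnd G zl v"
    by blast
  have y0: "y a = 0" if "a \<notin> oddn G p q" for a using y(1) that unfolding supported_def by blast
  have z0: "z a = 0" if "a \<notin> oddn G b d" for a using zs(1) that unfolding supported_def by blast
  have "zl - y \<in> cyc G (min b p) q"
    unfolding cyc_def
  proof (intro CollectI conjI allI impI)
    show "zl - y \<in> supported (oddn G (min b p) q)"
      unfolding supported_def
    proof (intro CollectI allI impI)
      fix a assume a: "a \<notin> oddn G (min b p) q"
      have "a \<notin> oddn G p q" using a oddn_mono[of "min b p" p q q G] by auto
      hence "y a = 0" by (rule y0)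
      moreover have "zl a = 0"
      proof (rule ccontr)
        assume nz: "zl a \<noteq> 0"
        hence f: "fst a \<le> 2 * p - 1" "z a \<noteq> 0" by (auto simp: zl_def split: if_splits)
        hence o: "a \<in> oddn G b d" using z0 by blast
        have "p = q + 1 \<Longrightarrow> fst a \<noteq> 2 * p - 1" using top f(2) by blast
        hence "fst a < 2 * q"
          using f(1) pq o by (cases "p = q + 1") (auto simp: oddn_def, presburger?)
        thus False using a o by (auto simp: oddn_def nodes_def)
      qed
      ultimately show "(zl - y) a = 0" by simp
    qed
    fix v :: "'a node" assume "even (fst v)"
    thus "bnd G (zl - y) v = 0" unfolding bnd_diff using y(2) by simp
  qed
  moreover have "z - (zl - y) \<in> cyc G p (max d q)"
    unfolding cyc_def
  proof (intro CollectI conjI allI impI)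
    show "z - (zl - y) \<in> supported (oddn G p (max d q))"
      unfolding supported_def
    proof (intro CollectI allI impI)
      fix a assume a: "a \<notin> oddn G p (max d q)"
      have "a \<notin> oddn G p q" using a oddn_mono[of p p q "max d q" G] by auto
      hence "y a = 0" by (rule y0)
      moreover have "z a = zl a"
      proof (rule ccontr)
        assume ne: "z a \<noteq> zl a"
        hence "2 * p - 1 < fst a" "z a \<noteq> 0" by (auto simp: zl_def split: if_splits)
        moreover have "a \<in> oddn G b d" using z0 calculation(2) by blast
        ultimately show False using a unfolding oddn_def nodes_def
          by (cases "fst a = 2 * p") auto
      qed
      ultimately show "(z - (zl - y)) a = 0" by simp
    qed
    fix v :: "'a node" assume v: "even (fst v)"
    show "bnd G (z - (zl - y)) v = 0" unfolding bnd_diff using y(2)[OF v] zs(2)[OF v] by simp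
  qed
  moreover have "z = (zl - y) + (z - (zl - y))" by simp
  ultimately show ?thesis by blast
qed

end

text \<open>For a cycle, all odd levels of the window yield the same number.\<close>

definition crossw :: "'a zigzag \<Rightarrow> real \<times> real \<Rightarrow> 'a node set \<Rightarrow> ('a node \<Rightarrow> real) \<Rightarrow> real" where
  "crossw G u K z = cross G (2 * \<lceil>fst u\<rceil> - 1) K z"

lemma win_oddwin: "win u = oddwin \<lceil>fst u\<rceil> \<lfloor>snd u\<rfloor>"
proof -
  have "n \<in> win u \<longleftrightarrow> \<lceil>fst u\<rceil> \<le> (n + 1) div 2 \<and> n div 2 \<le> \<lfloor>snd u\<rfloor>" for n
    by (simp add: win_def ceiling_le_iff le_floor_iff)
  moreover have "\<lceil>fst u\<rceil> \<le> (n + 1) div 2 \<longleftrightarrow> 2 * \<lceil>fst u\<rceil> - 1 \<le> n"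
    "n div 2 \<le> \<lfloor>snd u\<rfloor> \<longleftrightarrow> n \<le> 2 * \<lfloor>snd u\<rfloor> + 1" for n
    by presburger+
  ultimately show ?thesis by (auto simp: oddwin_def)
qed

lemma UU_ceiling_floor:
  assumes "u \<in> UU"
  shows "\<lceil>fst u\<rceil> \<le> \<lfloor>snd u\<rfloor> + 1"
proof -
  have "fst u \<le> snd u" using assms by (auto simp: UU_def)
  also have "snd u \<le> real_of_int (\<lfloor>snd u\<rfloor> + 1)" by linarith
  finally show ?thesis by (simp only: ceiling_le_iff)
qed

context reeb
begin

text \<open>\<open>flow_exists\<close> for masses \<open>c K\<close> placed at nodes
  \<open>w K\<close>. The link from \<open>e K\<close> to \<open>w K\<close> translates the zero-sum
  condition into one about the components \<open>K\<close> of the smaller window.\<close>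

lemma src_flow:
  assumes pq1: "p1 \<le> q1" and sub: "oddwin p q \<subseteq> oddwin p1 q1" and C: "finite C"
    and w: "\<And>K. K \<in> C \<Longrightarrow> K \<in> comps G (oddwin p q)" "\<And>K. K \<in> C \<Longrightarrow> w K \<in> evn G p1 q1"
      "\<And>K. K \<in> C \<Longrightarrow> e K \<in> K" "\<And>K. K \<in> C \<Longrightarrow> (e K, w K) \<in> linked G (oddwin p1 q1)"
    and zero: "\<And>K'. K' \<in> comps G (oddwin p1 q1) \<Longrightarrow> (\<Sum>K | K \<in> C \<and> K \<subseteq> K'. c K) = 0"
  shows "\<exists>y\<in>supported (oddn G p1 q1). \<forall>v. bnd G y v = (\<Sum>K\<in>C. c K * unit (w K) v)"
proof (rule flow_exists)
  show "(\<lambda>v. \<Sum>K\<in>C. c K * unit (w K) v) \<in> supported (evn G p1 q1)"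
    unfolding supported_def
  proof (intro CollectI allI impI)
    fix v assume v: "v \<notin> evn G p1 q1"
    have "unit (w K) v = 0" if "K \<in> C" for K using w(2)[OF that] v by (auto simp: unit_def)
    thus "(\<Sum>K\<in>C. c K * unit (w K) v) = 0" by simp
  qed
next
  fix K0 assume K0: "K0 \<in> comps G {2 * p1..2 * q1}"
  let ?K = "ext G (oddwin p1 q1) K0"
  note ep = even_part_ext[OF pq1 K0]
  have iff: "w K \<in> K0 \<longleftrightarrow> K \<subseteq> ?K" if K: "K \<in> C" for K
  proof
    assume "w K \<in> K0"
    hence "w K \<in> ?K" using ep(1) by blast
    hence "e K \<in> ?K" using comps_closed[OF ep(2)] linked_sym[OF w(4)[OF K]] by blast
    thus "K \<subseteq> ?K" using comps_subset_if_meet[OF sub w(1)[OF K] ep(2) w(3)[OF K]] by blast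
  next
    assume "K \<subseteq> ?K"
    hence "w K \<in> ?K" using comps_closed[OF ep(2) _ w(4)[OF K]] w(3)[OF K] by blast
    thus "w K \<in> K0" using ep(1) w(2)[OF K] evn_nodes by blast
  qed
  have u: "(\<Sum>a\<in>evn G p1 q1 \<inter> K0. unit (w K) a) = (if K \<subseteq> ?K then 1 else 0)" if K: "K \<in> C" for K
  proof -
    have "(\<Sum>a\<in>evn G p1 q1 \<inter> K0. unit (w K) a) = (\<Sum>a\<in>evn G p1 q1 \<inter> K0. if a = w K then 1 else 0)"
      by (rule sum.cong) (auto simp: unit_def)
    also have "\<dots> = (if w K \<in> evn G p1 q1 \<inter> K0 then 1 else 0)" using finite_evn[of p1 q1] by simp
    finally show ?thesis using w(2)[OF K] iff[OF K] by simp
  qed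
  have "(\<Sum>a\<in>evn G p1 q1 \<inter> K0. \<Sum>K\<in>C. c K * unit (w K) a) =
      (\<Sum>K\<in>C. c K * (\<Sum>a\<in>evn G p1 q1 \<inter> K0. unit (w K) a))"
    unfolding sum_distrib_left by (rule sum.swap)
  also have "\<dots> = (\<Sum>K\<in>C. if K \<subseteq> ?K then c K else 0)" by (rule sum.cong) (auto simp: u)
  also have "\<dots> = (\<Sum>K | K \<in> C \<and> K \<subseteq> ?K. c K)" using C by (simp add: sum.inter_filter)
  also have "\<dots> = 0" by (rule zero[OF ep(2)])
  finally show "(\<Sum>a\<in>evn G p1 q1 \<inter> K0. \<Sum>K\<in>C. c K * unit (w K) a) = 0" .
qed

text \<open>A flow \<open>c K\<close> is put on one odd node \<open>e K\<close> of each component.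
  By \<open>low\<close> its lower ends are balanced by a chain \<open>y1\<close> on the left-hand
  side, and by \<open>high\<close> its upper ends by a chain \<open>y2\<close> on the right-hand
  side.\<close>

lemma crossing_image:
  assumes pq: "p \<le> q + 1" "p' < p" "q < q'"
    and low: "\<And>K'. K' \<in> comps G (oddwin p' q) \<Longrightarrow> (\<Sum>K | K \<in> comps G (oddwin p q) \<and> K \<subseteq> K'. c K) = 0"
    and high: "\<And>K'. K' \<in> comps G (oddwin p q') \<Longrightarrow> (\<Sum>K | K \<in> comps G (oddwin p q) \<and> K \<subseteq> K'. c K) = 0"
  shows "\<exists>z\<in>cyc G (p' - 1) (q' + 1). \<forall>K\<in>comps G (oddwin p q). cross G (2 * p - 1) K z = c K"
proof -
  define C where "C = {K \<in> comps G (oddwin p q). c K \<noteq> 0}"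
  have fin: "finite (comps G (oddwin p q))" by (rule finite_comps) (simp add: oddwin_def)
  hence fC: "finite C" by (simp add: C_def)
  have sub: "oddwin p q \<subseteq> oddwin p' q" "oddwin p q \<subseteq> oddwin p q'" using pq by (auto simp: oddwin_def)
  \<comment> \<open>A component without odd nodes misses both end levels of the window, so it
    remains a component of the window enlarged on the left, and \<open>low\<close> forces
    \<open>c K = 0\<close>.\<close>
  have "\<exists>e\<in>K. odd (fst e)" if K: "K \<in> C" for K
  proof (rule ccontr)
    assume no: "\<not> ?thesis"
    have Kc: "K \<in> comps G (oddwin p q)" using K by (simp add: C_def)
    have "K \<in> comps G (oddwin p' q)"
    proof (rule comps_extend[OF Kc sub(1)])
      fix a b assume ab: "a \<in> K" "(a, b) \<in> edges G (oddwin p' q) \<or> (b, a) \<in> edges G (oddwin p' q)"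
      have a: "a \<in> nodes G (oddwin p q)" "even (fst a)" using comps_sub[OF Kc] ab(1) no by blast+
      have "fst b = fst a + 1 \<or> fst b = fst a - 1" using ab(2) edges_fst[of a b] edges_fst[of b a] by auto
      moreover have "2 * p - 1 \<le> fst a" "fst a \<le> 2 * q + 1" using fst_nodes[OF a(1)] by (auto simp: oddwin_def)
      moreover have "fst a \<noteq> 2 * p - 1" "fst a \<noteq> 2 * q + 1" using a(2) by auto
      ultimately show "fst b \<in> oddwin p q" by (auto simp: oddwin_def)
    qed
    hence "(\<Sum>K' | K' \<in> comps G (oddwin p q) \<and> K' \<subseteq> K. c K') = 0" by (rule low)
    moreover have "K' = K" if K': "K' \<in> comps G (oddwin p q)" "K' \<subseteq> K" for K'
    proof -
      obtain a where "a \<in> K'" using comps_nonempty[OF K'(1)] by blast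
      thus ?thesis using comps_eqI[OF K'(1) Kc, of a] K'(2) by blast
    qed
    hence "{K' \<in> comps G (oddwin p q). K' \<subseteq> K} = {K}" using Kc by blast
    ultimately show False using K by (simp add: C_def)
  qed
  then obtain e where e: "\<And>K. K \<in> C \<Longrightarrow> e K \<in> K" "\<And>K. K \<in> C \<Longrightarrow> odd (fst (e K))" by metis
  have Cc: "K \<in> comps G (oddwin p q)" if "K \<in> C" for K using that by (simp add: C_def)
  have en: "e K \<in> nodes G (oddwin p q)" if "K \<in> C" for K using comps_sub[OF Cc[OF that]] e(1)[OF that] by blast
  have lv: "2 * p - 1 \<le> fst (e K)" "fst (e K) \<le> 2 * q + 1" if "K \<in> C" for K
    using fst_nodes[OF en[OF that]] by (auto simp: oddwin_def)
  have fu: "fst (upn G a) = fst a + 1" "fst (dnn G a) = fst a - 1" for a by (simp_all add: upn_def dnn_def)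
  have ud: "upn G (e K) \<in> nodes G {fst (e K) + 1}" "dnn G (e K) \<in> nodes G {fst (e K) - 1}" if "K \<in> C" for K
    using upn_dnn(1,2)[OF en[OF that] e(2)[OF that]] .
  have sC: "(\<Sum>K | K \<in> C \<and> K \<subseteq> K'. c K) = (\<Sum>K | K \<in> comps G (oddwin p q) \<and> K \<subseteq> K'. c K)" for K'
    by (rule sum.mono_neutral_left) (use fin in \<open>auto simp: C_def\<close>)
  have "\<exists>y\<in>supported (oddn G p' q). \<forall>v. bnd G y v = (\<Sum>K\<in>C. c K * unit (dnn G (e K)) v)"
  proof (rule src_flow[OF _ sub(1) fC Cc])
    fix K assume K: "K \<in> C"
    have n: "dnn G (e K) \<in> nodes G {2 * p'..2 * q}"
      using ud(2)[OF K] lv[OF K] pq nodes_mono[of "{fst (e K) - 1}" "{2 * p'..2 * q}" G] by auto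
    thus "dnn G (e K) \<in> evn G p' q" using e(2)[OF K] fu by (simp add: evn_def)
    have "e K \<in> nodes G (oddwin p' q)" using en[OF K] nodes_mono[OF sub(1)] by blast
    hence "(e K, dnn G (e K)) \<in> edges G (oddwin p' q)"
      using upn_dnn(4)[OF _ e(2)[OF K]] lv[OF K] pq by (simp add: oddwin_def)
    thus "(e K, dnn G (e K)) \<in> linked G (oddwin p' q)" by (rule edges_linked)
  qed (use pq e(1) low sC in auto)
  then obtain y1 where y1: "y1 \<in> supported (oddn G p' q)"
    "\<And>v. bnd G y1 v = (\<Sum>K\<in>C. c K * unit (dnn G (e K)) v)" by blast
  have "\<exists>y\<in>supported (oddn G p q'). \<forall>v. bnd G y v = (\<Sum>K\<in>C. c K * unit (upn G (e K)) v)"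
  proof (rule src_flow[OF _ sub(2) fC Cc])
    fix K assume K: "K \<in> C"
    have n: "upn G (e K) \<in> nodes G {2 * p..2 * q'}"
      using ud(1)[OF K] lv[OF K] pq nodes_mono[of "{fst (e K) + 1}" "{2 * p..2 * q'}" G] by auto
    thus "upn G (e K) \<in> evn G p q'" using e(2)[OF K] fu by (simp add: evn_def)
    have "e K \<in> nodes G (oddwin p q')" using en[OF K] nodes_mono[OF sub(2)] by blast
    hence "(e K, upn G (e K)) \<in> edges G (oddwin p q')"
      using upn_dnn(3)[OF _ e(2)[OF K]] lv[OF K] pq by (simp add: oddwin_def)
    thus "(e K, upn G (e K)) \<in> linked G (oddwin p q')" by (rule edges_linked)
  qed (use pq e(1) high sC in auto)
  then obtain y2 where y2: "y2 \<in> supported (oddn G p q')"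
    "\<And>v. bnd G y2 v = (\<Sum>K\<in>C. c K * unit (upn G (e K)) v)" by blast
  define \<zeta> where "\<zeta> = (\<Sum>K\<in>C. scl (c K) (unit (e K)))"
  have b\<zeta>: "bnd G \<zeta> v = (\<Sum>K\<in>C. c K * unit (upn G (e K)) v) - (\<Sum>K\<in>C. c K * unit (dnn G (e K)) v)" for v
  proof -
    have "bnd G \<zeta> v = (\<Sum>K\<in>C. c K * (unit (upn G (e K)) v - unit (dnn G (e K)) v))"
      unfolding \<zeta>_def bnd_sum[OF fC] bnd_scl by (rule sum.cong) (auto simp: bnd_unit[OF en])
    thus ?thesis by (simp add: right_diff_distrib sum_subtractf)
  qed
  have \<zeta>s: "\<zeta> \<in> supported (oddn G (p' - 1) (q' + 1))"
    unfolding \<zeta>_def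
  proof (intro fn.subspace_sum[OF subspace_supported] fn.subspace_scale[OF subspace_supported] unit_supported)
    fix K assume K: "K \<in> C"
    show "e K \<in> oddn G (p' - 1) (q' + 1)"
      using en[OF K] e(2)[OF K] lv[OF K] pq by (auto simp: oddn_def nodes_def)
  qed
  have ys: "y1 \<in> supported (oddn G (p' - 1) (q' + 1))" "y2 \<in> supported (oddn G (p' - 1) (q' + 1))"
    using y1(1) y2(1) supported_mono[OF oddn_mono[of "p' - 1" p' q "q' + 1" G]]
      supported_mono[OF oddn_mono[of "p' - 1" p q' "q' + 1" G]] pq by auto
  let ?z = "(y1 + \<zeta>) - y2"
  have "?z \<in> supported (oddn G (p' - 1) (q' + 1))"
    by (intro fn.subspace_diff[OF subspace_supported] fn.subspace_add[OF subspace_supported] ys \<zeta>s)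
  moreover have "bnd G ?z v = 0" for v unfolding bnd_diff bnd_add b\<zeta> y1(2) y2(2) by simp
  ultimately have zc: "?z \<in> cyc G (p' - 1) (q' + 1)" unfolding cyc_def by blast
  have "cross G (2 * p - 1) K ?z = c K" if K: "K \<in> comps G (oddwin p q)" for K
  proof -
    \<comment> \<open>\<open>y2\<close> lives above level \<open>2 * p - 1\<close> and
      \<open>y1\<close> below level \<open>2 * q + 1\<close>; so the flux of
      \<open>y1 + \<zeta>\<close> is computed from the top level downwards.\<close>
    have c0: "cross G (2 * p - 1) K y2 = 0"
      by (rule cross_eq_0[OF y2(1)]) (auto simp: oddn_def nodes_def)
    have c1: "cross G (2 * q + 1) K y1 = 0"
      by (rule cross_eq_0[OF y1(1)]) (auto simp: oddn_def nodes_def)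
    have "cross G (2 * q + 1) K \<zeta> = (\<Sum>K'\<in>C. c K' * (if fst (e K') = 2 * q + 1 \<and> e K' \<in> K then 1 else 0))"
      unfolding \<zeta>_def cross_sum[OF fC] cross_scl by (rule sum.cong) (auto simp: cross_unit[OF en])
    hence c2: "cross G (2 * q + 1) K (y1 + \<zeta>) =
        (\<Sum>K'\<in>C. c K' * (if fst (e K') = 2 * q + 1 \<and> e K' \<in> K then 1 else 0))"
      unfolding cross_add c1 by simp
    have b: "bnd G (y1 + \<zeta>) a = (\<Sum>K'\<in>C. c K' * unit (upn G (e K')) a)" for a
      unfolding bnd_add b\<zeta> y1(2) by simp
    have u: "(\<Sum>a\<in>evn G p q \<inter> K. unit w a) = (if w \<in> evn G p q \<inter> K then 1 else 0)" for w
    proof -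
      have "(\<Sum>a\<in>evn G p q \<inter> K. unit w a) = (\<Sum>a\<in>evn G p q \<inter> K. if a = w then 1 else 0)"
        by (rule sum.cong) (auto simp: unit_def)
      thus ?thesis using finite_evn[of p q] by simp
    qed
    have "(\<Sum>a\<in>evn G p q \<inter> K. bnd G (y1 + \<zeta>) a) =
        (\<Sum>K'\<in>C. c K' * (\<Sum>a\<in>evn G p q \<inter> K. unit (upn G (e K')) a))"
      unfolding b sum_distrib_left by (rule sum.swap)
    also have "\<dots> = (\<Sum>K'\<in>C. c K' * (if upn G (e K') \<in> evn G p q \<inter> K then 1 else 0))" unfolding u ..
    finally have c3: "(\<Sum>a\<in>evn G p q \<inter> K. bnd G (y1 + \<zeta>) a) =
      (\<Sum>K'\<in>C. c K' * (if upn G (e K') \<in> evn G p q \<inter> K then 1 else 0))" .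
    have one: "(if fst (e K') = 2 * q + 1 \<and> e K' \<in> K then 1 else 0) +
        (if upn G (e K') \<in> evn G p q \<inter> K then 1 else 0) = (if K' = K then 1 else 0 :: real)"
      if K': "K' \<in> C" for K'
    proof -
      have mem: "e K' \<in> K \<longleftrightarrow> K' = K" using comps_eqI[OF Cc[OF K'] K] e(1)[OF K'] by blast
      show ?thesis
      proof (cases "fst (e K') = 2 * q + 1")
        case True
        hence "upn G (e K') \<notin> evn G p q" using fu[of "e K'"] by (auto simp: evn_def nodes_def)
        thus ?thesis using True mem by simp
      next
        case False
        moreover have "fst (e K') \<noteq> 2 * q" using e(2)[OF K'] by auto
        ultimately have l: "fst (e K') + 1 \<le> 2 * q" using lv[OF K'] by simp
        have "(e K', upn G (e K')) \<in> edges G (oddwin p q)"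
          using upn_dnn(3)[OF en[OF K'] e(2)[OF K']] l lv[OF K'] by (simp add: oddwin_def)
        hence "upn G (e K') \<in> K \<longleftrightarrow> e K' \<in> K" using comps_closed[OF K] edges_linked linked_sym by blast
        moreover have "upn G (e K') \<in> evn G p q"
          using ud(1)[OF K'] l lv[OF K'] e(2)[OF K'] fu[of "e K'"] nodes_mono[of "{fst (e K') + 1}" "{2 * p..2 * q}" G]
          by (auto simp: evn_def)
        ultimately show ?thesis using False mem by simp
      qed
    qed
    have "cross G (2 * p - 1) K ?z = cross G (2 * p - 1) K (y1 + \<zeta>)" unfolding cross_diff c0 by simp
    also have "\<dots> = cross G (2 * q + 1) K (y1 + \<zeta>) + (\<Sum>a\<in>evn G p q \<inter> K. bnd G (y1 + \<zeta>) a)"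
      using cross_telescope[OF K, of q "y1 + \<zeta>"] pq(1) by simp
    also have "\<dots> = (\<Sum>K'\<in>C. c K' * ((if fst (e K') = 2 * q + 1 \<and> e K' \<in> K then 1 else 0) +
        (if upn G (e K') \<in> evn G p q \<inter> K then 1 else 0)))"
      unfolding c2 c3 sum.distrib[symmetric] distrib_left ..
    also have "\<dots> = (\<Sum>K'\<in>C. if K' = K then c K else 0)"
      by (rule sum.cong) (auto simp only: one mult_1_right mult_zero_right split: if_splits)
    also have "\<dots> = c K" using fC K by (simp add: C_def)
    finally show ?thesis .
  qed
  thus ?thesis using zc by blast
qed

text \<open>By conservation the flux in the larger window may be measured at the lowest level of the
  smaller one, where the nodes of \<open>K'\<close> are distributed among the components inside
  \<open>K'\<close>.\<close>

lemma crossw_ext: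
  assumes u: "u \<in> UU" "v \<in> UU" "u \<unlhd> v" and z: "z \<in> cyc G b d" and K': "K' \<in> comps G (win v)"
  shows "crossw G v K' z = (\<Sum>K | K \<in> comps G (win u) \<and> K \<subseteq> K'. crossw G u K z)"
proof -
  define p where "p = \<lceil>fst u\<rceil>"
  define k where "k = 2 * p - 1"
  have K'w: "K' \<in> comps G (oddwin \<lceil>fst v\<rceil> \<lfloor>snd v\<rfloor>)" using K' by (simp add: win_oddwin)
  have uv: "fst v \<le> fst u" "snd u \<le> snd v" using u(3) by (auto simp: op_le_def)
  have r: "\<lceil>fst v\<rceil> - 1 \<le> p - 1" "p - 1 \<le> \<lfloor>snd v\<rfloor>"
    using ceiling_mono[OF uv(1)] floor_mono[OF uv(2)] UU_ceiling_floor[OF u(1)] unfolding p_def by linarith+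
  have b0: "bnd G z a = 0" if "a \<in> evn G m n" for a m n using z that unfolding cyc_def evn_def by blast
  have kk: "2 * (p - 1) + 1 = k" by (simp add: k_def)
  have "(\<Sum>a\<in>evn G \<lceil>fst v\<rceil> (p - 1) \<inter> K'. bnd G z a) = 0"
    by (rule sum.neutral) (use b0 in blast)
  hence "crossw G v K' z = cross G k K' z"
    using cross_telescope[OF K'w r, of z] unfolding crossw_def kk by simp
  also have "\<dots> = (\<Sum>K | K \<in> comps G (win u) \<and> K \<subseteq> K'.
      \<Sum>x | x \<in> {x. x \<in> Lev G k \<and> (k, x) \<in> K'} \<and> cmp G (win u) (k, x) = K. z (k, x))"
    unfolding cross_def
  proof (rule sum.group[symmetric])
    show "finite {x. x \<in> Lev G k \<and> (k, x) \<in> K'}" using finite_Lev by simp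
    show "finite {K. K \<in> comps G (win u) \<and> K \<subseteq> K'}"
      using finite_comps[of "win u"] by (simp add: win_oddwin oddwin_def)
    show "(\<lambda>x. cmp G (win u) (k, x)) ` {x. x \<in> Lev G k \<and> (k, x) \<in> K'} \<subseteq> {K. K \<in> comps G (win u) \<and> K \<subseteq> K'}"
    proof
      fix K assume "K \<in> (\<lambda>x. cmp G (win u) (k, x)) ` {x. x \<in> Lev G k \<and> (k, x) \<in> K'}"
      then obtain x where x: "x \<in> Lev G k" "(k, x) \<in> K'" "K = cmp G (win u) (k, x)" by blast
      have "k \<in> win u" using UU_ceiling_floor[OF u(1)] by (simp add: win_oddwin oddwin_def k_def p_def)
      hence "K \<in> comps G (win u)" using x by (simp add: cmp_comps)
      moreover have "K \<subseteq> K'"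
        using comps_subset_if_meet[OF win_mono[OF u(3)] calculation K', of "(k, x)"] x by simp
      ultimately show "K \<in> {K. K \<in> comps G (win u) \<and> K \<subseteq> K'}" by blast
    qed
  qed
  also have "\<dots> = (\<Sum>K | K \<in> comps G (win u) \<and> K \<subseteq> K'. crossw G u K z)"
  proof (rule sum.cong[OF refl])
    fix K assume "K \<in> {K. K \<in> comps G (win u) \<and> K \<subseteq> K'}"
    hence K: "K \<in> comps G (win u)" "K \<subseteq> K'" by auto
    have "{x. x \<in> {x. x \<in> Lev G k \<and> (k, x) \<in> K'} \<and> cmp G (win u) (k, x) = K} = {x. x \<in> Lev G k \<and> (k, x) \<in> K}"
      using K comps_cmp[OF K(1)] mem_cmp by blast
    thus "(\<Sum>x | x \<in> {x. x \<in> Lev G k \<and> (k, x) \<in> K'} \<and> cmp G (win u) (k, x) = K. z (k, x)) = crossw G u K z"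
      unfolding crossw_def cross_def k_def p_def by simp
  qed
  finally show ?thesis .
qed

end

subsection \<open>Open intervals: loops\<close>

text \<open>The conclusion of \<open>adapted_basis\<close> for the spaces \<open>cyc G b d\<close>,
  packaged so that one basis can be fixed by choice.\<close>

definition ob_spec :: "'a zigzag \<Rightarrow> (int \<Rightarrow> int \<Rightarrow> ('a node \<Rightarrow> real) set) \<Rightarrow> bool" where
  "ob_spec G E \<longleftrightarrow> (\<forall>b d. E b d \<subseteq> cyc G b d \<and> finite (E b d)) \<and>
    (\<forall>b d b' d' x. x \<in> E b d \<longrightarrow> x \<in> E b' d' \<longrightarrow> b = b' \<and> d = d') \<and>
    fn.independent (\<Union>(b, d). E b d) \<and>
    (\<forall>b d. cyc G b d \<subseteq> fn.span (\<Union>(b', d')\<in>{(b', d'). b \<le> b' \<and> d' \<le> d}. E b' d')) \<and>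
    (\<forall>b d. b < d \<longrightarrow> int (card (E b d)) = int (fn.dim (cyc G b d)) - int (fn.dim (cyc G b (d - 1)))
      - int (fn.dim (cyc G (b + 1) d)) + int (fn.dim (cyc G (b + 1) (d - 1))))"

definition ob :: "'a zigzag \<Rightarrow> int \<Rightarrow> int \<Rightarrow> ('a node \<Rightarrow> real) set" where
  "ob G = (SOME E. ob_spec G E)"

definition obasis :: "'a zigzag \<Rightarrow> ('a node \<Rightarrow> real) set" where
  "obasis G = (\<Union>(b, d). ob G b d)"

definition open_bars :: "'a zigzag \<Rightarrow> ((int \<times> int) \<times> ('a node \<Rightarrow> real)) set" where
  "open_bars G = {((b, d), e). e \<in> ob G b d}"

definition cycs :: "'a zigzag \<Rightarrow> ('a node \<Rightarrow> real) set" where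
  "cycs G = (\<Union>(b, d). cyc G b d)"

definition coef :: "'a zigzag \<Rightarrow> ('a node \<Rightarrow> real) \<Rightarrow> ('a node \<Rightarrow> real) \<Rightarrow> real" where
  "coef G z e = fn.representation (obasis G) z e"

text \<open>Strict, because the crossing numbers of a cycle vanish as soon as the window reaches an
  end of its support, see \<open>crossw_low\<close> and \<open>crossw_high\<close>.\<close>

definition alive :: "(int \<times> int) \<times> ('a node \<Rightarrow> real) \<Rightarrow> real \<times> real \<Rightarrow> bool" where
  "alive x u \<longleftrightarrow> of_int (fst (fst x)) < fst u \<and> snd u < of_int (snd (fst x))"

context reeb
begin

lemma ob_spec: "ob_spec G (ob G)"
proof -
  have "\<exists>F. finite F \<and> cyc G b d \<subseteq> fn.span F" for b d
  proof -
    have "cyc G b d \<subseteq> supported (oddn G b d)" by (auto simp: cyc_def)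
    also have "\<dots> \<subseteq> fn.span (unit ` oddn G b d)" by (rule supported_span_unit[OF finite_oddn])
    finally show ?thesis using finite_oddn by blast
  qed
  hence "\<exists>E. ob_spec G E"
    unfolding ob_spec_def by (intro fn.adapted_basis subspace_cyc cyc_triv cyc_mono cyc_Int)
  thus ?thesis unfolding ob_def by (rule someI_ex)
qed

lemma ob_cyc: "ob G b d \<subseteq> cyc G b d"
  and ob_finite: "finite (ob G b d)"
  and ob_disjoint: "e \<in> ob G b d \<Longrightarrow> e \<in> ob G b' d' \<Longrightarrow> b = b' \<and> d = d'"
  and ob_span: "cyc G b d \<subseteq> fn.span (\<Union>(b', d')\<in>{(b', d'). b \<le> b' \<and> d' \<le> d}. ob G b' d')"
  and card_ob: "b < d \<Longrightarrow> int (card (ob G b d)) = int (fn.dim (cyc G b d))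
      - int (fn.dim (cyc G b (d - 1))) - int (fn.dim (cyc G (b + 1) d)) + int (fn.dim (cyc G (b + 1) (d - 1)))"
  and obasis_independent: "fn.independent (obasis G)"
  using ob_spec unfolding ob_spec_def obasis_def by blast+

lemma ob_empty:
  assumes "d \<le> b"
  shows "ob G b d = {}"
proof -
  have "ob G b d \<subseteq> {0}" using ob_cyc[of b d] unfolding cyc_triv[OF assms] .
  moreover have "0 \<notin> obasis G" using obasis_independent fn.dependent_zero by blast
  hence "0 \<notin> ob G b d" unfolding obasis_def by blast
  ultimately show ?thesis by blast
qed

lemma ob_obasis: "e \<in> ob G b d \<Longrightarrow> e \<in> obasis G"
  unfolding obasis_def by blast

lemma cycs_span: "cycs G \<subseteq> fn.span (obasis G)"
proof
  fix z assume "z \<in> cycs G"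
  then obtain b d where "z \<in> cyc G b d" unfolding cycs_def by blast
  moreover have "(\<Union>(b', d')\<in>{(b', d'). b \<le> b' \<and> d' \<le> d}. ob G b' d') \<subseteq> obasis G"
    unfolding obasis_def by blast
  ultimately show "z \<in> fn.span (obasis G)" using subsetD[OF fn.span_mono subsetD[OF ob_span]] by simp
qed

lemma cyc_cycs: "z \<in> cyc G b d \<Longrightarrow> z \<in> cycs G"
  unfolding cycs_def by blast

lemma subspace_cycs: "fn.subspace (cycs G)"
  unfolding fn.subspace_def
proof (intro conjI ballI allI)
  have "0 \<in> cyc G 0 0" by (rule fn.subspace_0[OF subspace_cyc])
  thus "0 \<in> cycs G" by (rule cyc_cycs)
  fix x assume "x \<in> cycs G"
  then obtain b d where x: "x \<in> cyc G b d" unfolding cycs_def by blast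
  show "scl c x \<in> cycs G" for c by (rule cyc_cycs[OF fn.subspace_scale[OF subspace_cyc x]])
  fix y assume "y \<in> cycs G"
  then obtain b' d' where y: "y \<in> cyc G b' d'" unfolding cycs_def by blast
  have "x \<in> cyc G (min b b') (max d d')" "y \<in> cyc G (min b b') (max d d')"
    using x y cyc_mono[of "min b b'" b d "max d d'" G] cyc_mono[of "min b b'" b' d' "max d d'" G] by auto
  thus "x + y \<in> cycs G" using cyc_cycs[OF fn.subspace_add[OF subspace_cyc]] by blast
qed

lemma coef_add: "z \<in> cycs G \<Longrightarrow> w \<in> cycs G \<Longrightarrow> coef G (z + w) e = coef G z e + coef G w e"
  unfolding coef_def
  by (simp add: fn.representation_add[OF obasis_independent subsetD[OF cycs_span] subsetD[OF cycs_span]])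

lemma coef_diff: "z \<in> cycs G \<Longrightarrow> w \<in> cycs G \<Longrightarrow> coef G (z - w) e = coef G z e - coef G w e"
  unfolding coef_def
  by (simp add: fn.representation_diff[OF obasis_independent subsetD[OF cycs_span] subsetD[OF cycs_span]])

lemma coef_scl: "z \<in> cycs G \<Longrightarrow> coef G (scl c z) e = c * coef G z e"
  unfolding coef_def
  by (simp add: fn.representation_scale[OF obasis_independent subsetD[OF cycs_span]])

lemma coef_basis: "e \<in> obasis G \<Longrightarrow> coef G e e' = (if e' = e then 1 else 0)"
  unfolding coef_def using fn.representation_basis[OF obasis_independent] by simp

lemma coef_0 [simp]: "coef G 0 e = 0"
  unfolding coef_def by (simp add: fn.representation_zero)

text \<open>The purpose of the adapted basis: a cycle supported between \<open>2 * b\<close> and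
  \<open>2 * d\<close> involves only basis vectors supported there.\<close>

lemma coef_bounds:
  assumes z: "z \<in> cyc G b d" and nz: "coef G z e \<noteq> 0" and e: "e \<in> ob G b' d'"
  shows "b \<le> b' \<and> d' \<le> d"
proof -
  let ?U = "\<Union>(b', d')\<in>{(b', d'). b \<le> b' \<and> d' \<le> d}. ob G b' d'"
  have U: "?U \<subseteq> obasis G" unfolding obasis_def by blast
  have "z \<in> fn.span ?U" using ob_span z by blast
  hence "fn.representation ?U z e \<noteq> 0"
    using nz fn.representation_extend[OF obasis_independent _ U] unfolding coef_def by metis
  hence "e \<in> ?U" by (rule fn.representation_ne_zero)
  then obtain b2 d2 where "b \<le> b2" "d2 \<le> d" "e \<in> ob G b2 d2" by blast
  thus ?thesis using ob_disjoint[OF e] by blast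
qed

lemma crossw_low: "z \<in> cyc G b d \<Longrightarrow> fst u \<le> of_int b \<Longrightarrow> crossw G u K z = 0"
proof -
  assume z: "z \<in> cyc G b d" and u: "fst u \<le> of_int b"
  have "\<lceil>fst u\<rceil> \<le> b" using u by (simp add: ceiling_le_iff)
  moreover have "z \<in> supported (oddn G b d)" using z by (simp add: cyc_def)
  ultimately show ?thesis
    unfolding crossw_def by (intro cross_eq_0) (auto simp: oddn_def nodes_def)
qed

text \<open>By conservation the flux may be measured at the top level of the window, which lies
  above the support of \<open>z\<close>.\<close>

lemma crossw_high:
  assumes z: "z \<in> cyc G b d" and u: "u \<in> UU" "of_int d \<le> snd u" and K: "K \<in> comps G (win u)"
  shows "crossw G u K z = 0"
proof -
  have q: "d \<le> \<lfloor>snd u\<rfloor>" using u(2) by (simp add: le_floor_iff)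
  have K': "K \<in> comps G (oddwin \<lceil>fst u\<rceil> \<lfloor>snd u\<rfloor>)" using K by (simp add: win_oddwin)
  have zs: "z \<in> supported (oddn G b d)" using z by (simp add: cyc_def)
  have "\<lceil>fst u\<rceil> - 1 \<le> \<lfloor>snd u\<rfloor>" using UU_ceiling_floor[OF u(1)] by simp
  from cross_telescope[OF K' this order_refl, of z]
  have "cross G (2 * \<lceil>fst u\<rceil> - 1) K z - cross G (2 * \<lfloor>snd u\<rfloor> + 1) K z =
    (\<Sum>a\<in>evn G \<lceil>fst u\<rceil> \<lfloor>snd u\<rfloor> \<inter> K. bnd G z a)" .
  moreover have "(\<Sum>a\<in>evn G \<lceil>fst u\<rceil> \<lfloor>snd u\<rfloor> \<inter> K. bnd G z a) = 0"
  proof (rule sum.neutral, rule ballI)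
    fix a assume "a \<in> evn G \<lceil>fst u\<rceil> \<lfloor>snd u\<rfloor> \<inter> K"
    hence "even (fst a)" by (simp add: evn_def)
    thus "bnd G z a = 0" using z unfolding cyc_def by blast
  qed
  moreover have "cross G (2 * \<lfloor>snd u\<rfloor> + 1) K z = 0"
    by (rule cross_eq_0[OF zs]) (use q in \<open>auto simp: oddn_def nodes_def\<close>)
  ultimately show ?thesis unfolding crossw_def by simp
qed

text \<open>By \<open>crossing_kernel\<close> the cycle splits into one that ends within the right
  bound of the window and one that starts within the left bound; neither involves a bar containing
  the window.\<close>

lemma coef_zero_if_crossing_zero:
  assumes z: "z \<in> cycs G" and u: "u \<in> UU" and zero: "\<And>K. K \<in> comps G (win u) \<Longrightarrow> crossw G u K z = 0"
    and e: "e \<in> ob G b' d'" "of_int b' < fst u" "snd u < of_int d'"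
  shows "coef G z e = 0"
proof -
  obtain b d where zc: "z \<in> cyc G b d" using z unfolding cycs_def by blast
  obtain z1 z2 where zz: "z1 \<in> cyc G (min b \<lceil>fst u\<rceil>) \<lfloor>snd u\<rfloor>" "z2 \<in> cyc G \<lceil>fst u\<rceil> (max d \<lfloor>snd u\<rfloor>)"
    "z = z1 + z2"
    using crossing_kernel[OF zc UU_ceiling_floor[OF u]] zero unfolding crossw_def win_oddwin by blast
  have "coef G z1 e = 0"
  proof (rule ccontr)
    assume "coef G z1 e \<noteq> 0"
    hence "d' \<le> \<lfloor>snd u\<rfloor>" using coef_bounds[OF zz(1) _ e(1)] by blast
    thus False using e(3) by (simp add: le_floor_iff)
  qed
  moreover have "coef G z2 e = 0"
  proof (rule ccontr)
    assume "coef G z2 e \<noteq> 0"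
    hence "\<lceil>fst u\<rceil> \<le> b'" using coef_bounds[OF zz(2) _ e(1)] by blast
    thus False using e(2) by (simp add: ceiling_le_iff)
  qed
  ultimately show ?thesis using coef_add[OF cyc_cycs[OF zz(1)] cyc_cycs[OF zz(2)]] zz(3) by simp
qed

lemma crossw_add: "crossw G u K (z + w) = crossw G u K z + crossw G u K w"
  unfolding crossw_def by (rule cross_add)

lemma crossw_diff: "crossw G u K (z - w) = crossw G u K z - crossw G u K w"
  unfolding crossw_def by (rule cross_diff)

lemma crossw_scl: "crossw G u K (scl c z) = c * crossw G u K z"
  unfolding crossw_def by (rule cross_scl)

lemma crossw_0: "crossw G u K 0 = 0"
  unfolding crossw_def cross_def by (rule sum.neutral) auto

lemma finite_comps_win: "finite (comps G (win u))"
  by (rule finite_comps) (simp add: win_oddwin oddwin_def)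

lemma crossw_ext_cycs:
  assumes "u \<in> UU" "v \<in> UU" "u \<unlhd> v" "z \<in> cycs G" "K' \<in> comps G (win v)"
  shows "crossw G v K' z = (\<Sum>K | K \<in> comps G (win u) \<and> K \<subseteq> K'. crossw G u K z)"
proof -
  obtain b d where "z \<in> cyc G b d" using assms(4) unfolding cycs_def by blast
  thus ?thesis using crossw_ext[OF assms(1-3) _ assms(5)] by blast
qed

end

section \<open>Images of cycles under an interleaving\<close>

context interleaving
begin

text \<open>A relation instead of a map: \<open>f\<close> acts on components of windows only, so an
  image cycle is described by its crossing numbers and determined up to cycles without
  crossings.\<close>

definition img :: "real \<times> real \<Rightarrow> ('a node \<Rightarrow> real) \<Rightarrow> ('b node \<Rightarrow> real) \<Rightarrow> bool" where
  "img u z z' \<longleftrightarrow> (\<forall>K'\<in>comps H (win (shift_pt \<epsilon> u)).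
     crossw H (shift_pt \<epsilon> u) K' z' = (\<Sum>K | K \<in> comps G (win u) \<and> f u K = K'. crossw G u K z))"

text \<open>Pushing forward commutes with enlarging the window: both sides sum over the components
  of \<open>win u\<close> whose image lies in \<open>K''\<close>.\<close>

lemma push_sum:
  assumes u: "u \<in> UU" "v \<in> UU" "u \<unlhd> v" and z: "z \<in> cycs G" and K: "K'' \<in> comps H (win (shift_pt \<epsilon> v))"
  shows "(\<Sum>K' | K' \<in> comps H (win (shift_pt \<epsilon> u)) \<and> K' \<subseteq> K''.
      \<Sum>K | K \<in> comps G (win u) \<and> f u K = K'. crossw G u K z) =
    (\<Sum>K' | K' \<in> comps G (win v) \<and> f v K' = K''. crossw G v K' z)"
proof -
  let ?S = "{K. K \<in> comps G (win u) \<and> f u K \<subseteq> K''}"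
  let ?T = "{K'. K' \<in> comps H (win (shift_pt \<epsilon> u)) \<and> K' \<subseteq> K''}"
  let ?R = "{K'. K' \<in> comps G (win v) \<and> f v K' = K''}"
  have fin: "finite ?S" "finite ?T" "finite ?R"
    using X.finite_comps_win Y.finite_comps_win by auto
  have e: "ext G (win v) K \<in> comps G (win v)" "K \<subseteq> ext G (win v) K" if "K \<in> comps G (win u)" for K
    using X.ext[OF that win_mono[OF u(3)]] by auto
  have fe: "f u K \<subseteq> K'' \<longleftrightarrow> f v (ext G (win v) K) = K''" if Kc: "K \<in> comps G (win u)" for K
  proof -
    have s: "f u K \<subseteq> f v (ext G (win v) K)" by (rule f_mono[OF u Kc e(1,2)[OF Kc]])
    obtain a where "a \<in> f u K" using comps_nonempty[OF f_comps[OF u(1) Kc]] by blast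
    thus ?thesis using s comps_eqI[OF f_comps[OF u(2) e(1)[OF Kc]] K, of a] by blast
  qed
  have es: "K \<subseteq> K' \<longleftrightarrow> ext G (win v) K = K'" if "K \<in> comps G (win u)" "K' \<in> comps G (win v)" for K K'
    using X.ext_eqI[OF that(1) win_mono[OF u(3)] that(2)] e(2)[OF that(1)] by blast
  have "(\<Sum>K'\<in>?T. \<Sum>K | K \<in> comps G (win u) \<and> f u K = K'. crossw G u K z) =
      (\<Sum>K'\<in>?T. \<Sum>K | K \<in> ?S \<and> f u K = K'. crossw G u K z)"
  proof (rule sum.cong[OF refl])
    fix K' assume "K' \<in> ?T"
    hence "{K. K \<in> comps G (win u) \<and> f u K = K'} = {K. K \<in> ?S \<and> f u K = K'}" by blast
    thus "(\<Sum>K | K \<in> comps G (win u) \<and> f u K = K'. crossw G u K z) =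
        (\<Sum>K | K \<in> ?S \<and> f u K = K'. crossw G u K z)" by (simp only:)
  qed
  also have "\<dots> = (\<Sum>K\<in>?S. crossw G u K z)"
    by (rule sum.group[OF fin(1,2)]) (use f_comps[OF u(1)] in blast)
  also have "\<dots> = (\<Sum>K'\<in>?R. \<Sum>K | K \<in> ?S \<and> ext G (win v) K = K'. crossw G u K z)"
    by (rule sum.group[OF fin(1,3), symmetric]) (use e(1) fe in blast)
  also have "\<dots> = (\<Sum>K'\<in>?R. crossw G v K' z)"
  proof (rule sum.cong[OF refl])
    fix K' assume K': "K' \<in> ?R"
    hence K'c: "K' \<in> comps G (win v)" by blast
    have "{K. K \<in> ?S \<and> ext G (win v) K = K'} = {K. K \<in> comps G (win u) \<and> K \<subseteq> K'}"
      using fe es K' by blast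
    thus "(\<Sum>K | K \<in> ?S \<and> ext G (win v) K = K'. crossw G u K z) = crossw G v K' z"
      using X.crossw_ext_cycs[OF u z K'c] by (simp only:)
  qed
  finally show ?thesis .
qed

lemma img_mono:
  assumes u: "u \<in> UU" "v \<in> UU" "u \<unlhd> v" and z: "z \<in> cycs G" "z' \<in> cycs H" and i: "img u z z'"
  shows "img v z z'"
  unfolding img_def
proof
  fix K'' assume K: "K'' \<in> comps H (win (shift_pt \<epsilon> v))"
  have "crossw H (shift_pt \<epsilon> v) K'' z' =
      (\<Sum>K' | K' \<in> comps H (win (shift_pt \<epsilon> u)) \<and> K' \<subseteq> K''. crossw H (shift_pt \<epsilon> u) K' z')"
    by (rule Y.crossw_ext_cycs[OF shift_pt_UU[OF u(1) eps] shift_pt_UU[OF u(2) eps]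
          shift_pt_mono[OF u(3)] z(2) K])
  also have "\<dots> = (\<Sum>K' | K' \<in> comps H (win (shift_pt \<epsilon> u)) \<and> K' \<subseteq> K''.
      \<Sum>K | K \<in> comps G (win u) \<and> f u K = K'. crossw G u K z)"
    by (rule sum.cong) (use i in \<open>auto simp: img_def\<close>)
  also have "\<dots> = (\<Sum>K' | K' \<in> comps G (win v) \<and> f v K' = K''. crossw G v K' z)"
    by (rule push_sum[OF u z(1) K])
  finally show "crossw H (shift_pt \<epsilon> v) K'' z' = (\<Sum>K' | K' \<in> comps G (win v) \<and> f v K' = K''. crossw G v K' z)" .
qed

lemma img_add: "img u z z' \<Longrightarrow> img u w w' \<Longrightarrow> img u (z + w) (z' + w')"
  unfolding img_def X.crossw_add Y.crossw_add sum.distrib by simp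

lemma img_scl: "img u z z' \<Longrightarrow> img u (scl c z) (scl c z')"
  unfolding img_def X.crossw_scl Y.crossw_scl sum_distrib_left[symmetric] by simp

lemma img_zero:
  assumes "\<And>K. K \<in> comps G (win u) \<Longrightarrow> crossw G u K z = 0"
  shows "img u z 0"
  unfolding img_def Y.crossw_0 by (intro ballI sum.neutral[symmetric]) (use assms in blast)

text \<open>\<open>crossing_image\<close> applies because the transported numbers vanish on wider
  windows: once widened by \<open>s\<close> on the left or by \<open>t\<close> on the right, the
  window reaches beyond the support of \<open>z\<close> on that side.\<close>

lemma img_exists:
  assumes u: "u \<in> UU" and z: "z \<in> cycs G"
  shows "\<exists>z'\<in>cycs H. img u z z'"
proof -
  obtain b d where zc: "z \<in> cyc G b d" using z unfolding cycs_def by blast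
  \<comment> \<open>Integral, so that rounding commutes with the widening, and at least one, because
    \<open>crossing_image\<close> asks for strictly larger windows.\<close>
  define s t :: int where "s = max 1 (\<lceil>fst u\<rceil> - b)" and "t = max 1 (d - \<lfloor>snd u\<rfloor>)"
  define v w where "v = (fst u - of_int s, snd u)" and "w = (fst u, snd u + of_int t)"
  have edges: "1 \<le> s" "1 \<le> t" by (auto simp: s_def t_def)
  have vw: "v \<in> UU" "w \<in> UU" "u \<unlhd> v" "u \<unlhd> w"
    using u edges by (auto simp: v_def w_def UU_def op_le_def)
  define p where "p = \<lceil>fst u - \<epsilon>\<rceil>"
  define q where "q = \<lfloor>snd u + \<epsilon>\<rfloor>"
  have wins: "win (shift_pt \<epsilon> u) = oddwin p q"
    "win (shift_pt \<epsilon> v) = oddwin (p - s) q" "win (shift_pt \<epsilon> w) = oddwin p (q + t)"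
  proof -
    have "\<lceil>fst u - of_int s - \<epsilon>\<rceil> = p - s" unfolding p_def by linarith
    moreover have "\<lfloor>snd u + of_int t + \<epsilon>\<rfloor> = q + t" unfolding q_def by linarith
    ultimately show "win (shift_pt \<epsilon> u) = oddwin p q"
      "win (shift_pt \<epsilon> v) = oddwin (p - s) q" "win (shift_pt \<epsilon> w) = oddwin p (q + t)"
      by (simp_all add: win_oddwin shift_pt_def v_def w_def p_def q_def)
  qed
  have pq: "p \<le> q + 1" using UU_ceiling_floor[OF shift_pt_UU[OF u eps]] by (simp add: shift_pt_def p_def q_def)
  define c where "c K' = (\<Sum>K | K \<in> comps G (win u) \<and> f u K = K'. crossw G u K z)" for K'
  have low: "(\<Sum>K | K \<in> comps H (oddwin p q) \<and> K \<subseteq> K'. c K) = 0" if K': "K' \<in> comps H (oddwin (p - s) q)" for K'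
  proof -
    have "fst v \<le> of_int b"
    proof -
      have "\<lceil>fst u\<rceil> - b \<le> s" by (simp add: s_def)
      thus ?thesis unfolding v_def fst_conv by linarith
    qed
    hence "crossw G v K z = 0" for K by (rule X.crossw_low[OF zc])
    thus ?thesis using push_sum[OF u vw(1,3) z, of K'] K' unfolding wins c_def by simp
  qed
  have high: "(\<Sum>K | K \<in> comps H (oddwin p q) \<and> K \<subseteq> K'. c K) = 0" if K': "K' \<in> comps H (oddwin p (q + t))" for K'
  proof -
    have "of_int d \<le> snd w"
    proof -
      have "d - \<lfloor>snd u\<rfloor> \<le> t" by (simp add: t_def)
      thus ?thesis unfolding w_def snd_conv by linarith
    qed
    hence "crossw G w K z = 0" if "K \<in> comps G (win w)" for K by (rule X.crossw_high[OF zc vw(2) _ that])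
    hence "(\<Sum>K | K \<in> comps G (win w) \<and> f w K = K'. crossw G w K z) = 0" by (intro sum.neutral) blast
    thus ?thesis using push_sum[OF u vw(2,4) z, of K'] K' unfolding wins c_def by simp
  qed
  have "\<exists>z'\<in>cyc H (p - s - 1) (q + t + 1). \<forall>K\<in>comps H (oddwin p q). cross H (2 * p - 1) K z' = c K"
    by (rule Y.crossing_image[OF pq]) (use edges low high in auto)
  then obtain z' where z': "z' \<in> cyc H (p - s - 1) (q + t + 1)"
    "\<And>K. K \<in> comps H (oddwin p q) \<Longrightarrow> cross H (2 * p - 1) K z' = c K" by blast
  have "img u z z'"
    unfolding img_def wins crossw_def[of H] using z'(2) by (simp add: shift_pt_def p_def c_def)
  thus ?thesis using Y.cyc_cycs[OF z'(1)] by blast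
qed

lemma img_unique:
  assumes u: "u \<in> UU" and z: "z1 \<in> cycs H" "z2 \<in> cycs H" and i: "img u z z1" "img u z z2"
    and y: "y \<in> open_bars H" "alive y (shift_pt \<epsilon> u)"
  shows "coef H z1 (snd y) = coef H z2 (snd y)"
proof -
  have e: "snd y \<in> ob H (fst (fst y)) (snd (fst y))" using y(1) by (auto simp: open_bars_def)
  have "coef H (z1 - z2) (snd y) = 0"
  proof (rule Y.coef_zero_if_crossing_zero[OF _ shift_pt_UU[OF u eps] _ e])
    show "z1 - z2 \<in> cycs H" by (rule fn.subspace_diff[OF Y.subspace_cycs z])
    show "crossw H (shift_pt \<epsilon> u) K (z1 - z2) = 0" if "K \<in> comps H (win (shift_pt \<epsilon> u))" for K
      unfolding Y.crossw_diff using i that by (simp add: img_def)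
  qed (use y(2) in \<open>auto simp: alive_def\<close>)
  thus ?thesis using Y.coef_diff[OF z] by simp
qed

text \<open>A window of a single point at the centre of \<open>y\<close>, which \<open>y\<close>
  contains for the largest possible shift.\<close>

definition mid :: "(int \<times> int) \<times> ('c \<Rightarrow> real) \<Rightarrow> real \<times> real" where
  "mid y = ((of_int (fst (fst y)) + of_int (snd (fst y))) / 2, (of_int (fst (fst y)) + of_int (snd (fst y))) / 2)"

text \<open>The coefficient at the bar \<open>y\<close> of the image of \<open>z\<close>.\<close>

definition omat :: "('a node \<Rightarrow> real) \<Rightarrow> (int \<times> int) \<times> ('b node \<Rightarrow> real) \<Rightarrow> real" where
  "omat z y = coef H (SOME z'. z' \<in> cycs H \<and> img (mid y) z z') (snd y)"

lemma mid_UU: "mid y \<in> UU"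
  by (simp add: mid_def UU_def)

text \<open>Any window whose shift keeps \<open>y\<close> alive gives the same coefficient; it is
  compared with the centre through the window spanned by both.\<close>

lemma omat_eq:
  assumes u: "u \<in> UU" and z: "z \<in> cycs G" "z' \<in> cycs H" and i: "img u z z'"
    and y: "y \<in> open_bars H" "alive y (shift_pt \<epsilon> u)"
  shows "omat z y = coef H z' (snd y)"
proof -
  let ?z = "SOME z'. z' \<in> cycs H \<and> img (mid y) z z'"
  have "\<exists>z'. z' \<in> cycs H \<and> img (mid y) z z'" using img_exists[OF mid_UU z(1)] by blast
  hence zs: "?z \<in> cycs H" "img (mid y) z ?z" using someI_ex[of "\<lambda>z'. z' \<in> cycs H \<and> img (mid y) z z'"] by auto
  define w where "w = (min (fst u) (fst (mid y)), max (snd u) (snd (mid y)))"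
  have w: "w \<in> UU" "u \<unlhd> w" "mid y \<unlhd> w" using u by (auto simp: w_def UU_def op_le_def)
  have "of_int (fst (fst y)) < fst u - \<epsilon>" "snd u + \<epsilon> < of_int (snd (fst y))" "fst u \<le> snd u"
    using y(2) u by (auto simp: alive_def shift_pt_def UU_def)
  hence "of_int (fst (fst y)) < fst (mid y) - \<epsilon>" "snd (mid y) + \<epsilon> < of_int (snd (fst y))"
    by (simp_all add: mid_def field_simps)
  hence a: "alive y (shift_pt \<epsilon> w)"
    using y(2) unfolding alive_def shift_pt_def w_def by (auto simp: min_def max_def)
  show ?thesis
    unfolding omat_def
    by (rule img_unique[OF w(1) zs(1) z(2) img_mono[OF mid_UU w(1,3) z(1) zs]
          img_mono[OF u w(1,2) z i] y(1) a])
qed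

lemma alive_mid:
  assumes "2 * \<delta> < of_int (snd (fst y)) - of_int (fst (fst y))"
  shows "alive y (shift_pt \<delta> (mid y))"
proof -
  have "of_int (fst (fst y)) < (of_int (fst (fst y)) + of_int (snd (fst y))) / 2 - \<delta>"
    "(of_int (fst (fst y)) + of_int (snd (fst y))) / 2 + \<delta> < of_int (snd (fst y))"
    using assms by (simp_all add: field_simps)
  thus ?thesis unfolding alive_def shift_pt_def mid_def by simp
qed

text \<open>The cycles chosen in \<open>omat\<close> need not be compatible with sums, but sums of
  images are images, and \<open>omat_eq\<close> makes the coefficient independent of the
  choice.\<close>

lemma omat_sum:
  assumes X: "finite X" "\<And>e. e \<in> X \<Longrightarrow> e \<in> cycs G"
    and y: "y \<in> open_bars H" "2 * \<epsilon> < of_int (snd (fst y)) - of_int (fst (fst y))"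
  shows "omat (\<Sum>e\<in>X. scl (c e) e) y = (\<Sum>e\<in>X. c e * omat e y) \<and> (\<Sum>e\<in>X. scl (c e) e) \<in> cycs G"
  using X
proof induction
  case empty
  have z: "0 \<in> cycs G" "0 \<in> cycs H" using fn.subspace_0 X.subspace_cycs Y.subspace_cycs by blast+
  have "omat 0 y = coef H 0 (snd y)"
    by (rule omat_eq[OF mid_UU z img_zero y(1) alive_mid[OF y(2)]]) (rule X.crossw_0)
  thus ?case unfolding sum.empty Y.coef_0 using z(1) by blast
next
  case (insert a X)
  let ?S = "\<Sum>e\<in>X. scl (c e) e"
  have "omat ?S y = (\<Sum>e\<in>X. c e * omat e y) \<and> ?S \<in> cycs G"
    by (rule insert.IH) (rule insert.prems, blast)
  hence S: "?S \<in> cycs G" "omat ?S y = (\<Sum>e\<in>X. c e * omat e y)" by (rule conjunct2, rule conjunct1)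
  have a: "a \<in> cycs G" using insert.prems by simp
  have ca: "scl (c a) a \<in> cycs G" by (rule fn.subspace_scale[OF X.subspace_cycs a])
  obtain a' where a': "a' \<in> cycs H" "img (mid y) a a'" using img_exists[OF mid_UU a] by blast
  obtain S' where S': "S' \<in> cycs H" "img (mid y) ?S S'" using img_exists[OF mid_UU S(1)] by blast
  have ca': "scl (c a) a' \<in> cycs H" by (rule fn.subspace_scale[OF Y.subspace_cycs a'(1)])
  note al = alive_mid[OF y(2)]
  have sum: "scl (c a) a + ?S \<in> cycs G" by (rule fn.subspace_add[OF X.subspace_cycs ca S(1)])
  have "omat (scl (c a) a + ?S) y = coef H (scl (c a) a' + S') (snd y)"
    by (rule omat_eq[OF mid_UU sum fn.subspace_add[OF Y.subspace_cycs ca' S'(1)]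
          img_add[OF img_scl[OF a'(2)] S'(2)] y(1) al])
  also have "\<dots> = c a * coef H a' (snd y) + coef H S' (snd y)"
    using Y.coef_add[OF ca' S'(1)] Y.coef_scl[OF a'(1)] by simp
  also have "coef H a' (snd y) = omat a y" using omat_eq[OF mid_UU a a' y(1) al] by simp
  also have "coef H S' (snd y) = omat ?S y" using omat_eq[OF mid_UU S(1) S' y(1) al] by simp
  finally show ?case
    unfolding sum.insert[OF insert.hyps] S(2)[symmetric] by (rule conjI[OF _ sum])
qed

lemma omat_zero:
  assumes u: "u \<in> UU" and z: "z \<in> cycs G" and zero: "\<And>K. K \<in> comps G (win u) \<Longrightarrow> crossw G u K z = 0"
    and y: "y \<in> open_bars H" "alive y (shift_pt \<epsilon> u)"
  shows "omat z y = 0"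
  using omat_eq[OF u z _ img_zero[OF zero] y] fn.subspace_0[OF Y.subspace_cycs] by simp

text \<open>If \<open>b\<close> were too large, there would be a one-point window not beyond the
  left end of the support of \<open>z\<close> whose shift still lies inside \<open>y\<close>; all
  crossing numbers vanish there. The right end is symmetric.\<close>

lemma omat_nonzero:
  assumes z: "z \<in> cyc G b d"
    and y: "y \<in> open_bars H" "2 * \<epsilon> < of_int (snd (fst y)) - of_int (fst (fst y))"
    and nz: "omat z y \<noteq> 0"
  shows "of_int b \<le> of_int (fst (fst y)) + \<epsilon>" "of_int (snd (fst y)) \<le> of_int d + \<epsilon>"
proof -
  let ?m = "(real_of_int (fst (fst y)) + real_of_int (snd (fst y))) / 2"
  have m: "of_int (fst (fst y)) < ?m - \<epsilon>" "?m + \<epsilon> < of_int (snd (fst y))"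
    using y(2) by (simp_all add: field_simps)
  show "of_int b \<le> of_int (fst (fst y)) + \<epsilon>"
  proof (rule ccontr)
    assume c: "\<not> ?thesis"
    let ?t = "min (of_int b) ?m"
    have "alive y (shift_pt \<epsilon> (?t, ?t))" using m c by (auto simp: alive_def shift_pt_def min_def)
    moreover have "crossw G (?t, ?t) K z = 0" for K by (rule X.crossw_low[OF z]) simp
    ultimately have "omat z y = 0"
      by (intro omat_zero[OF _ X.cyc_cycs[OF z] _ y(1), of "(?t, ?t)"]) (simp_all add: UU_def)
    thus False using nz by blast
  qed
  show "of_int (snd (fst y)) \<le> of_int d + \<epsilon>"
  proof (rule ccontr)
    assume c: "\<not> ?thesis"
    let ?t = "max (of_int d) ?m"
    have uu: "(?t, ?t) \<in> UU" by (simp add: UU_def)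
    have "alive y (shift_pt \<epsilon> (?t, ?t))" using m c by (auto simp: alive_def shift_pt_def max_def)
    moreover have "crossw G (?t, ?t) K z = 0" if "K \<in> comps G (win (?t, ?t))" for K
      by (rule X.crossw_high[OF z uu _ that]) simp
    ultimately have "omat z y = 0"
      by (intro omat_zero[OF uu X.cyc_cycs[OF z] _ y(1)])
    thus False using nz by blast
  qed
qed

end

context reeb
begin

lemma obarsD:
  assumes "y \<in> open_bars G"
  shows "snd y \<in> ob G (fst (fst y)) (snd (fst y))" "snd y \<in> obasis G" "snd y \<in> cycs G"
    "snd y \<in> cyc G (fst (fst y)) (snd (fst y))"
proof -
  show o: "snd y \<in> ob G (fst (fst y)) (snd (fst y))" using assms by (auto simp: open_bars_def)
  show "snd y \<in> obasis G" by (rule ob_obasis[OF o])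
  show c: "snd y \<in> cyc G (fst (fst y)) (snd (fst y))" by (rule subsetD[OF ob_cyc o])
  show "snd y \<in> cycs G" by (rule cyc_cycs[OF c])
qed

lemma inj_on_open_bars: "inj_on snd (open_bars G)"
proof (rule inj_onI)
  fix x y assume a: "x \<in> open_bars G" "y \<in> open_bars G" "snd x = snd y"
  have "fst (fst x) = fst (fst y) \<and> snd (fst x) = snd (fst y)"
    by (rule ob_disjoint[OF obarsD(1)[OF a(1)]]) (use obarsD(1)[OF a(2)] a(3) in simp)
  thus "x = y" using a(3) by (simp add: prod_eq_iff)
qed

lemma open_bars_snd: "e \<in> obasis G \<Longrightarrow> e \<in> snd ` open_bars G"
  unfolding obasis_def open_bars_def by force

lemma open_bars_lt: "y \<in> open_bars G \<Longrightarrow> fst (fst y) < snd (fst y)"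
  using obarsD(1) ob_empty by (metis empty_iff not_less)

lemma finite_open_bars_box:
  "finite {y \<in> open_bars G. fst (fst y) \<in> {p..q} \<and> snd (fst y) \<in> {p'..q'}}"
proof (rule finite_subset)
  show "{y \<in> open_bars G. fst (fst y) \<in> {p..q} \<and> snd (fst y) \<in> {p'..q'}} \<subseteq>
      (SIGMA bd:{p..q} \<times> {p'..q'}. ob G (fst bd) (snd bd))"
    by (auto simp: open_bars_def)
  show "finite (SIGMA bd:{p..q} \<times> {p'..q'}. ob G (fst bd) (snd bd))"
    using ob_finite by (intro finite_SigmaI) auto
qed

lemma coef_expand:
  assumes "z \<in> cycs G"
  shows "finite {e. coef G z e \<noteq> 0}" "{e. coef G z e \<noteq> 0} \<subseteq> obasis G"
    and "z = (\<Sum>e | coef G z e \<noteq> 0. scl (coef G z e) e)"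
  using fn.finite_representation[of "obasis G" z] fn.representation_ne_zero[of "obasis G" z]
    fn.sum_nonzero_representation_eq[OF obasis_independent subsetD[OF cycs_span assms]]
  unfolding coef_def by auto

end

context interleaving
begin

interpretation S: interleaving H G \<epsilon> g f
  by (rule interleaving_sym)

text \<open>The composite of the two transports sums over the components whose round trip is
  \<open>K''\<close>, and these are the ones contained in \<open>K''\<close>.\<close>

lemma crossw_img_img:
  assumes u: "u \<in> UU" and z: "z \<in> cycs G" and i: "img u z z'" "S.img (shift_pt \<epsilon> u) z' z''"
    and K: "K'' \<in> comps G (win (shift_pt \<epsilon> (shift_pt \<epsilon> u)))"
  shows "crossw G (shift_pt \<epsilon> (shift_pt \<epsilon> u)) K'' z'' = crossw G (shift_pt \<epsilon> (shift_pt \<epsilon> u)) K'' z"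
proof -
  let ?v = "shift_pt \<epsilon> u" and ?w = "shift_pt \<epsilon> (shift_pt \<epsilon> u)"
  have v: "?v \<in> UU" "?w \<in> UU" using shift_pt_UU[OF _ eps] u by auto
  have uw: "u \<unlhd> ?w" using eps by (simp add: op_le_def shift_pt_def)
  let ?T = "{K'. K' \<in> comps H (win ?v) \<and> g ?v K' = K''}"
  let ?S = "{K. K \<in> comps G (win u) \<and> g ?v (f u K) = K''}"
  have fin: "finite ?S" "finite ?T" using X.finite_comps_win Y.finite_comps_win by auto
  have "crossw G ?w K'' z'' = (\<Sum>K'\<in>?T. crossw H ?v K' z')"
    using i(2) K unfolding S.img_def by blast
  also have "\<dots> = (\<Sum>K'\<in>?T. \<Sum>K | K \<in> ?S \<and> f u K = K'. crossw G u K z)"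
  proof (rule sum.cong[OF refl])
    fix K' assume K': "K' \<in> ?T"
    have "{K. K \<in> comps G (win u) \<and> f u K = K'} = {K. K \<in> ?S \<and> f u K = K'}" using K' by blast
    moreover have "crossw H ?v K' z' = (\<Sum>K | K \<in> comps G (win u) \<and> f u K = K'. crossw G u K z)"
      using i(1) K' unfolding img_def by blast
    ultimately show "crossw H ?v K' z' = (\<Sum>K | K \<in> ?S \<and> f u K = K'. crossw G u K z)" by (simp only:)
  qed
  also have "\<dots> = (\<Sum>K\<in>?S. crossw G u K z)"
    by (rule sum.group[OF fin]) (use f_comps[OF u] in blast)
  also have "?S = {K. K \<in> comps G (win u) \<and> K \<subseteq> K''}"
  proof (rule Collect_cong, rule conj_cong[OF refl])
    fix K assume Kc: "K \<in> comps G (win u)"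
    have s: "K \<subseteq> g ?v (f u K)" by (rule gf[OF u Kc])
    obtain a where "a \<in> K" using comps_nonempty[OF Kc] by blast
    thus "g ?v (f u K) = K'' \<longleftrightarrow> K \<subseteq> K''"
      using s comps_eqI[OF g_comps[OF v(1) f_comps[OF u Kc]] K, of a] by blast
  qed
  also have "(\<Sum>K\<in>\<dots>. crossw G u K z) = crossw G ?w K'' z"
    by (rule X.crossw_ext_cycs[OF u v(2) uw z K, symmetric])
  finally show ?thesis .
qed

text \<open>Evaluated at the centre of \<open>x'\<close>. The two maps enlarge this window by
  \<open>2 * \<epsilon>\<close> at each end, and \<open>x'\<close> still contains it because its
  length exceeds \<open>4 * \<epsilon>\<close>. There the double image has the crossing numbers of
  \<open>x\<close> and hence the same coefficient at \<open>x'\<close>; expanding the single image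
  in the basis of \<open>H\<close> gives the matrix product.\<close>

lemma omat_comp:
  assumes x: "x \<in> open_bars G" "x' \<in> open_bars G" "4 * \<epsilon> < of_int (snd (fst x')) - of_int (fst (fst x'))"
    and N: "finite N" "N \<subseteq> {y \<in> open_bars H. 2 * \<epsilon> < of_int (snd (fst y)) - of_int (fst (fst y))}"
    "\<And>y. y \<in> open_bars H \<Longrightarrow> 2 * \<epsilon> < of_int (snd (fst y)) - of_int (fst (fst y)) \<Longrightarrow>
      omat (snd x) y * S.omat (snd y) x' \<noteq> 0 \<Longrightarrow> y \<in> N"
  shows "(\<Sum>y\<in>N. omat (snd x) y * S.omat (snd y) x') = (if x = x' then 1 else 0)"
proof -
  let ?u = "mid x'" and ?v = "shift_pt \<epsilon> (mid x')" and ?w = "shift_pt \<epsilon> (shift_pt \<epsilon> (mid x'))"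
  have u: "?u \<in> UU" "?v \<in> UU" "?w \<in> UU"
    by (rule mid_UU shift_pt_UU[OF _ eps])+
  note z = X.obarsD(3)[OF x(1)]
  have x2: "2 * \<epsilon> < of_int (snd (fst x')) - of_int (fst (fst x'))" using x(3) eps by linarith
  have ww: "?w = shift_pt (2 * \<epsilon>) (mid x')" by (simp add: shift_pt_def)
  have aw: "alive x' ?w" unfolding ww by (rule S.alive_mid) (use x(3) in simp)
  obtain z' where z': "z' \<in> cycs H" "img ?u (snd x) z'" using img_exists[OF u(1) z] by blast
  obtain z'' where z'': "z'' \<in> cycs G" "S.img ?v z' z''" using S.img_exists[OF u(2) z'(1)] by blast
  \<comment> \<open>The intermediate bars that matter are longer than \<open>2 * \<epsilon>\<close>
    and contain the window enlarged once, so their coefficients can be read off from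
    \<open>z'\<close>.\<close>
  have yB: "2 * \<epsilon> < of_int (snd (fst y)) - of_int (fst (fst y))" "alive y ?v" "coef H z' (snd y) = omat (snd x) y"
    if y: "y \<in> open_bars H" "S.omat (snd y) x' \<noteq> 0" for y
  proof -
    have b: "of_int (fst (fst y)) \<le> of_int (fst (fst x')) + \<epsilon>" "of_int (snd (fst x')) \<le> of_int (snd (fst y)) + \<epsilon>"
      using S.omat_nonzero[OF Y.obarsD(4)[OF y(1)] x(2) x2 y(2)] by auto
    show "2 * \<epsilon> < of_int (snd (fst y)) - of_int (fst (fst y))" using b x(3) by linarith
    show a: "alive y ?v" using b x(3) by (auto simp: alive_def shift_pt_def mid_def field_simps)
    show "coef H z' (snd y) = omat (snd x) y" using omat_eq[OF u(1) z z' y(1) a] by simp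
  qed
  let ?T = "{e. coef H z' e \<noteq> 0}"
  let ?T' = "{y \<in> open_bars H. snd y \<in> ?T}"
  note ex = Y.coef_expand[OF z'(1)]
  have T: "?T = snd ` ?T'" using ex(2) Y.open_bars_snd by blast
  have inj: "inj_on snd ?T'" by (rule inj_on_subset[OF Y.inj_on_open_bars]) blast
  have fT: "finite ?T'" by (rule finite_imageD[OF _ inj]) (unfold T[symmetric], rule ex(1))
  have Tc: "e \<in> cycs H" if "e \<in> ?T" for e using that ex(2) Y.open_bars_snd Y.obarsD(3) by blast
  have "(\<Sum>y\<in>N. omat (snd x) y * S.omat (snd y) x') = (\<Sum>y\<in>?T'. coef H z' (snd y) * S.omat (snd y) x')"
  proof (rule sum.mono_neutral_cong[OF fT N(1)])
    have eq: "omat (snd x) y * S.omat (snd y) x' = coef H z' (snd y) * S.omat (snd y) x'"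
      if "y \<in> open_bars H" for y
      using yB(3)[OF that] by (cases "S.omat (snd y) x' = 0") simp_all
    show "coef H z' (snd y) * S.omat (snd y) x' = 0" if y: "y \<in> ?T' - N" for y
    proof (rule ccontr)
      have yo: "y \<in> open_bars H" using y by blast
      assume nz: "\<not> ?thesis"
      hence "S.omat (snd y) x' \<noteq> 0" by simp
      hence "y \<in> N" using N(3)[OF yo yB(1)[OF yo]] nz eq[OF yo] by simp
      thus False using y by blast
    qed
    show "omat (snd x) y * S.omat (snd y) x' = 0" if y: "y \<in> N - ?T'" for y
    proof -
      have yo: "y \<in> open_bars H" using y N(2) by blast
      hence "coef H z' (snd y) = 0" using y by blast
      thus ?thesis using eq[OF yo] by simp
    qed
    show "omat (snd x) y * S.omat (snd y) x' = coef H z' (snd y) * S.omat (snd y) x'" if "y \<in> N \<inter> ?T'" for y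
      using that by (intro eq) blast
  qed
  also have "\<dots> = (\<Sum>e\<in>?T. coef H z' e * S.omat e x')"
    using sum.reindex[OF inj, of "\<lambda>e. coef H z' e * S.omat e x'"] unfolding T[symmetric] comp_def by simp
  also have "\<dots> = S.omat z' x'"
    by (rule conjunct1[OF S.omat_sum[OF ex(1) Tc x(2) x2, of "coef H z'"], folded ex(3), symmetric])
  also have "\<dots> = coef G z'' (snd x')"
    by (rule S.omat_eq[OF u(2) z'(1) z'' x(2) aw])
  also have "\<dots> = coef G (snd x) (snd x')"
  proof -
    have "coef G (z'' - snd x) (snd x') = 0"
    proof (rule X.coef_zero_if_crossing_zero[OF _ u(3) _ X.obarsD(1)[OF x(2)]])
      show "z'' - snd x \<in> cycs G" by (rule fn.subspace_diff[OF X.subspace_cycs z''(1) z])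
      show "crossw G ?w K (z'' - snd x) = 0" if "K \<in> comps G (win ?w)" for K
        unfolding X.crossw_diff using crossw_img_img[OF u(1) z z'(2) z''(2) that] by simp
    qed (use aw in \<open>auto simp: alive_def\<close>)
    thus ?thesis using X.coef_diff[OF z''(1) z] by simp
  qed
  also have "\<dots> = (if x = x' then 1 else 0)"
    using X.coef_basis[OF X.obarsD(2)[OF x(1)]] inj_onD[OF X.inj_on_open_bars _ x(1,2)] by auto
  finally show ?thesis .
qed

lemma open_bars_injection:
  assumes L: "L = {x \<in> open_bars G. 4 * \<epsilon> < of_int (snd (fst x)) - of_int (fst (fst x))}"
  shows "\<exists>h. inj_on h L \<and> (\<forall>x\<in>L. h x \<in> open_bars H \<and>
    near \<epsilon> (ereal (of_int (fst (fst x)))) (ereal (of_int (fst (fst (h x))))) \<and>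
    near \<epsilon> (ereal (of_int (snd (fst x)))) (ereal (of_int (snd (fst (h x))))))"
proof -
  let ?B = "{y \<in> open_bars H. 2 * \<epsilon> < of_int (snd (fst y)) - of_int (fst (fst y))}"
  have LG: "x \<in> open_bars G" "2 * \<epsilon> < of_int (snd (fst x)) - of_int (fst (fst x))"
    "4 * \<epsilon> < of_int (snd (fst x)) - of_int (fst (fst x))" if "x \<in> L" for x
    using that L eps by auto
  \<comment> \<open>Left endpoints are negated, since a nonzero entry means that the target bar lies
    in the source bar up to \<open>\<epsilon>\<close>. The sum that orders the bars is then their
    length.\<close>
  have "\<exists>h. inj_on h L \<and> (\<forall>x\<in>L. h x \<in> ?B \<and>
    near \<epsilon> (ereal (- of_int (fst (fst x)))) (ereal (- of_int (fst (fst (h x))))) \<and>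
    near \<epsilon> (ereal (of_int (snd (fst x)))) (ereal (of_int (snd (fst (h x))))))"
  proof (rule bars_injection[where P = "\<lambda>x. omat (snd x)" and R = "\<lambda>y. S.omat (snd y)"])
    show "0 \<le> \<epsilon>" by (rule eps)
    show "ereal (- of_int (fst (fst x))) \<noteq> \<infinity>" for x :: "(int \<times> int) \<times> ('a node \<Rightarrow> real)" by simp
    show "ereal (- of_int (fst (fst y))) \<le> ereal (- of_int (fst (fst x))) + ereal \<epsilon> \<and>
        real_of_int (snd (fst y)) \<le> of_int (snd (fst x)) + \<epsilon>"
      if "x \<in> L" "y \<in> ?B" "omat (snd x) y \<noteq> 0" for x y
      using omat_nonzero[OF X.obarsD(4)[OF LG(1)[OF that(1)]] _ _ that(3)] that(2) by simp
    show "ereal (- of_int (fst (fst x))) \<le> ereal (- of_int (fst (fst y))) + ereal \<epsilon> \<and>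
        real_of_int (snd (fst x)) \<le> of_int (snd (fst y)) + \<epsilon>"
      if "x \<in> L" "y \<in> ?B" "S.omat (snd y) x \<noteq> 0" for x y
      using S.omat_nonzero[OF Y.obarsD(4) LG(1,2)[OF that(1)] that(3)] that(2) by simp
    show "finite {y \<in> ?B. near \<epsilon> (ereal (- of_int (fst (fst x)))) (ereal (- of_int (fst (fst y)))) \<and>
        near \<epsilon> (ereal (of_int (snd (fst x)))) (ereal (of_int (snd (fst y))))}"
      for x :: "(int \<times> int) \<times> ('a node \<Rightarrow> real)"
      by (rule finite_subset[OF _ Y.finite_open_bars_box[of "\<lfloor>fst (fst x) - \<epsilon>\<rfloor>" "\<lceil>fst (fst x) + \<epsilon>\<rceil>"
              "\<lfloor>snd (fst x) - \<epsilon>\<rfloor>" "\<lceil>snd (fst x) + \<epsilon>\<rceil>"]])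
        (auto simp: near_ereal, linarith+)
    show "(\<Sum>y\<in>N. omat (snd x) y * S.omat (snd y) x') = (if x = x' then 1 else 0)"
      if "x \<in> L" "x' \<in> L" "finite N" "N \<subseteq> ?B" "\<And>y. y \<in> ?B \<Longrightarrow> omat (snd x) y * S.omat (snd y) x' \<noteq> 0 \<Longrightarrow> y \<in> N"
      for x x' N
      by (rule omat_comp[OF LG(1)[OF that(1)] LG(1,3)[OF that(2)] that(3,4)]) (use that(5) in blast)
  qed
  moreover have "near \<epsilon> (ereal (- a)) (ereal (- b)) \<longleftrightarrow> near \<epsilon> (ereal a) (ereal b)" for a b
    unfolding near_ereal by linarith
  ultimately show ?thesis by auto
qed

end

theorem open_bars_matching:
  assumes "interleaving G H \<epsilon> f g"
  shows "\<exists>m. m \<subseteq> open_bars G \<times> open_bars H \<and> partial_inj m \<and>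
    (\<forall>(x, y)\<in>m. near \<epsilon> (ereal (of_int (fst (fst x)))) (ereal (of_int (fst (fst y)))) \<and>
      near \<epsilon> (ereal (of_int (snd (fst x)))) (ereal (of_int (snd (fst y))))) \<and>
    (\<forall>x\<in>open_bars G - Domain m. of_int (snd (fst x)) - of_int (fst (fst x)) \<le> 4 * \<epsilon>) \<and>
    (\<forall>y\<in>open_bars H - Range m. of_int (snd (fst y)) - of_int (fst (fst y)) \<le> 4 * \<epsilon>)"
proof -
  interpret interleaving G H \<epsilon> f g by fact
  interpret S: interleaving H G \<epsilon> g f by (rule interleaving_sym)
  define L where "L = {x \<in> open_bars G. 4 * \<epsilon> < of_int (snd (fst x)) - of_int (fst (fst x))}"
  define M where "M = {x \<in> open_bars H. 4 * \<epsilon> < of_int (snd (fst x)) - of_int (fst (fst x))}"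
  let ?r = "{(x, y). near \<epsilon> (ereal (of_int (fst (fst x)))) (ereal (of_int (fst (fst y)))) \<and>
      near \<epsilon> (ereal (of_int (snd (fst x)))) (ereal (of_int (snd (fst y))))}"
  obtain \<alpha> where \<alpha>: "inj_on \<alpha> L" "\<And>x. x \<in> L \<Longrightarrow> \<alpha> x \<in> open_bars H \<and> (x, \<alpha> x) \<in> ?r"
    using open_bars_injection[OF L_def] by auto
  obtain \<beta> where \<beta>: "inj_on \<beta> M" and "\<And>y. y \<in> M \<Longrightarrow> \<beta> y \<in> open_bars G \<and>
      near \<epsilon> (ereal (of_int (fst (fst y)))) (ereal (of_int (fst (fst (\<beta> y))))) \<and>
      near \<epsilon> (ereal (of_int (snd (fst y)))) (ereal (of_int (snd (fst (\<beta> y)))))"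
    using S.open_bars_injection[OF M_def] by blast
  hence \<beta>': "\<beta> y \<in> open_bars G \<and> (\<beta> y, y) \<in> ?r" if "y \<in> M" for y
    using that near_sym unfolding mem_Collect_eq case_prod_conv by metis
  have "L \<subseteq> open_bars G" "M \<subseteq> open_bars H" by (auto simp: L_def M_def)
  then obtain m where m: "m \<subseteq> ?r \<inter> (open_bars G \<times> open_bars H)" "partial_inj m" "L \<subseteq> Domain m" "M \<subseteq> Range m"
    using banach_matching[OF _ \<alpha> _ \<beta> \<beta>'] by blast
  have "of_int (snd (fst x)) - of_int (fst (fst x)) \<le> 4 * \<epsilon>" if "x \<in> open_bars G - Domain m" for x
  proof -
    have "x \<notin> L" using that m(3) by blast
    thus ?thesis using that unfolding L_def by (simp add: not_less)
  qed
  moreover have "of_int (snd (fst y)) - of_int (fst (fst y)) \<le> 4 * \<epsilon>" if "y \<in> open_bars H - Range m" for y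
  proof -
    have "y \<notin> M" using that m(4) by blast
    thus ?thesis using that unfolding M_def by (simp add: not_less)
  qed
  ultimately show ?thesis using m(1,2) by (intro exI[of _ m]) blast
qed

section \<open>Counting open bars\<close>

context reeb
begin

text \<open>Each node of the leaf level attaches to exactly one component over \<open>S\<close>; by
  \<open>adj\<close> none of them is isolated.\<close>

lemma card_comps_odd_leaf:
  assumes p: "odd p" "p \<notin> S" "\<not> (p - 1 \<in> S \<and> p + 1 \<in> S)" and adj: "p - 1 \<in> S \<or> p + 1 \<in> S"
  shows "card (comps G (insert p S)) = card (comps G S)"
proof (rule bij_betw_same_card[of "\<lambda>K. K \<inter> nodes G S"], rule bij_betwI')
  have ne: "\<exists>a. a \<in> K \<inter> nodes G S" if K: "K \<in> comps G (insert p S)" for K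
  proof -
    obtain a where a: "a \<in> K" using comps_nonempty[OF K] by blast
    have an: "a \<in> nodes G (insert p S)" using comps_sub[OF K] a by blast
    show ?thesis
    proof (cases "fst a = p")
      case True
      hence o: "odd (fst a)" using p(1) by simp
      show ?thesis
        using adj
      proof
        assume s: "p - 1 \<in> S"
        have "dnn G a \<in> K"
          by (rule comps_closed[OF K a edges_linked[OF upn_dnn(4)[OF an o]]]) (use s True in simp)
        moreover have "dnn G a \<in> nodes G S"
          using upn_dnn(2)[OF an o] nodes_mono[of "{fst a - 1}" S G] s True by auto
        ultimately show ?thesis by blast
      next
        assume s: "p + 1 \<in> S"
        have "upn G a \<in> K"
          by (rule comps_closed[OF K a edges_linked[OF upn_dnn(3)[OF an o]]]) (use s True in simp)
        moreover have "upn G a \<in> nodes G S"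
          using upn_dnn(1)[OF an o] nodes_mono[of "{fst a + 1}" S G] s True by auto
        ultimately show ?thesis by blast
      qed
    next
      case False
      thus ?thesis using a an by (intro exI[of _ a]) (auto simp: nodes_def)
    qed
  qed
  show c: "K \<inter> nodes G S \<in> comps G S" if "K \<in> comps G (insert p S)" for K
    using comps_leaf[OF p that] ne[OF that] by blast
  show "K \<inter> nodes G S = K' \<inter> nodes G S \<longleftrightarrow> K = K'"
    if "K \<in> comps G (insert p S)" "K' \<in> comps G (insert p S)" for K K'
    using ne[OF that(1)] comps_eqI[OF that] by blast
  fix L assume L: "L \<in> comps G S"
  have sub: "S \<subseteq> insert p S" by blast
  obtain a where a: "a \<in> L" using comps_nonempty[OF L] by blast
  have "a \<in> ext G (insert p S) L \<inter> nodes G S" using a ext_sub[OF L sub] comps_sub[OF L] by blast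
  hence "L = ext G (insert p S) L \<inter> nodes G S"
    using comps_eqI[OF L c[OF ext_comps[OF L sub]] a] by blast
  thus "\<exists>K\<in>comps G (insert p S). L = K \<inter> nodes G S" using ext_comps[OF L sub] by blast
qed

text \<open>Every node at the odd level \<open>r\<close> has an edge to \<open>p\<close>, and from
  \<open>S\<close> the level \<open>p\<close> is reached only through \<open>r\<close>. So avoiding
  \<open>r\<close> before \<open>p\<close> is added amounts to avoiding \<open>p\<close>
  afterwards.\<close>

lemma comps_even_leaf:
  assumes p: "even p" "p \<notin> S" and r: "r \<in> S" "p = r + 1 \<or> p = r - 1"
    and other: "\<And>s. s \<in> S \<Longrightarrow> s = p + 1 \<or> s = p - 1 \<Longrightarrow> s = r"
  shows "{K \<in> comps G S. r \<notin> lev K} = {K \<in> comps G (insert p S). p \<notin> lev K}"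
proof (intro set_eqI iffI)
  fix K assume "K \<in> {K \<in> comps G S. r \<notin> lev K}"
  hence K: "K \<in> comps G S" "r \<notin> lev K" by auto
  have "K \<in> comps G (insert p S)"
  proof (rule comps_extend[OF K(1)])
    fix a b assume a: "a \<in> K" and ab: "(a, b) \<in> edges G (insert p S) \<or> (b, a) \<in> edges G (insert p S)"
    have aS: "fst a \<in> S" using comps_lev[OF K(1)] a unfolding lev_def by blast
    have nb: "fst b = fst a + 1 \<or> fst b = fst a - 1" using ab edges_fst by fastforce
    show "fst b \<in> S"
    proof (rule ccontr)
      assume "fst b \<notin> S"
      moreover have "b \<in> nodes G (insert p S)" using ab edges_nodes by blast
      ultimately have "fst b = p" using fst_nodes by blast
      hence "fst a = r" using other[OF aS] nb by auto
      thus False using K(2) a unfolding lev_def by blast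
    qed
  qed blast
  thus "K \<in> {K \<in> comps G (insert p S). p \<notin> lev K}" using comps_lev[OF K(1)] p(2) by blast
next
  fix K assume "K \<in> {K \<in> comps G (insert p S). p \<notin> lev K}"
  hence K: "K \<in> comps G (insert p S)" "p \<notin> lev K" by auto
  have "K \<in> comps G S" by (rule comps_restrict[OF K(1)]) (use comps_lev[OF K(1)] K(2) in blast)+
  moreover have "r \<notin> lev K"
  proof
    assume "r \<in> lev K"
    then obtain a where a: "a \<in> K" "fst a = r" unfolding lev_def by blast
    have an: "a \<in> nodes G (insert p S)" using comps_sub[OF K(1)] a by blast
    have o: "odd (fst a)" using p(1) r(2) a(2) by auto
    from r(2) have "\<exists>b\<in>K. fst b = p"
    proof
      assume "p = r + 1"
      thus ?thesis using comps_closed[OF K(1) a(1) edges_linked[OF upn_dnn(3)[OF an o]]] a(2)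
        by (intro bexI[of _ "upn G a"]) (simp_all add: upn_def)
    next
      assume "p = r - 1"
      thus ?thesis using comps_closed[OF K(1) a(1) edges_linked[OF upn_dnn(4)[OF an o]]] a(2)
        by (intro bexI[of _ "dnn G a"]) (simp_all add: dnn_def)
    qed
    thus False using K(2) unfolding lev_def by blast
  qed
  ultimately show "K \<in> {K \<in> comps G S. r \<notin> lev K}" by blast
qed

text \<open>Level sets are convex, so a component that reaches both ends reaches all of
  \<open>{x..y}\<close>.\<close>

lemma full_inclusion_exclusion:
  assumes "x \<le> y"
  shows "int (full G {x..y}) = int (card (comps G {x..y})) - int (card {K \<in> comps G {x..y}. x \<notin> lev K})
    - int (card {K \<in> comps G {x..y}. y \<notin> lev K})
    + int (card ({K \<in> comps G {x..y}. x \<notin> lev K} \<inter> {K \<in> comps G {x..y}. y \<notin> lev K}))"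
proof -
  let ?C = "comps G {x..y}"
  let ?A = "{K \<in> ?C. x \<notin> lev K}" and ?B = "{K \<in> ?C. y \<notin> lev K}"
  have fin: "finite ?C" by (rule finite_comps) simp
  have f: "finite ?A" "finite ?B" using fin by auto
  have "comps_at G {x..y} {x..y} = ?C - (?A \<union> ?B)"
  proof (intro set_eqI iffI)
    fix K assume "K \<in> comps_at G {x..y} {x..y}"
    thus "K \<in> ?C - (?A \<union> ?B)" using assms by (auto simp: comps_at_def)
  next
    fix K assume "K \<in> ?C - (?A \<union> ?B)"
    hence K: "K \<in> ?C" "x \<in> lev K" "y \<in> lev K" by auto
    have "{x..y} \<subseteq> lev K" using lev_convex[OF K(1)] K(2,3) unfolding convex_ints_def by fastforce
    thus "K \<in> comps_at G {x..y} {x..y}" using comps_lev[OF K(1)] K(1) by (auto simp: comps_at_def)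
  qed
  hence "full G {x..y} = card ?C - card (?A \<union> ?B)"
    unfolding full_def using card_Diff_subset[of "?A \<union> ?B" ?C] f by auto
  moreover have "card (?A \<union> ?B) \<le> card ?C" by (rule card_mono[OF fin]) blast
  moreover have "card ?A + card ?B = card (?A \<union> ?B) + card (?A \<inter> ?B)" by (rule card_Un_Int[OF f])
  ultimately show ?thesis by linarith
qed

text \<open>In the alternating sum of four inclusion-exclusion formulas the components that miss an
  end cancel, because \<open>comps_even_leaf\<close> identifies them across the four
  intervals.\<close>

lemma dgz_open:
  assumes "b < d"
  shows "dgz G {2 * b + 1..2 * d - 1} = int (card (comps G {2 * b + 1..2 * d - 1})) - int (card (comps G {2 * b..2 * d - 1}))
    - int (card (comps G {2 * b + 1..2 * d})) + int (card (comps G {2 * b..2 * d}))"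
proof -
  define S0 S1 S2 S3 where "S0 = {2 * b + 1..2 * d - 1}" and "S1 = {2 * b..2 * d - 1}"
    and "S2 = {2 * b + 1..2 * d}" and "S3 = {2 * b..2 * d}"
  note S = S0_def S1_def S2_def S3_def
  have ins: "S1 = insert (2 * b) S0" "S2 = insert (2 * d) S0" "S3 = insert (2 * b) S2" "S3 = insert (2 * d) S1"
    using assms by (auto simp: S)
  define A where "A n T = {K \<in> comps G T. n \<notin> lev K}" for n T
  have 1: "A (2 * b + 1) S0 = A (2 * b) S1" "A (2 * b + 1) S2 = A (2 * b) S3"
    unfolding A_def ins(1,3) by (rule comps_even_leaf; use assms in \<open>auto simp: S\<close>)+
  have 2: "A (2 * d - 1) S0 = A (2 * d) S2" "A (2 * d - 1) S1 = A (2 * d) S3"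
    unfolding A_def ins(2,4) by (rule comps_even_leaf; use assms in \<open>auto simp: S\<close>)+
  have Int1: "A n T \<inter> A m T = A n T \<inter> {K. m \<notin> lev K}" and Int2: "A n T \<inter> A m T = {K. n \<notin> lev K} \<inter> A m T" for n m T
    unfolding A_def by blast+
  have 3: "A (2 * b) S1 \<inter> A (2 * d - 1) S1 = A (2 * b + 1) S0 \<inter> A (2 * d - 1) S0"
    using Int1[of "2 * b" S1 "2 * d - 1"] Int1[of "2 * b + 1" S0 "2 * d - 1"] 1(1) by metis
  have 4: "A (2 * b + 1) S2 \<inter> A (2 * d) S2 = A (2 * b + 1) S0 \<inter> A (2 * d - 1) S0"
    using Int2[of "2 * b + 1" S2 "2 * d"] Int2[of "2 * b + 1" S0 "2 * d - 1"] 2(1) by metis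
  have 5: "A (2 * b) S3 \<inter> A (2 * d) S3 = A (2 * b + 1) S0 \<inter> A (2 * d - 1) S0"
    using Int1[of "2 * b" S3 "2 * d"] Int1[of "2 * b + 1" S2 "2 * d"] 1(2) 4 by metis
  have f: "int (full G {x..y}) = int (card (comps G {x..y})) - int (card (A x {x..y})) -
      int (card (A y {x..y})) + int (card (A x {x..y} \<inter> A y {x..y}))" if "x \<le> y" for x y
    unfolding A_def by (rule full_inclusion_exclusion[OF that])
  have lo: "lo S0 = {2 * b}" and hi: "hi S0 = {2 * d}" using assms by (auto simp: S lo_def hi_def)
  have c: "convex_ints S0" "S0 \<noteq> {}" using assms by (auto simp: S convex_ints_def)
  have "lo (insert (2 * d) S0) = lo S0" by (rule lo_insert_hi[OF c(1)]) (simp add: hi)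
  hence "dgz G S0 = int (full G S0) - int (full G S1) - int (full G S2) + int (full G S3)"
    unfolding dgz_eq[OF c] lb_def hi lo by (simp add: lo ins insert_commute)
  also have "\<dots> = int (card (comps G S0)) - int (card (comps G S1)) - int (card (comps G S2)) + int (card (comps G S3))"
    using f[of "2 * b + 1" "2 * d - 1", folded S] f[of "2 * b" "2 * d - 1", folded S]
      f[of "2 * b + 1" "2 * d", folded S] f[of "2 * b" "2 * d", folded S] assms 1 2 3 4 5
    by simp
  finally show ?thesis unfolding S .
qed

lemma card_oddn_step:
  assumes "b < d"
  shows "card (oddn G b d) = card (oddn G b (d - 1)) + card (nodes G {2 * d - 1})"
proof -
  have "oddn G b d = oddn G b (d - 1) \<union> nodes G {2 * d - 1}"
  proof (intro set_eqI iffI)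
    fix a assume a: "a \<in> oddn G b d"
    have "odd (fst a)" "2 * b < fst a" "fst a < 2 * d" using a by (auto simp: oddn_def nodes_def)
    hence "fst a = 2 * d - 1 \<or> fst a < 2 * (d - 1)" by presburger
    thus "a \<in> oddn G b (d - 1) \<union> nodes G {2 * d - 1}" using a by (auto simp: oddn_def nodes_def)
  qed (use assms in \<open>auto simp: oddn_def nodes_def\<close>)
  moreover have "oddn G b (d - 1) \<inter> nodes G {2 * d - 1} = {}" by (auto simp: oddn_def nodes_def)
  ultimately show ?thesis
    using card_Un_disjoint[OF finite_oddn finite_nodes, of "{2 * d - 1}" b "d - 1"] by simp
qed

lemma card_evn_step:
  assumes "b \<le> d"
  shows "card (evn G b d) = card (evn G b (d - 1)) + card (nodes G {2 * d})"
proof -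
  have "evn G b d = evn G b (d - 1) \<union> nodes G {2 * d}"
  proof (intro set_eqI iffI)
    fix a assume a: "a \<in> evn G b d"
    have "even (fst a)" "2 * b \<le> fst a" "fst a \<le> 2 * d" using a by (auto simp: evn_def nodes_def)
    hence "fst a = 2 * d \<or> fst a \<le> 2 * (d - 1)" by presburger
    thus "a \<in> evn G b (d - 1) \<union> nodes G {2 * d}" using a by (auto simp: evn_def nodes_def)
  qed (use assms in \<open>auto simp: evn_def nodes_def\<close>)
  moreover have "evn G b (d - 1) \<inter> nodes G {2 * d} = {}" by (auto simp: evn_def nodes_def)
  ultimately show ?thesis
    using card_Un_disjoint[OF finite_evn finite_nodes, of "{2 * d}" b "d - 1"] by simp
qed

lemma card_comps_point:
  assumes "odd n"
  shows "card (comps G {n}) = card (nodes G {n})"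
proof -
  have "edges G {n} = {}" by (auto simp: edges_def)
  hence "linked G {n} = Id" by (simp add: linked_def)
  hence "cmp G {n} = (\<lambda>a. {a})" by (auto simp: cmp_def)
  hence "comps G {n} = (\<lambda>a. {a}) ` nodes G {n}" by (simp add: comps_def)
  thus ?thesis by (simp add: card_image)
qed

text \<open>Second differences of Euler's formula: the numbers of nodes cancel, and the numbers of
  components agree with \<open>dgz_open\<close> after odd end levels are removed, which does not
  change them.\<close>

lemma card_ob_dgz:
  assumes bd: "b < d"
  shows "int (card (ob G b d)) = dgz G {2 * b + 1..2 * d - 1}"
proof -
  have leaf: "card (comps G {x..2 * d - 1}) = card (comps G {x..2 * d - 2})" if "x \<le> 2 * d - 2" for x
  proof -
    have "{x..2 * d - 1} = insert (2 * d - 1) {x..2 * d - 2}" using that by auto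
    thus ?thesis using card_comps_odd_leaf[of "2 * d - 1" "{x..2 * d - 2}"] that by simp
  qed
  have leaf': "card (comps G {2 * b + 1..y}) = card (comps G {2 * b + 2..y})" if "2 * b + 2 \<le> y" for y
  proof -
    have "{2 * b + 1..y} = insert (2 * b + 1) {2 * b + 2..y}" using that by auto
    thus ?thesis using card_comps_odd_leaf[of "2 * b + 1" "{2 * b + 2..y}"] that by simp
  qed
  note d1 = dim_cyc[of b d] dim_cyc[of b "d - 1"] dim_cyc[of "b + 1" d]
  have w: "2 * (d - 1) = 2 * d - 2" "2 * (b + 1) = 2 * b + 2" by simp_all
  show ?thesis
  proof (cases "d = b + 1")
    \<comment> \<open>The innermost cycle space is trivial and lies outside the range of
      \<open>dim_cyc\<close>; instead the interval is the single odd level \<open>2 * b + 1\<close>,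
      whose components are its nodes.\<close>
    case True
    have "fn.dim (cyc G (b + 1) (d - 1)) = 0" 
      using cyc_triv[of "d - 1" "b + 1" G] True fn.dim_span[of "{} :: ('a node \<Rightarrow> real) set"]
        fn.dim_eq_card_independent[of "{} :: ('a node \<Rightarrow> real) set", OF fn.independent_empty]
      by simp
    moreover have "card (evn G (b + 1) (d - 1)) = 0"
      using True by (simp add: evn_def nodes_def)
    moreover have "card (oddn G (b + 1) d) = 0" "card (oddn G b (d - 1)) = 0"
      using True by (simp_all add: oddn_def nodes_def)
    moreover have e: "{2 * b + 1..2 * d - 1} = {2 * b + 1}" "2 * d - 1 = 2 * b + 1" using True by auto
    have "card (comps G {2 * b + 1..2 * d - 1}) = card (nodes G {2 * d - 1})"
      unfolding e(1) unfolding e(2) by (rule card_comps_point) simp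
    ultimately show ?thesis
      using card_ob[OF bd] dgz_open[OF bd] d1 leaf[of "2 * b"] leaf'[of "2 * d"] bd card_oddn_step[OF bd]
        card_evn_step[of b d] card_evn_step[of "b + 1" d] unfolding w by simp
  next
    case False
    hence lt: "b + 1 < d" using bd by simp
    have "card (comps G {2 * b + 1..2 * d - 1}) = card (comps G {2 * b + 2..2 * d - 2})"
      using leaf[of "2 * b + 1"] leaf'[of "2 * d - 2"] lt by simp
    thus ?thesis
      using card_ob[OF bd] dgz_open[OF bd] d1 dim_cyc[of "b + 1" "d - 1"] leaf[of "2 * b"] leaf'[of "2 * d"] lt
        card_oddn_step[OF bd] card_oddn_step[OF lt] card_evn_step[of b d] card_evn_step[of "b + 1" d]
      unfolding w by simp
  qed
qed

end

subsection \<open>From diagrams to zigzags\<close>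

definition pt :: "int \<Rightarrow> int \<times> int" where
  "pt n = ((n + 1) div 2, n div 2)"

definition pos :: "int \<times> int \<Rightarrow> int" where
  "pos p = fst p + snd p"

definition zz :: "(int, 'a) diagram \<Rightarrow> 'a zigzag" where
  "zz M = \<lparr>Lev = (\<lambda>n. Ob M (pt n)), Up = (\<lambda>n. Mor M (pt n) (pt (n + 1))), Dn = (\<lambda>n. Mor M (pt n) (pt (n - 1)))\<rparr>"

definition nu :: "'a node \<Rightarrow> (int \<times> int) \<times> 'a" where
  "nu a = (pt (fst a), snd a)"

definition un :: "(int \<times> int) \<times> 'a \<Rightarrow> 'a node" where
  "un a = (pos (fst a), snd a)"

lemma pos_pt [simp]: "pos (pt n) = n"
  unfolding pos_def pt_def fst_conv snd_conv by presburger

lemma pt_pos: "p \<in> ZZ \<Longrightarrow> pt (pos p) = p"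
  by (auto simp: pos_def pt_def ZZ_def)

lemma pt_ZZ [simp]: "pt n \<in> ZZ"
  unfolding pt_def ZZ_def mem_Collect_eq case_prod_conv by presburger

lemma inj_pt: "inj pt"
  by (metis injI pos_pt)

lemma pt_eq [simp]: "pt m = pt n \<longleftrightarrow> m = n"
  by (metis pos_pt)

lemma mem_pt_image [simp]: "pt n \<in> pt ` S \<longleftrightarrow> n \<in> S"
  by (auto simp: inj_pt)

lemma ZZ_pt: "ZZ = range pt"
proof (intro set_eqI iffI)
  fix p assume "p \<in> ZZ"
  thus "p \<in> range pt" using pt_pos rangeI by metis
next
  fix p assume "p \<in> range pt"
  then obtain n where "p = pt n" by (rule rangeE)
  thus "p \<in> ZZ" by simp
qed

lemma pt_pos_image:
  assumes "I \<subseteq> ZZ"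
  shows "pt ` pos ` I = I"
proof -
  have "(\<lambda>p. pt (pos p)) ` I = (\<lambda>p. p) ` I" by (rule image_cong[OF refl pt_pos[OF subsetD[OF assms]]])
  thus ?thesis by (simp only: image_image image_ident)
qed

lemma pt_le: "pt m \<unlhd> pt n \<longleftrightarrow> m = n \<or> odd m \<and> (n = m + 1 \<or> n = m - 1)"
proof -
  have e: "pt (2 * a) = (a, a)" "pt (2 * a - 1) = (a, a - 1)" for a by (simp_all add: pt_def)
  obtain a where a: "m = 2 * a \<or> m = 2 * a - 1" by (metis evenE oddE add_diff_cancel_right' distrib_left mult_1_right)
  obtain c where c: "n = 2 * c \<or> n = 2 * c - 1" by (metis evenE oddE add_diff_cancel_right' distrib_left mult_1_right)
  from a c show ?thesis by (elim disjE) (simp_all add: op_le_def e, presburger+)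
qed

lemma un_nu [simp]: "un (nu a) = a"
  by (simp add: un_def nu_def)

lemma un_nu_image [simp]: "un ` nu ` K = K"
  by (simp add: image_image)

lemma ZZ_below_pt: "ZZ_below u = pt ` win u"
  unfolding ZZ_below_def ZZ_pt win_def by (auto simp: pt_def)

lemma colim_rel_step:
  assumes "reeb_graph M" and "x \<in> Ob M (pt m)" "m \<in> S" "n \<in> S" "pt m \<unlhd> pt n"
  shows "((m, x), (n, Mor M (pt m) (pt n) x)) \<in> linked (zz M) S"
proof (cases "m = n")
  case True
  have "Mor M (pt m) (pt m) x = x"
    using assms(1,2) unfolding reeb_graph_def finset_functor_def is_functor_def by simp
  thus ?thesis using True by simp
next
  case False
  hence "odd m" "n = m + 1 \<or> n = m - 1" using assms(5) pt_le by blast+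
  hence "((m, x), (n, Mor M (pt m) (pt n) x)) \<in> edges (zz M) S"
    using assms(2-4) by (auto simp: edges_def zz_def)
  thus ?thesis by (rule edges_linked)
qed

lemma colim_rel_iff:
  assumes M: "reeb_graph M"
  shows "(nu a, y) \<in> colim_rel (pt ` S) M \<longleftrightarrow> (\<exists>b. y = nu b \<and> (a, b) \<in> linked (zz M) S)"
proof -
  let ?R = "{((p, x), (q, Mor M p q x)) | p q x. p \<in> pt ` S \<and> q \<in> pt ` S \<and> p \<unlhd> q \<and> x \<in> Ob M p}"
  have cr: "colim_rel (pt ` S) M = (?R \<union> ?R\<inverse>)\<^sup>*" by (simp add: colim_rel_def Let_def)
  have R: "\<exists>m n x. u = nu (m, x) \<and> v = nu (n, Mor M (pt m) (pt n) x) \<and> ((m, x), (n, Mor M (pt m) (pt n) x)) \<in> linked (zz M) S"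
    if uv: "(u, v) \<in> ?R" for u v
  proof -
    obtain p q x where 1: "u = (p, x)" "v = (q, Mor M p q x)" "p \<in> pt ` S" "q \<in> pt ` S" "p \<unlhd> q" "x \<in> Ob M p"
      using uv by blast
    obtain m n where "p = pt m" "q = pt n" "m \<in> S" "n \<in> S" using 1(3,4) by blast
    thus ?thesis using 1 colim_rel_step[OF M] by (auto simp: nu_def intro!: exI[of _ m] exI[of _ n] exI[of _ x])
  qed
  show ?thesis
  proof
    assume "(nu a, y) \<in> colim_rel (pt ` S) M"
    thus "\<exists>b. y = nu b \<and> (a, b) \<in> linked (zz M) S"
      unfolding cr
    proof (induction rule: rtrancl_induct)
      case base
      show ?case using linked_refl by blast
    next
      case (step y z)
      then obtain b where b: "y = nu b" "(a, b) \<in> linked (zz M) S" by blast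
      have "\<exists>c. z = nu c \<and> (b, c) \<in> linked (zz M) S"
      proof (cases "(y, z) \<in> ?R")
        case True
        show ?thesis using R[OF True] b(1) by (metis un_nu)
      next
        case False
        hence "(z, y) \<in> ?R" using step.hyps(2) by blast
        from R[OF this] show ?thesis using b(1) linked_sym by (metis un_nu)
      qed
      thus ?case using b(2) linked_trans by blast
    qed
  next
    assume "\<exists>b. y = nu b \<and> (a, b) \<in> linked (zz M) S"
    then obtain b where y: "y = nu b" and ab: "(a, b) \<in> linked (zz M) S" by blast
    have edges: "(nu c, nu d) \<in> ?R" if "(c, d) \<in> edges (zz M) S" for c d
    proof -
      have "\<exists>n n' x. c = (n, x) \<and> d = (n', Mor M (pt n) (pt n') x) \<and> odd n \<and> (n' = n + 1 \<or> n' = n - 1) \<and>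
          x \<in> Ob M (pt n) \<and> n \<in> S \<and> n' \<in> S"
        using that unfolding edges_def zz_def by auto
      then obtain n n' x where c: "c = (n, x)" "d = (n', Mor M (pt n) (pt n') x)" "odd n"
        "n' = n + 1 \<or> n' = n - 1" "x \<in> Ob M (pt n)" "n \<in> S" "n' \<in> S" by blast
      have "pt n \<unlhd> pt n'" using c(3,4) pt_le by blast
      thus ?thesis using c(5-7) unfolding c(1,2) nu_def fst_conv snd_conv by blast
    qed
    have "(nu a, nu b) \<in> (?R \<union> ?R\<inverse>)\<^sup>*"
      using ab
    proof (induction rule: linked_induct)
      case (step b c)
      hence "(nu b, nu c) \<in> ?R \<union> ?R\<inverse>" using edges by blast
      thus ?case using step.IH by (rule rtrancl_into_rtrancl[rotated])
    qed simp
    thus "(nu a, y) \<in> colim_rel (pt ` S) M" unfolding cr y .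
  qed
qed

lemma colim_rel_image:
  assumes "reeb_graph M"
  shows "colim_rel (pt ` S) M `` {nu a} = nu ` cmp (zz M) S a"
proof (intro set_eqI)
  fix y
  have "y \<in> colim_rel (pt ` S) M `` {nu a} \<longleftrightarrow> (\<exists>b. y = nu b \<and> (a, b) \<in> linked (zz M) S)"
    unfolding Image_singleton_iff by (rule colim_rel_iff[OF assms])
  thus "y \<in> colim_rel (pt ` S) M `` {nu a} \<longleftrightarrow> y \<in> nu ` cmp (zz M) S a"
    unfolding image_iff Bex_def cmp_iff by blast
qed

lemma colim_comps:
  assumes "reeb_graph M"
  shows "colim (pt ` S) M = (`) nu ` comps (zz M) S"
proof -
  have "(SIGMA p:pt ` S. Ob M p) = nu ` nodes (zz M) S"
    by (auto simp: nu_def nodes_def zz_def image_def)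
  thus ?thesis
    unfolding colim_def quotient_def comps_def using colim_rel_image[OF assms] by auto
qed

lemma reeb_zz: "reeb_graph M \<Longrightarrow> reeb (zz M)"
proof -
  assume M: "reeb_graph M"
  have F: "\<And>p q. p \<in> ZZ \<Longrightarrow> q \<in> ZZ \<Longrightarrow> p \<unlhd> q \<Longrightarrow> Mor M p q \<in> Ob M p \<rightarrow> Ob M q"
    and fin: "\<And>p. p \<in> ZZ \<Longrightarrow> finite (Ob M p)"
    using M unfolding reeb_graph_def finset_functor_def is_functor_def by blast+
  show ?thesis
  proof
    show "finite (Lev (zz M) n)" for n using fin by (simp add: zz_def)
    fix n x assume "odd n" "x \<in> Lev (zz M) n"
    thus "Up (zz M) n x \<in> Lev (zz M) (n + 1)" "Dn (zz M) n x \<in> Lev (zz M) (n - 1)"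
      using F[of "pt n" "pt (n + 1)"] F[of "pt n" "pt (n - 1)"] by (auto simp: zz_def pt_le)
  qed
qed

lemma colim_rel_ext:
  assumes M: "reeb_graph M" and K: "K \<in> comps (zz M) S" "S \<subseteq> T"
  shows "colim_rel (pt ` T) M `` (nu ` K) = nu ` ext (zz M) T K"
proof -
  interpret reeb "zz M" by (rule reeb_zz[OF M])
  have e: "cmp (zz M) T a = ext (zz M) T K" if "a \<in> K" for a
    using comps_cmp[OF ext_comps[OF K]] ext_sub[OF K] that by blast
  obtain a where "a \<in> K" using comps_nonempty[OF K(1)] by blast
  hence "(\<Union>a\<in>K. cmp (zz M) T a) = ext (zz M) T K" using e by blast
  moreover have "colim_rel (pt ` T) M `` (nu ` K) = (\<Union>a\<in>K. nu ` cmp (zz M) T a)"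
    unfolding colim_rel_image[OF M, symmetric] by blast
  ultimately show ?thesis by (metis image_UN)
qed

lemma colim_ext_Ob: "reeb_graph M \<Longrightarrow> Ob (colim_ext M) u = (`) nu ` comps (zz M) (win u)"
  by (simp add: colim_ext_def ZZ_below_pt colim_comps)

lemma colim_ext_Mor:
  "reeb_graph M \<Longrightarrow> K \<in> comps (zz M) (win u) \<Longrightarrow> u \<unlhd> v \<Longrightarrow> Mor (colim_ext M) u v (nu ` K) = nu ` ext (zz M) (win v) K"
  by (simp add: colim_ext_def ZZ_below_pt colim_rel_ext win_mono)

text \<open>Naturality turns into monotonicity, because the structure maps of the extended functor
  send a component to the one that contains it.\<close>

lemma interleaved_step:
  assumes M: "reeb_graph M" and N: "reeb_graph N" and eps: "0 \<le> \<epsilon>"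
    and f: "nat_trans UU (colim_ext M) (shift \<epsilon> (colim_ext N)) f"
  defines "f' \<equiv> \<lambda>u K. un ` f u (nu ` K)"
  shows "u \<in> UU \<Longrightarrow> K \<in> comps (zz M) (win u) \<Longrightarrow>
      f' u K \<in> comps (zz N) (win (shift_pt \<epsilon> u)) \<and> f u (nu ` K) = nu ` f' u K"
    and "u \<in> UU \<Longrightarrow> v \<in> UU \<Longrightarrow> u \<unlhd> v \<Longrightarrow> K \<in> comps (zz M) (win u) \<Longrightarrow> K' \<in> comps (zz M) (win v) \<Longrightarrow>
      K \<subseteq> K' \<Longrightarrow> f' u K \<subseteq> f' v K'"
proof -
  interpret X: reeb "zz M" by (rule reeb_zz[OF M])
  interpret Y: reeb "zz N" by (rule reeb_zz[OF N])
  show c: "f' u K \<in> comps (zz N) (win (shift_pt \<epsilon> u)) \<and> f u (nu ` K) = nu ` f' u K"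
    if u: "u \<in> UU" "K \<in> comps (zz M) (win u)" for u K
  proof -
    have "f u (nu ` K) \<in> Ob (colim_ext N) (shift_pt \<epsilon> u)"
      using f u unfolding nat_trans_def shift_def by (auto simp: colim_ext_Ob[OF M])
    then obtain L where "L \<in> comps (zz N) (win (shift_pt \<epsilon> u))" "f u (nu ` K) = nu ` L"
      unfolding colim_ext_Ob[OF N] by blast
    thus ?thesis by (simp add: f'_def)
  qed
  show "f' u K \<subseteq> f' v K'"
    if u: "u \<in> UU" "v \<in> UU" "u \<unlhd> v" and K: "K \<in> comps (zz M) (win u)" "K' \<in> comps (zz M) (win v)" "K \<subseteq> K'"
    for u v K K'
  proof -
    note cK = c[OF u(1) K(1)] and cK' = c[OF u(2) K(2)]
    have w: "win (shift_pt \<epsilon> u) \<subseteq> win (shift_pt \<epsilon> v)" by (rule win_mono[OF shift_pt_mono[OF u(3)]])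
    have "f v (nu ` K') = f v (Mor (colim_ext M) u v (nu ` K))"
      using colim_ext_Mor[OF M K(1) u(3)] X.ext_eqI[OF K(1) win_mono[OF u(3)] K(2,3)] by simp
    also have "\<dots> = Mor (colim_ext N) (shift_pt \<epsilon> u) (shift_pt \<epsilon> v) (f u (nu ` K))"
      using f u K(1) unfolding nat_trans_def shift_def by (auto simp: colim_ext_Ob[OF M])
    also have "\<dots> = nu ` ext (zz N) (win (shift_pt \<epsilon> v)) (f' u K)"
      using cK colim_ext_Mor[OF N conjunct1[OF cK] shift_pt_mono[OF u(3)]] by simp
    finally have "f' v K' = ext (zz N) (win (shift_pt \<epsilon> v)) (f' u K)" by (simp add: f'_def)
    thus ?thesis using Y.ext_sub[OF conjunct1[OF cK] w] by simp
  qed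
qed

lemma interleaved_round:
  assumes M: "reeb_graph M" and N: "reeb_graph N" and eps: "0 \<le> \<epsilon>"
    and f: "nat_trans UU (colim_ext M) (shift \<epsilon> (colim_ext N)) f"
    and g: "nat_trans UU (colim_ext N) (shift \<epsilon> (colim_ext M)) g"
    and gf: "\<And>u x. u \<in> UU \<Longrightarrow> x \<in> Ob (colim_ext M) u \<Longrightarrow>
      g (shift_pt \<epsilon> u) (f u x) = Mor (colim_ext M) u (shift_pt (2 * \<epsilon>) u) x"
    and u: "u \<in> UU" and K: "K \<in> comps (zz M) (win u)"
  shows "K \<subseteq> un ` g (shift_pt \<epsilon> u) (nu ` un ` f u (nu ` K))"
proof -
  interpret X: reeb "zz M" by (rule reeb_zz[OF M])
  have le: "u \<unlhd> shift_pt (2 * \<epsilon>) u" using eps by (simp add: op_le_def shift_pt_def)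
  have "g (shift_pt \<epsilon> u) (nu ` un ` f u (nu ` K)) = g (shift_pt \<epsilon> u) (f u (nu ` K))"
    using interleaved_step(1)[OF M N eps f u K] by simp
  also have "\<dots> = nu ` ext (zz M) (win (shift_pt (2 * \<epsilon>) u)) K"
    using gf[OF u, of "nu ` K"] K colim_ext_Mor[OF M K le] by (simp add: colim_ext_Ob[OF M])
  finally show ?thesis using X.ext_sub[OF K win_mono[OF le]] by simp
qed

theorem interleaving_zz:
  assumes M: "reeb_graph M" and N: "reeb_graph N" and eps: "0 \<le> \<epsilon>"
    and i: "interleaved \<epsilon> (colim_ext M) (colim_ext N)"
  shows "\<exists>f g. interleaving (zz M) (zz N) \<epsilon> f g"
proof -
  obtain f g where f: "nat_trans UU (colim_ext M) (shift \<epsilon> (colim_ext N)) f"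
    and g: "nat_trans UU (colim_ext N) (shift \<epsilon> (colim_ext M)) g"
    and gf: "\<And>u x. u \<in> UU \<Longrightarrow> x \<in> Ob (colim_ext M) u \<Longrightarrow>
      g (shift_pt \<epsilon> u) (f u x) = Mor (colim_ext M) u (shift_pt (2 * \<epsilon>) u) x"
    and fg: "\<And>u x. u \<in> UU \<Longrightarrow> x \<in> Ob (colim_ext N) u \<Longrightarrow>
      f (shift_pt \<epsilon> u) (g u x) = Mor (colim_ext N) u (shift_pt (2 * \<epsilon>) u) x"
    using i unfolding interleaved_def by blast
  interpret X: reeb "zz M" by (rule reeb_zz[OF M])
  interpret Y: reeb "zz N" by (rule reeb_zz[OF N])
  have "interleaving (zz M) (zz N) \<epsilon> (\<lambda>u K. un ` f u (nu ` K)) (\<lambda>u K. un ` g u (nu ` K))"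
    by unfold_locales (rule eps conjunct1[OF interleaved_step(1)[OF M N eps f]] conjunct1[OF interleaved_step(1)[OF N M eps g]]
      interleaved_step(2)[OF M N eps f] interleaved_step(2)[OF N M eps g]
      interleaved_round[OF M N eps f g gf] interleaved_round[OF N M eps g f fg]; assumption)+
  thus ?thesis by blast
qed

subsection \<open>Intervals\<close>

text \<open>A comparability changes the position by at most one, so a chain from \<open>i\<close> to
  \<open>k\<close> passes through every level between them.\<close>

lemma connected_convex:
  assumes c: "connected_poset (pt ` S)"
  shows "convex_ints S"
  unfolding convex_ints_def
proof (intro ballI allI impI)
  fix i k j assume S: "i \<in> S" "k \<in> S" and ij: "i \<le> j" "j \<le> k"
  have "(pt i, pt k) \<in> {(x, y). x \<in> pt ` S \<and> y \<in> pt ` S \<and> (x \<unlhd> y \<or> y \<unlhd> x)}\<^sup>*"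
    using c S unfolding connected_poset_def by blast
  hence "\<forall>j. i \<le> j \<longrightarrow> j \<le> pos (pt k) \<longrightarrow> j \<in> S"
  proof (induction rule: rtrancl_induct)
    case base
    thus ?case using S(1) by (metis antisym pos_pt)
  next
    case (step y z)
    then obtain m n where mn: "y = pt m" "z = pt n" "n \<in> S" "pt m \<unlhd> pt n \<or> pt n \<unlhd> pt m" by blast
    hence "n \<le> m + 1" by (auto simp: pt_le)
    show ?case
    proof (intro allI impI)
      fix j assume j: "i \<le> j" "j \<le> pos z"
      show "j \<in> S"
      proof (cases "j = n")
        case False
        hence "j \<le> pos y" using j(2) mn \<open>n \<le> m + 1\<close> by simp
        thus ?thesis using step.IH j(1) by blast
      qed (use mn in simp)
    qed
  qed
  thus "j \<in> S" using ij by simp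
qed

lemma convex_connected:
  assumes c: "convex_ints S"
  shows "connected_poset (pt ` S)"
proof -
  let ?R = "{(x, y). x \<in> pt ` S \<and> y \<in> pt ` S \<and> (x \<unlhd> y \<or> y \<unlhd> x)}"
  have up: "(pt i, pt (i + int n)) \<in> ?R\<^sup>*" if "i \<in> S" "i + int n \<in> S" for i n
    using that
  proof (induction n)
    case (Suc n)
    hence s: "i + int n \<in> S" using c unfolding convex_ints_def by (smt (verit) int_ops(4) of_nat_0_le_iff)
    have "pt (i + int n) \<unlhd> pt (i + int (Suc n)) \<or> pt (i + int (Suc n)) \<unlhd> pt (i + int n)"
      by (auto simp: pt_le)
    hence "(pt (i + int n), pt (i + int (Suc n))) \<in> ?R" using s Suc.prems(2) by blast
    thus ?case using Suc.IH[OF Suc.prems(1) s] by (rule rtrancl_into_rtrancl[rotated])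
  qed simp
  have sym: "(x, y) \<in> ?R\<^sup>* \<Longrightarrow> (y, x) \<in> ?R\<^sup>*" for x y
    by (rule symD[OF sym_rtrancl]) (auto intro: symI)
  have "(pt i, pt k) \<in> ?R\<^sup>*" if "i \<in> S" "k \<in> S" for i k
  proof (cases "i \<le> k")
    case True
    thus ?thesis using up[of i "nat (k - i)"] that by simp
  next
    case False
    thus ?thesis using sym[OF up[of k "nat (i - k)"]] that by simp
  qed
  thus ?thesis unfolding connected_poset_def by blast
qed

text \<open>Two comparable elements of \<open>ZZ\<close> have nothing strictly between them;
  convexity of the set of levels comes from connectedness instead.\<close>

lemma convex_in_pt: "convex_in ZZ (pt ` S)"
  unfolding convex_in_def ZZ_pt by (auto simp: pt_le)

lemma IntZZ_pt: "IntZZ = (`) pt ` {S. S \<noteq> {} \<and> convex_ints S}"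
proof (intro set_eqI iffI)
  fix I assume "I \<in> IntZZ"
  hence I: "I \<subseteq> ZZ" "I \<noteq> {}" "connected_poset I" by (auto simp: IntZZ_def)
  have e: "pt ` pos ` I = I" by (rule pt_pos_image[OF I(1)])
  have "convex_ints (pos ` I)" by (rule connected_convex) (simp add: e I)
  thus "I \<in> (`) pt ` {S. S \<noteq> {} \<and> convex_ints S}" using e I(2) by (metis (mono_tags, lifting) image_eqI image_is_empty mem_Collect_eq)
next
  fix I assume "I \<in> (`) pt ` {S. S \<noteq> {} \<and> convex_ints S}"
  thus "I \<in> IntZZ" using convex_connected convex_in_pt by (auto simp: IntZZ_def)
qed

lemma covers_pt: "covers ZZ (pt n) (pt m) \<longleftrightarrow> odd m \<and> (n = m + 1 \<or> n = m - 1)"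
proof -
  have "\<not> (\<exists>r\<in>ZZ. pt m \<unlhd> r \<and> r \<unlhd> pt n \<and> r \<noteq> pt m \<and> r \<noteq> pt n)"
    unfolding ZZ_pt by (auto simp: pt_le)
  thus ?thesis unfolding covers_def by (auto simp: pt_le)
qed

lemma nbd_pt: "nbd (pt ` S) = pt ` (lo S \<union> hi S)"
proof (intro set_eqI iffI)
  fix p assume "p \<in> nbd (pt ` S)"
  then obtain n m where "p = pt n" "n \<notin> S" "m \<in> S" "covers ZZ (pt n) (pt m) \<or> covers ZZ (pt m) (pt n)"
    unfolding nbd_def ZZ_pt by auto
  thus "p \<in> pt ` (lo S \<union> hi S)" by (auto simp: covers_pt lo_def hi_def)
next
  fix p assume "p \<in> pt ` (lo S \<union> hi S)"
  then obtain n where n: "p = pt n" "n \<notin> S" "n + 1 \<in> S \<or> n - 1 \<in> S" by (auto simp: lo_def hi_def)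
  then obtain m where m: "m \<in> S" "m = n + 1 \<or> m = n - 1" by blast
  have "covers ZZ (pt n) (pt m) \<or> covers ZZ (pt m) (pt n)" using m(2) by (auto simp: covers_pt)
  thus "p \<in> nbd (pt ` S)" using n m(1) unfolding nbd_def by auto
qed

section \<open>Decomposition into components, and ranks\<close>

definition summand :: "(int, 'a) diagram \<Rightarrow> 'a node set \<Rightarrow> (int, 'a) diagram" where
  "summand M K = \<lparr>Ob = (\<lambda>p. {x. (pos p, x) \<in> K}), Mor = Mor M\<rparr>"

lemma summand_Ob [simp]: "Ob (summand M K) (pt n) = {x. (n, x) \<in> K}"
  by (simp add: summand_def)

lemma summand_Mor [simp]: "Mor (summand M K) = Mor M"
  by (simp add: summand_def)

lemma zz_Lev [simp]: "Lev (zz M) n = Ob M (pt n)"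
  by (simp add: zz_def)

lemma comps_Mor:
  assumes M: "reeb_graph M" and K: "K \<in> comps (zz M) S" and x: "(m, x) \<in> K"
    and n: "n \<in> S" and le: "pt m \<unlhd> pt n"
  shows "(n, Mor M (pt m) (pt n) x) \<in> K"
proof -
  interpret reeb "zz M" by (rule reeb_zz[OF M])
  have "(m, x) \<in> nodes (zz M) S" by (rule subsetD[OF comps_sub[OF K] x])
  hence "((m, x), (n, Mor M (pt m) (pt n) x)) \<in> linked (zz M) S"
    by (intro colim_rel_step[OF M _ _ n le]) simp_all
  thus ?thesis by (rule comps_closed[OF K x])
qed

lemma reeb_graphD:
  assumes "reeb_graph M"
  shows "pt m \<unlhd> pt n \<Longrightarrow> x \<in> Ob M (pt m) \<Longrightarrow> Mor M (pt m) (pt n) x \<in> Ob M (pt n)"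
    and "x \<in> Ob M (pt n) \<Longrightarrow> Mor M (pt n) (pt n) x = x"
    and "pt l \<unlhd> pt m \<Longrightarrow> pt m \<unlhd> pt n \<Longrightarrow> x \<in> Ob M (pt l) \<Longrightarrow>
      Mor M (pt l) (pt n) x = Mor M (pt m) (pt n) (Mor M (pt l) (pt m) x)"
    and "finite (Ob M (pt n))"
proof -
  have F: "is_functor ZZ M" "\<forall>p\<in>ZZ. finite (Ob M p)"
    using assms unfolding reeb_graph_def finset_functor_def by blast+
  show "finite (Ob M (pt n))" using F(2) by simp
  show "x \<in> Ob M (pt n) \<Longrightarrow> Mor M (pt n) (pt n) x = x" using F(1) unfolding is_functor_def by simp
  show "pt m \<unlhd> pt n \<Longrightarrow> x \<in> Ob M (pt m) \<Longrightarrow> Mor M (pt m) (pt n) x \<in> Ob M (pt n)"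
    using F(1) pt_ZZ unfolding is_functor_def by (meson PiE)
  show "pt l \<unlhd> pt m \<Longrightarrow> pt m \<unlhd> pt n \<Longrightarrow> x \<in> Ob M (pt l) \<Longrightarrow>
      Mor M (pt l) (pt n) x = Mor M (pt m) (pt n) (Mor M (pt l) (pt m) x)"
    using F(1) pt_ZZ unfolding is_functor_def by meson
qed

lemma summand_functor:
  assumes M: "reeb_graph M" and K: "K \<in> comps (zz M) S"
  shows "finset_functor (pt ` S) (summand M K)"
proof -
  interpret reeb "zz M" by (rule reeb_zz[OF M])
  have sub: "x \<in> Ob M (pt n)" if "(n, x) \<in> K" for n x
    using subsetD[OF comps_sub[OF K] that] by simp
  note F = reeb_graphD[OF M]
  have "is_functor (pt ` S) (summand M K)"
    unfolding is_functor_def summand_Mor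
  proof (intro conjI ballI impI)
    fix p q assume "p \<in> pt ` S" "q \<in> pt ` S" and le: "p \<unlhd> q"
    then obtain m n where mn: "p = pt m" "q = pt n" "n \<in> S" by blast
    show "Mor M p q \<in> Ob (summand M K) p \<rightarrow> Ob (summand M K) q"
      using comps_Mor[OF M K _ mn(3)] le unfolding mn(1,2) by auto
    fix r x assume "r \<in> pt ` S" and qr: "q \<unlhd> r" and x: "x \<in> Ob (summand M K) p"
    then obtain l where l: "r = pt l" by blast
    have "x \<in> Ob M (pt m)" using x sub unfolding mn(1) by simp
    thus "Mor M p r x = Mor M q r (Mor M p q x)"
      using F(3) le qr unfolding mn l by blast
  next
    fix p x assume "p \<in> pt ` S" and x: "x \<in> Ob (summand M K) p"
    then obtain m where m: "p = pt m" by blast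
    have "x \<in> Ob M (pt m)" using x sub unfolding m by simp
    thus "Mor M p p x = x" unfolding m by (rule F(2))
  qed
  moreover have "finite (Ob (summand M K) p)" if p: "p \<in> pt ` S" for p
  proof -
    obtain n where n: "p = pt n" using p by blast
    have "Ob (summand M K) (pt n) \<subseteq> Ob M (pt n)" using sub by auto
    thus ?thesis unfolding n using finite_subset F(4) by blast
  qed
  ultimately show ?thesis unfolding finset_functor_def by blast
qed

lemma summand_nonempty:
  assumes M: "reeb_graph M" and K: "K \<in> comps (zz M) S"
  shows "nonempty_diagram (pt ` S) (summand M K)"
proof -
  interpret reeb "zz M" by (rule reeb_zz[OF M])
  obtain a where a: "a \<in> K" using comps_nonempty[OF K] by blast
  hence "fst a \<in> S" using comps_lev[OF K] unfolding lev_def by blast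
  moreover have "snd a \<in> Ob (summand M K) (pt (fst a))" using a by simp
  ultimately show ?thesis unfolding nonempty_diagram_def by blast
qed

lemma coprod2_Inl: "Ob (coprod2 A B) p = Ob A p <+> Ob B p" "Mor (coprod2 A B) p q = map_sum (Mor A p q) (Mor B p q)"
  by (simp_all add: coprod2_def)

text \<open>In a splitting, the side to which a node belongs is constant along edges and hence on
  the whole component, while both sides would have to be nonempty.\<close>

lemma summand_indecomposable:
  assumes M: "reeb_graph M" and K: "K \<in> comps (zz M) S"
  shows "indecomposable (pt ` S) (summand M K)"
  unfolding indecomposable_def
proof (intro conjI notI)
  interpret reeb "zz M" by (rule reeb_zz[OF M])
  show "nonempty_diagram (pt ` S) (summand M K)" by (rule summand_nonempty[OF M K])
  assume "\<exists>(A :: (int, 'a) diagram) (B :: (int, 'a) diagram). finset_functor (pt ` S) A \<and> finset_functor (pt ` S) B \<and>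
    nonempty_diagram (pt ` S) A \<and> nonempty_diagram (pt ` S) B \<and>
    isomorphic (pt ` S) (summand M K) (coprod2 A B)"
  then obtain A B :: "(int, 'a) diagram" where AB: "nonempty_diagram (pt ` S) A" "nonempty_diagram (pt ` S) B"
    and iso: "isomorphic (pt ` S) (summand M K) (coprod2 A B)" by blast
  obtain \<eta> where \<eta>: "nat_trans (pt ` S) (summand M K) (coprod2 A B) \<eta>"
    and bij: "\<And>p. p \<in> pt ` S \<Longrightarrow> bij_betw (\<eta> p) (Ob (summand M K) p) (Ob (coprod2 A B) p)"
    using iso unfolding isomorphic_def by blast
  define L where "L a \<longleftrightarrow> isl (\<eta> (pt (fst a)) (snd a))" for a
  have stp: "L a \<longleftrightarrow> L b" if a: "a \<in> K" and ab: "(a, b) \<in> edges (zz M) S" for a b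
  proof -
    have "\<exists>n n' x. a = (n, x) \<and> b = (n', Mor M (pt n) (pt n') x) \<and> odd n \<and> (n' = n + 1 \<or> n' = n - 1) \<and>
        n \<in> S \<and> n' \<in> S"
      using ab unfolding edges_def zz_def by auto
    then obtain n n' x where c: "a = (n, x)" "b = (n', Mor M (pt n) (pt n') x)" "odd n"
      "n' = n + 1 \<or> n' = n - 1" "n \<in> S" "n' \<in> S" by blast
    have "pt n \<unlhd> pt n'" using c(3,4) pt_le by blast
    hence "\<eta> (pt n') (Mor M (pt n) (pt n') x) = Mor (coprod2 A B) (pt n) (pt n') (\<eta> (pt n) x)"
      using \<eta> c(5,6) a unfolding nat_trans_def c(1) by simp
    thus ?thesis unfolding L_def c(1,2) fst_conv snd_conv coprod2_Inl by (cases "\<eta> (pt n) x") simp_all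
  qed
  have "L a \<longleftrightarrow> L b" if "a \<in> K" "b \<in> K" for a b
    using comps_linked[OF K that]
  proof (induction rule: linked_induct)
    case (step b c)
    have "b \<in> K" by (rule comps_closed[OF K that(1) step.hyps(1)])
    moreover have "c \<in> K"
      by (rule comps_closed[OF K \<open>b \<in> K\<close>]) (use step.hyps(2) edges_linked linked_sym in blast)
    ultimately show ?case using step stp by blast
  qed simp
  moreover obtain n where n: "n \<in> S" "Ob A (pt n) \<noteq> {}" using AB(1) unfolding nonempty_diagram_def by blast
  then obtain x where "x \<in> Ob A (pt n)" by blast
  hence "Inl x \<in> Ob (coprod2 A B) (pt n)" unfolding coprod2_Inl by (rule InlI)
  then obtain y where y: "(n, y) \<in> K" "\<eta> (pt n) y = Inl x"
    using bij[OF imageI[OF n(1)]] unfolding bij_betw_def by force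
  moreover obtain m where m: "m \<in> S" "Ob B (pt m) \<noteq> {}" using AB(2) unfolding nonempty_diagram_def by blast
  then obtain z where "z \<in> Ob B (pt m)" by blast
  hence "Inr z \<in> Ob (coprod2 A B) (pt m)" unfolding coprod2_Inl by (rule InrI)
  then obtain w where w: "(m, w) \<in> K" "\<eta> (pt m) w = Inr z"
    using bij[OF imageI[OF m(1)]] unfolding bij_betw_def by force
  ultimately have "L (n, y) \<longleftrightarrow> L (m, w)" by blast
  thus False unfolding L_def by (simp add: y w)
qed

lemma countable_comps: "reeb_graph M \<Longrightarrow> countable (comps (zz M) S)"
proof -
  assume M: "reeb_graph M"
  have "nodes (zz M) S = Sigma S (Lev (zz M))" by (auto simp: nodes_def)
  moreover have "countable (Lev (zz M) n)" for n using reeb_graphD(4)[OF M] by (simp add: countable_finite)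
  ultimately have "countable (nodes (zz M) S)" by (metis countable_SIGMA countableI_type)
  thus ?thesis unfolding comps_def by (rule countable_image)
qed

text \<open>\<open>e\<close> numbers the components, because summands are indexed by natural numbers
  in \<open>untwisted\<close>. Naturality holds since a node and its image are linked.\<close>

lemma isomorphic_summands:
  assumes M: "reeb_graph M" and e: "inj_on e (comps (zz M) S)"
    and N: "\<And>K. K \<in> comps (zz M) S \<Longrightarrow> N (e K) = summand M K"
  shows "isomorphic (pt ` S) M (coprod (e ` comps (zz M) S) N)"
proof -
  interpret reeb "zz M" by (rule reeb_zz[OF M])
  define \<eta> where "\<eta> p x = (e (cmp (zz M) S (pos p, x)), x)" for p x
  have c: "cmp (zz M) S (n, x) \<in> comps (zz M) S" if "n \<in> S" "x \<in> Ob M (pt n)" for n x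
    using that by (intro cmp_comps) simp
  have cO: "Ob (coprod J N) p = (SIGMA j:J. Ob (N j) p)"
    "Mor (coprod J N) p q (j, x) = (j, Mor (N j) p q x)" for J p q j x
    by (simp_all add: coprod_def)
  have bij: "bij_betw (\<eta> (pt n)) (Ob M (pt n)) (Ob (coprod (e ` comps (zz M) S) N) (pt n))" if n: "n \<in> S" for n
  proof (rule bij_betwI')
    show "\<eta> (pt n) x = \<eta> (pt n) y \<longleftrightarrow> x = y" for x y by (auto simp: \<eta>_def)
    show "\<eta> (pt n) x \<in> Ob (coprod (e ` comps (zz M) S) N) (pt n)" if "x \<in> Ob M (pt n)" for x
      using c[OF n that] unfolding cO \<eta>_def by (simp add: N)
    fix jx assume "jx \<in> Ob (coprod (e ` comps (zz M) S) N) (pt n)"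
    then obtain K x where K: "K \<in> comps (zz M) S" "jx = (e K, x)" "x \<in> Ob (N (e K)) (pt n)"
      unfolding cO by blast
    have x: "(n, x) \<in> K" using K(1,3) by (simp add: N)
    hence "x \<in> Ob M (pt n)" using comps_sub[OF K(1)] by auto
    moreover have "jx = \<eta> (pt n) x" using comps_cmp[OF K(1) x] K(2) by (simp add: \<eta>_def)
    ultimately show "\<exists>x\<in>Ob M (pt n). jx = \<eta> (pt n) x" by blast
  qed
  have "nat_trans (pt ` S) M (coprod (e ` comps (zz M) S) N) \<eta>"
    unfolding nat_trans_def
  proof (intro conjI ballI impI)
    fix p assume "p \<in> pt ` S"
    thus "\<eta> p \<in> Ob M p \<rightarrow> Ob (coprod (e ` comps (zz M) S) N) p"
      using bij bij_betw_imp_funcset by blast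
  next
    fix p q x assume "p \<in> pt ` S" "q \<in> pt ` S" and le: "p \<unlhd> q" and x: "x \<in> Ob M p"
    then obtain m n where mn: "p = pt m" "q = pt n" "m \<in> S" "n \<in> S" by blast
    have x': "x \<in> Ob M (pt m)" using x mn(1) by simp
    have "((m, x), (n, Mor M (pt m) (pt n) x)) \<in> linked (zz M) S"
      by (rule colim_rel_step[OF M x' mn(3,4)]) (use le mn in simp)
    hence "cmp (zz M) S (n, Mor M (pt m) (pt n) x) = cmp (zz M) S (m, x)" using cmp_eq by metis
    thus "\<eta> q (Mor M p q x) = Mor (coprod (e ` comps (zz M) S) N) p q (\<eta> p x)"
      unfolding \<eta>_def mn cO pos_pt using N[OF c[OF mn(3) x']] by simp
  qed
  thus ?thesis unfolding isomorphic_def using bij by blast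
qed

text \<open>Here untwistedness enters: the summand of \<open>K\<close> has all of \<open>S\<close>
  as support, so a point of its limit is a section over \<open>S\<close>.\<close>

lemma untwisted_section:
  assumes M: "reeb_graph M" and u: "untwisted M" and S: "convex_ints S" "S \<noteq> {}"
    and K: "K \<in> comps_at (zz M) S S"
  shows "\<exists>s. (\<forall>n\<in>S. (n, s n) \<in> K) \<and> (\<forall>m\<in>S. \<forall>n\<in>S. pt m \<unlhd> pt n \<longrightarrow> Mor M (pt m) (pt n) (s m) = s n)"
proof -
  interpret reeb "zz M" by (rule reeb_zz[OF M])
  have KS: "K \<in> comps (zz M) S" "lev K = S" using K by (auto simp: comps_at_def)
  obtain e :: "'a node set \<Rightarrow> nat" where e: "inj_on e (comps (zz M) S)"
    using countable_comps[OF M, of S] unfolding countable_def by blast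
  define N where "N j = summand M (inv_into (comps (zz M) S) e j)" for j
  have N: "N (e L) = summand M L" if "L \<in> comps (zz M) S" for L
    unfolding N_def inv_into_f_f[OF e that] ..
  have I: "pt ` S \<in> IntZZ" unfolding IntZZ_pt using S by blast
  have "nonempty_diagram (pt ` S) M"
    using summand_nonempty[OF M KS(1)] comps_sub[OF KS(1)] unfolding nonempty_diagram_def by fastforce
  moreover have "\<forall>j\<in>e ` comps (zz M) S. finset_functor (pt ` S) (N j) \<and> nonempty_diagram (pt ` S) (N j) \<and>
      indecomposable (pt ` S) (N j)"
    using N summand_functor[OF M] summand_nonempty[OF M] summand_indecomposable[OF M] by auto
  ultimately have "\<forall>j\<in>e ` comps (zz M) S. dlim (supp (pt ` S) (N j)) (N j) \<noteq> {}"
    using u I isomorphic_summands[OF M e N] unfolding untwisted_def by blast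
  hence "dlim (supp (pt ` S) (summand M K)) (summand M K) \<noteq> {}" using KS(1) N by force
  moreover have "supp (pt ` S) (summand M K) = pt ` S"
    using KS(2) unfolding supp_def lev_def by force
  ultimately obtain t where "t \<in> dlim (pt ` S) (summand M K)" by auto
  hence t: "\<And>p. p \<in> pt ` S \<Longrightarrow> t p \<in> Ob (summand M K) p"
    "\<And>p q. p \<in> pt ` S \<Longrightarrow> q \<in> pt ` S \<Longrightarrow> p \<unlhd> q \<Longrightarrow> Mor M p q (t p) = t q"
    unfolding dlim_def by (auto simp: PiE_def Pi_def)
  have "(n, t (pt n)) \<in> K" if "n \<in> S" for n using t(1)[OF imageI[OF that]] by simp
  thus ?thesis using t(2) by (intro exI[of _ "\<lambda>n. t (pt n)"]) blast
qed

text \<open>Neighbouring levels are always comparable, so consecutive values of a section are joined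
  by an edge.\<close>

lemma section_connected:
  assumes S: "convex_ints S" and s: "\<And>n. n \<in> S \<Longrightarrow> s n \<in> Ob M (pt n)"
    "\<And>m n. m \<in> S \<Longrightarrow> n \<in> S \<Longrightarrow> pt m \<unlhd> pt n \<Longrightarrow> Mor M (pt m) (pt n) (s m) = s n"
    and mn: "m \<in> S" "n \<in> S"
  shows "((m, s m), (n, s n)) \<in> linked (zz M) S"
proof -
  have stp: "((k, s k), (k + 1, s (k + 1))) \<in> linked (zz M) S" if k: "k \<in> S" "k + 1 \<in> S" for k
  proof (cases "odd k")
    case True
    have "s (k + 1) = Mor M (pt k) (pt (k + 1)) (s k)" using s(2)[OF k] True by (simp add: pt_le)
    hence "((k, s k), (k + 1, s (k + 1))) \<in> edges (zz M) S"
      using True k s(1) unfolding edges_def zz_def by auto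
    thus ?thesis by (rule edges_linked)
  next
    case False
    have "s k = Mor M (pt (k + 1)) (pt (k + 1 - 1)) (s (k + 1))"
      using s(2)[OF k(2) k(1)] False by (simp add: pt_le)
    hence "\<exists>l x. ((k + 1, s (k + 1)), (k, s k)) = ((l, x), (l - 1, Dn (zz M) l x)) \<and> odd l \<and> x \<in> Lev (zz M) l \<and> l \<in> S \<and> l - 1 \<in> S"
      using False k s(1) by (intro exI[of _ "k + 1"] exI[of _ "s (k + 1)"]) (simp add: zz_def)
    hence "((k + 1, s (k + 1)), (k, s k)) \<in> edges (zz M) S" unfolding edges_def by blast
    thus ?thesis using edges_linked linked_sym by blast
  qed
  have up: "((i, s i), (i + int n, s (i + int n))) \<in> linked (zz M) S" if "i \<in> S" "i + int n \<in> S" for i n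
    using that
  proof (induction n)
    case (Suc n)
    hence k: "i + int n \<in> S" using S unfolding convex_ints_def by (smt (verit) int_ops(4) of_nat_0_le_iff)
    have "i + int (Suc n) = i + int n + 1" by simp
    thus ?case using Suc.IH[OF Suc.prems(1) k] stp[OF k] Suc.prems(2) linked_trans by metis
  qed simp
  show ?thesis
  proof (cases "m \<le> n")
    case True
    thus ?thesis using up[of m "nat (n - m)"] mn by simp
  next
    case False
    thus ?thesis using linked_sym[OF up[of n "nat (m - n)"]] mn by simp
  qed
qed

text \<open>A section maps to the component that it runs through, which then reaches all levels;
  conversely \<open>untwisted_section\<close> supplies a section of each component that
  does.\<close>

theorem rk_full:
  assumes M: "reeb_graph M" and u: "untwisted M" and S: "convex_ints S" "S \<noteq> {}"
  shows "rk M (pt ` S) = full (zz M) S"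
proof -
  interpret reeb "zz M" by (rule reeb_zz[OF M])
  let ?a = "SOME a. a \<in> pt ` S"
  have "\<exists>a. a \<in> pt ` S" using S(2) by blast
  hence "?a \<in> pt ` S" by (rule someI_ex)
  then obtain n0 where n0: "?a = pt n0" "n0 \<in> S" by blast
  have l2c: "lim_to_colim (pt ` S) M t = nu ` cmp (zz M) S (n0, t (pt n0))" for t
    unfolding lim_to_colim_def Let_def n0(1) colim_rel_image[OF M, symmetric] by (simp add: nu_def)
  have "lim_to_colim (pt ` S) M ` dlim (pt ` S) M = (`) nu ` comps_at (zz M) S S"
  proof (intro set_eqI iffI)
    fix c assume "c \<in> lim_to_colim (pt ` S) M ` dlim (pt ` S) M"
    then obtain t where t: "t \<in> dlim (pt ` S) M" "c = lim_to_colim (pt ` S) M t" by blast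
    have "t \<in> (\<Pi>\<^sub>E p\<in>pt ` S. Ob M p)" using t(1) unfolding dlim_def by blast
    hence t1: "t (pt n) \<in> Ob M (pt n)" if "n \<in> S" for n by (rule PiE_mem) (rule imageI[OF that])
    have t2: "Mor M (pt m) (pt n) (t (pt m)) = t (pt n)" if "m \<in> S" "n \<in> S" "pt m \<unlhd> pt n" for m n
      using t(1) that unfolding dlim_def by auto
    let ?K = "cmp (zz M) S (n0, t (pt n0))"
    have K: "?K \<in> comps (zz M) S" using n0(2) t1 by (intro cmp_comps) simp
    have "(n, t (pt n)) \<in> ?K" if "n \<in> S" for n
      unfolding cmp_iff using section_connected[OF S(1) t1 t2 n0(2) that] .
    hence "S \<subseteq> lev ?K" by (meson mem_lev subsetI)
    hence "?K \<in> comps_at (zz M) S S" using K comps_lev[OF K] unfolding comps_at_def by blast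
    thus "c \<in> (`) nu ` comps_at (zz M) S S" unfolding t(2) l2c by (rule imageI)
  next
    fix c assume "c \<in> (`) nu ` comps_at (zz M) S S"
    then obtain K where K: "K \<in> comps_at (zz M) S S" "c = nu ` K" by blast
    have KS: "K \<in> comps (zz M) S" using K(1) by (simp add: comps_at_def)
    obtain s where s: "\<And>n. n \<in> S \<Longrightarrow> (n, s n) \<in> K"
      "\<And>m n. m \<in> S \<Longrightarrow> n \<in> S \<Longrightarrow> pt m \<unlhd> pt n \<Longrightarrow> Mor M (pt m) (pt n) (s m) = s n"
      using untwisted_section[OF M u S K(1)] by blast
    have s1: "s n \<in> Ob M (pt n)" if "n \<in> S" for n using subsetD[OF comps_sub[OF KS] s(1)[OF that]] by simp
    define t where "t = restrict (\<lambda>p. s (pos p)) (pt ` S)"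
    have "t \<in> dlim (pt ` S) M"
      unfolding dlim_def t_def using s1 s(2) by auto
    moreover have "lim_to_colim (pt ` S) M t = c"
      unfolding l2c K(2) using comps_cmp[OF KS s(1)[OF n0(2)]] n0(2) by (simp add: t_def)
    ultimately show "c \<in> lim_to_colim (pt ` S) M ` dlim (pt ` S) M" by blast
  qed
  moreover have "inj_on ((`) nu) (comps_at (zz M) S S)" by (rule inj_onI) (metis un_nu_image)
  ultimately show ?thesis unfolding rk_def full_def by (simp add: card_image)
qed

lemma convex_insert_lo:
  assumes "convex_ints S" "q \<in> lo S"
  shows "convex_ints (insert q S)"
proof -
  have "q + 1 \<in> S" using assms(2) by (simp add: lo_def)
  moreover have "q < s" if "s \<in> S" for s using lo_less[OF assms that] .
  ultimately show ?thesis using assms(1) unfolding convex_ints_def by (smt (verit) insert_iff)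
qed

lemma convex_Un_nbd:
  assumes S: "convex_ints S" and A: "A \<subseteq> lo S \<union> hi S"
  shows "convex_ints (S \<union> A)"
proof -
  have "convex_ints (S \<union> A \<inter> hi S) \<and> lo (S \<union> A \<inter> hi S) = lo S"
  proof (cases "A \<inter> hi S = {}")
    case False
    then obtain q where q: "q \<in> hi S" "q \<in> A" by blast
    hence "S \<union> A \<inter> hi S = insert q S" using hi_unique[OF S] by blast
    thus ?thesis using convex_insert_hi[OF S q(1)] lo_insert_hi[OF S q(1)] by simp
  qed (use S in simp)
  moreover have "convex_ints (T \<union> A \<inter> lo S)" if T: "convex_ints T" "lo T = lo S" for T
  proof (cases "A \<inter> lo S = {}")
    case False
    then obtain p where p: "p \<in> lo S" "p \<in> A" by blast
    hence "T \<union> A \<inter> lo S = insert p T" using lo_unique[OF S] by blast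
    thus ?thesis using convex_insert_lo[OF T(1)] p(1) T(2) by simp
  qed (use T in simp)
  moreover have "S \<union> A = (S \<union> A \<inter> hi S) \<union> A \<inter> lo S" using A by blast
  ultimately show ?thesis by metis
qed

theorem dgm_dgz:
  assumes M: "reeb_graph M" and u: "untwisted M" and S: "convex_ints S" "S \<noteq> {}"
  shows "dgm M (pt ` S) = dgz (zz M) S"
proof -
  have P: "Pow (pt ` (lo S \<union> hi S)) = (`) pt ` Pow (lo S \<union> hi S)" by (rule image_Pow_surj[OF refl, symmetric])
  have inj: "inj_on ((`) pt) (Pow (lo S \<union> hi S))" by (rule inj_on_image_Pow) (rule inj_on_subset[OF inj_pt subset_UNIV])
  have "dgm M (pt ` S) = (\<Sum>A\<in>Pow (lo S \<union> hi S). (- 1) ^ card (pt ` A) * int (rk M (pt ` S \<union> pt ` A)))"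
    unfolding dgm_def nbd_pt P sum.reindex[OF inj] comp_def ..
  also have "\<dots> = dgz (zz M) S"
    unfolding dgz_def
  proof (rule sum.cong[OF refl])
    fix A assume "A \<in> Pow (lo S \<union> hi S)"
    hence "convex_ints (S \<union> A)" "S \<union> A \<noteq> {}" using convex_Un_nbd[OF S(1)] S(2) by auto
    hence "rk M (pt ` S \<union> pt ` A) = full (zz M) (S \<union> A)"
      unfolding image_Un[symmetric] by (rule rk_full[OF M u])
    moreover have "card (pt ` A) = card A" by (rule card_image) (rule inj_on_subset[OF inj_pt subset_UNIV])
    ultimately show "(- 1) ^ card (pt ` A) * int (rk M (pt ` S \<union> pt ` A)) =
      (- 1) ^ card A * int (full (zz M) (S \<union> A))" by simp
  qed
  finally show ?thesis .
qed

subsection \<open>Endpoints\<close>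

text \<open>An interval with a left neighbour \<open>p\<close> is closed at \<open>i\<close> if \<open>p = 2 * i - 1\<close>, and open at \<open>i\<close> if
  \<open>p = 2 * i\<close>; likewise on the right.\<close>

definition lend :: "int set \<Rightarrow> ereal" where
  "lend S = (if lo S = {} then - \<infinity> else ereal (of_int (((THE p. p \<in> lo S) + 1) div 2)))"

definition rend :: "int set \<Rightarrow> ereal" where
  "rend S = (if hi S = {} then \<infinity> else ereal (of_int ((THE q. q \<in> hi S) div 2)))"

text \<open>The flag tells whether the end is closed; with it the four forms of intervals are
  treated at once.\<close>

definition lbd :: "bool \<Rightarrow> ereal \<Rightarrow> int \<Rightarrow> bool" where
  "lbd c b n \<longleftrightarrow> (if c then (b, b) \<le> ereal_pt (pt n) else (b, b) < ereal_pt (pt n))"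

definition rbd :: "bool \<Rightarrow> ereal \<Rightarrow> int \<Rightarrow> bool" where
  "rbd c d n \<longleftrightarrow> (if c then ereal_pt (pt n) \<le> (d, d) else ereal_pt (pt n) < (d, d))"

lemma lend_lo: "lo S = {p} \<Longrightarrow> lend S = ereal (of_int ((p + 1) div 2))"
  by (simp add: lend_def)

lemma rend_hi: "hi S = {q} \<Longrightarrow> rend S = ereal (of_int (q div 2))"
  by (simp add: rend_def)

lemma lbd_simps:
  "lbd c (ereal (of_int B)) n \<longleftrightarrow> (if c then 2 * B \<le> n else 2 * B < n)"
  "lbd c (- \<infinity>) n" "\<not> lbd c \<infinity> n"
proof -
  have "B \<le> (n + 1) div 2 \<and> B \<le> n div 2 \<longleftrightarrow> 2 * B \<le> n" "(n + 1) div 2 \<le> B \<and> n div 2 \<le> B \<longleftrightarrow> n \<le> 2 * B"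
    by presburger+
  thus "lbd c (ereal (of_int B)) n \<longleftrightarrow> (if c then 2 * B \<le> n else 2 * B < n)"
    unfolding lbd_def less_prod_def less_eq_prod_def ereal_pt_def pt_def fst_conv snd_conv ereal_less_eq of_int_le_iff
    by auto
  show "lbd c (- \<infinity>) n" "\<not> lbd c \<infinity> n"
    by (auto simp: lbd_def less_prod_def less_eq_prod_def ereal_pt_def)
qed

lemma rbd_simps:
  "rbd c (ereal (of_int D)) n \<longleftrightarrow> (if c then n \<le> 2 * D else n < 2 * D)"
  "rbd c \<infinity> n" "\<not> rbd c (- \<infinity>) n"
proof -
  have "D \<le> (n + 1) div 2 \<and> D \<le> n div 2 \<longleftrightarrow> 2 * D \<le> n" "(n + 1) div 2 \<le> D \<and> n div 2 \<le> D \<longleftrightarrow> n \<le> 2 * D"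
    by presburger+
  thus "rbd c (ereal (of_int D)) n \<longleftrightarrow> (if c then n \<le> 2 * D else n < 2 * D)"
    unfolding rbd_def less_prod_def less_eq_prod_def ereal_pt_def pt_def fst_conv snd_conv ereal_less_eq of_int_le_iff
    by auto
  show "rbd c \<infinity> n" "\<not> rbd c (- \<infinity>) n"
    by (auto simp: rbd_def less_prod_def less_eq_prod_def ereal_pt_def)
qed

lemma lend_eq:
  assumes b: "b \<in> ereal_ints \<union> {- \<infinity>, \<infinity>}" and S: "S = {n. lbd c b n \<and> Q n}" "S \<noteq> {}"
    and Q: "\<And>m n. Q n \<Longrightarrow> m \<le> n \<Longrightarrow> Q m"
  shows "lend S = b"
proof -
  consider "b = - \<infinity>" | B where "b = ereal (of_int B)" | "b = \<infinity>" using b by (auto simp: ereal_ints_def)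
  thus ?thesis
  proof cases
    case 1
    have "lo S = {}" using Q[of "n + 1" n for n] by (auto simp: lo_def S 1 lbd_simps)
    thus ?thesis by (simp add: lend_def 1)
  next
    case 2
    define m where "m = (if c then 2 * B else 2 * B + 1)"
    have Sm: "S = {n. m \<le> n \<and> Q n}" unfolding S(1) 2 lbd_simps by (auto simp: m_def)
    then obtain s where "m \<le> s" "Q s" using S(2) by blast
    hence "Q m" using Q by blast
    hence "lo S = {m - 1}" using Q[of "n + 1" n for n] by (auto simp: lo_def Sm)
    thus ?thesis using lend_lo by (simp add: 2 m_def)
  next
    case 3
    thus ?thesis using S by (simp add: lbd_simps)
  qed
qed

lemma rend_eq:
  assumes d: "d \<in> ereal_ints \<union> {- \<infinity>, \<infinity>}" and S: "S = {n. Q n \<and> rbd c d n}" "S \<noteq> {}"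
    and Q: "\<And>m n. Q m \<Longrightarrow> m \<le> n \<Longrightarrow> Q n"
  shows "rend S = d"
proof -
  consider "d = \<infinity>" | D where "d = ereal (of_int D)" | "d = - \<infinity>" using d by (auto simp: ereal_ints_def)
  thus ?thesis
  proof cases
    case 1
    have "hi S = {}" using Q[of "n - 1" n for n] by (auto simp: hi_def S 1 rbd_simps)
    thus ?thesis by (simp add: rend_def 1)
  next
    case 2
    define m where "m = (if c then 2 * D else 2 * D - 1)"
    have Sm: "S = {n. Q n \<and> n \<le> m}" unfolding S(1) 2 rbd_simps by (auto simp: m_def)
    then obtain s where "s \<le> m" "Q s" using S(2) by blast
    hence "Q m" using Q by blast
    hence "hi S = {m + 1}" using Q[of "n - 1" n for n] by (auto simp: hi_def Sm)
    thus ?thesis using rend_hi by (simp add: 2 m_def)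
  next
    case 3
    thus ?thesis using S by (simp add: rbd_simps)
  qed
qed

lemma lbd_mono: "lbd c b m \<Longrightarrow> m \<le> n \<Longrightarrow> b \<in> ereal_ints \<union> {- \<infinity>, \<infinity>} \<Longrightarrow> lbd c b n"
  by (auto simp: ereal_ints_def lbd_simps split: if_splits)

lemma rbd_mono: "rbd c d n \<Longrightarrow> m \<le> n \<Longrightarrow> d \<in> ereal_ints \<union> {- \<infinity>, \<infinity>} \<Longrightarrow> rbd c d m"
  by (auto simp: ereal_ints_def rbd_simps split: if_splits)

lemma ZZ_intervals:
  "ZZ_oo b d = pt ` {n. lbd False b n \<and> rbd False d n}"
  "ZZ_co b d = pt ` {n. lbd True b n \<and> rbd False d n}"
  "ZZ_oc b d = pt ` {n. lbd False b n \<and> rbd True d n}"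
  "ZZ_cc b d = pt ` {n. lbd True b n \<and> rbd True d n}"
proof -
  have "{p \<in> ZZ. P p} = pt ` {n. P (pt n)}" for P unfolding ZZ_pt by blast
  thus "ZZ_oo b d = pt ` {n. lbd False b n \<and> rbd False d n}"
    "ZZ_co b d = pt ` {n. lbd True b n \<and> rbd False d n}"
    "ZZ_oc b d = pt ` {n. lbd False b n \<and> rbd True d n}"
    "ZZ_cc b d = pt ` {n. lbd True b n \<and> rbd True d n}"
    unfolding ZZ_oo_def ZZ_co_def ZZ_oc_def ZZ_cc_def lbd_def rbd_def by simp_all
qed

lemma pt_image_eq: "pt ` S = pt ` T \<longleftrightarrow> S = T"
  by (rule inj_image_eq_iff[OF inj_pt])

text \<open>The endpoints are recovered from the neighbours of \<open>S\<close>, whichever form the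
  interval is written in; this justifies the definite description in
  \<open>endpoints\<close>.\<close>

lemma has_endpoints_unique:
  assumes "has_endpoints (pt ` S) (b, d)" "S \<noteq> {}"
  shows "b = lend S \<and> d = rend S"
proof -
  have bd: "b \<in> ereal_ints \<union> {- \<infinity>, \<infinity>}" "d \<in> ereal_ints \<union> {- \<infinity>, \<infinity>}"
    and "\<exists>c c'. S = {n. lbd c b n \<and> rbd c' d n}"
    using assms(1) unfolding has_endpoints_def case_prod_conv ZZ_intervals pt_image_eq by blast+
  then obtain c c' where S: "S = {n. lbd c b n \<and> rbd c' d n}" by blast
  show ?thesis
    using lend_eq[OF bd(1) S assms(2)] rend_eq[OF bd(2) S assms(2)] rbd_mono[OF _ _ bd(2)] lbd_mono[OF _ _ bd(1)]
    by metis
qed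

lemma convex_gap_lo:
  assumes "s \<in> S" "n \<notin> S" "n \<le> s"
  shows "\<exists>p\<in>lo S. n \<le> p"
proof (rule ccontr)
  assume c: "\<not> ?thesis"
  have "m \<le> s \<longrightarrow> m \<notin> S" if "n \<le> m" for m
    using that
  proof (induction m rule: int_ge_induct)
    case (step m)
    show ?case
    proof (intro impI notI)
      assume "m + 1 \<le> s" "m + 1 \<in> S"
      hence "m \<in> lo S" using step.IH by (simp add: lo_def)
      thus False using c step.hyps by blast
    qed
  qed (use assms in simp)
  thus False using assms by blast
qed

lemma convex_gap_hi:
  assumes "s \<in> S" "n \<notin> S" "s \<le> n"
  shows "\<exists>q\<in>hi S. q \<le> n"
proof -
  obtain p where "p \<in> lo (uminus ` S)" "- n \<le> p"
    using convex_gap_lo[of "- s" "uminus ` S" "- n"] assms by (auto simp: mem_uminus_image)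
  thus ?thesis unfolding lo_uminus by force
qed

lemma lbd_lend:
  assumes "convex_ints S"
  shows "lbd (\<exists>p\<in>lo S. odd p) (lend S) n \<longleftrightarrow> (\<forall>p\<in>lo S. p < n)"
proof (cases rule: lo_cases[OF assms])
  case 1
  thus ?thesis by (simp add: lend_def lbd_simps)
next
  case (2 p)
  show ?thesis unfolding lend_lo[OF 2] lbd_simps 2 by (auto elim!: oddE)
qed

lemma rbd_rend:
  assumes "convex_ints S"
  shows "rbd (\<exists>q\<in>hi S. odd q) (rend S) n \<longleftrightarrow> (\<forall>q\<in>hi S. n < q)"
proof (cases rule: hi_cases[OF assms])
  case 1
  thus ?thesis by (simp add: rend_def rbd_simps)
next
  case (2 q)
  show ?thesis unfolding rend_hi[OF 2] rbd_simps 2 by (auto elim!: oddE)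
qed

lemma has_endpoints_pt:
  assumes S: "convex_ints S" "S \<noteq> {}"
  shows "has_endpoints (pt ` S) (lend S, rend S)"
proof -
  let ?c = "\<exists>p\<in>lo S. odd p" and ?c' = "\<exists>q\<in>hi S. odd q"
  have SS: "S = {n. lbd ?c (lend S) n \<and> rbd ?c' (rend S) n}"
    unfolding lbd_lend[OF S(1)] rbd_rend[OF S(1)]
  proof (intro set_eqI iffI)
    fix n assume "n \<in> S"
    thus "n \<in> {n. (\<forall>p\<in>lo S. p < n) \<and> (\<forall>q\<in>hi S. n < q)}"
      using lo_less[OF S(1)] hi_greater[OF S(1)] by blast
  next
    fix n assume n: "n \<in> {n. (\<forall>p\<in>lo S. p < n) \<and> (\<forall>q\<in>hi S. n < q)}"
    obtain s where s: "s \<in> S" using S(2) by blast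
    show "n \<in> S"
    proof (rule ccontr)
      assume nS: "n \<notin> S"
      show False
      proof (cases "n \<le> s")
        case True
        thus False using convex_gap_lo[OF s nS] n by force
      next
        case False
        thus False using convex_gap_hi[OF s nS] n by force
      qed
    qed
  qed
  obtain s where s: "lbd ?c (lend S) s" "rbd ?c' (rend S) s" using SS S(2) by blast
  have l: "lend S \<in> ereal_ints" if "lo S \<noteq> {}" using that by (auto simp: lend_def ereal_ints_def)
  have r: "rend S \<in> ereal_ints" if "hi S \<noteq> {}" using that by (auto simp: rend_def ereal_ints_def)
  have lm: "lend S = - \<infinity>" if "lo S = {}" using that by (simp add: lend_def)
  have rm: "rend S = \<infinity>" if "hi S = {}" using that by (simp add: rend_def)
  \<comment> \<open>The level \<open>s\<close> lies between the two ends, which yields their order,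
    and strictness if one of them is open.\<close>
  have le: "lend S \<le> rend S \<and> (\<not> (?c \<and> ?c') \<longrightarrow> lend S < rend S)"
  proof (cases "lo S = {} \<or> hi S = {}")
    case True
    moreover have "lend S \<noteq> \<infinity>" "rend S \<noteq> - \<infinity>" by (simp_all add: lend_def rend_def)
    ultimately show ?thesis using lm rm by (auto simp: less_le)
  next
    case False
    then obtain B D where BD: "lend S = ereal (of_int B)" "rend S = ereal (of_int D)"
      using l r unfolding ereal_ints_def by blast
    show ?thesis using s unfolding BD lbd_simps rbd_simps by (auto split: if_splits)
  qed
  note he = has_endpoints_def case_prod_conv ZZ_intervals pt_image_eq
  consider "?c" "?c'" | "?c" "\<not> ?c'" | "\<not> ?c" "?c'" | "\<not> ?c" "\<not> ?c'" by blast
  thus ?thesis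
  proof cases
    case 1
    have "S = {n. lbd True (lend S) n \<and> rbd True (rend S) n}" using SS 1 by simp
    moreover have "lend S \<in> ereal_ints" "rend S \<in> ereal_ints" using 1 l r by blast+
    ultimately show ?thesis using le unfolding he by blast
  next
    case 2
    have "S = {n. lbd True (lend S) n \<and> rbd False (rend S) n}" using SS 2 by simp
    moreover have "lend S \<in> ereal_ints" "rend S \<in> ereal_ints \<union> {\<infinity>}" using 2 l r rm by blast+
    ultimately show ?thesis using le 2 unfolding he by blast
  next
    case 3
    have "S = {n. lbd False (lend S) n \<and> rbd True (rend S) n}" using SS 3 by simp
    moreover have "lend S \<in> ereal_ints \<union> {- \<infinity>}" "rend S \<in> ereal_ints" using 3 l r lm by blast+
    ultimately show ?thesis using le 3 unfolding he by blast
  next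
    case 4
    have "S = {n. lbd False (lend S) n \<and> rbd False (rend S) n}" using SS 4 by simp
    moreover have "lend S \<in> ereal_ints \<union> {- \<infinity>, \<infinity>}" "rend S \<in> ereal_ints \<union> {- \<infinity>, \<infinity>}"
      using l r lm rm by blast+
    ultimately show ?thesis using le 4 unfolding he by blast
  qed
qed

theorem endpoints_pt:
  assumes "convex_ints S" "S \<noteq> {}"
  shows "endpoints (pt ` S) = (lend S, rend S)"
  unfolding endpoints_def
proof (rule the_equality)
  show "has_endpoints (pt ` S) (lend S, rend S)" by (rule has_endpoints_pt[OF assms])
  fix u assume "has_endpoints (pt ` S) u"
  thus "u = (lend S, rend S)" using has_endpoints_unique[OF _ assms(2), of "fst u" "snd u"] by (simp add: prod_eq_iff)
qed

lemma lend_uminus: "convex_ints S \<Longrightarrow> lend (uminus ` S) = - rend S"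
proof -
  assume S: "convex_ints S"
  show ?thesis
  proof (cases rule: hi_cases[OF S])
    case 1
    thus ?thesis by (simp add: lend_def rend_def lo_uminus)
  next
    case (2 q)
    have "lo (uminus ` S) = {- q}" by (simp add: lo_uminus 2)
    moreover have "(- q + 1) div 2 = - (q div 2)" by presburger
    ultimately show ?thesis using lend_lo rend_hi[OF 2] by simp
  qed
qed

lemma rend_uminus: "convex_ints S \<Longrightarrow> rend (uminus ` S) = - lend S"
  using lend_uminus[OF convex_ints_uminus] by (metis ereal_uminus_uminus uminus_image_uminus)

text \<open>An odd left neighbour means that the lowest level is even, so the infimum is attained
  there; without a left neighbour there are even levels arbitrarily far down.\<close>

lemma birth_lend:
  assumes K: "convex_ints (lev K)" "lev K \<noteq> {}" and odd: "\<And>p. p \<in> lo (lev K) \<Longrightarrow> odd p"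
  shows "birth K = lend (lev K)"
proof -
  have e: "{ereal (of_int i) | i x. (2 * i, x) \<in> K} = {ereal (of_int i) | i. 2 * i \<in> lev K}"
    by (force simp: lev_def)
  show ?thesis
  proof (cases rule: lo_cases[OF K(1)])
    case 1
    have mem: "n \<in> lev K" if "n \<le> s" "s \<in> lev K" for n s
      using convex_gap_lo[OF that(2) _ that(1)] 1 by blast
    obtain s where s: "s \<in> lev K" using K(2) by blast
    have "birth K \<le> ereal r" for r
    proof -
      have "2 * min \<lfloor>r\<rfloor> (s div 2) \<in> lev K" by (rule mem[OF _ s]) linarith
      hence "birth K \<le> ereal (of_int (min \<lfloor>r\<rfloor> (s div 2)))"
        unfolding birth_def e by (intro Inf_lower) blast
      also have "\<dots> \<le> ereal (of_int \<lfloor>r\<rfloor>)" unfolding ereal_less_eq of_int_le_iff by (rule min.cobounded1)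
      also have "\<dots> \<le> ereal r" unfolding ereal_less_eq by (rule of_int_floor_le)
      finally show ?thesis .
    qed
    hence "birth K = - \<infinity>" using ereal_bot by blast
    thus ?thesis by (simp add: lend_def 1)
  next
    case (2 p)
    have "odd p" using odd 2 by simp
    then obtain k where "p = 2 * k + 1" by (rule oddE)
    then obtain i where i: "p = 2 * i - 1" by (intro that[of "k + 1"]) simp
    have "p \<in> lo (lev K)" using 2 by simp
    hence "2 * i \<in> lev K" using i by (simp add: lo_def)
    moreover have "i \<le> j" if "2 * j \<in> lev K" for j using lo_less[OF K(1), of p, OF _ that] 2 i by simp
    ultimately have "birth K = ereal (of_int i)"
      unfolding birth_def e by (intro antisym Inf_lower Inf_greatest) auto
    thus ?thesis using lend_lo[OF 2] i by simp
  qed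
qed

lemma birth_rn: "birth (rn ` K) = - death K"
proof -
  have "{ereal (of_int i) | i x. (2 * i, x) \<in> rn ` K} = uminus ` {ereal (of_int i) | i x. (2 * i, x) \<in> K}"
  proof (intro set_eqI iffI)
    fix t assume "t \<in> {ereal (of_int i) | i x. (2 * i, x) \<in> rn ` K}"
    then obtain i x where t: "t = ereal (of_int i)" "(2 * i, x) \<in> rn ` K" by blast
    hence "(2 * - i, x) \<in> K" by (auto simp: rn_def)
    moreover have "t = - ereal (of_int (- i))" using t by simp
    ultimately show "t \<in> uminus ` {ereal (of_int i) | i x. (2 * i, x) \<in> K}" by blast
  next
    fix t assume "t \<in> uminus ` {ereal (of_int i) | i x. (2 * i, x) \<in> K}"
    then obtain i x where t: "t = - ereal (of_int i)" "(2 * i, x) \<in> K" by blast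
    hence "(2 * - i, x) \<in> rn ` K" by (force simp: rn_def)
    moreover have "t = ereal (of_int (- i))" using t by simp
    ultimately show "t \<in> {ereal (of_int i) | i x. (2 * i, x) \<in> rn ` K}" by blast
  qed
  thus ?thesis unfolding birth_def death_def by (simp add: ereal_Inf_uminus_image_eq)
qed

lemma death_rend:
  assumes K: "convex_ints (lev K)" "lev K \<noteq> {}" and odd: "\<And>q. q \<in> hi (lev K) \<Longrightarrow> odd q"
  shows "death K = rend (lev K)"
proof -
  have "birth (rn ` K) = lend (lev (rn ` K))"
    by (rule birth_lend) (use K odd in \<open>auto simp: lev_rn lo_uminus intro: convex_ints_uminus\<close>)
  thus ?thesis using birth_rn[of K] lend_uminus[OF K(1)] by (simp add: lev_rn)
qed

context reeb
begin

text \<open>If \<open>p\<close> were even, a node at the odd level \<open>p + 1\<close> would have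
  an edge to level \<open>p\<close>. So an end at which a component stops by itself is a closed
  end.\<close>

lemma comps_lo_odd:
  assumes K: "K \<in> comps G S" and p: "p \<in> lo (lev K)" "p \<in> S"
  shows "odd p"
proof (rule ccontr)
  assume e: "\<not> odd p"
  obtain a where a: "a \<in> K" "fst a = p + 1" using p(1) unfolding lo_def lev_def by force
  have an: "a \<in> nodes G S" by (rule subsetD[OF comps_sub[OF K] a(1)])
  have "dnn G a \<in> K"
    by (rule comps_closed[OF K a(1) edges_linked[OF upn_dnn(4)[OF an]]]) (use e a(2) p(2) in simp_all)
  hence "p \<in> lev K" using a(2) unfolding lev_def dnn_def by force
  thus False using p(1) by (simp add: lo_def)
qed

lemma comps_hi_odd:
  assumes K: "K \<in> comps G S" and p: "p \<in> hi (lev K)" "p \<in> S"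
  shows "odd p"
proof (rule ccontr)
  assume e: "\<not> odd p"
  obtain a where a: "a \<in> K" "fst a = p - 1" using p(1) unfolding hi_def lev_def by force
  have an: "a \<in> nodes G S" by (rule subsetD[OF comps_sub[OF K] a(1)])
  have "upn G a \<in> K"
    by (rule comps_closed[OF K a(1) edges_linked[OF upn_dnn(3)[OF an]]]) (use e a(2) p(2) in simp_all)
  hence "p \<in> lev K" using a(2) unfolding lev_def upn_def by force
  thus False using p(1) by (simp add: hi_def)
qed

lemma comps_lev_nonempty: "K \<in> comps G S \<Longrightarrow> lev K \<noteq> {}"
  using comps_nonempty unfolding lev_def by blast

end

subsection \<open>Matching the diagrams\<close>

definition refl_pt :: "real \<times> real \<Rightarrow> real \<times> real" where
  "refl_pt u = (- snd u, - fst u)"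

lemma refl_pt_simps:
  "refl_pt (shift_pt \<epsilon> u) = shift_pt \<epsilon> (refl_pt u)" "refl_pt u \<in> UU \<longleftrightarrow> u \<in> UU" "refl_pt u \<unlhd> refl_pt v \<longleftrightarrow> u \<unlhd> v"
  by (auto simp: refl_pt_def shift_pt_def UU_def op_le_def case_prod_beta)

lemma win_refl_pt: "win (refl_pt u) = uminus ` win u"
proof (intro set_eqI)
  fix n :: int
  have "(n + 1) div 2 = - ((- n) div 2)" "n div 2 = - ((- n + 1) div 2)" by presburger+
  hence "real_of_int ((n + 1) div 2) = - of_int ((- n) div 2)" "real_of_int (n div 2) = - of_int ((- n + 1) div 2)"
    by (simp_all only: of_int_minus)
  thus "n \<in> win (refl_pt u) \<longleftrightarrow> n \<in> uminus ` win u"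
    unfolding mem_uminus_image win_def refl_pt_def mem_Collect_eq fst_conv snd_conv by auto
qed

lemma comps_rfl_win: "K \<in> comps (rfl G) (win u) \<longleftrightarrow> rn ` K \<in> comps G (win (refl_pt u))"
proof -
  have "K \<in> (`) rn ` C \<longleftrightarrow> rn ` K \<in> C" for C
  proof
    assume "K \<in> (`) rn ` C"
    then obtain L where "L \<in> C" "K = rn ` L" by blast
    thus "rn ` K \<in> C" by simp
  next
    assume "rn ` K \<in> C"
    hence "rn ` (rn ` K) \<in> (`) rn ` C" by (rule imageI)
    thus "K \<in> (`) rn ` C" by simp
  qed
  thus ?thesis unfolding comps_rfl win_refl_pt .
qed

text \<open>Reflecting levels reflects windows by \<open>refl_pt\<close>, which commutes with
  shifts. Thus the result on bars open on the right is also available for bars open on the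
  left.\<close>

lemma interleaving_rfl:
  assumes "interleaving G H \<epsilon> f g"
  shows "interleaving (rfl G) (rfl H) \<epsilon> (\<lambda>u K. rn ` f (refl_pt u) (rn ` K)) (\<lambda>u K. rn ` g (refl_pt u) (rn ` K))"
proof -
  interpret interleaving G H \<epsilon> f g by fact
  interpret GR: reeb "rfl G" by (rule reeb_rfl) unfold_locales
  interpret HR: reeb "rfl H" by (rule reeb_rfl) unfold_locales
  have l: "K \<subseteq> rn ` A" if "rn ` K \<subseteq> A" for K A :: "'c node set" using image_mono[OF that, of rn] by simp
  note U = refl_pt_simps(2,3)
  show ?thesis
  proof
    show "0 \<le> \<epsilon>" by (rule eps)
    fix u :: "real \<times> real" assume u: "u \<in> UU"
    hence u': "refl_pt u \<in> UU" by (simp only: U)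
    {
      fix K assume "K \<in> comps (rfl G) (win u)"
      hence K: "rn ` K \<in> comps G (win (refl_pt u))" by (simp only: comps_rfl_win)
      show "rn ` f (refl_pt u) (rn ` K) \<in> comps (rfl H) (win (shift_pt \<epsilon> u))"
        unfolding comps_rfl_win rn_image_rn refl_pt_simps(1) by (rule f_comps[OF u' K])
      show "K \<subseteq> rn ` g (refl_pt (shift_pt \<epsilon> u)) (rn ` rn ` f (refl_pt u) (rn ` K))"
        unfolding rn_image_rn refl_pt_simps(1) by (rule l[OF gf[OF u' K]])
      fix v K' assume v: "v \<in> UU" "u \<unlhd> v" and a: "K' \<in> comps (rfl G) (win v)" "K \<subseteq> K'"
      note K' = a(1)[unfolded comps_rfl_win] image_mono[OF a(2), of rn]
      show "rn ` f (refl_pt u) (rn ` K) \<subseteq> rn ` f (refl_pt v) (rn ` K')"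
        by (rule image_mono[OF f_mono[OF u' _ _ K K']]) (simp_all only: U v)
    next
      fix K assume "K \<in> comps (rfl H) (win u)"
      hence K: "rn ` K \<in> comps H (win (refl_pt u))" by (simp only: comps_rfl_win)
      show "rn ` g (refl_pt u) (rn ` K) \<in> comps (rfl G) (win (shift_pt \<epsilon> u))"
        unfolding comps_rfl_win rn_image_rn refl_pt_simps(1) by (rule g_comps[OF u' K])
      show "K \<subseteq> rn ` f (refl_pt (shift_pt \<epsilon> u)) (rn ` rn ` g (refl_pt u) (rn ` K))"
        unfolding rn_image_rn refl_pt_simps(1) by (rule l[OF fg[OF u' K]])
      fix v K' assume v: "v \<in> UU" "u \<unlhd> v" and a: "K' \<in> comps (rfl H) (win v)" "K \<subseteq> K'"
      note K' = a(1)[unfolded comps_rfl_win] image_mono[OF a(2), of rn]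
      show "rn ` g (refl_pt u) (rn ` K) \<subseteq> rn ` g (refl_pt v) (rn ` K')"
        by (rule image_mono[OF g_mono[OF u' _ _ K K']]) (simp_all only: U v)
    }
  qed
qed

text \<open>The flags tell whether the left and the right end are open.\<close>

definition kind :: "bool \<Rightarrow> bool \<Rightarrow> int set set" where
  "kind l r = {S. convex_ints S \<and> S \<noteq> {} \<and> ((\<exists>p\<in>lo S. even p) \<longleftrightarrow> l) \<and> ((\<exists>q\<in>hi S. even q) \<longleftrightarrow> r)}"

definition labels :: "(int, 'a) diagram \<Rightarrow> int set set \<Rightarrow> ((int \<times> int) set \<times> nat) set" where
  "labels M \<S> = {(I, k). I \<in> (`) pt ` \<S> \<and> k < nat (dgm M I)}"

text \<open>Each kind of interval has its own model of bars; this interface transfers matchings of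
  the models to the diagrams uniformly.\<close>

definition represents :: "(int, 'a) diagram \<Rightarrow> int set set \<Rightarrow> 'x set \<Rightarrow> ('x \<Rightarrow> int set) \<Rightarrow> bool" where
  "represents M \<S> B \<sigma> \<longleftrightarrow> (\<forall>x\<in>B. \<sigma> x \<in> \<S>) \<and>
    (\<forall>S\<in>\<S>. finite {x \<in> B. \<sigma> x = S} \<and> int (card {x \<in> B. \<sigma> x = S}) = dgm M (pt ` S))"

text \<open>The bound \<open>4 * \<epsilon>\<close> on unmatched bars is that of a
  \<open>2 * \<epsilon>\<close>-matching; for matched pairs the sharper bound
  \<open>\<epsilon>\<close> is kept.\<close>

definition close_matching ::
  "real \<Rightarrow> 'x set \<Rightarrow> ('x \<Rightarrow> ereal \<times> ereal) \<Rightarrow> 'y set \<Rightarrow> ('y \<Rightarrow> ereal \<times> ereal) \<Rightarrow> ('x \<times> 'y) set \<Rightarrow> bool" where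
  "close_matching \<epsilon> X p Y q m \<longleftrightarrow> m \<subseteq> X \<times> Y \<and> partial_inj m \<and>
    (\<forall>(x, y)\<in>m. near \<epsilon> (fst (p x)) (fst (q y)) \<and> near \<epsilon> (snd (p x)) (snd (q y))) \<and>
    (\<forall>x\<in>X - Domain m. snd (p x) \<le> fst (p x) + ereal (4 * \<epsilon>)) \<and>
    (\<forall>y\<in>Y - Range m. snd (q y) \<le> fst (q y) + ereal (4 * \<epsilon>))"

abbreviation ends :: "int set \<Rightarrow> ereal \<times> ereal" where
  "ends S \<equiv> (lend S, rend S)"

lemma represents_labels:
  assumes "represents M \<S> B \<sigma>"
  shows "\<exists>\<beta>. bij_betw \<beta> B (labels M \<S>) \<and> (\<forall>x\<in>B. fst (\<beta> x) = pt ` \<sigma> x)"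
proof -
  let ?F = "\<lambda>S. {x \<in> B. \<sigma> x = S}"
  have "\<forall>S\<in>\<S>. \<exists>h. bij_betw h (?F S) {0..<card (?F S)}"
    using assms ex_bij_betw_finite_nat unfolding represents_def by blast
  then obtain h where h: "\<And>S. S \<in> \<S> \<Longrightarrow> bij_betw (h S) (?F S) {0..<card (?F S)}" by metis
  have \<sigma>: "\<sigma> x \<in> \<S>" if "x \<in> B" for x using assms that unfolding represents_def by blast
  have card: "nat (dgm M (pt ` S)) = card (?F S)" if "S \<in> \<S>" for S
    using assms that unfolding represents_def by (metis nat_int)
  define \<beta> where "\<beta> x = (pt ` \<sigma> x, h (\<sigma> x) x)" for x
  have "bij_betw \<beta> B (labels M \<S>)"
  proof (rule bij_betwI')
    fix x y assume xy: "x \<in> B" "y \<in> B"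
    show "\<beta> x = \<beta> y \<longleftrightarrow> x = y"
    proof
      assume "\<beta> x = \<beta> y"
      hence "\<sigma> y = \<sigma> x" "h (\<sigma> x) x = h (\<sigma> x) y" unfolding \<beta>_def prod.inject pt_image_eq by metis+
      thus "x = y" using h[OF \<sigma>[OF xy(1)]] xy unfolding bij_betw_def inj_on_def by blast
    qed simp
  next
    fix x assume x: "x \<in> B"
    hence "h (\<sigma> x) x \<in> {0..<card (?F (\<sigma> x))}" using h[OF \<sigma>[OF x]] unfolding bij_betw_def by blast
    thus "\<beta> x \<in> labels M \<S>" using \<sigma>[OF x] card unfolding \<beta>_def labels_def by auto
  next
    fix l assume "l \<in> labels M \<S>"
    then obtain S k where l: "l = (pt ` S, k)" "S \<in> \<S>" "k < nat (dgm M (pt ` S))" unfolding labels_def by blast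
    hence "k \<in> h S ` ?F S" using h[OF l(2)] card[OF l(2)] unfolding bij_betw_def by simp
    thus "\<exists>x\<in>B. l = \<beta> x" unfolding \<beta>_def l(1) by blast
  qed
  thus ?thesis by (intro exI[of _ \<beta>]) (simp add: \<beta>_def)
qed

lemma close_matching_labels:
  assumes X: "represents M \<S> X \<sigma>" and Y: "represents N \<S> Y \<tau>"
    and S: "\<And>S. S \<in> \<S> \<Longrightarrow> convex_ints S \<and> S \<noteq> {}"
    and m: "close_matching \<epsilon> X (\<lambda>x. ends (\<sigma> x)) Y (\<lambda>y. ends (\<tau> y)) m"
  shows "\<exists>m. close_matching \<epsilon> (labels M \<S>) (endpoints \<circ> fst) (labels N \<S>) (endpoints \<circ> fst) m"
proof -
  obtain \<beta> where \<beta>: "bij_betw \<beta> X (labels M \<S>)" "\<And>x. x \<in> X \<Longrightarrow> fst (\<beta> x) = pt ` \<sigma> x"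
    using represents_labels[OF X] by blast
  obtain \<gamma> where \<gamma>: "bij_betw \<gamma> Y (labels N \<S>)" "\<And>y. y \<in> Y \<Longrightarrow> fst (\<gamma> y) = pt ` \<tau> y"
    using represents_labels[OF Y] by blast
  have e\<beta>: "endpoints (fst (\<beta> x)) = ends (\<sigma> x)" if "x \<in> X" for x
    unfolding \<beta>(2)[OF that] using endpoints_pt S X that unfolding represents_def by blast
  have e\<gamma>: "endpoints (fst (\<gamma> y)) = ends (\<tau> y)" if "y \<in> Y" for y
    unfolding \<gamma>(2)[OF that] using endpoints_pt S Y that unfolding represents_def by blast
  have mXY: "m \<subseteq> X \<times> Y" and mi: "partial_inj m"
    and mn: "\<And>x y. (x, y) \<in> m \<Longrightarrow> near \<epsilon> (lend (\<sigma> x)) (lend (\<tau> y)) \<and> near \<epsilon> (rend (\<sigma> x)) (rend (\<tau> y))"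
    and mX: "\<And>x. x \<in> X \<Longrightarrow> x \<notin> Domain m \<Longrightarrow> rend (\<sigma> x) \<le> lend (\<sigma> x) + ereal (4 * \<epsilon>)"
    and mY: "\<And>y. y \<in> Y \<Longrightarrow> y \<notin> Range m \<Longrightarrow> rend (\<tau> y) \<le> lend (\<tau> y) + ereal (4 * \<epsilon>)"
    using m unfolding close_matching_def by auto
  define m' where "m' = {(\<beta> x, \<gamma> y) | x y. (x, y) \<in> m}"
  have inj: "inj_on \<beta> X" "inj_on \<gamma> Y" and im: "\<beta> ` X = labels M \<S>" "\<gamma> ` Y = labels N \<S>"
    using \<beta>(1) \<gamma>(1) by (simp_all add: bij_betw_def)
  have "close_matching \<epsilon> (labels M \<S>) (endpoints \<circ> fst) (labels N \<S>) (endpoints \<circ> fst) m'"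
    unfolding close_matching_def
  proof (intro conjI ballI)
    show "m' \<subseteq> labels M \<S> \<times> labels N \<S>" using mXY im unfolding m'_def by blast
    show "partial_inj m'"
      unfolding partial_inj_def
    proof (intro conjI single_valuedI)
      fix a b c assume "(a, b) \<in> m'" "(a, c) \<in> m'"
      then obtain x y x' z where xy: "a = \<beta> x" "b = \<gamma> y" "(x, y) \<in> m" "a = \<beta> x'" "c = \<gamma> z" "(x', z) \<in> m"
        unfolding m'_def by blast
      have "x \<in> X" "x' \<in> X" using xy(3,6) mXY by blast+
      hence "x = x'" using xy(1,4) inj_onD[OF inj(1)] by blast
      hence "y = z" using mi xy(3,6) unfolding partial_inj_def single_valued_def by blast
      thus "b = c" using xy by simp
    next
      fix a b c assume "(a, b) \<in> m'\<inverse>" "(a, c) \<in> m'\<inverse>"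
      then obtain x y x' z where xy: "b = \<beta> x" "a = \<gamma> y" "(x, y) \<in> m" "c = \<beta> x'" "a = \<gamma> z" "(x', z) \<in> m"
        unfolding m'_def by blast
      have "y \<in> Y" "z \<in> Y" using xy(3,6) mXY by blast+
      hence "y = z" using xy(2,5) inj_onD[OF inj(2)] by blast
      hence "x = x'" using mi xy(3,6) unfolding partial_inj_def single_valued_def by blast
      thus "b = c" using xy by simp
    qed
  next
    fix ab assume "ab \<in> m'"
    then obtain x y where xy: "ab = (\<beta> x, \<gamma> y)" "(x, y) \<in> m" unfolding m'_def by blast
    have "x \<in> X" "y \<in> Y" using xy(2) mXY by blast+
    thus "case ab of (x, y) \<Rightarrow> near \<epsilon> (fst ((endpoints \<circ> fst) x)) (fst ((endpoints \<circ> fst) y)) \<and>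
        near \<epsilon> (snd ((endpoints \<circ> fst) x)) (snd ((endpoints \<circ> fst) y))"
      using mn[OF xy(2)] xy(1) e\<beta> e\<gamma> by simp
  next
    fix l assume l: "l \<in> labels M \<S> - Domain m'"
    then obtain x where x: "x \<in> X" "l = \<beta> x" using im(1) by blast
    have "x \<notin> Domain m" using l x(2) unfolding m'_def by blast
    thus "snd ((endpoints \<circ> fst) l) \<le> fst ((endpoints \<circ> fst) l) + ereal (4 * \<epsilon>)"
      using mX[OF x(1)] e\<beta>[OF x(1)] x(2) by simp
  next
    fix l assume l: "l \<in> labels N \<S> - Range m'"
    then obtain y where y: "y \<in> Y" "l = \<gamma> y" using im(2) by blast
    have "y \<notin> Range m" using l y(2) unfolding m'_def by blast
    thus "snd ((endpoints \<circ> fst) l) \<le> fst ((endpoints \<circ> fst) l) + ereal (4 * \<epsilon>)"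
      using mY[OF y(1)] e\<gamma>[OF y(1)] y(2) by simp
  qed
  thus ?thesis by blast
qed

context reeb
begin

lemma lev_kind_UNIV: "K \<in> comps G UNIV \<Longrightarrow> lev K \<in> kind False False"
  unfolding kind_def using lev_convex comps_lev_nonempty comps_lo_odd comps_hi_odd by blast

lemma ends_UNIV: "K \<in> comps G UNIV \<Longrightarrow> ends (lev K) = (birth K, death K)"
  using birth_lend death_rend lev_convex comps_lev_nonempty comps_lo_odd comps_hi_odd UNIV_I by metis

lemma half_bar_lev:
  assumes x: "x \<in> half_bars G"
  shows "lev (snd x) \<in> kind False True" "ends (lev (snd x)) = (birth (snd x), ereal (of_int (fst x)))"
proof -
  have c: "snd x \<in> comps G {..2 * fst x - 1}" using half_bar_cq[OF x] by (simp add: cq_def algebra_simps)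
  have r: "2 * fst x - 1 \<in> lev (snd x)" by (rule half_bar_reaches[OF x])
  have sub: "lev (snd x) \<subseteq> {..2 * fst x - 1}" by (rule comps_lev[OF c])
  have cv: "convex_ints (lev (snd x))" "lev (snd x) \<noteq> {}" using lev_convex[OF c] r by auto
  have "2 * fst x \<in> hi (lev (snd x))" using r sub by (auto simp: hi_def)
  hence hi: "hi (lev (snd x)) = {2 * fst x}" using hi_unique[OF cv(1)] by blast
  have lo: "odd p" if p: "p \<in> lo (lev (snd x))" for p
  proof (rule comps_lo_odd[OF c p])
    have "p + 1 \<in> {..2 * fst x - 1}" using p sub unfolding lo_def by blast
    thus "p \<in> {..2 * fst x - 1}" by simp
  qed
  show "lev (snd x) \<in> kind False True" unfolding kind_def using cv hi lo by auto
  show "ends (lev (snd x)) = (birth (snd x), ereal (of_int (fst x)))"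
    using birth_lend[OF cv lo] rend_hi[OF hi] by simp
qed

lemma open_bar_lev:
  assumes x: "x \<in> open_bars G"
  defines "S \<equiv> {2 * fst (fst x) + 1..2 * snd (fst x) - 1}"
  shows "S \<in> kind True True" "ends S = (ereal (of_int (fst (fst x))), ereal (of_int (snd (fst x))))"
proof -
  have lt: "fst (fst x) < snd (fst x)" by (rule open_bars_lt[OF x])
  have lo: "lo S = {2 * fst (fst x)}" and hi: "hi S = {2 * snd (fst x)}"
    using lt by (auto simp: S_def lo_def hi_def)
  have "convex_ints S" "S \<noteq> {}" using lt by (auto simp: S_def convex_ints_def)
  thus "S \<in> kind True True" unfolding kind_def using lo hi by auto
  show "ends S = (ereal (of_int (fst (fst x))), ereal (of_int (snd (fst x))))"
    using lend_lo[OF lo] rend_hi[OF hi] by simp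
qed

end

lemma kind_uminus: "S \<in> kind l r \<Longrightarrow> uminus ` S \<in> kind r l"
  unfolding kind_def by (auto simp: lo_uminus hi_uminus intro: convex_ints_uminus)

lemma kindD: "S \<in> kind l r \<Longrightarrow> convex_ints S \<and> S \<noteq> {}"
  by (simp add: kind_def)

lemma kind_open_open:
  assumes S: "S \<in> kind True True"
  obtains b d where "b < d" "S = {2 * b + 1..2 * d - 1}"
proof -
  have cv: "convex_ints S" "S \<noteq> {}" using kindD[OF S] by auto
  obtain p q where "p \<in> lo S" "even p" "q \<in> hi S" "even q" using S unfolding kind_def by blast
  then obtain b d where bd: "2 * b \<in> lo S" "2 * d \<in> hi S" by (auto elim!: evenE)
  have "2 * b + 1 \<in> S" "2 * d - 1 \<in> S" using bd by (simp_all add: lo_def hi_def)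
  hence "{2 * b + 1..2 * d - 1} \<subseteq> S"
    using cv(1) unfolding convex_ints_def by (meson atLeastAtMost_iff subsetI)
  moreover have "n \<in> {2 * b + 1..2 * d - 1}" if "n \<in> S" for n
    using lo_less[OF cv(1) bd(1) that] hi_greater[OF cv(1) bd(2) that] by simp
  ultimately have e: "S = {2 * b + 1..2 * d - 1}" by blast
  hence "b < d" using cv(2) by simp
  thus thesis by (rule that[OF _ e])
qed

lemma represents_closed_closed:
  assumes M: "reeb_graph M" "untwisted M"
  shows "represents M (kind False False) (comps (zz M) UNIV) lev"
proof -
  interpret reeb "zz M" by (rule reeb_zz[OF M(1)])
  have "finite {K \<in> comps (zz M) UNIV. lev K = S} \<and> int (card {K \<in> comps (zz M) UNIV. lev K = S}) = dgm M (pt ` S)"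
    if S: "S \<in> kind False False" for S
  proof -
    have cv: "convex_ints S" "S \<noteq> {}" and odd: "\<And>p. p \<in> lo S \<Longrightarrow> odd p" "\<And>q. q \<in> hi S \<Longrightarrow> odd q"
      using S by (auto simp: kind_def)
    show ?thesis
      using dgm_dgz[OF M cv] dgz_closed[OF cv odd] finite_comps_at[OF cv(2), of UNIV]
      unfolding comps_at_def by simp
  qed
  thus ?thesis unfolding represents_def using lev_kind_UNIV by blast
qed

lemma represents_closed_open:
  assumes M: "reeb_graph M" "untwisted M"
  shows "represents M (kind False True) (half_bars (zz M)) (\<lambda>x. lev (snd x))"
proof -
  interpret reeb "zz M" by (rule reeb_zz[OF M(1)])
  have "finite {x \<in> half_bars (zz M). lev (snd x) = S} \<and> int (card {x \<in> half_bars (zz M). lev (snd x) = S}) = dgm M (pt ` S)"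
    if S: "S \<in> kind False True" for S
  proof -
    have cv: "convex_ints S" "S \<noteq> {}" and odd: "\<And>p. p \<in> lo S \<Longrightarrow> odd p" using S by (auto simp: kind_def)
    obtain q where "q \<in> hi S" "even q" using S unfolding kind_def by blast
    then obtain d where d: "2 * d \<in> hi S" by (auto elim!: evenE)
    show ?thesis using dgm_dgz[OF M cv] card_half_bars[OF cv odd d] by simp
  qed
  thus ?thesis unfolding represents_def using half_bar_lev(1) by blast
qed

lemma represents_open_closed:
  assumes M: "reeb_graph M" "untwisted M"
  shows "represents M (kind True False) (half_bars (rfl (zz M))) (\<lambda>x. uminus ` lev (snd x))"
proof -
  interpret reeb "rfl (zz M)" by (rule reeb_rfl[OF reeb_zz[OF M(1)]])
  have "finite {x \<in> half_bars (rfl (zz M)). uminus ` lev (snd x) = S} \<and>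
      int (card {x \<in> half_bars (rfl (zz M)). uminus ` lev (snd x) = S}) = dgm M (pt ` S)"
    if S: "S \<in> kind True False" for S
  proof -
    have cvS: "convex_ints S" "S \<noteq> {}" using kindD[OF S] by auto
    let ?T = "uminus ` S"
    have T: "?T \<in> kind False True" by (rule kind_uminus[OF S])
    have cv: "convex_ints ?T" "?T \<noteq> {}" and odd: "\<And>p. p \<in> lo ?T \<Longrightarrow> odd p" using T by (auto simp: kind_def)
    obtain q where "q \<in> hi ?T" "even q" using T unfolding kind_def by blast
    then obtain d where d: "2 * d \<in> hi ?T" by (auto elim!: evenE)
    have e: "uminus ` lev (snd x) = S \<longleftrightarrow> lev (snd x) = ?T" for x :: "int \<times> 'a node set"
      by (metis uminus_image_uminus)
    show ?thesis
      unfolding e using dgm_dgz[OF M cvS] card_half_bars[OF cv odd d] by (simp add: dgz_rfl)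
  qed
  moreover have "uminus ` lev (snd x) \<in> kind True False" if "x \<in> half_bars (rfl (zz M))" for x
    by (rule kind_uminus[OF half_bar_lev(1)[OF that]])
  ultimately show ?thesis unfolding represents_def by blast
qed

lemma represents_open_open:
  assumes M: "reeb_graph M" "untwisted M"
  shows "represents M (kind True True) (open_bars (zz M)) (\<lambda>x. {2 * fst (fst x) + 1..2 * snd (fst x) - 1})"
proof -
  interpret reeb "zz M" by (rule reeb_zz[OF M(1)])
  let ?F = "\<lambda>S. {x \<in> open_bars (zz M). {2 * fst (fst x) + 1..2 * snd (fst x) - 1} = S}"
  have "finite (?F S) \<and> int (card (?F S)) = dgm M (pt ` S)" if S: "S \<in> kind True True" for S
  proof -
    have cv: "convex_ints S" "S \<noteq> {}" using kindD[OF S] by auto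
    obtain b d where bd: "b < d" "S = {2 * b + 1..2 * d - 1}" using kind_open_open[OF S] .
    have "?F S = Pair (b, d) ` ob (zz M) b d"
    proof (intro set_eqI iffI)
      fix x assume x: "x \<in> ?F S"
      hence xo: "x \<in> open_bars (zz M)" by blast
      have "{2 * fst (fst x) + 1..2 * snd (fst x) - 1} = {2 * b + 1..2 * d - 1}" using x bd(2) by blast
      hence "fst (fst x) = b" "snd (fst x) = d"
        unfolding Icc_eq_Icc using open_bars_lt[OF xo] bd(1) by linarith+
      thus "x \<in> Pair (b, d) ` ob (zz M) b d" using obarsD(1)[OF xo] by (cases x) auto
    next
      fix x assume "x \<in> Pair (b, d) ` ob (zz M) b d"
      thus "x \<in> ?F S" unfolding bd(2) open_bars_def by auto
    qed
    hence "finite (?F S)" "card (?F S) = card (ob (zz M) b d)" using ob_finite by (simp_all add: card_image inj_on_def)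
    thus ?thesis using dgm_dgz[OF M cv] card_ob_dgz[OF bd(1)] bd(2) by simp
  qed
  thus ?thesis unfolding represents_def using open_bar_lev(1) by blast
qed

lemma close_matching_cong:
  assumes "\<And>x. x \<in> X \<Longrightarrow> p x = p' x" "\<And>y. y \<in> Y \<Longrightarrow> q y = q' y" "close_matching \<epsilon> X p Y q m"
  shows "close_matching \<epsilon> X p' Y q' m"
proof -
  have m: "m \<subseteq> X \<times> Y" using assms(3) by (simp add: close_matching_def)
  have "near \<epsilon> (fst (p' x)) (fst (q' y)) \<and> near \<epsilon> (snd (p' x)) (snd (q' y))" if xy: "(x, y) \<in> m" for x y
  proof -
    have "x \<in> X" "y \<in> Y" using m xy by blast+
    thus ?thesis using assms xy unfolding close_matching_def by fastforce
  qed
  moreover have "snd (p' x) \<le> fst (p' x) + ereal (4 * \<epsilon>)" if "x \<in> X - Domain m" for x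
    using assms that unfolding close_matching_def by force
  moreover have "snd (q' y) \<le> fst (q' y) + ereal (4 * \<epsilon>)" if "y \<in> Y - Range m" for y
    using assms that unfolding close_matching_def by force
  ultimately show ?thesis using assms(3) unfolding close_matching_def by blast
qed

lemma near_uminus: "near \<epsilon> (- a) (- b) \<longleftrightarrow> near \<epsilon> a b"
proof -
  have "- a \<le> - b + ereal \<epsilon> \<longleftrightarrow> b \<le> a + ereal \<epsilon>" for a b
    by (cases a; cases b) auto
  thus ?thesis unfolding near_def by blast
qed

lemma le_uminus_add: "- b \<le> - d + ereal c \<longleftrightarrow> d \<le> b + ereal c"
  by (cases b; cases d) auto

lemma half_bars_close_matching:
  assumes "interleaving G H \<epsilon> f g"
  shows "\<exists>m. close_matching \<epsilon> (half_bars G) (\<lambda>x. (birth (snd x), ereal (of_int (fst x))))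
    (half_bars H) (\<lambda>y. (birth (snd y), ereal (of_int (fst y)))) m"
proof -
  interpret interleaving G H \<epsilon> f g by fact
  obtain m where m: "m \<subseteq> half_bars G \<times> half_bars H" "partial_inj m"
    "\<forall>(x, y)\<in>m. near \<epsilon> (birth (snd x)) (birth (snd y)) \<and>
      near \<epsilon> (ereal (of_int (fst x))) (ereal (of_int (fst y)))"
    "\<forall>x\<in>half_bars G - Domain m. ereal (of_int (fst x)) \<le> birth (snd x) + ereal (2 * \<epsilon>)"
    "\<forall>y\<in>half_bars H - Range m. ereal (of_int (fst y)) \<le> birth (snd y) + ereal (2 * \<epsilon>)"
    using half_bars_matching[OF assms] by blast
  have "b + ereal (2 * \<epsilon>) \<le> b + ereal (4 * \<epsilon>)" for b
    by (rule add_left_mono) (use eps in simp)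
  hence "\<forall>x\<in>half_bars G - Domain m. ereal (of_int (fst x)) \<le> birth (snd x) + ereal (4 * \<epsilon>)"
    "\<forall>y\<in>half_bars H - Range m. ereal (of_int (fst y)) \<le> birth (snd y) + ereal (4 * \<epsilon>)"
    using m(4,5) order_trans by blast+
  thus ?thesis unfolding close_matching_def fst_conv snd_conv using m(1-3) by blast
qed

text \<open>Bars are only ever matched with bars of the same kind, so each kind relies on the
  matching theorem for its own model.\<close>

lemma kind_close_matching:
  assumes M: "reeb_graph M" "untwisted M" and N: "reeb_graph N" "untwisted N"
    and i: "interleaving (zz M) (zz N) \<epsilon> f g"
  shows "\<exists>m. close_matching \<epsilon> (labels M (kind l r)) (endpoints \<circ> fst) (labels N (kind l r)) (endpoints \<circ> fst) m"
proof -
  interpret interleaving "zz M" "zz N" \<epsilon> f g by fact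
  consider "\<not> l" "\<not> r" | "\<not> l" r | l "\<not> r" | l r by blast
  thus ?thesis
  proof cases
    case 1
    obtain m where m: "m \<subseteq> {(K, K'). near \<epsilon> (birth K) (birth K') \<and> near \<epsilon> (death K) (death K')}"
      "partial_inj m" "Domain m = comps (zz M) UNIV" "Range m = comps (zz N) UNIV"
      using global_matching[OF i] by blast
    have "m \<subseteq> comps (zz M) UNIV \<times> comps (zz N) UNIV" unfolding m(3,4)[symmetric] by auto
    hence "close_matching \<epsilon> (comps (zz M) UNIV) (\<lambda>K. (birth K, death K)) (comps (zz N) UNIV) (\<lambda>K. (birth K, death K)) m"
      using m unfolding close_matching_def by auto
    hence "close_matching \<epsilon> (comps (zz M) UNIV) (\<lambda>K. ends (lev K)) (comps (zz N) UNIV) (\<lambda>K. ends (lev K)) m"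
      by (rule close_matching_cong[rotated 2]) (simp_all only: X.ends_UNIV Y.ends_UNIV)
    from close_matching_labels[OF represents_closed_closed[OF M] represents_closed_closed[OF N] kindD this]
    show ?thesis using 1 by simp
  next
    case 2
    obtain m where "close_matching \<epsilon> (half_bars (zz M)) (\<lambda>x. (birth (snd x), ereal (of_int (fst x))))
        (half_bars (zz N)) (\<lambda>y. (birth (snd y), ereal (of_int (fst y)))) m"
      using half_bars_close_matching[OF i] by blast
    hence "close_matching \<epsilon> (half_bars (zz M)) (\<lambda>x. ends (lev (snd x))) (half_bars (zz N)) (\<lambda>y. ends (lev (snd y))) m"
      by (rule close_matching_cong[rotated 2]) (simp_all only: X.half_bar_lev(2) Y.half_bar_lev(2))
    from close_matching_labels[OF represents_closed_open[OF M] represents_closed_open[OF N] kindD this]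
    show ?thesis using 2 by simp
  next
    case 3
    interpret XR: reeb "rfl (zz M)" by (rule reeb_rfl) unfold_locales
    interpret YR: reeb "rfl (zz N)" by (rule reeb_rfl) unfold_locales
    obtain m where "close_matching \<epsilon> (half_bars (rfl (zz M))) (\<lambda>x. (birth (snd x), ereal (of_int (fst x))))
        (half_bars (rfl (zz N))) (\<lambda>y. (birth (snd y), ereal (of_int (fst y)))) m"
      using half_bars_close_matching[OF interleaving_rfl[OF i]] by blast
    hence cm: "close_matching \<epsilon> (half_bars (rfl (zz M))) (\<lambda>x. (- ereal (of_int (fst x)), - birth (snd x)))
        (half_bars (rfl (zz N))) (\<lambda>y. (- ereal (of_int (fst y)), - birth (snd y))) m"
      unfolding close_matching_def fst_conv snd_conv near_uminus le_uminus_add by auto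
    have e1: "ends (uminus ` lev (snd x)) = (- ereal (of_int (fst x)), - birth (snd x))"
      if "x \<in> half_bars (rfl (zz M))" for x
      using XR.half_bar_lev(2)[OF that] lend_uminus[OF conjunct1[OF kindD[OF XR.half_bar_lev(1)[OF that]]]]
        rend_uminus[OF conjunct1[OF kindD[OF XR.half_bar_lev(1)[OF that]]]] by simp
    have e2: "ends (uminus ` lev (snd x)) = (- ereal (of_int (fst x)), - birth (snd x))"
      if "x \<in> half_bars (rfl (zz N))" for x
      using YR.half_bar_lev(2)[OF that] lend_uminus[OF conjunct1[OF kindD[OF YR.half_bar_lev(1)[OF that]]]]
        rend_uminus[OF conjunct1[OF kindD[OF YR.half_bar_lev(1)[OF that]]]] by simp
    have "close_matching \<epsilon> (half_bars (rfl (zz M))) (\<lambda>x. ends (uminus ` lev (snd x)))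
        (half_bars (rfl (zz N))) (\<lambda>y. ends (uminus ` lev (snd y))) m"
      by (rule close_matching_cong[OF e1[symmetric] e2[symmetric] cm])
    from close_matching_labels[OF represents_open_closed[OF M] represents_open_closed[OF N] kindD this]
    show ?thesis using 3 by simp
  next
    case 4
    let ?b = "\<lambda>x. ereal (of_int (fst (fst x)))" and ?d = "\<lambda>x. ereal (of_int (snd (fst x)))"
    let ?S = "\<lambda>x. {2 * fst (fst x) + 1..2 * snd (fst x) - 1}"
    obtain m where m: "m \<subseteq> open_bars (zz M) \<times> open_bars (zz N)" "partial_inj m"
      "\<forall>(x, y)\<in>m. near \<epsilon> (ereal (of_int (fst (fst x)))) (ereal (of_int (fst (fst y)))) \<and>
        near \<epsilon> (ereal (of_int (snd (fst x)))) (ereal (of_int (snd (fst y))))"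
      "\<forall>x\<in>open_bars (zz M) - Domain m. of_int (snd (fst x)) - of_int (fst (fst x)) \<le> 4 * \<epsilon>"
      "\<forall>y\<in>open_bars (zz N) - Range m. of_int (snd (fst y)) - of_int (fst (fst y)) \<le> 4 * \<epsilon>"
      using open_bars_matching[OF i] by blast
    have e: "ereal d \<le> ereal b + ereal (4 * \<epsilon>) \<longleftrightarrow> d - b \<le> 4 * \<epsilon>" for b d :: real by auto
    have "close_matching \<epsilon> (open_bars (zz M)) (\<lambda>x. (?b x, ?d x)) (open_bars (zz N)) (\<lambda>y. (?b y, ?d y)) m"
      unfolding close_matching_def fst_conv snd_conv e using m by blast
    hence "close_matching \<epsilon> (open_bars (zz M)) (\<lambda>x. ends (?S x)) (open_bars (zz N)) (\<lambda>y. ends (?S y)) m"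
      by (rule close_matching_cong[rotated 2]) (simp_all only: X.open_bar_lev(2) Y.open_bar_lev(2))
    from close_matching_labels[OF represents_open_open[OF M] represents_open_open[OF N] kindD this]
    show ?thesis using 4 by simp
  qed
qed

lemma labels_dgm_mset: "fst (dgm_mset M) = (\<Union>(l, r)\<in>UNIV. labels M (kind l r))"
proof -
  have k: "S \<noteq> {} \<and> convex_ints S \<longleftrightarrow> (\<exists>l r. S \<in> kind l r)" for S by (auto simp: kind_def)
  have "(I, n) \<in> fst (dgm_mset M) \<longleftrightarrow> (\<exists>l r. (I, n) \<in> labels M (kind l r))" for I n
    unfolding dgm_mset_def IntZZ_pt labels_def fst_conv k mem_Collect_eq case_prod_conv by blast
  thus ?thesis by auto
qed

lemma labels_kind_disjoint:
  assumes "x \<in> labels M (kind l r)" "x \<in> labels N (kind l' r')"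
  shows "l = l' \<and> r = r'"
proof -
  obtain S S' where S: "fst x = pt ` S" "S \<in> kind l r" "fst x = pt ` S'" "S' \<in> kind l' r'"
    using assms unfolding labels_def by auto
  have "S' = S" using S(1,3) pt_image_eq by metis
  thus ?thesis using S(2,4) unfolding kind_def mem_Collect_eq by simp
qed

text \<open>Disjointness of the pieces on either side keeps the union single-valued in both
  directions.\<close>

lemma close_matching_UN:
  assumes m: "\<And>k. close_matching \<epsilon> (A k) p (B k) q (m k)"
    and A: "\<And>k k' x. x \<in> A k \<Longrightarrow> x \<in> A k' \<Longrightarrow> k = k'" and B: "\<And>k k' y. y \<in> B k \<Longrightarrow> y \<in> B k' \<Longrightarrow> k = k'"
  shows "close_matching \<epsilon> (\<Union>k. A k) p (\<Union>k. B k) q (\<Union>k. m k)"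
proof -
  have sub: "x \<in> A k" "y \<in> B k" if "(x, y) \<in> m k" for x y k
    using m[of k] that unfolding close_matching_def by blast+
  have inj: "partial_inj (m k)" for k using m[of k] unfolding close_matching_def by blast
  have "single_valued (\<Union>k. m k)"
  proof (rule single_valuedI)
    fix x y z assume "(x, y) \<in> (\<Union>k. m k)" "(x, z) \<in> (\<Union>k. m k)"
    then obtain k k' where k: "(x, y) \<in> m k" "(x, z) \<in> m k'" by blast
    hence "k = k'" using A sub(1) by blast
    thus "y = z" using k inj[of k] unfolding partial_inj_def single_valued_def by blast
  qed
  moreover have "single_valued ((\<Union>k. m k)\<inverse>)"
  proof (rule single_valuedI)
    fix x y z assume "(x, y) \<in> (\<Union>k. m k)\<inverse>" "(x, z) \<in> (\<Union>k. m k)\<inverse>"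
    then obtain k k' where k: "(y, x) \<in> m k" "(z, x) \<in> m k'" by blast
    hence "k = k'" using B sub(2) by blast
    thus "y = z" using k inj[of k] unfolding partial_inj_def single_valued_def by blast
  qed
  moreover have "(\<Union>k. m k) \<subseteq> (\<Union>k. A k) \<times> (\<Union>k. B k)"
  proof
    fix a assume "a \<in> (\<Union>k. m k)"
    then obtain k where "(fst a, snd a) \<in> m k" by auto
    hence "fst a \<in> A k" "snd a \<in> B k" by (rule sub)+
    thus "a \<in> (\<Union>k. A k) \<times> (\<Union>k. B k)" unfolding mem_Times_iff by blast
  qed
  moreover have "near \<epsilon> (fst (p x)) (fst (q y)) \<and> near \<epsilon> (snd (p x)) (snd (q y))" if "(x, y) \<in> m k" for x y k
    using m[of k] that unfolding close_matching_def by blast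
  moreover have "snd (p x) \<le> fst (p x) + ereal (4 * \<epsilon>)"
    if x: "x \<in> (\<Union>k. A k) - Domain (\<Union>k. m k)" for x
  proof -
    obtain k where "x \<in> A k" "x \<notin> Domain (m k)" using x by blast
    thus ?thesis using m[of k] unfolding close_matching_def by blast
  qed
  moreover have "snd (q y) \<le> fst (q y) + ereal (4 * \<epsilon>)"
    if y: "y \<in> (\<Union>k. B k) - Range (\<Union>k. m k)" for y
  proof -
    obtain k where "y \<in> B k" "y \<notin> Range (m k)" using y by blast
    thus ?thesis using m[of k] unfolding close_matching_def by blast
  qed
  ultimately show ?thesis unfolding close_matching_def partial_inj_def by auto
qed

text \<open>Infinite values are near only if they are equal, and then \<open>ediff\<close> is zero
  by definition.\<close>

lemma ediff_near:
  assumes "near \<epsilon> a b" "0 \<le> \<epsilon>"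
  shows "\<bar>ediff a b\<bar> \<le> ereal \<epsilon>"
  using assms unfolding near_def ediff_def by (cases a; cases b) auto

lemma ediff_short:
  assumes "d \<le> b + ereal c" "0 \<le> c"
  shows "ediff d b \<le> ereal c"
  using assms unfolding ediff_def by (cases b; cases d) auto

lemma is_matching_close_matching:
  assumes eps: "0 \<le> \<epsilon>" and m: "close_matching \<epsilon> (fst X) (snd X) (fst Y) (snd Y) m"
  shows "\<exists>\<alpha>. is_matching (2 * \<epsilon>) X Y \<alpha>"
proof -
  have sub: "m \<subseteq> fst X \<times> fst Y"
    and sv: "\<And>x y z. (x, y) \<in> m \<Longrightarrow> (x, z) \<in> m \<Longrightarrow> y = z" "\<And>x y z. (x, y) \<in> m \<Longrightarrow> (z, y) \<in> m \<Longrightarrow> x = z"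
    and nr: "\<And>x y. (x, y) \<in> m \<Longrightarrow> near \<epsilon> (fst (snd X x)) (fst (snd Y y)) \<and> near \<epsilon> (snd (snd X x)) (snd (snd Y y))"
    and sX: "\<And>x. x \<in> fst X \<Longrightarrow> x \<notin> Domain m \<Longrightarrow> snd (snd X x) \<le> fst (snd X x) + ereal (4 * \<epsilon>)"
    and sY: "\<And>y. y \<in> fst Y \<Longrightarrow> y \<notin> Range m \<Longrightarrow> snd (snd Y y) \<le> fst (snd Y y) + ereal (4 * \<epsilon>)"
    using m unfolding close_matching_def partial_inj_def single_valued_def by blast+
  define \<alpha> where "\<alpha> x = (if x \<in> Domain m then Some (THE y. (x, y) \<in> m) else None)" for x
  have \<alpha>: "\<alpha> x = Some y \<longleftrightarrow> (x, y) \<in> m" for x y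
  proof
    assume "\<alpha> x = Some y"
    hence x: "x \<in> Domain m" "y = (THE y. (x, y) \<in> m)" unfolding \<alpha>_def by (simp_all split: if_splits)
    obtain z where z: "(x, z) \<in> m" using x(1) by blast
    hence "(THE y. (x, y) \<in> m) = z" using sv(1) by blast
    thus "(x, y) \<in> m" using x(2) z by simp
  next
    assume xy: "(x, y) \<in> m"
    hence "(THE y. (x, y) \<in> m) = y" using sv(1) by blast
    thus "\<alpha> x = Some y" using xy unfolding \<alpha>_def by auto
  qed
  have dom: "dom \<alpha> = Domain m" and ran: "ran \<alpha> = Range m" by (auto simp: dom_def ran_def \<alpha>)
  have le: "ereal \<epsilon> \<le> ereal (2 * \<epsilon>)" using eps by simp
  have e4: "ereal (2 * (2 * \<epsilon>)) = ereal (4 * \<epsilon>)" by simp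
  have "is_matching (2 * \<epsilon>) X Y \<alpha>"
    unfolding is_matching_def e4 dom ran
  proof (intro conjI ballI allI impI)
    show "Domain m \<subseteq> fst X" "Range m \<subseteq> fst Y" using sub by blast+
    show "inj_on \<alpha> (Domain m)"
    proof (rule inj_onI)
      fix x z assume x: "x \<in> Domain m" "\<alpha> x = \<alpha> z"
      obtain y where "\<alpha> x = Some y" using x(1) \<alpha> by blast
      hence "\<alpha> x = Some y" "\<alpha> z = Some y" using x(2) by simp_all
      thus "x = z" using \<alpha> sv(2) by blast
    qed
    show "linf_dist (snd X x) (snd Y y) \<le> ereal (2 * \<epsilon>)" if xy: "\<alpha> x = Some y" for x y
    proof -
      have "near \<epsilon> (fst (snd X x)) (fst (snd Y y)) \<and> near \<epsilon> (snd (snd X x)) (snd (snd Y y))"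
        using nr xy \<alpha> by blast
      hence "\<bar>ediff (fst (snd X x)) (fst (snd Y y))\<bar> \<le> ereal \<epsilon>" "\<bar>ediff (snd (snd X x)) (snd (snd Y y))\<bar> \<le> ereal \<epsilon>"
        using ediff_near eps by blast+
      hence "linf_dist (snd X x) (snd Y y) \<le> ereal \<epsilon>" unfolding linf_dist_def by (rule max.boundedI)
      thus ?thesis using le by (rule order_trans)
    qed
    show "ediff (snd (snd X x)) (fst (snd X x)) \<le> ereal (4 * \<epsilon>)" if "x \<in> fst X - Domain m" for x
      by (rule ediff_short) (use sX that eps in auto)
    show "ediff (snd (snd Y y)) (fst (snd Y y)) \<le> ereal (4 * \<epsilon>)" if "y \<in> fst Y - Range m" for y
      by (rule ediff_short) (use sY that eps in auto)
  qed
  thus ?thesis by blast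
qed

lemma interleaved_matching:
  assumes M: "reeb_graph M" "untwisted M" and N: "reeb_graph N" "untwisted N"
    and eps: "0 \<le> \<epsilon>" and i: "interleaved \<epsilon> (colim_ext M) (colim_ext N)"
  shows "\<exists>\<alpha>. is_matching (2 * \<epsilon>) (dgm_mset M) (dgm_mset N) \<alpha>"
proof -
  obtain f g where fg: "interleaving (zz M) (zz N) \<epsilon> f g" using interleaving_zz[OF M(1) N(1) eps i] by blast
  let ?A = "\<lambda>k. labels M (case k of (l, r) \<Rightarrow> kind l r)" and ?B = "\<lambda>k. labels N (case k of (l, r) \<Rightarrow> kind l r)"
  have "\<forall>k. \<exists>m. close_matching \<epsilon> (?A k) (endpoints \<circ> fst) (?B k) (endpoints \<circ> fst) m"
    using kind_close_matching[OF M N fg] by auto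
  then obtain m where m: "\<And>k. close_matching \<epsilon> (?A k) (endpoints \<circ> fst) (?B k) (endpoints \<circ> fst) (m k)" by metis
  have "close_matching \<epsilon> (\<Union>k. ?A k) (endpoints \<circ> fst) (\<Union>k. ?B k) (endpoints \<circ> fst) (\<Union>k. m k)"
    by (rule close_matching_UN[OF m]) (auto dest: labels_kind_disjoint)
  moreover have "snd (dgm_mset L) = endpoints \<circ> fst" for L :: "(int, 'c) diagram"
    by (auto simp: dgm_mset_def fun_eq_iff)
  moreover have "fst (dgm_mset M) = (\<Union>k. ?A k)" "fst (dgm_mset N) = (\<Union>k. ?B k)"
    unfolding labels_dgm_mset by auto
  ultimately show ?thesis using is_matching_close_matching[OF eps] by metis
qed

theorem theorem4p21:
  fixes M :: "(int, 'a) diagram" and N :: "(int, 'b) diagram"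
  assumes "reeb_graph M" and "reeb_graph N"
    and "untwisted M" and "untwisted N"
  shows "d_B (dgm_mset M) (dgm_mset N) \<le> 2 * d_I M N"
proof -
  let ?D = "{ereal \<epsilon> | \<epsilon>. 0 \<le> \<epsilon> \<and> interleaved \<epsilon> (colim_ext M) (colim_ext N)}"
  have le: "d_B (dgm_mset M) (dgm_mset N) \<le> 2 * e" if e: "e \<in> ?D" for e
  proof -
    obtain \<epsilon> where \<epsilon>: "e = ereal \<epsilon>" "0 \<le> \<epsilon>" "interleaved \<epsilon> (colim_ext M) (colim_ext N)" using e by blast
    have "\<exists>\<alpha>. is_matching (2 * \<epsilon>) (dgm_mset M) (dgm_mset N) \<alpha>"
      by (rule interleaved_matching[OF assms(1,3,2,4) \<epsilon>(2,3)])
    hence "d_B (dgm_mset M) (dgm_mset N) \<le> ereal (2 * \<epsilon>)"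
      unfolding d_B_def using \<epsilon>(2) by (intro Inf_lower) auto
    thus ?thesis using \<epsilon>(1) by simp
  qed
  \<comment> \<open>Dividing by two allows the infimum to be bounded from below directly; this also
    covers the case that no interleaving exists and the infimum is infinite.\<close>
  have "d_B (dgm_mset M) (dgm_mset N) / 2 \<le> Inf ?D"
  proof (rule Inf_greatest)
    fix e assume "e \<in> ?D"
    thus "d_B (dgm_mset M) (dgm_mset N) / 2 \<le> e" using le[of e] by (simp add: ereal_divide_le_pos)
  qed
  thus ?thesis unfolding d_I_def by (simp add: ereal_divide_le_pos)
qed

end
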